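(* Let $E\to(X,\omega)$ be a holomorphic vector bundle over a compact K\"ahler manifold of dimension $n$, with Hermitian metric $h$, and let $Z$ be a polynomial central charge with $Z(E)\neq0$ and fixed representatives $\omega,\tilde U$. A Chern connection $A\in\mathcal{A}(h)$ is a minimum of the $Z$-Yang--Mills functional $Z\mathrm{YM}$ if and only if $A$ is $Z$-critical and $$\mathrm{Re}(e^{-i\varphi(E)}\tilde Z(A))=\lambda\,\mathrm{id}_E\otimes\omega^n$$ for some constant $\lambda\in\mathbb{R}$. On the locus of $Z$-almost calibrated connections, $\lambda>0$.
   Context: A stability vector is $\rho=(\rho_0,\dots,\rho_n)\in(\mathbb{C}^* )^{n+1}$ with $\mathrm{Im}(\rho_n)>0$ and $\mathrm{Im}(\rho_d/\rho_{d+1})>0$ for $d<n$. A polynomial central charge is given by such $\rho$, the K\"ahler class $[\omega]$ and a real class $U=1+N$, $N\in H^{>0}(X,\mathbb{R})$; $Z(E)=\int_X\big(\sum_d\rho_d[\omega]^d\big)\cdot\mathrm{Ch}(E)\cdot U$, $\varphi(E)=\arg Z(E)$. Fix $\omega$ and a real differential form $\tilde U$ representing $U$. $\mathcal{A}(h)$ is the space of integrable $h$-unitary connections. For $A\in\mathcal{A}(h)$ with curvature $F_A$, $\tilde Z(A)$ is the degree $2n$ part of $\big(\sum_d\rho_d\omega^d\big)\wedge\exp(\frac{i}{2\pi}F_A)\wedge\tilde U$. $\mathrm{Re}(T)=(T+T^* )/2$ and $\mathrm{Im}(T)=(T-T^* )/(2i)$ with respect to $h$. $A$ is $Z$-critical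 if $\mathrm{Im}(e^{-i\varphi(E)}\tilde Z(A))=0$, and $Z$-almost calibrated if $\mathrm{Re}\big(\mathrm{tr}(e^{-i\varphi(E)}\tilde Z(A))\big)>0$ as a volume form. Writing $\tilde Z(A)=\zeta(A)\frac{\omega^n}{n!}$ with $\zeta(A)\in\Gamma(\mathrm{End}\,E)$, the $Z$-Yang--Mills functional is $Z\mathrm{YM}(A)=\int_X|\zeta(A)|^2\frac{\omega^n}{n!}$, where $|\zeta|^2=\mathrm{tr}(\zeta\zeta^* )$.
   Formalization: "Minimum" means a minimiser of ZYM over A(h) whose value is the bound |Z(E)|²/(rk E·Vol X); for a bare minimiser the claim fails, e.g. the split connection on O⊕O(1) over P¹ with U=1. Dimension n≥1 is assumed. *)

theory Defs
  imports "HOL-Analysis.Analysis"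
begin

section \<open>Smooth maps\<close>

primrec Ck_on :: "nat \<Rightarrow> 'a::real_normed_vector set \<Rightarrow> ('a \<Rightarrow> 'b::real_normed_vector) \<Rightarrow> bool" where
  "Ck_on 0 S f \<longleftrightarrow> continuous_on S f"
| "Ck_on (Suc k) S f \<longleftrightarrow>
     (\<forall>x\<in>S. f differentiable (at x)) \<and>
     (\<forall>v. Ck_on k S (\<lambda>x. frechet_derivative f (at x) v))"

definition smooth_on :: "'a::real_normed_vector set \<Rightarrow> ('a \<Rightarrow> 'b::real_normed_vector) \<Rightarrow> bool" where
  "smooth_on S f \<longleftrightarrow> (\<forall>k. Ck_on k S f)"


section \<open>Exterior algebra\<close>

text \<open>An element of mixed degree of the algebra of alternating forms on a real vector space
  is a function on lists of vectors; its restriction to lists of length \<open>k\<close> is the part of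
  degree \<open>k\<close>.\<close>

definition alternating_form :: "('v::real_vector list \<Rightarrow> 'a::real_vector) \<Rightarrow> bool" where
  "alternating_form f \<longleftrightarrow>
     (\<forall>us ws. linear (\<lambda>v. f (us @ v # ws))) \<and>
     (\<forall>us ws ys v. f (us @ v # ws @ v # ys) = 0)"

definition degree_part :: "nat \<Rightarrow> ('v list \<Rightarrow> 'a::zero) \<Rightarrow> 'v list \<Rightarrow> 'a" where
  "degree_part k f vs = (if length vs = k then f vs else 0)"

definition shuffle_sign :: "nat set \<Rightarrow> nat \<Rightarrow> real" where
  "shuffle_sign S m = (- 1) ^ card {(a, b). a \<in> S \<and> b \<in> {..<m} - S \<and> b < a}"

text \<open>Sum over shuffles, so that \<open>(dx \<and> dy) (\<partial>\<^sub>x, \<partial>\<^sub>y) = 1\<close>.  The first argument is the product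
  of the coefficients.\<close>

definition wedge ::
    "('a \<Rightarrow> 'b \<Rightarrow> 'c::real_vector) \<Rightarrow> ('v list \<Rightarrow> 'a) \<Rightarrow> ('v list \<Rightarrow> 'b) \<Rightarrow> 'v list \<Rightarrow> 'c" where
  "wedge mul f g vs =
     (\<Sum>S\<in>Pow {..<length vs}.
        shuffle_sign S (length vs) *\<^sub>R mul (f (nths vs S)) (g (nths vs (- S))))"

primrec wedge_power ::
    "('a \<Rightarrow> 'a \<Rightarrow> 'a::real_vector) \<Rightarrow> 'a \<Rightarrow> ('v list \<Rightarrow> 'a) \<Rightarrow> nat \<Rightarrow> 'v list \<Rightarrow> 'a" where
  "wedge_power mul e f 0 = (\<lambda>vs. if vs = [] then e else 0)"
| "wedge_power mul e f (Suc k) = wedge mul f (wedge_power mul e f k)"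


section \<open>Compact complex manifolds\<close>

text \<open>The manifold is the whole type \<open>'x\<close>; as it is compact, a finite atlas suffices.\<close>

record ('x, 'n) atlas =
  charts :: nat
  dom :: "nat \<Rightarrow> 'x set"
  coord :: "nat \<Rightarrow> 'x \<Rightarrow> complex ^ ('n::finite)"

definition param :: "('x, 'n::finite) atlas \<Rightarrow> nat \<Rightarrow> complex ^ 'n \<Rightarrow> 'x" where
  "param X i = inv_into (dom X i) (coord X i)"

definition chart_smooth ::
    "('x, 'n::finite) atlas \<Rightarrow> nat \<Rightarrow> 'x set \<Rightarrow> ('x \<Rightarrow> 'a::real_normed_vector) \<Rightarrow> bool" where
  "chart_smooth X i S f \<longleftrightarrow> smooth_on (coord X i ` S) (f \<circ> param X i)"

text \<open>The differential of \<open>f\<close> at \<open>x\<close> applied to the tangent vector with components \<open>v\<close> in chart \<open>i\<close>.\<close>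

definition chart_deriv ::
    "('x, 'n::finite) atlas \<Rightarrow> nat \<Rightarrow> ('x \<Rightarrow> 'a::real_normed_vector) \<Rightarrow> 'x \<Rightarrow> complex ^ 'n \<Rightarrow> 'a" where
  "chart_deriv X i f x v = frechet_derivative (f \<circ> param X i) (at (coord X i x)) v"

text \<open>Holomorphic on an open set: smooth with complex linear differential.\<close>

definition chart_holomorphic ::
    "('x, 'n::finite) atlas \<Rightarrow> nat \<Rightarrow> 'x set \<Rightarrow> ('x \<Rightarrow> complex) \<Rightarrow> bool" where
  "chart_holomorphic X i S f \<longleftrightarrow>
     chart_smooth X i S f \<and>
     (\<forall>x\<in>S. \<forall>v. chart_deriv X i f x (\<i> *s v) = \<i> * chart_deriv X i f x v)"

definition compact_complex_manifold :: "('x::t2_space, 'n::finite) atlas \<Rightarrow> bool" where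
  "compact_complex_manifold X \<longleftrightarrow>
     compact (UNIV :: 'x set) \<and>
     (\<Union>i<charts X. dom X i) = UNIV \<and>
     (\<forall>i<charts X.
        open (dom X i) \<and> open (coord X i ` dom X i) \<and>
        homeomorphism (dom X i) (coord X i ` dom X i) (coord X i) (param X i) \<and>
        (\<forall>j<charts X. \<forall>a. chart_holomorphic X i (dom X i \<inter> dom X j) (\<lambda>x. coord X j x $ a)))"


section \<open>Differential forms\<close>

text \<open>A form is given by its local expressions: \<open>\<alpha> i x vs\<close> is its value at \<open>x\<close> on the tangent
  vectors whose components in chart \<open>i\<close> are \<open>vs\<close>.\<close>

type_synonym ('x, 'n, 'a) form = "nat \<Rightarrow> 'x \<Rightarrow> (complex ^ 'n) list \<Rightarrow> 'a"

definition smooth_form ::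
    "('x, 'n::finite) atlas \<Rightarrow> ('x, 'n, 'a::real_normed_vector) form \<Rightarrow> bool" where
  "smooth_form X \<alpha> \<longleftrightarrow>
     (\<forall>i<charts X.
        (\<forall>x\<in>dom X i. alternating_form (\<alpha> i x)) \<and>
        (\<forall>vs. chart_smooth X i (dom X i) (\<lambda>x. \<alpha> i x vs)) \<and>
        (\<forall>j<charts X. \<forall>x\<in>dom X i \<inter> dom X j. \<forall>vs.
           \<alpha> i x vs = \<alpha> j x (map (chart_deriv X i (coord X j) x) vs)))"

text \<open>The usual formula for the exterior derivative, on vector fields that are constant in the chart.\<close>

definition ext_deriv ::
    "('x, 'n::finite) atlas \<Rightarrow> ('x, 'n, 'a::real_normed_vector) form \<Rightarrow> ('x, 'n, 'a) form" where
  "ext_deriv X \<alpha> i x vs =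
     (\<Sum>j<length vs. (- 1) ^ j *\<^sub>R
        chart_deriv X i (\<lambda>y. \<alpha> i y (take j vs @ drop (Suc j) vs)) x (vs ! j))"

definition closed_form ::
    "('x, 'n::finite) atlas \<Rightarrow> ('x, 'n, 'a::real_normed_vector) form \<Rightarrow> bool" where
  "closed_form X \<alpha> \<longleftrightarrow>
     smooth_form X \<alpha> \<and> (\<forall>i<charts X. \<forall>x\<in>dom X i. \<forall>vs. ext_deriv X \<alpha> i x vs = 0)"

text \<open>The real basis \<open>e\<^sub>1, i e\<^sub>1, \<dots>, e\<^sub>n, i e\<^sub>n\<close>.  The orientation it defines does not depend on the
  enumeration of the index type.\<close>

definition complex_frame :: "(complex ^ 'n::finite) list" where
  "complex_frame =
     concat (map (\<lambda>k. [axis k 1, axis k \<i>]) (SOME ks. distinct ks \<and> set ks = (UNIV :: 'n set)))"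

text \<open>Integral of the part of top degree, for the complex orientation.  The manifold is cut into
  the Borel pieces \<open>dom X i - (\<Union>j<i. dom X j)\<close>; \<open>lborel\<close> on \<open>complex ^ 'n\<close> is normalised by the
  basis \<open>complex_frame\<close>.\<close>

definition form_integral ::
    "('x, 'n::finite) atlas \<Rightarrow>
     ('x, 'n, 'a::{banach, second_countable_topology}) form \<Rightarrow> 'a" where
  "form_integral X \<alpha> =
     (\<Sum>i<charts X. LINT z : coord X i ` disjointed (dom X) i | lborel.
        \<alpha> i (param X i z) complex_frame)"

definition form_power :: "('x, 'n, real) form \<Rightarrow> nat \<Rightarrow> ('x, 'n::finite, real) form" where
  "form_power \<omega> k i x = wedge_power (*) 1 (\<omega> i x) k"

definition kaehler_form ::
    "('x, 'n::finite) atlas \<Rightarrow> ('x, 'n, real) form \<Rightarrow> bool" where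
  "kaehler_form X \<omega> \<longleftrightarrow>
     closed_form X \<omega> \<and>
     (\<forall>i<charts X. \<forall>x\<in>dom X i.
        (\<forall>vs. length vs \<noteq> 2 \<longrightarrow> \<omega> i x vs = 0) \<and>
        (\<forall>v w. \<omega> i x [\<i> *s v, \<i> *s w] = \<omega> i x [v, w]) \<and>
        (\<forall>v. v \<noteq> 0 \<longrightarrow> \<omega> i x [v, \<i> *s v] > 0))"

text \<open>A real form representing a class \<open>1 + N\<close> with \<open>N\<close> of positive degree.\<close>

definition unipotent_form ::
    "('x, 'n::finite) atlas \<Rightarrow> ('x, 'n, real) form \<Rightarrow> bool" where
  "unipotent_form X \<upsilon> \<longleftrightarrow>
     closed_form X \<upsilon> \<and> (\<forall>i<charts X. \<forall>x\<in>dom X i. \<upsilon> i x [] = 1)"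


section \<open>Holomorphic vector bundles, Hermitian metrics, connections\<close>

text \<open>A holomorphic vector bundle, trivialised over the charts, is given by its transition
  functions; a section has local components with \<open>s\<^sub>i = g\<^sub>i\<^sub>j s\<^sub>j\<close>.\<close>

definition holomorphic_bundle ::
    "('x, 'n::finite) atlas \<Rightarrow> (nat \<Rightarrow> nat \<Rightarrow> 'x \<Rightarrow> complex ^ 'r ^ 'r::finite) \<Rightarrow> bool" where
  "holomorphic_bundle X g \<longleftrightarrow>
     (\<forall>i<charts X. \<forall>x\<in>dom X i. g i i x = mat 1) \<and>
     (\<forall>i<charts X. \<forall>j<charts X. \<forall>k<charts X. \<forall>x\<in>dom X i \<inter> dom X j \<inter> dom X k.
        g i j x ** g j k x = g i k x) \<and>
     (\<forall>i<charts X. \<forall>j<charts X. \<forall>a b.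
        chart_holomorphic X i (dom X i \<inter> dom X j) (\<lambda>x. g i j x $ a $ b))"

definition conj_transpose :: "complex ^ 'r ^ 'r \<Rightarrow> complex ^ 'r ^ ('r::finite)" where
  "conj_transpose M = map_matrix cnj (transpose M)"

text \<open>The matrix of the metric in the frame over chart \<open>i\<close>: \<open>\<langle>s, t\<rangle> = s\<^sub>i\<^sup>* h\<^sub>i t\<^sub>i\<close>.\<close>

definition hermitian_metric ::
    "('x, 'n::finite) atlas \<Rightarrow> (nat \<Rightarrow> nat \<Rightarrow> 'x \<Rightarrow> complex ^ 'r ^ 'r::finite) \<Rightarrow>
     (nat \<Rightarrow> 'x \<Rightarrow> complex ^ 'r ^ 'r) \<Rightarrow> bool" where
  "hermitian_metric X g h \<longleftrightarrow>
     (\<forall>i<charts X.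
        chart_smooth X i (dom X i) (h i) \<and>
        (\<forall>x\<in>dom X i.
           conj_transpose (h i x) = h i x \<and>
           (\<forall>v. v \<noteq> 0 \<longrightarrow> 0 < Re (\<Sum>a\<in>UNIV. cnj (v $ a) * (h i x *v v) $ a))) \<and>
        (\<forall>j<charts X. \<forall>x\<in>dom X i \<inter> dom X j.
           h j x = conj_transpose (g i j x) ** h i x ** g i j x))"

text \<open>The adjoint, real part and imaginary part of an endomorphism of the fibre, with respect to a
  metric with matrix \<open>H\<close>.\<close>

definition adj_wrt :: "complex ^ 'r ^ 'r \<Rightarrow> complex ^ 'r ^ 'r \<Rightarrow> complex ^ 'r ^ ('r::finite)" where
  "adj_wrt H T = matrix_inv H ** conj_transpose T ** H"

definition Re_wrt :: "complex ^ 'r ^ 'r \<Rightarrow> complex ^ 'r ^ 'r \<Rightarrow> complex ^ 'r ^ ('r::finite)" where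
  "Re_wrt H T = mat (1 / 2) ** (T + adj_wrt H T)"

definition Im_wrt :: "complex ^ 'r ^ 'r \<Rightarrow> complex ^ 'r ^ 'r \<Rightarrow> complex ^ 'r ^ ('r::finite)" where
  "Im_wrt H T = mat (1 / (2 * \<i>)) ** (T - adj_wrt H T)"

text \<open>A connection is given by its connection matrices: \<open>(\<nabla>s)\<^sub>i = ds\<^sub>i + A\<^sub>i s\<^sub>i\<close>.\<close>

type_synonym ('x, 'n, 'r) conn = "nat \<Rightarrow> 'x \<Rightarrow> complex ^ 'n \<Rightarrow> complex ^ 'r ^ 'r"

definition connection ::
    "('x, 'n::finite) atlas \<Rightarrow> (nat \<Rightarrow> nat \<Rightarrow> 'x \<Rightarrow> complex ^ 'r ^ 'r::finite) \<Rightarrow>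
     ('x, 'n, 'r) conn \<Rightarrow> bool" where
  "connection X g A \<longleftrightarrow>
     (\<forall>i<charts X.
        (\<forall>x\<in>dom X i. linear (A i x)) \<and>
        (\<forall>v. chart_smooth X i (dom X i) (\<lambda>x. A i x v)) \<and>
        (\<forall>j<charts X. \<forall>x\<in>dom X i \<inter> dom X j. \<forall>v.
           g i j x ** A j x (chart_deriv X i (coord X j) x v) =
             A i x v ** g i j x + chart_deriv X i (g i j) x v))"

definition unitary_connection ::
    "('x, 'n::finite) atlas \<Rightarrow> (nat \<Rightarrow> 'x \<Rightarrow> complex ^ 'r ^ 'r::finite) \<Rightarrow>
     ('x, 'n, 'r) conn \<Rightarrow> bool" where
  "unitary_connection X h A \<longleftrightarrow>
     (\<forall>i<charts X. \<forall>x\<in>dom X i. \<forall>v.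
        chart_deriv X i (h i) x v = conj_transpose (A i x v) ** h i x + h i x ** A i x v)"

definition one_form :: "('x, 'n, 'r) conn \<Rightarrow> ('x, 'n::finite, complex ^ 'r ^ 'r::finite) form" where
  "one_form A i x vs = (case vs of [v] \<Rightarrow> A i x v | _ \<Rightarrow> 0)"

definition curvature ::
    "('x, 'n::finite) atlas \<Rightarrow> ('x, 'n, 'r) conn \<Rightarrow>
     ('x, 'n, complex ^ 'r ^ 'r::finite) form" where
  "curvature X A i x vs =
     ext_deriv X (one_form A) i x vs + wedge (**) (one_form A i x) (one_form A i x) vs"

text \<open>Integrability is \<open>F\<^sup>0\<^sup>,\<^sup>2 = 0\<close>: the complex bilinear extension of the curvature vanishes on the
  vectors \<open>v + \<surd>-1 J v\<close> of type \<open>(0,1)\<close>, where \<open>J\<close> is the complex structure.\<close>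

definition integrable_connection ::
    "('x, 'n::finite) atlas \<Rightarrow> ('x, 'n, 'r::finite) conn \<Rightarrow> bool" where
  "integrable_connection X A \<longleftrightarrow>
     (\<forall>i<charts X. \<forall>x\<in>dom X i. \<forall>v w.
        curvature X A i x [v, w] - curvature X A i x [\<i> *s v, \<i> *s w]
        + mat \<i> ** (curvature X A i x [\<i> *s v, w] + curvature X A i x [v, \<i> *s w]) = 0)"

definition integrable_unitary_connections ::
    "('x, 'n::finite) atlas \<Rightarrow> (nat \<Rightarrow> nat \<Rightarrow> 'x \<Rightarrow> complex ^ 'r ^ 'r::finite) \<Rightarrow>
     (nat \<Rightarrow> 'x \<Rightarrow> complex ^ 'r ^ 'r) \<Rightarrow> ('x, 'n, 'r) conn set" where
  "integrable_unitary_connections X g h =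
     {A. connection X g A \<and> unitary_connection X h A \<and> integrable_connection X A}"

text \<open>The Chern connection \<open>h\<^sup>-\<^sup>1 \<partial>h\<close> of the holomorphic bundle, where
  \<open>\<partial>f (v) = (df (v) - i df (J v)) / 2\<close>.\<close>

definition chern_connection ::
    "('x, 'n::finite) atlas \<Rightarrow> (nat \<Rightarrow> 'x \<Rightarrow> complex ^ 'r ^ 'r::finite) \<Rightarrow>
     ('x, 'n, 'r) conn" where
  "chern_connection X h i x v =
     matrix_inv (h i x) ** mat (1 / 2) **
       (chart_deriv X i (h i) x v - mat \<i> ** chart_deriv X i (h i) x (\<i> *s v))"


section \<open>Polynomial central charges\<close>

definition stability_vector :: "nat \<Rightarrow> (nat \<Rightarrow> complex) \<Rightarrow> bool" where
  "stability_vector n \<rho> \<longleftrightarrow>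
     (\<forall>d\<le>n. \<rho> d \<noteq> 0) \<and> Im (\<rho> n) > 0 \<and> (\<forall>d<n. Im (\<rho> d / \<rho> (Suc d)) > 0)"

definition stability_form ::
    "(nat \<Rightarrow> complex) \<Rightarrow> ('x, 'n, real) form \<Rightarrow> ('x, 'n::finite, complex) form" where
  "stability_form \<rho> \<omega> i x vs = (\<Sum>d\<le>CARD('n). \<rho> d * of_real (form_power \<omega> d i x vs))"

text \<open>\<open>exp (i F / 2\<pi>)\<close>; the powers beyond the complex dimension have degree more than \<open>2n\<close>.\<close>

definition exp_curvature ::
    "('x, 'n::finite) atlas \<Rightarrow> ('x, 'n, 'r) conn \<Rightarrow>
     ('x, 'n, complex ^ 'r ^ 'r::finite) form" where
  "exp_curvature X A i x vs =
     (\<Sum>k\<le>CARD('n). (1 / fact k) *\<^sub>R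
        wedge_power (**) (mat 1) (\<lambda>us. mat (\<i> / (2 * of_real pi)) ** curvature X A i x us) k vs)"

definition Z_form ::
    "('x, 'n::finite) atlas \<Rightarrow> (nat \<Rightarrow> complex) \<Rightarrow> ('x, 'n, real) form \<Rightarrow> ('x, 'n, real) form \<Rightarrow>
     ('x, 'n, 'r) conn \<Rightarrow> ('x, 'n, complex ^ 'r ^ 'r::finite) form" where
  "Z_form X \<rho> \<omega> \<upsilon> A i x =
     degree_part (2 * CARD('n))
       (wedge (\<lambda>M t. t *\<^sub>R M)
          (wedge (\<lambda>c M. mat c ** M) (stability_form \<rho> \<omega> i x) (exp_curvature X A i x))
          (\<upsilon> i x))"

text \<open>\<open>Z(E) = \<integral> (\<Sum>\<^sub>d \<rho>\<^sub>d [\<omega>]\<^sup>d) Ch(E) U\<close>, evaluated on the representatives \<open>\<omega>\<close> and \<open>\<upsilon>\<close> of the classes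
  and on the Chern--Weil representative \<open>tr exp (i F / 2\<pi>)\<close> of \<open>Ch(E)\<close> for the Chern connection.\<close>

definition central_charge ::
    "('x, 'n::finite) atlas \<Rightarrow> (nat \<Rightarrow> 'x \<Rightarrow> complex ^ 'r ^ 'r::finite) \<Rightarrow>
     (nat \<Rightarrow> complex) \<Rightarrow> ('x, 'n, real) form \<Rightarrow> ('x, 'n, real) form \<Rightarrow> complex" where
  "central_charge X h \<rho> \<omega> \<upsilon> =
     form_integral X (\<lambda>i x.
       wedge (\<lambda>c t. c * of_real t)
         (wedge (*) (stability_form \<rho> \<omega> i x)
            (\<lambda>vs. trace (exp_curvature X (chern_connection X h) i x vs)))
         (\<upsilon> i x))"

text \<open>The form \<open>e\<^sup>-\<^sup>i\<^sup>\<phi> Z(A)\<close> with \<open>\<phi> = arg Z(E)\<close>.\<close>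

definition rotated_Z_form ::
    "('x, 'n::finite) atlas \<Rightarrow> (nat \<Rightarrow> 'x \<Rightarrow> complex ^ 'r ^ 'r::finite) \<Rightarrow>
     (nat \<Rightarrow> complex) \<Rightarrow> ('x, 'n, real) form \<Rightarrow> ('x, 'n, real) form \<Rightarrow>
     ('x, 'n, 'r) conn \<Rightarrow> ('x, 'n, complex ^ 'r ^ 'r) form" where
  "rotated_Z_form X h \<rho> \<omega> \<upsilon> A i x vs =
     mat (exp (- \<i> * of_real (Arg (central_charge X h \<rho> \<omega> \<upsilon>)))) ** Z_form X \<rho> \<omega> \<upsilon> A i x vs"

definition Z_critical ::
    "('x, 'n::finite) atlas \<Rightarrow> (nat \<Rightarrow> 'x \<Rightarrow> complex ^ 'r ^ 'r::finite) \<Rightarrow>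
     (nat \<Rightarrow> complex) \<Rightarrow> ('x, 'n, real) form \<Rightarrow> ('x, 'n, real) form \<Rightarrow>
     ('x, 'n, 'r) conn \<Rightarrow> bool" where
  "Z_critical X h \<rho> \<omega> \<upsilon> A \<longleftrightarrow>
     (\<forall>i<charts X. \<forall>x\<in>dom X i. \<forall>vs.
        Im_wrt (h i x) (rotated_Z_form X h \<rho> \<omega> \<upsilon> A i x vs) = 0)"

definition Z_almost_calibrated ::
    "('x, 'n::finite) atlas \<Rightarrow> (nat \<Rightarrow> 'x \<Rightarrow> complex ^ 'r ^ 'r::finite) \<Rightarrow>
     (nat \<Rightarrow> complex) \<Rightarrow> ('x, 'n, real) form \<Rightarrow> ('x, 'n, real) form \<Rightarrow>
     ('x, 'n, 'r) conn \<Rightarrow> bool" where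
  "Z_almost_calibrated X h \<rho> \<omega> \<upsilon> A \<longleftrightarrow>
     (\<forall>i<charts X. \<forall>x\<in>dom X i.
        Re (trace (rotated_Z_form X h \<rho> \<omega> \<upsilon> A i x complex_frame)) > 0)"

definition has_constant_real_part ::
    "('x, 'n::finite) atlas \<Rightarrow> (nat \<Rightarrow> 'x \<Rightarrow> complex ^ 'r ^ 'r::finite) \<Rightarrow>
     (nat \<Rightarrow> complex) \<Rightarrow> ('x, 'n, real) form \<Rightarrow> ('x, 'n, real) form \<Rightarrow>
     ('x, 'n, 'r) conn \<Rightarrow> real \<Rightarrow> bool" where
  "has_constant_real_part X h \<rho> \<omega> \<upsilon> A lam \<longleftrightarrow>
     (\<forall>i<charts X. \<forall>x\<in>dom X i. \<forall>vs.
        Re_wrt (h i x) (rotated_Z_form X h \<rho> \<omega> \<upsilon> A i x vs) =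
          (lam * form_power \<omega> CARD('n) i x vs) *\<^sub>R mat 1)"


section \<open>The Z-Yang--Mills functional\<close>

definition volume_form :: "('x, 'n, real) form \<Rightarrow> ('x, 'n::finite, real) form" where
  "volume_form \<omega> i x vs = form_power \<omega> CARD('n) i x vs / fact CARD('n)"

text \<open>The endomorphism \<open>\<zeta>(A)\<close> with \<open>Z(A) = \<zeta>(A) \<omega>\<^sup>n / n!\<close>; forms of top degree are determined
  by their value on a frame.\<close>

definition zeta ::
    "('x, 'n::finite) atlas \<Rightarrow> (nat \<Rightarrow> complex) \<Rightarrow> ('x, 'n, real) form \<Rightarrow> ('x, 'n, real) form \<Rightarrow>
     ('x, 'n, 'r) conn \<Rightarrow> nat \<Rightarrow> 'x \<Rightarrow> complex ^ 'r ^ 'r::finite" where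
  "zeta X \<rho> \<omega> \<upsilon> A i x =
     (1 / volume_form \<omega> i x complex_frame) *\<^sub>R Z_form X \<rho> \<omega> \<upsilon> A i x complex_frame"

definition ZYM ::
    "('x, 'n::finite) atlas \<Rightarrow> (nat \<Rightarrow> 'x \<Rightarrow> complex ^ 'r ^ 'r::finite) \<Rightarrow>
     (nat \<Rightarrow> complex) \<Rightarrow> ('x, 'n, real) form \<Rightarrow> ('x, 'n, real) form \<Rightarrow>
     ('x, 'n, 'r) conn \<Rightarrow> real" where
  "ZYM X h \<rho> \<omega> \<upsilon> A =
     form_integral X (\<lambda>i x vs.
       Re (trace (zeta X \<rho> \<omega> \<upsilon> A i x ** adj_wrt (h i x) (zeta X \<rho> \<omega> \<upsilon> A i x)))
         * volume_form \<omega> i x vs)"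

text \<open>The Cauchy--Schwarz lower bound \<open>|Z(E)|\<^sup>2 / (rk E \<cdot> Vol X)\<close> for the functional.\<close>

definition ZYM_bound ::
    "('x, 'n::finite) atlas \<Rightarrow> (nat \<Rightarrow> 'x \<Rightarrow> complex ^ 'r ^ 'r::finite) \<Rightarrow>
     (nat \<Rightarrow> complex) \<Rightarrow> ('x, 'n, real) form \<Rightarrow> ('x, 'n, real) form \<Rightarrow> real" where
  "ZYM_bound X h \<rho> \<omega> \<upsilon> =
     (cmod (central_charge X h \<rho> \<omega> \<upsilon>))\<^sup>2 /
       (real CARD('r) * form_integral X (volume_form \<omega>))"

text \<open>Being a minimum of the functional means being an absolute minimum that realises the
  topological lower bound.  A bare minimiser need not be Z-critical when the bound is not attained:
  on the projective line with the Fubini--Study metric and \<open>U = 1\<close>, the split Yang--Mills connection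
  on \<open>O \<oplus> O(1)\<close> minimises the functional, but its \<open>\<zeta>\<close> has two distinct eigenvalues.\<close>

definition ZYM_minimum ::
    "('x, 'n::finite) atlas \<Rightarrow> (nat \<Rightarrow> nat \<Rightarrow> 'x \<Rightarrow> complex ^ 'r ^ 'r::finite) \<Rightarrow>
     (nat \<Rightarrow> 'x \<Rightarrow> complex ^ 'r ^ 'r) \<Rightarrow>
     (nat \<Rightarrow> complex) \<Rightarrow> ('x, 'n, real) form \<Rightarrow> ('x, 'n, real) form \<Rightarrow>
     ('x, 'n, 'r) conn \<Rightarrow> bool" where
  "ZYM_minimum X g h \<rho> \<omega> \<upsilon> A \<longleftrightarrow>
     is_arg_min (ZYM X h \<rho> \<omega> \<upsilon>) (\<lambda>B. B \<in> integrable_unitary_connections X g h) A \<and>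
     ZYM X h \<rho> \<omega> \<upsilon> A = ZYM_bound X h \<rho> \<omega> \<upsilon>"

end

theory Submission
  imports Defs
begin

text \<open>Write \<open>c = |Z(E)| / (rk E \<cdot> Vol X)\<close>.  Completing the square gives
  \<open>ZYM(A) = |Z(E)|\<^sup>2 / (rk E \<cdot> Vol X) + \<integral> |e\<^sup>-\<^sup>i\<^sup>\<phi> \<zeta>(A) - c id|\<^sup>2\<close>, because the cross term is a multiple of
  \<open>Re (e\<^sup>-\<^sup>i\<^sup>\<phi> \<integral> tr Z(A)) = |Z(E)|\<close>; this last integral is the one of the Chern connection by Chern--Weil
  theory.  Hence the bound is attained exactly where \<open>e\<^sup>-\<^sup>i\<^sup>\<phi> \<zeta>(A) = c id\<close>, and separating the Hermitian and
  the skew part turns this into the two stated equations, the constant being determined by integration.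

  Chern--Weil invariance needs neither Stokes' theorem nor de Rham cohomology on the manifold: one
  connection is deformed into the other in finitely many steps, each of which changes it only inside
  a coordinate ball, where the forms differ by the derivative of a compactly supported form.\<close>

section \<open>Calculus of finitely differentiable maps\<close>

text \<open>Cut-off functions exist at every finite order as polynomials in \<open>max 0 s\<close>,
  and class C2 is what the Bianchi identity asks of the connection matrices; hence a calculus with
  an explicit order of differentiability. The form representing U may have mixed parity. Products
  are therefore always written in the order stability form, power of the curvature, U: the first two
  factors are even and let a covector pass without a sign, and U stands last, where nothing is moved
  past it. The atlas carries no orientation: Jacobians of coordinate changes are shown positive
  because the top power of the Kaehler form is positive on \<open>complex_frame\<close> in every
  chart, a fact of linear algebra obtained by deforming the form at a point to the standard one. The
  coordinate images of the Borel pieces that define the integral need not be relatively compact, so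
  compactness of X enters through finitely many coordinate balls, once for integrability and once
  for the deformation. The constant of the theorem is lambda = c / n!, because the volume form is
  omega^n / n!.\<close>

lemma Ck_on_imp_continuous_on: "Ck_on k S f \<Longrightarrow> continuous_on S f"
proof (cases k)
  case (Suc m)
  assume "Ck_on k S f"
  with Suc have "f differentiable_on S"
    by (simp add: differentiable_on_def differentiable_at_withinI)
  then show ?thesis by (rule differentiable_imp_continuous_on)
qed simp

lemma Ck_on_Suc_D: "Ck_on (Suc k) S f \<Longrightarrow> Ck_on k S f"
proof (induction k arbitrary: f)
  case 0
  then show ?case using Ck_on_imp_continuous_on[of "Suc 0"] by auto
next
  case (Suc k)
  then show ?case by (metis Ck_on.simps(2))
qed

lemma Ck_on_le: "Ck_on m S f \<Longrightarrow> k \<le> m \<Longrightarrow> Ck_on k S f"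
  by (induction m) (auto simp: le_Suc_eq dest: Ck_on_Suc_D simp del: Ck_on.simps)

lemma Ck_on_Suc_differentiable: "Ck_on (Suc k) S f \<Longrightarrow> x \<in> S \<Longrightarrow> f differentiable (at x)"
  by simp

lemma Ck_on_subset: "Ck_on k S f \<Longrightarrow> T \<subseteq> S \<Longrightarrow> Ck_on k T f"
  by (induction k arbitrary: f) (auto intro: continuous_on_subset)

text \<open>\<open>frechet_derivative\<close> is a choice among all derivatives. Near
  \<open>x\<close> the two functions have the same derivatives, so the choices agree, even where
  there is none to choose.\<close>

lemma frechet_derivative_cong_open:
  assumes "open S" "x \<in> S" "\<And>y. y \<in> S \<Longrightarrow> f y = g y"
  shows "frechet_derivative f (at x) = frechet_derivative g (at x)"
proof -
  have "(f has_derivative D) (at x) \<longleftrightarrow> (g has_derivative D) (at x)" for D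
    using assms has_derivative_transform_within_open[of f D x UNIV S g]
      has_derivative_transform_within_open[of g D x UNIV S f] by auto
  then show ?thesis by (simp add: frechet_derivative_def)
qed

lemma differentiable_cong_open:
  assumes "open S" "x \<in> S" "\<And>y. y \<in> S \<Longrightarrow> f y = g y"
  shows "f differentiable (at x) \<longleftrightarrow> g differentiable (at x)"
proof -
  have "(f has_derivative D) (at x) \<longleftrightarrow> (g has_derivative D) (at x)" for D
    using assms has_derivative_transform_within_open[of f D x UNIV S g]
      has_derivative_transform_within_open[of g D x UNIV S f] by auto
  then show ?thesis by (simp add: differentiable_def)
qed

text \<open>Derivative formulas hold only at the points of \<open>S\<close>, not as equations
  between functions. This lemma lets every induction below replace the derivative of a compound map
  by its formula before descending one order.\<close>

lemma Ck_on_cong: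
  assumes "open S" "\<And>y. y \<in> S \<Longrightarrow> f y = g y" "Ck_on k S f"
  shows "Ck_on k S g"
  using assms(2,3)
proof (induction k arbitrary: f g)
  case 0
  then show ?case by (metis Ck_on.simps(1) continuous_on_cong)
next
  case (Suc k)
  have "Ck_on k S (\<lambda>x. frechet_derivative g (at x) v)" for v
  proof (rule Suc.IH)
    show "Ck_on k S (\<lambda>x. frechet_derivative f (at x) v)" using Suc.prems by simp
    show "frechet_derivative f (at y) v = frechet_derivative g (at y) v" if "y \<in> S" for y
      using frechet_derivative_cong_open[OF assms(1) that Suc.prems(1)] by simp
  qed
  moreover have "g differentiable (at x)" if "x \<in> S" for x
    using differentiable_cong_open[OF assms(1) that, of f g] Suc.prems that by simp
  ultimately show ?case by simp
qed

lemma frechet_derivative_eqI: "(f has_derivative D) (at x) \<Longrightarrow> frechet_derivative f (at x) = D"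
  by (rule frechet_derivative_at[symmetric])

lemma frechet_derivative_has_derivative:
  "f differentiable (at x) \<Longrightarrow> (f has_derivative frechet_derivative f (at x)) (at x)"
  by (simp add: frechet_derivative_works)

lemma Ck_on_const [simp]: "Ck_on k S (\<lambda>x. c)"
proof (induction k arbitrary: c)
  case (Suc k)
  then show ?case by (simp add: frechet_derivative_const)
qed simp

lemma Ck_on_compose_bounded_linear:
  assumes "open S" "bounded_linear L" "Ck_on k S f"
  shows "Ck_on k S (\<lambda>x. L (f x))"
  using assms(3)
proof (induction k arbitrary: f)
  case 0
  then show ?case using assms(2) by (simp add: linear_continuous_on_compose bounded_linear.continuous_on)
next
  case (Suc k)
  have D: "((\<lambda>x. L (f x)) has_derivative (\<lambda>v. L (frechet_derivative f (at x) v))) (at x)" if "x \<in> S" for x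
    using Suc.prems that
    by (auto intro!: bounded_linear.has_derivative[OF assms(2)] frechet_derivative_has_derivative)
  have "Ck_on k S (\<lambda>x. frechet_derivative (\<lambda>x. L (f x)) (at x) v)" for v
    by (rule Ck_on_cong[OF assms(1) _ Suc.IH[of "\<lambda>x. frechet_derivative f (at x) v"]])
      (use Suc.prems frechet_derivative_eqI[OF D] in auto)
  then show ?case using D by (auto simp: differentiable_def)
qed

lemma Ck_on_id: "Ck_on k S (\<lambda>x. x)"
  by (cases k) (auto simp: frechet_derivative_ident)

lemma Ck_on_add:
  assumes "open S" "Ck_on k S f" "Ck_on k S g"
  shows "Ck_on k S (\<lambda>x. f x + g x)"
  using assms(2,3)
proof (induction k arbitrary: f g)
  case 0
  then show ?case by (simp add: continuous_on_add)
next
  case (Suc k)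
  have D: "((\<lambda>x. f x + g x) has_derivative
      (\<lambda>v. frechet_derivative f (at x) v + frechet_derivative g (at x) v)) (at x)" if "x \<in> S" for x
    using Suc.prems that
    by (auto intro!: has_derivative_add frechet_derivative_has_derivative)
  have "Ck_on k S (\<lambda>x. frechet_derivative (\<lambda>x. f x + g x) (at x) v)" for v
    by (rule Ck_on_cong[OF assms(1) _ Suc.IH[of "\<lambda>x. frechet_derivative f (at x) v"
            "\<lambda>x. frechet_derivative g (at x) v"]])
      (use Suc.prems frechet_derivative_eqI[OF D] in auto)
  then show ?case using D by (auto simp: differentiable_def)
qed

lemma Ck_on_sum:
  assumes "open S" "\<And>i. i \<in> I \<Longrightarrow> Ck_on k S (f i)"
  shows "Ck_on k S (\<lambda>x. \<Sum>i\<in>I. f i x)"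
  using assms(2)
  by (induction I rule: infinite_finite_induct) (auto intro: Ck_on_add[OF assms(1)])

text \<open>One Leibniz induction covers products, scalings, matrix products and inner products. The
  product rule also leaves an undifferentiated factor, which is known only at the higher order;
  hence \<open>Ck_on_Suc_D\<close>.\<close>

lemma Ck_on_bilinear:
  assumes "open S" "bounded_bilinear B" "Ck_on k S f" "Ck_on k S g"
  shows "Ck_on k S (\<lambda>x. B (f x) (g x))"
  using assms(3,4)
proof (induction k arbitrary: f g)
  case 0
  then show ?case by (simp add: bounded_bilinear.continuous_on[OF assms(2)])
next
  case (Suc k)
  have D: "((\<lambda>x. B (f x) (g x)) has_derivative
      (\<lambda>v. B (f x) (frechet_derivative g (at x) v) + B (frechet_derivative f (at x) v) (g x))) (at x)"
    if "x \<in> S" for x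
    using Suc.prems that
    by (auto intro!: bounded_bilinear.FDERIV[OF assms(2)] frechet_derivative_has_derivative)
  have "Ck_on k S (\<lambda>x. frechet_derivative (\<lambda>x. B (f x) (g x)) (at x) v)" for v
  proof (rule Ck_on_cong[OF assms(1)])
    show "Ck_on k S (\<lambda>x. B (f x) (frechet_derivative g (at x) v) + B (frechet_derivative f (at x) v) (g x))"
      using Suc.prems Ck_on_Suc_D[OF Suc.prems(1)] Ck_on_Suc_D[OF Suc.prems(2)]
      by (intro Ck_on_add assms Suc.IH) simp_all
  qed (use frechet_derivative_eqI[OF D] in auto)
  then show ?case using D by (auto simp: differentiable_def)
qed

lemma Ck_on_frechet_derivative: "Ck_on (Suc k) S f \<Longrightarrow> Ck_on k S (\<lambda>x. frechet_derivative f (at x) v)"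
  by simp

lemma linear_eq_sum_Basis:
  fixes L :: "'a::euclidean_space \<Rightarrow> 'b::real_vector"
  assumes "linear L" shows "L v = (\<Sum>b\<in>Basis. (v \<bullet> b) *\<^sub>R L b)"
  by (subst (1) euclidean_representation[symmetric]) (simp add: linear_sum[OF assms] linear_scale[OF assms])

text \<open>\<open>Ck_on\<close> controls derivatives in fixed directions, but the chain rule
  applies the outer derivative to a direction that moves with \<open>x\<close>. Expanding that
  direction in \<open>Basis\<close> reduces to fixed ones, which is why the middle space is
  Euclidean.\<close>

lemma Ck_on_linear_apply:
  fixes u :: "'a::real_normed_vector \<Rightarrow> 'b::euclidean_space"
    and L :: "'a \<Rightarrow> 'b \<Rightarrow> 'c::real_normed_vector"
  assumes "open S" "\<And>x. x \<in> S \<Longrightarrow> linear (L x)" "\<And>b. b \<in> Basis \<Longrightarrow> Ck_on k S (\<lambda>x. L x b)" "Ck_on k S u"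
  shows "Ck_on k S (\<lambda>x. L x (u x))"
proof (rule Ck_on_cong[OF assms(1)])
  have "Ck_on k S (\<lambda>x. u x \<bullet> b)" for b
    by (rule Ck_on_compose_bounded_linear[OF assms(1) bounded_linear_inner_left assms(4)])
  then have "Ck_on k S (\<lambda>x. (u x \<bullet> b) *\<^sub>R L x b)" if "b \<in> Basis" for b
    by (rule Ck_on_bilinear[OF assms(1) bounded_bilinear_scaleR _ assms(3)[OF that]])
  then show "Ck_on k S (\<lambda>x. \<Sum>b\<in>Basis. (u x \<bullet> b) *\<^sub>R L x b)"
    by (rule Ck_on_sum[OF assms(1)])
  show "(\<Sum>b\<in>Basis. (u x \<bullet> b) *\<^sub>R L x b) = L x (u x)" if "x \<in> S" for x
    by (rule linear_eq_sum_Basis[OF assms(2)[OF that], symmetric])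
qed

lemma frechet_derivative_compose:
  assumes "f differentiable (at x)" "g differentiable (at (f x))"
  shows "frechet_derivative (\<lambda>y. g (f y)) (at x) v = frechet_derivative g (at (f x)) (frechet_derivative f (at x) v)"
    and "(\<lambda>y. g (f y)) differentiable (at x)"
proof -
  have "((\<lambda>y. g (f y)) has_derivative (\<lambda>v. frechet_derivative g (at (f x)) (frechet_derivative f (at x) v))) (at x)"
    using diff_chain_at[OF frechet_derivative_has_derivative[OF assms(1)] frechet_derivative_has_derivative[OF assms(2)]]
    by (simp add: o_def)
  then show "frechet_derivative (\<lambda>y. g (f y)) (at x) v = frechet_derivative g (at (f x)) (frechet_derivative f (at x) v)"
    and "(\<lambda>y. g (f y)) differentiable (at x)"
    by (auto simp: frechet_derivative_eqI differentiable_def)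
qed

lemma Ck_on_compose:
  fixes f :: "'a::real_normed_vector \<Rightarrow> 'b::euclidean_space"
  assumes "open S" "Ck_on k S f" "Ck_on k T g" "f ` S \<subseteq> T"
  shows "Ck_on k S (\<lambda>x. g (f x))"
  using assms(2,3)
proof (induction k arbitrary: g)
  case 0
  then show ?case using assms(4) by (auto intro: continuous_on_compose2)
next
  case (Suc k)
  have d: "f differentiable (at x)" "g differentiable (at (f x))" if "x \<in> S" for x
    using Suc.prems assms(4) that by auto
  have "Ck_on k S (\<lambda>x. frechet_derivative (\<lambda>x. g (f x)) (at x) v)" for v
  proof (rule Ck_on_cong[OF assms(1)])
    show "Ck_on k S (\<lambda>x. frechet_derivative g (at (f x)) (frechet_derivative f (at x) v))"
    proof (rule Ck_on_linear_apply[OF assms(1)])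
      show "linear (frechet_derivative g (at (f x)))" if "x \<in> S" for x
        using d(2)[OF that] by (rule linear_frechet_derivative)
      show "Ck_on k S (\<lambda>x. frechet_derivative g (at (f x)) b)" for b
        by (rule Suc.IH) (use Suc.prems Ck_on_Suc_D[OF Suc.prems(1)] in auto)
      show "Ck_on k S (\<lambda>x. frechet_derivative f (at x) v)" using Suc.prems by simp
    qed
  qed (use frechet_derivative_compose(1) d in metis)
  then show ?case using frechet_derivative_compose(2)[OF d] by simp
qed

lemma Ck_on_vec_lambda:
  fixes f :: "'a::real_normed_vector \<Rightarrow> 'b::euclidean_space ^ 'n"
  assumes "open S" "\<And>i. Ck_on k S (\<lambda>x. f x $ i)"
  shows "Ck_on k S f"
proof (rule Ck_on_cong[OF assms(1)])
  show "Ck_on k S (\<lambda>x. \<Sum>i\<in>UNIV. axis i (f x $ i))"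
    by (rule Ck_on_sum[OF assms(1) Ck_on_compose_bounded_linear[OF assms(1) _ assms(2)]])
       (auto intro!: linear_conv_bounded_linear[THEN iffD1] linearI simp: axis_def vec_eq_iff)
  show "(\<Sum>i\<in>UNIV. axis i (f x $ i)) = f x" for x
    by (simp add: vec_eq_iff axis_def if_distrib[of "\<lambda>v. v $ _"] sum.delta cong: if_cong)
qed

lemma Ck_on_vec_nth:
  fixes f :: "'a::real_normed_vector \<Rightarrow> 'b::real_normed_vector ^ 'n"
  shows "open S \<Longrightarrow> Ck_on k S f \<Longrightarrow> Ck_on k S (\<lambda>x. f x $ i)"
  by (rule Ck_on_compose_bounded_linear[OF _ bounded_linear_vec_nth])

lemma Ck_on_mult:
  fixes f g :: "'a::real_normed_vector \<Rightarrow> 'b::real_normed_algebra"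
  shows "open S \<Longrightarrow> Ck_on k S f \<Longrightarrow> Ck_on k S g \<Longrightarrow> Ck_on k S (\<lambda>x. f x * g x)"
  by (rule Ck_on_bilinear[OF _ bounded_bilinear_mult])

lemma Ck_on_scaleR:
  shows "open S \<Longrightarrow> Ck_on k S f \<Longrightarrow> Ck_on k S g \<Longrightarrow> Ck_on k S (\<lambda>x. f x *\<^sub>R g x)"
  by (rule Ck_on_bilinear[OF _ bounded_bilinear_scaleR])

lemma Ck_on_minus: "open S \<Longrightarrow> Ck_on k S f \<Longrightarrow> Ck_on k S (\<lambda>x. - f x)"
  by (rule Ck_on_compose_bounded_linear[OF _ bounded_linear_minus[OF bounded_linear_ident]])

lemma Ck_on_diff: "open S \<Longrightarrow> Ck_on k S f \<Longrightarrow> Ck_on k S g \<Longrightarrow> Ck_on k S (\<lambda>x. f x - g x)"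
  using Ck_on_add[OF _ _ Ck_on_minus, of S k f g] by simp

lemma Ck_on_prod:
  fixes f :: "'i \<Rightarrow> 'a::real_normed_vector \<Rightarrow> 'b::{real_normed_algebra_1, comm_ring_1}"
  assumes "open S" "\<And>i. i \<in> I \<Longrightarrow> Ck_on k S (f i)"
  shows "Ck_on k S (\<lambda>x. \<Prod>i\<in>I. f i x)"
  using assms(2)
  by (induction I rule: infinite_finite_induct) (auto intro: Ck_on_mult[OF assms(1)])

text \<open>The derivative of \<open>inverse (f x)\<close> contains \<open>inverse (f x)\<close>
  itself, now required one order lower, so the induction closes with \<open>f\<close> fixed.\<close>

lemma Ck_on_inverse:
  fixes f :: "'a::real_normed_vector \<Rightarrow> 'b::real_normed_field"
  assumes "open S" "Ck_on k S f" "\<And>x. x \<in> S \<Longrightarrow> f x \<noteq> 0"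
  shows "Ck_on k S (\<lambda>x. inverse (f x))"
  using assms(2)
proof (induction k)
  case 0
  then show ?case using assms(3) by (simp add: continuous_on_inverse)
next
  case (Suc k)
  have D: "((\<lambda>x. inverse (f x)) has_derivative
      (\<lambda>v. - (inverse (f x) * frechet_derivative f (at x) v * inverse (f x)))) (at x)" if "x \<in> S" for x
    using Suc.prems that assms(3)
    by (intro Deriv.has_derivative_inverse frechet_derivative_has_derivative) auto
  have "Ck_on k S (\<lambda>x. frechet_derivative (\<lambda>x. inverse (f x)) (at x) v)" for v
  proof (rule Ck_on_cong[OF assms(1)])
    show "Ck_on k S (\<lambda>x. - (inverse (f x) * frechet_derivative f (at x) v * inverse (f x)))"
      using Suc.prems Ck_on_Suc_D[OF Suc.prems(1)]
      by (intro Ck_on_minus Ck_on_mult assms Suc.IH) simp_all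
  qed (use frechet_derivative_eqI[OF D] in auto)
  then show ?case using D by (auto simp: differentiable_def)
qed

lemma smooth_on_Ck: "smooth_on S f \<Longrightarrow> Ck_on k S f"
  by (simp add: smooth_on_def)

subsection \<open>Symmetry of second derivatives\<close>

lemma has_vector_derivative_line:
  assumes "f differentiable (at (x + s *\<^sub>R v))"
  shows "((\<lambda>s. f (x + s *\<^sub>R v)) has_vector_derivative frechet_derivative f (at (x + s *\<^sub>R v)) v) (at s within T)"
proof -
  have "((\<lambda>s. x + s *\<^sub>R v) has_derivative (\<lambda>s. s *\<^sub>R v)) (at s)"
    by (auto intro!: derivative_eq_intros)
  from diff_chain_at[OF this frechet_derivative_has_derivative[OF assms]]
  have "((\<lambda>s. f (x + s *\<^sub>R v)) has_derivative (\<lambda>r. frechet_derivative f (at (x + s *\<^sub>R v)) (r *\<^sub>R v))) (at s)"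
    by (simp add: o_def)
  then have "((\<lambda>s. f (x + s *\<^sub>R v)) has_vector_derivative frechet_derivative f (at (x + s *\<^sub>R v)) v) (at s)"
    by (simp add: has_vector_derivative_def linear_scale[OF linear_frechet_derivative[OF assms]])
  then show ?thesis by (rule has_vector_derivative_at_within)
qed

text \<open>Both sides are the derivative at \<open>\<tau> = 0\<close> of \<open>\<partial>\<^sub>v f (x + \<tau> w) - \<partial>\<^sub>v f x\<close>, which by the Leibniz rule
  is the integral over \<open>[0, \<tau>]\<close> of \<open>\<partial>\<^sub>v \<partial>\<^sub>w f (x + t w)\<close>.\<close>

lemma frechet_derivative_commute:
  fixes f :: "'a::real_normed_vector \<Rightarrow> 'b::euclidean_space"
  assumes "open S" "x \<in> S" and f: "Ck_on 2 S f"
  shows "frechet_derivative (\<lambda>y. frechet_derivative f (at y) w) (at x) v =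
         frechet_derivative (\<lambda>y. frechet_derivative f (at y) v) (at x) w"
proof -
  define fv where "fv = (\<lambda>y. frechet_derivative f (at y) v)"
  define fw where "fw = (\<lambda>y. frechet_derivative f (at y) w)"
  define fwv where "fwv = (\<lambda>y. frechet_derivative fw (at y) v)"
  have df: "f differentiable (at y)" and dfv: "fv differentiable (at y)" and dfw: "fw differentiable (at y)"
    if "y \<in> S" for y
    using f that by (auto simp: numeral_2_eq_2 fv_def fw_def)
  have contwv: "continuous_on S fwv" and contw: "continuous_on S fw"
    using f Ck_on_imp_continuous_on[of 1 S fw] by (auto simp: numeral_2_eq_2 fw_def fwv_def)
  obtain e where e: "e > 0" "ball x e \<subseteq> S" using assms by (meson openE)
  \<comment> \<open>Scaling by the norms keeps \<open>x + t w + s v\<close> in the ball for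
    parameters up to \<open>d\<close>; the summand 1 protects against a zero denominator and the
    factor 2 makes the estimate strict.\<close>
  define d where "d = e / (2 * (norm v + norm w + 1))"
  have d: "d > 0" using e by (auto simp: d_def intro!: divide_pos_pos add_nonneg_pos)
  have inS: "x + t *\<^sub>R w + s *\<^sub>R v \<in> S" if "\<bar>s\<bar> \<le> d" "\<bar>t\<bar> \<le> d" for s t
  proof -
    have "norm (t *\<^sub>R w + s *\<^sub>R v) \<le> \<bar>t\<bar> * norm w + \<bar>s\<bar> * norm v"
      using norm_triangle_ineq[of "t *\<^sub>R w" "s *\<^sub>R v"] by simp
    also have "\<dots> \<le> d * norm w + d * norm v" using that by (intro add_mono mult_right_mono) auto
    also have "\<dots> < d * (2 * (norm v + norm w + 1))" using d by (simp add: algebra_simps) (smt (verit) mult_nonneg_nonneg norm_ge_zero)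
    also have "\<dots> = e"
      unfolding d_def using norm_ge_zero[of v] norm_ge_zero[of w] by (simp add: add_nonneg_eq_0_iff field_simps)
    finally have "dist x (x + t *\<^sub>R w + s *\<^sub>R v) < e" 
      by (metis add.assoc add_diff_cancel_left' dist_commute dist_norm)
    then show ?thesis using e by auto
  qed
  have key: "integral (cbox 0 \<tau>) (\<lambda>t. fwv (x + t *\<^sub>R w)) = fv (x + \<tau> *\<^sub>R w) - fv x" if \<tau>: "0 \<le> \<tau>" "\<tau> \<le> d" for \<tau>
  proof -
    let ?U = "{-d..d}"
    have FTC: "((\<lambda>t. fw (x + t *\<^sub>R w + s *\<^sub>R v)) has_integral f (x + s *\<^sub>R v + \<tau> *\<^sub>R w) - f (x + s *\<^sub>R v)) {0..\<tau>}"
      if "s \<in> ?U" for s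
    proof -
      have "((\<lambda>t. f ((x + s *\<^sub>R v) + t *\<^sub>R w)) has_vector_derivative fw ((x + s *\<^sub>R v) + t *\<^sub>R w))
          (at t within {0..\<tau>})" if "t \<in> {0..\<tau>}" for t
        unfolding fw_def
        by (rule has_vector_derivative_line[OF df]) (use inS[of s t] that \<open>s \<in> ?U\<close> \<tau> in \<open>auto simp: add_ac\<close>)
      from fundamental_theorem_of_calculus[OF \<tau>(1) this] show ?thesis by (simp add: add_ac)
    qed
    have "((\<lambda>s. integral (cbox 0 \<tau>) (\<lambda>t. fw (x + t *\<^sub>R w + s *\<^sub>R v))) has_vector_derivative
        integral (cbox 0 \<tau>) (\<lambda>t. fwv (x + t *\<^sub>R w + 0 *\<^sub>R v))) (at 0 within ?U)"
    proof (rule leibniz_rule_vector_derivative)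
      show "((\<lambda>s. fw (x + t *\<^sub>R w + s *\<^sub>R v)) has_vector_derivative fwv (x + t *\<^sub>R w + s *\<^sub>R v)) (at s within ?U)"
        if "s \<in> ?U" "t \<in> cbox 0 \<tau>" for s t
        unfolding fwv_def using that \<tau> by (intro has_vector_derivative_line dfw inS) auto
      show "(\<lambda>t. fw (x + t *\<^sub>R w + s *\<^sub>R v)) integrable_on cbox 0 \<tau>" if "s \<in> ?U" for s
        using FTC[OF that] by (auto simp: integrable_on_def)
      have "continuous_on (?U \<times> cbox 0 \<tau>) (\<lambda>p. fwv (x + snd p *\<^sub>R w + fst p *\<^sub>R v))"
        by (rule continuous_on_compose2[OF contwv]) (use \<tau> inS in \<open>auto intro!: continuous_intros\<close>)
      then show "continuous_on (?U \<times> cbox 0 \<tau>) (\<lambda>(s, t). fwv (x + t *\<^sub>R w + s *\<^sub>R v))"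
        by (simp add: case_prod_unfold)
    qed (use d in auto)
    then have 1: "((\<lambda>s. f (x + s *\<^sub>R v + \<tau> *\<^sub>R w) - f (x + s *\<^sub>R v)) has_vector_derivative
        integral (cbox 0 \<tau>) (\<lambda>t. fwv (x + t *\<^sub>R w))) (at 0 within ?U)"
      by (rule has_vector_derivative_transform[rotated 2, THEN has_vector_derivative_eq_rhs])
        (use d integral_unique[OF FTC] in auto)
    have 2: "((\<lambda>s. f ((x + \<tau> *\<^sub>R w) + s *\<^sub>R v) - f (x + s *\<^sub>R v)) has_vector_derivative
        frechet_derivative f (at ((x + \<tau> *\<^sub>R w) + 0 *\<^sub>R v)) v - frechet_derivative f (at (x + 0 *\<^sub>R v)) v) (at 0 within ?U)"
      using inS[of 0 \<tau>] \<tau> d assms(2)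
      by (intro has_vector_derivative_diff has_vector_derivative_line df) auto
    have "at 0 within ?U \<noteq> bot" using d by (auto simp: trivial_limit_within)
    then show ?thesis
      using vector_derivative_unique_within[OF _ 1, of "frechet_derivative f (at (x + \<tau> *\<^sub>R w)) v - frechet_derivative f (at x) v"] 2
      by (simp add: fv_def add_ac)
  qed
  \<comment> \<open>\<open>key\<close> covers nonnegative parameters, so both derivatives at 0 are
    taken within \<open>{0..d}\<close>, where they are still unique.\<close>
  have L: "((\<lambda>\<tau>. integral (cbox 0 \<tau>) (\<lambda>t. fwv (x + t *\<^sub>R w))) has_vector_derivative fwv (x + 0 *\<^sub>R w)) (at 0 within {0..d})"
    unfolding box_real
  proof (rule integral_has_vector_derivative)
    show "continuous_on {0..d} (\<lambda>t. fwv (x + t *\<^sub>R w))"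
      by (rule continuous_on_compose2[OF contwv]) (use inS[of 0] d in \<open>auto intro!: continuous_intros\<close>)
  qed (use d in auto)
  have R: "((\<lambda>\<tau>. fv (x + \<tau> *\<^sub>R w) - fv x) has_vector_derivative frechet_derivative fv (at (x + 0 *\<^sub>R w)) w - 0) (at 0 within {0..d})"
    using dfv assms(2) by (intro has_vector_derivative_diff has_vector_derivative_line) auto
  have L': "((\<lambda>\<tau>. fv (x + \<tau> *\<^sub>R w) - fv x) has_vector_derivative fwv (x + 0 *\<^sub>R w)) (at 0 within {0..d})"
    by (rule has_vector_derivative_transform[OF _ _ L]) (use d key in auto)
  have "at 0 within {0..d} \<noteq> bot" using d by (auto simp: trivial_limit_within)
  from vector_derivative_unique_within[OF this R L'] show ?thesis
    by (simp add: fv_def fw_def fwv_def)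
qed

section \<open>The exterior product\<close>

lemma length_nths_complement: "length (nths vs S) + length (nths vs (- S)) = length vs"
proof -
  have "{i. i < length vs \<and> i \<in> S} \<union> {i. i < length vs \<and> i \<in> - S} = {..<length vs}" by auto
  moreover have "card ({i. i < length vs \<and> i \<in> S} \<union> {i. i < length vs \<and> i \<in> - S}) =
      card {i. i < length vs \<and> i \<in> S} + card {i. i < length vs \<and> i \<in> - S}"
    by (rule card_Un_disjoint) auto
  ultimately show ?thesis by (simp add: length_nths)
qed

text \<open>An index 0 in the chosen set lies below every complementary index, so it adds no
  inversion, and the remaining indices are merely shifted.\<close>

lemma shuffle_sign_insert_0: "shuffle_sign (insert 0 (Suc ` S)) (Suc m) = shuffle_sign S m"
proof -
  have "{(a, b). a \<in> insert 0 (Suc ` S) \<and> b \<in> {..<Suc m} - insert 0 (Suc ` S) \<and> b < a} =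
      map_prod Suc Suc ` {(a, b). a \<in> S \<and> b \<in> {..<m} - S \<and> b < a}" (is "?L = ?R")
  proof
    show "?L \<subseteq> ?R"
    proof (rule subrelI)
      fix a b assume "(a, b) \<in> ?L"
      then have *: "a \<in> insert 0 (Suc ` S)" "b < Suc m" "b \<notin> insert 0 (Suc ` S)" "b < a" by auto
      then obtain a' b' where "a = Suc a'" "b = Suc b'" by (metis insertCI not_less0 not0_implies_Suc)
      with * show "(a, b) \<in> ?R" by (auto simp: image_iff)
    qed
  qed auto
  then show ?thesis by (simp add: shuffle_sign_def card_image inj_on_def)
qed

text \<open>Now 0 lies in the complement and is passed by every chosen index: one extra inversion
  for each element of \<open>S\<close>. This is the sign that \<open>grade_inv\<close>
  records.\<close>

lemma shuffle_sign_image_Suc: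
  assumes "S \<subseteq> {..<m}"
  shows "shuffle_sign (Suc ` S) (Suc m) = (- 1) ^ card S * shuffle_sign S m"
proof -
  have "{(a, b). a \<in> Suc ` S \<and> b \<in> {..<Suc m} - Suc ` S \<and> b < a} =
      map_prod Suc Suc ` {(a, b). a \<in> S \<and> b \<in> {..<m} - S \<and> b < a} \<union> (\<lambda>a. (Suc a, 0)) ` S" (is "?L = ?R")
  proof
    show "?L \<subseteq> ?R"
    proof (rule subrelI)
      fix a b assume "(a, b) \<in> ?L"
      then obtain a' where *: "a = Suc a'" "a' \<in> S" "b < Suc m" "b \<notin> Suc ` S" "b < Suc a'" by auto
      then show "(a, b) \<in> ?R" by (cases b) (auto simp: image_iff)
    qed
  qed auto
  moreover have "finite S" using assms finite_subset by blast
  then have "finite {(a, b). a \<in> S \<and> b \<in> {..<m} - S \<and> b < a}"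
    by (rule finite_subset[rotated, OF finite_cartesian_product[OF _ finite_lessThan[of m]]]) auto
  moreover have "card ((\<lambda>a. (Suc a, 0::nat)) ` S) = card S" by (simp add: card_image inj_on_def)
  ultimately have "card {(a, b). a \<in> Suc ` S \<and> b \<in> {..<Suc m} - Suc ` S \<and> b < a} =
      card {(a, b). a \<in> S \<and> b \<in> {..<m} - S \<and> b < a} + card S"
    using \<open>finite S\<close> by (subst \<open>?L = ?R\<close>, subst card_Un_disjoint) (auto simp: card_image inj_on_def)
  then show ?thesis by (simp add: shuffle_sign_def power_add)
qed

text \<open>Separates the shuffles according to which factor of a product receives the first
  vector.\<close>

lemma sum_Pow_lessThan_Suc:
  "(\<Sum>S\<in>Pow {..<Suc m}. F S) = (\<Sum>S\<in>Pow {..<m}. F (insert 0 (Suc ` S))) + (\<Sum>S\<in>Pow {..<m}. F (Suc ` S))"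
  for F :: "nat set \<Rightarrow> 'a::comm_monoid_add"
proof -
  have eq: "Pow {..<Suc m} = (\<lambda>S. insert 0 (Suc ` S)) ` Pow {..<m} \<union> (`) Suc ` Pow {..<m}"
    unfolding lessThan_Suc_eq_insert_0 Pow_insert image_Pow_surj[OF refl, of Suc, symmetric]
    by (simp add: image_image Un_commute)
  have inj: "inj_on ((`) Suc) (Pow {..<m})" "inj_on (\<lambda>S. insert 0 (Suc ` S)) (Pow {..<m})"
  proof -
    show "inj_on ((`) Suc) (Pow {..<m})"
      by (rule inj_on_image) simp
    have "{j. Suc j \<in> insert 0 (Suc ` S)} = S" for S by auto
    then show "inj_on (\<lambda>S. insert 0 (Suc ` S)) (Pow {..<m})"
      by (rule inj_on_inverseI[where g = "\<lambda>T. {j. Suc j \<in> T}"])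
  qed
  have "(\<Sum>S\<in>Pow {..<Suc m}. F S) =
      (\<Sum>S\<in>(\<lambda>S. insert 0 (Suc ` S)) ` Pow {..<m}. F S) + (\<Sum>S\<in>(`) Suc ` Pow {..<m}. F S)"
    unfolding eq by (rule sum.union_disjoint) auto
  also have "\<dots> = (\<Sum>S\<in>Pow {..<m}. F (insert 0 (Suc ` S))) + (\<Sum>S\<in>Pow {..<m}. F (Suc ` S))"
    using inj by (simp add: sum.reindex o_def)
  finally show ?thesis .
qed

text \<open>The interior product with \<open>v\<close>.\<close>

definition contract :: "'v \<Rightarrow> ('v list \<Rightarrow> 'a) \<Rightarrow> 'v list \<Rightarrow> 'a" where
  "contract v f = (\<lambda>us. f (v # us))"

text \<open>The grading involution. It expresses parity for forms of mixed degree, where there is no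
  single degree to refer to.\<close>

definition grade_inv :: "('v list \<Rightarrow> 'a::real_vector) \<Rightarrow> 'v list \<Rightarrow> 'a" where
  "grade_inv f = (\<lambda>us. (- 1) ^ length us *\<^sub>R f us)"

lemma grade_inv_grade_inv [simp]: "grade_inv (grade_inv f) = f"
  by (simp add: grade_inv_def flip: power_mult_distrib)

lemma contract_grade_inv: "contract v (grade_inv f) = (\<lambda>us. - grade_inv (contract v f) us)"
  by (simp add: grade_inv_def contract_def)

lemma wedge_Nil [simp]: "wedge mul f g [] = mul (f []) (g [])"
  by (simp add: wedge_def shuffle_sign_def)

text \<open>Contraction with a vector is an antiderivation.  This recursion along the list replaces the
  combinatorics of shuffles from here on.\<close>

lemma wedge_Cons:
  assumes "bilinear mul"
  shows "wedge mul f g (v # vs) = wedge mul (contract v f) g vs + wedge mul (grade_inv f) (contract v g) vs"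
proof -
  let ?G = "\<lambda>S. shuffle_sign S (length (v # vs)) *\<^sub>R mul (f (nths (v # vs) S)) (g (nths (v # vs) (- S)))"
  have "?G (insert 0 (Suc ` S)) =
      shuffle_sign S (length vs) *\<^sub>R mul (contract v f (nths vs S)) (g (nths vs (- S)))" for S
  proof -
    have "nths (v # vs) (insert 0 (Suc ` S)) = v # nths vs S"
      "nths (v # vs) (- insert 0 (Suc ` S)) = nths vs (- S)"
      by (auto simp: nths_Cons image_iff intro!: arg_cong[where f = "nths vs"])
    then show ?thesis by (simp add: shuffle_sign_insert_0 contract_def)
  qed
  moreover have "?G (Suc ` S) =
      shuffle_sign S (length vs) *\<^sub>R mul (grade_inv f (nths vs S)) (contract v g (nths vs (- S)))"
    if "S \<subseteq> {..<length vs}" for S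
  proof -
    have "length (nths vs S) = card S"
      using that by (auto simp: length_nths intro!: arg_cong[where f = card])
    moreover have "mul (r *\<^sub>R x) y = r *\<^sub>R mul x y" for r x y
      using assms by (simp add: bilinear_lmul)
    moreover have "nths (v # vs) (Suc ` S) = nths vs S"
      "nths (v # vs) (- (Suc ` S)) = v # nths vs (- S)"
      by (auto simp: nths_Cons image_iff intro!: arg_cong[where f = "nths vs"])
    ultimately show ?thesis
      by (simp add: shuffle_sign_image_Suc[OF that] grade_inv_def contract_def mult.commute)
  qed
  ultimately show ?thesis
    unfolding wedge_def by (simp add: sum_Pow_lessThan_Suc)
qed

lemma wedge_zero_left [simp]: "bilinear mul \<Longrightarrow> wedge mul (\<lambda>_. 0) g vs = 0"
  by (simp add: wedge_def bilinear_lzero)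

lemma wedge_zero_right [simp]: "bilinear mul \<Longrightarrow> wedge mul f (\<lambda>_. 0) vs = 0"
  by (simp add: wedge_def bilinear_rzero)

lemma wedge_add_left: "bilinear mul \<Longrightarrow> wedge mul (\<lambda>us. f us + f' us) g vs = wedge mul f g vs + wedge mul f' g vs"
  by (simp add: wedge_def bilinear_ladd scaleR_add_right sum.distrib)

lemma wedge_add_right: "bilinear mul \<Longrightarrow> wedge mul f (\<lambda>us. g us + g' us) vs = wedge mul f g vs + wedge mul f g' vs"
  by (simp add: wedge_def bilinear_radd scaleR_add_right sum.distrib)

lemma wedge_scale_left: "bilinear mul \<Longrightarrow> wedge mul (\<lambda>us. r *\<^sub>R f us) g vs = r *\<^sub>R wedge mul f g vs"
  by (simp add: wedge_def bilinear_lmul scaleR_sum_right mult.commute)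

lemma wedge_scale_right: "bilinear mul \<Longrightarrow> wedge mul f (\<lambda>us. r *\<^sub>R g us) vs = r *\<^sub>R wedge mul f g vs"
  by (simp add: wedge_def bilinear_rmul scaleR_sum_right mult.commute)

lemma wedge_minus_left: "bilinear mul \<Longrightarrow> wedge mul (\<lambda>us. - f us) g vs = - wedge mul f g vs"
  using wedge_scale_left[of mul "-1" f g vs] by simp

lemma wedge_minus_right: "bilinear mul \<Longrightarrow> wedge mul f (\<lambda>us. - g us) vs = - wedge mul f g vs"
  using wedge_scale_right[of mul f "-1" g vs] by simp

lemma grade_inv_wedge:
  assumes "bilinear mul"
  shows "grade_inv (wedge mul f g) = wedge mul (grade_inv f) (grade_inv g)"
proof
  fix vs
  have "(- 1) ^ length vs *\<^sub>R mul (f (nths vs S)) (g (nths vs (- S))) =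
      mul (grade_inv f (nths vs S)) (grade_inv g (nths vs (- S)))" for S
    by (subst length_nths_complement[of vs S, symmetric])
       (simp add: grade_inv_def power_add bilinear_lmul[OF assms] bilinear_rmul[OF assms])
  then show "grade_inv (wedge mul f g) vs = wedge mul (grade_inv f) (grade_inv g) vs"
    by (simp add: grade_inv_def[of "wedge mul f g"] wedge_def scaleR_sum_right)
       (metis (no_types, lifting) scaleR_left_commute scaleR_scaleR)
qed

text \<open>Contraction turns both bracketings into the same three terms, one for each factor, so
  the induction runs along the list of vectors with the forms arbitrary. Four products allow the
  coefficients to lie in different spaces.\<close>

lemma wedge_assoc:
  assumes "bilinear m1" "bilinear m2" "bilinear m3" "bilinear m4" "\<And>a b c. m1 (m2 a b) c = m3 a (m4 b c)"
  shows "wedge m1 (wedge m2 f g) h vs = wedge m3 f (wedge m4 g h) vs"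
proof (induction vs arbitrary: f g h)
  case (Cons v vs)
  have c: "contract v (wedge m f g) =
      (\<lambda>us. wedge m (contract v f) g us + wedge m (grade_inv f) (contract v g) us)" if "bilinear m" for m f g
    by (simp add: contract_def wedge_Cons[OF that])
  show ?case
    by (simp add: wedge_Cons[OF assms(1)] wedge_Cons[OF assms(3)] c assms(1-4) wedge_add_left wedge_add_right
        grade_inv_wedge Cons.IH)
qed (simp add: assms(5))

lemma wedge_hom:
  assumes "linear \<phi>" "\<And>a b. \<phi> (m a b) = m' (\<phi>1 a) (\<phi>2 b)"
  shows "\<phi> (wedge m f g vs) = wedge m' (\<lambda>us. \<phi>1 (f us)) (\<lambda>us. \<phi>2 (g us)) vs"
  by (simp add: wedge_def linear_sum[OF assms(1)] linear_scale[OF assms(1)] assms(2))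

lemma wedge_map: "wedge m f g (map L vs) = wedge m (\<lambda>us. f (map L us)) (\<lambda>us. g (map L us)) vs"
  by (simp add: wedge_def nths_map)

lemma wedge_power_map: "wedge_power m e f k (map L vs) = wedge_power m e (\<lambda>us. f (map L us)) k vs"
  by (induction k arbitrary: vs) (simp_all add: wedge_map)

subsection \<open>Alternating forms\<close>

lemma alternating_formD:
  assumes "alternating_form f"
  shows "linear (\<lambda>v. f (us @ v # ws))" "f (us @ v # ws @ v # ys) = 0"
  using assms by (auto simp: alternating_form_def)

text \<open>Polarisation: expand the vanishing value at the repeated vector
  \<open>v + w\<close>.\<close>

lemma neighbour_swap:
  assumes lin: "\<And>us ws. linear (\<lambda>v. f (us @ v # ws))" and adj: "\<And>us v ys. f (us @ v # v # ys) = 0"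
  shows "f (us @ v # w # ys) = - f (us @ w # v # ys)"
proof -
  have l1: "f (us @ (v + w) # z # ys) = f (us @ v # z # ys) + f (us @ w # z # ys)" for z
    using linear_add[OF lin[of us "z # ys"]] .
  have l2: "f (us @ z # (v + w) # ys) = f (us @ z # v # ys) + f (us @ z # w # ys)" for z
    using linear_add[OF lin[of "us @ [z]" ys]] by simp
  have "0 = f (us @ (v + w) # (v + w) # ys)" by (simp add: adj)
  also have "\<dots> = f (us @ v # (v + w) # ys) + f (us @ w # (v + w) # ys)" by (rule l1)
  also have "\<dots> = f (us @ v # w # ys) + f (us @ w # v # ys)"
    by (simp add: l2 adj)
  finally show ?thesis by (metis eq_neg_iff_add_eq_0)
qed

lemma alternating_form_swap:
  assumes "alternating_form f"
  shows "f (us @ v # w # ys) = - f (us @ w # v # ys)"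
  by (rule neighbour_swap) (use alternating_formD[OF assms] alternating_formD(2)[OF assms, of _ _ "[]"] in simp_all)

text \<open>A repetition at a distance becomes an adjacent one when the first copy is moved to the
  right, one sign for each vector in between.\<close>

lemma alternating_formI:
  assumes lin: "\<And>us ws. linear (\<lambda>v. f (us @ v # ws))" and adj: "\<And>us v ys. f (us @ v # v # ys) = 0"
  shows "alternating_form f"
proof -
  note swap = neighbour_swap[OF assms]
  have "f (us @ v # ws @ v # ys) = 0" for us v ws ys
  proof (induction ws arbitrary: us)
    case Nil
    then show ?case by (simp add: adj)
  next
    case (Cons w ws)
    have "f (us @ v # (w # ws) @ v # ys) = - f ((us @ [w]) @ v # ws @ v # ys)"
      by (simp add: swap[of us v w])
    then show ?case using Cons.IH[of "us @ [w]"] by simp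
  qed
  then show ?thesis by (simp add: alternating_form_def lin)
qed

lemma linear_wedge_left:
  assumes "bilinear mul" "\<And>us. linear (\<lambda>v. F v us)"
  shows "linear (\<lambda>v. wedge mul (F v) g vs)"
proof (rule linearI)
  have "F (a + b) = (\<lambda>us. F a us + F b us)" "F (r *\<^sub>R a) = (\<lambda>us. r *\<^sub>R F a us)" for a b r
    using assms(2) by (simp_all add: fun_eq_iff linear_add[of "\<lambda>v. F v _"] linear_scale[of "\<lambda>v. F v _"])
  then show "wedge mul (F (a + b)) g vs = wedge mul (F a) g vs + wedge mul (F b) g vs"
    "wedge mul (F (r *\<^sub>R a)) g vs = r *\<^sub>R wedge mul (F a) g vs" for a b r
    by (simp_all add: wedge_add_left wedge_scale_left assms(1))
qed

lemma linear_wedge_right: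
  assumes "bilinear mul" "\<And>us. linear (\<lambda>v. G v us)"
  shows "linear (\<lambda>v. wedge mul f (G v) vs)"
proof (rule linearI)
  have "G (a + b) = (\<lambda>us. G a us + G b us)" "G (r *\<^sub>R a) = (\<lambda>us. r *\<^sub>R G a us)" for a b r
    using assms(2) by (simp_all add: fun_eq_iff linear_add[of "\<lambda>v. G v _"] linear_scale[of "\<lambda>v. G v _"])
  then show "wedge mul f (G (a + b)) vs = wedge mul f (G a) vs + wedge mul f (G b) vs"
    "wedge mul f (G (r *\<^sub>R a)) vs = r *\<^sub>R wedge mul f (G a) vs" for a b r
    by (simp_all add: wedge_add_right wedge_scale_right assms(1))
qed

lemma contract_alternating: "alternating_form f \<Longrightarrow> alternating_form (contract v f)"
  using alternating_formD[of f "v # _"] by (simp add: alternating_form_def contract_def)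

lemma grade_inv_alternating:
  assumes "alternating_form f" shows "alternating_form (grade_inv f)"
proof -
  have "linear (\<lambda>v. (- 1) ^ Suc (length us + length ws) *\<^sub>R f (us @ v # ws))" for us ws
    using alternating_formD(1)[OF assms] by (rule linear_compose_scale_right)
  then show ?thesis
    using alternating_formD(2)[OF assms] by (simp add: alternating_form_def grade_inv_def)
qed

text \<open>Once the prefix is contracted away, an adjacent repetition amounts to contracting the
  product twice with \<open>v\<close>. Terms with both contractions on one factor vanish, and the
  two mixed terms cancel because contraction anticommutes with \<open>grade_inv\<close>.\<close>

lemma wedge_alternating:
  assumes m: "bilinear mul" and fg: "alternating_form f" "alternating_form g"
  shows "alternating_form (wedge mul f g)"
proof (rule alternating_formI)
  show "linear (\<lambda>v. wedge mul f g (us @ v # ws))" for us ws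
    using fg
  proof (induction us arbitrary: f g)
    case Nil
    have "linear (\<lambda>v. contract v f us)" "linear (\<lambda>v. contract v g us)" for us
      using alternating_formD(1)[OF Nil(1), of "[]"] alternating_formD(1)[OF Nil(2), of "[]"]
      by (simp_all add: contract_def)
    then show ?case
      by (simp add: wedge_Cons[OF m] linear_compose_add linear_wedge_left[OF m] linear_wedge_right[OF m])
  next
    case (Cons u us)
    then show ?case
      by (simp add: wedge_Cons[OF m] linear_compose_add contract_alternating grade_inv_alternating)
  qed
  show "wedge mul f g (us @ v # v # ys) = 0" for us v ys
    using fg
  proof (induction us arbitrary: f g)
    case Nil
    have "contract v (contract v f) = (\<lambda>_. 0)" "contract v (contract v g) = (\<lambda>_. 0)"
      using alternating_formD(2)[OF Nil(1), of "[]" v "[]"] alternating_formD(2)[OF Nil(2), of "[]" v "[]"]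
      by (auto simp: contract_def)
    then show ?case by (simp add: wedge_Cons[OF m] contract_grade_inv wedge_minus_left m)
  next
    case (Cons u us)
    then show ?case by (simp add: wedge_Cons[OF m] contract_alternating grade_inv_alternating)
  qed
qed

lemma alternating_form_unit: "alternating_form (\<lambda>vs. if vs = [] then e else 0)"
  by (simp add: alternating_form_def linear_zero)

lemma wedge_power_alternating:
  assumes "bilinear mul" "alternating_form f"
  shows "alternating_form (wedge_power mul e f k)"
  by (induction k) (simp_all add: alternating_form_unit wedge_alternating assms)

lemma alternating_form_compose_linear:
  assumes "linear \<phi>" "alternating_form f" shows "alternating_form (\<lambda>vs. \<phi> (f vs))"
proof -
  have "linear (\<lambda>v. \<phi> (f (us @ v # ws)))" for us ws
    using linear_compose[OF alternating_formD(1)[OF assms(2)] assms(1), of us ws] by (simp add: o_def)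
  then show ?thesis
    using alternating_formD(2)[OF assms(2)] linear_0[OF assms(1)] by (simp add: alternating_form_def)
qed

lemma alternating_form_add:
  "alternating_form f \<Longrightarrow> alternating_form g \<Longrightarrow> alternating_form (\<lambda>vs. f vs + g vs)"
  by (auto simp: alternating_form_def linear_compose_add)

lemma alternating_form_sum:
  "(\<And>i. i \<in> I \<Longrightarrow> alternating_form (f i)) \<Longrightarrow> alternating_form (\<lambda>vs. \<Sum>i\<in>I. f i vs)"
  by (auto simp: alternating_form_def linear_compose_sum)

lemma alternating_degree_part:
  assumes "alternating_form f" shows "alternating_form (degree_part k f)"
proof -
  have "linear (\<lambda>v. degree_part k f (us @ v # ws))" for us ws
    \<comment> \<open>Which case of \<open>degree_part\<close> applies depends on the length alone,
      so any vector may stand in the variable slot.\<close>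
    using alternating_formD(1)[OF assms, of us ws]
    by (cases "length (us @ undefined # ws) = k") (simp_all add: degree_part_def linear_zero)
  then show ?thesis using assms by (simp add: alternating_form_def degree_part_def)
qed

section \<open>The algebra of matrix-valued forms\<close>

lemma bilinear_matrix_mult: "bilinear ((**) :: complex ^ 'r ^ 'r \<Rightarrow> complex ^ 'r ^ 'r \<Rightarrow> complex ^ 'r ^ 'r)"
  unfolding bilinear_def
  by (auto intro!: linearI simp: matrix_matrix_mult_def vec_eq_iff algebra_simps sum.distrib scaleR_sum_right)

lemma bounded_bilinear_matrix_mult:
  "bounded_bilinear ((**) :: complex ^ 'r ^ 'r \<Rightarrow> complex ^ 'r ^ 'r \<Rightarrow> complex ^ 'r ^ 'r)"
  using bilinear_matrix_mult bilinear_conv_bounded_bilinear by blast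

lemma mat_mult_nth: "(mat c ** M) $ i $ j = c * M $ i $ j" "(M ** mat c) $ i $ j = M $ i $ j * c"
  for M :: "complex ^ 'r ^ 'r"
  by (simp_all add: matrix_matrix_mult_def mat_def if_distrib if_distribR sum.delta' sum.delta cong: if_cong)

lemma mat_mult_commute: "mat c ** M = M ** mat c" for M :: "complex ^ 'r ^ 'r"
  by (simp add: vec_eq_iff mat_mult_nth mult.commute)

lemma mat_mult_mat: "mat c ** mat d = (mat (c * d) :: complex ^ 'r ^ 'r)"
  by (simp add: vec_eq_iff mat_mult_nth) (simp add: mat_def)

lemma linear_mat: "linear (mat :: complex \<Rightarrow> complex ^ 'r ^ 'r)"
  by (auto intro!: linearI simp: mat_def vec_eq_iff)

lemma mat_of_real_mult: "mat (complex_of_real r) ** M = r *\<^sub>R M" for M :: "complex ^ 'r ^ 'r"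
  by (simp add: vec_eq_iff mat_mult_nth) (simp add: scaleR_conv_of_real)

lemma mat_one_neq_zero: "(mat 1 :: complex ^ 'r ^ 'r) \<noteq> 0"
proof
  assume "(mat 1 :: complex ^ 'r ^ 'r) = 0"
  then have "(mat 1 :: complex ^ 'r ^ 'r) $ undefined $ undefined = 0" by simp
  then show False by (simp add: mat_def)
qed

lemma linear_trace: "linear (trace :: complex ^ 'r ^ 'r \<Rightarrow> complex)"
  by (auto intro!: linearI simp: trace_def sum.distrib scaleR_sum_right)

lemma trace_mat_mult: "trace (mat c ** M) = c * trace M" for M :: "complex ^ 'r ^ 'r"
  by (simp add: trace_def mat_mult_nth sum_distrib_left)

text \<open>A type of its own lets the exterior product be the multiplication of a ring, with powers
  and distributivity over sums. Alternation is not built in: the contraction recursion gives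
  associativity and the unit laws for arbitrary functions on lists.\<close>

typedef ('v, 'r) gform = "UNIV :: ('v list \<Rightarrow> complex ^ 'r ^ 'r) set"
  morphisms coef Gf by simp

lemma coef_Gf [simp]: "coef (Gf f) = f" by (simp add: Gf_inverse)

lemma gform_eqI: "(\<And>vs. coef a vs = coef b vs) \<Longrightarrow> a = b"
  by (metis coef_inject ext)

instantiation gform :: (type, finite) real_algebra_1
begin

definition "0 = Gf (\<lambda>_. 0)"
definition "1 = Gf (\<lambda>vs. if vs = [] then mat 1 else 0)"
definition "a + b = Gf (\<lambda>vs. coef a vs + coef b vs)"
definition "a - b = Gf (\<lambda>vs. coef a vs - coef b vs)"
definition "- a = Gf (\<lambda>vs. - coef a vs)"
definition "r *\<^sub>R a = Gf (\<lambda>vs. r *\<^sub>R coef a vs)"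
definition "a * b = Gf (wedge (**) (coef a) (coef b))"

lemma coef_simps:
  "coef 0 vs = 0" "coef 1 vs = (if vs = [] then mat 1 else 0)"
  "coef (a + b) vs = coef a vs + coef b vs" "coef (a - b) vs = coef a vs - coef b vs"
  "coef (- a) vs = - coef a vs" "coef (r *\<^sub>R a) vs = r *\<^sub>R coef a vs"
  "coef (a * b) = wedge (**) (coef a) (coef b)"
  by (simp_all add: zero_gform_def one_gform_def plus_gform_def minus_gform_def uminus_gform_def
      scaleR_gform_def times_gform_def)

lemma wedge_unit_left:
  "wedge (**) (\<lambda>vs. if vs = [] then M else 0) f vs = M ** f vs" for f :: "'v list \<Rightarrow> complex ^ 'r ^ 'r" and M :: "complex ^ 'r ^ 'r"
proof (induction vs arbitrary: f)
  case (Cons v vs)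
  have "contract v (\<lambda>vs. if vs = [] then M else 0) = (\<lambda>_. 0)"
    "grade_inv (\<lambda>vs :: 'v list. if vs = [] then M else 0) = (\<lambda>vs. if vs = [] then M else 0)"
    by (auto simp: contract_def grade_inv_def)
  then show ?case
    by (simp add: wedge_Cons[OF bilinear_matrix_mult] bilinear_matrix_mult Cons.IH) (simp add: contract_def)
qed simp

lemma wedge_unit_right:
  "wedge (**) f (\<lambda>vs. if vs = [] then M else 0) vs = f vs ** M" for f :: "'v list \<Rightarrow> complex ^ 'r ^ 'r" and M :: "complex ^ 'r ^ 'r"
proof (induction vs arbitrary: f)
  case (Cons v vs)
  have "contract v (\<lambda>vs. if vs = [] then M else 0) = (\<lambda>_. 0)"
    by (auto simp: contract_def)
  then show ?case
    by (simp add: wedge_Cons[OF bilinear_matrix_mult] bilinear_matrix_mult Cons.IH) (simp add: contract_def)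
qed simp

instance
proof
  fix a b c :: "('a, 'b) gform" and r s :: real
  note m = bilinear_matrix_mult
  show "a * b * c = a * (b * c)"
    by (rule gform_eqI) (simp add: coef_simps wedge_assoc[OF m m m m matrix_mul_assoc[symmetric]])
  show "1 * a = a" "a * 1 = a"
    by (rule gform_eqI, simp add: coef_simps one_gform_def wedge_unit_left wedge_unit_right)+
  show "(a + b) * c = a * c + b * c" "a * (b + c) = a * b + a * c"
    by (rule gform_eqI, simp add: coef_simps plus_gform_def wedge_add_left[OF m] wedge_add_right[OF m])+
  show "r *\<^sub>R a * b = r *\<^sub>R (a * b)" "a * r *\<^sub>R b = r *\<^sub>R (a * b)"
    by (rule gform_eqI, simp add: coef_simps scaleR_gform_def wedge_scale_left[OF m] wedge_scale_right[OF m])+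
  have "coef (0 :: ('a, 'b) gform) [] \<noteq> coef 1 []"
    using mat_one_neq_zero[where 'r = 'b] by (simp add: coef_simps)
  then show "(0 :: ('a, 'b) gform) \<noteq> 1" by metis
qed (rule gform_eqI; simp add: coef_simps algebra_simps)+

end

lemma coef_sum: "coef (\<Sum>i\<in>I. a i) vs = (\<Sum>i\<in>I. coef (a i) vs)"
  by (induction I rule: infinite_finite_induct) (simp_all add: coef_simps)

lemma coef_power: "coef (a ^ k) = wedge_power (**) (mat 1) (coef a) k"
  by (induction k) (auto simp: coef_simps intro!: ext)

text \<open>Parity is stated throughout as \<open>gbar a = a\<close> or \<open>gbar a = - a\<close>,
  which also makes sense for sums of forms of several degrees.\<close>

definition gbar :: "('v, 'r::finite) gform \<Rightarrow> ('v, 'r) gform" where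
  "gbar a = Gf (grade_inv (coef a))"

lemma coef_gbar: "coef (gbar a) vs = (- 1) ^ length vs *\<^sub>R coef a vs"
  by (simp add: gbar_def grade_inv_def)

lemma gbar_mult: "gbar (a * b) = gbar a * gbar b"
  by (simp add: gbar_def times_gform_def grade_inv_wedge[OF bilinear_matrix_mult])

lemma gbar_one: "gbar 1 = 1"
  by (rule gform_eqI) (simp add: coef_gbar coef_simps)

lemma gbar_power: "gbar (a ^ k) = gbar a ^ k"
  by (induction k) (simp_all add: gbar_mult gbar_one)

lemma gbar_linear:
  "gbar (a + b) = gbar a + gbar b" "gbar (a - b) = gbar a - gbar b" "gbar (- a) = - gbar a"
  "gbar (r *\<^sub>R a) = r *\<^sub>R gbar a" "gbar (\<Sum>i\<in>I. f i) = (\<Sum>i\<in>I. gbar (f i))"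
  by (rule gform_eqI; simp add: coef_gbar coef_simps coef_sum scaleR_sum_right algebra_simps)+

lemmas gbar_simps = gbar_mult gbar_one gbar_power gbar_linear

definition const_form :: "complex ^ 'r ^ 'r \<Rightarrow> ('v, 'r::finite) gform" where
  "const_form M = Gf (\<lambda>vs. if vs = [] then M else 0)"

lemma coef_const_form_mult: "coef (const_form M * a) vs = M ** coef a vs" "coef (a * const_form M) vs = coef a vs ** M"
  by (simp_all add: coef_simps const_form_def wedge_unit_left wedge_unit_right)

lemma gbar_const_form: "gbar (const_form M) = const_form M"
  by (rule gform_eqI) (simp add: coef_gbar const_form_def)

lemma linear_const_form: "linear (const_form :: complex ^ 'r ^ 'r \<Rightarrow> ('v, 'r::finite) gform)"
  by (auto intro!: linearI gform_eqI simp: const_form_def coef_simps)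

text \<open>Scalar coefficients become multiples of the identity, so scalar and matrix-valued forms
  multiply in one algebra.\<close>

definition scalar_form :: "('v list \<Rightarrow> complex) \<Rightarrow> ('v, 'r::finite) gform" where
  "scalar_form c = Gf (\<lambda>vs. mat (c vs))"

lemma scalar_form_const_form: "const_form M * scalar_form c = scalar_form c * const_form M"
  by (rule gform_eqI) (simp add: coef_const_form_mult scalar_form_def mat_mult_commute)

text \<open>For \<open>b\<close> in \<open>Basis\<close> this is the coordinate one-form dual to
  \<open>b\<close>, times the identity matrix.\<close>

definition covec :: "'v::real_inner \<Rightarrow> ('v, 'r::finite) gform" where
  "covec b = scalar_form (\<lambda>vs. case vs of [v] \<Rightarrow> of_real (v \<bullet> b) | _ \<Rightarrow> 0)"

lemma contract_covec: "contract v (coef (covec b)) = (\<lambda>vs. if vs = [] then mat (of_real (v \<bullet> b)) else 0)"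
  by (auto simp: contract_def covec_def scalar_form_def fun_eq_iff split: list.splits)

lemma gbar_covec: "gbar (covec b) = - covec b"
  by (rule gform_eqI) (auto simp: coef_gbar covec_def scalar_form_def coef_simps split: list.splits)

lemma grade_inv_covec: "grade_inv (coef (covec b)) = (\<lambda>vs. - coef (covec b) vs)"
  using arg_cong[OF gbar_covec[of b], of coef] by (simp add: gbar_def fun_eq_iff coef_simps)

text \<open>The Koszul sign rule for mixed degree. In the recursion along the list, contracting
  \<open>a\<close> is covered by the induction hypothesis, while contracting the covector leaves a
  scalar matrix, which commutes with all coefficients.\<close>

lemma mult_covec: "a * covec b = covec b * gbar a"
proof (rule gform_eqI)
  fix vs
  show "coef (a * covec b) vs = coef (covec b * gbar a) vs"
  proof (induction vs arbitrary: a)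
    case Nil
    then show ?case by (simp add: coef_simps covec_def scalar_form_def)
  next
    case (Cons v vs)
    note [simp] = wedge_Cons[OF bilinear_matrix_mult] contract_covec wedge_unit_left wedge_unit_right
      grade_inv_covec wedge_minus_left[OF bilinear_matrix_mult] wedge_minus_right[OF bilinear_matrix_mult]
    have "wedge (**) (contract v (coef a)) (coef (covec b)) vs =
        wedge (**) (coef (covec b)) (grade_inv (contract v (coef a))) vs"
      using Cons.IH[of "Gf (contract v (coef a))"] by (simp add: coef_simps gbar_def)
    then show ?case by (simp add: coef_simps gbar_def contract_grade_inv mat_mult_commute)
  qed
qed

lemma covec_anticommute: "covec b * covec c = - (covec c * covec b)"
  by (simp add: mult_covec[of "covec b"] gbar_covec)

text \<open>This is the alternating sum over omitted vectors that occurs in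
  \<open>ext_deriv\<close>; through it \<open>coef_gext\<close> reconciles the two descriptions of
  the exterior derivative.\<close>

lemma coef_covec_mult:
  "coef (covec b * a) vs = (\<Sum>j<length vs. ((- 1) ^ j * ((vs ! j) \<bullet> b)) *\<^sub>R coef a (take j vs @ drop (Suc j) vs))"
proof (induction vs arbitrary: a)
  case Nil
  then show ?case by (simp add: coef_simps covec_def scalar_form_def)
next
  case (Cons v vs)
  have "coef (covec b * a) (v # vs) = (v \<bullet> b) *\<^sub>R coef a vs - coef (covec b * Gf (contract v (coef a))) vs"
    by (simp add: coef_simps wedge_Cons[OF bilinear_matrix_mult] contract_covec wedge_unit_left
        grade_inv_covec wedge_minus_left[OF bilinear_matrix_mult] mat_of_real_mult)
  then show ?case
    by (simp add: Cons.IH sum.lessThan_Suc_shift contract_def sum_negf[symmetric] del: sum.lessThan_Suc)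
qed

lemma mult_covec_even: "gbar a = a \<Longrightarrow> a * covec b = covec b * a"
  by (simp add: mult_covec)

lemma mult_covec_odd: "gbar a = - a \<Longrightarrow> a * covec b = - (covec b * a)"
  by (simp add: mult_covec)

lemma eq_minus_self_imp_zero:
  fixes x :: "'a::real_vector" assumes "x = - x" shows "x = 0"
proof -
  have "2 *\<^sub>R x = x + x" by (rule scaleR_2)
  also have "\<dots> = x + - x" by (subst (2) assms) (rule refl)
  finally show ?thesis by simp
qed

text \<open>A symmetric array is summed against anticommuting covectors: exchanging the indices
  shows that the sum is its own negative.\<close>

lemma sum_covec_covec_symmetric:
  assumes "\<And>b c. b \<in> B \<Longrightarrow> c \<in> B \<Longrightarrow> X b c = X c b"
  shows "(\<Sum>b\<in>B. \<Sum>c\<in>B. covec b * covec c * X b c) = 0"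
proof -
  let ?s = "\<Sum>b\<in>B. \<Sum>c\<in>B. covec b * covec c * X b c"
  have "?s = (\<Sum>c\<in>B. \<Sum>b\<in>B. covec b * covec c * X b c)" by (rule sum.swap)
  also have "\<dots> = (\<Sum>c\<in>B. \<Sum>b\<in>B. - (covec c * covec b * X c b))"
  proof (intro sum.cong refl)
    fix b c assume "b \<in> B" "c \<in> B"
    then show "covec b * covec c * X b c = - (covec c * covec b * X c b)"
      by (simp only: covec_anticommute[of b c] assms[of b c] mult_minus_left)
  qed
  also have "\<dots> = - ?s" by (simp only: sum_negf)
  finally show ?thesis by (rule eq_minus_self_imp_zero)
qed

subsection \<open>Differential calculus\<close>

text \<open>The space of all coefficient functions carries no norm here, so differentiability is
  imposed on each coefficient. The base point ranges over a type independent of \<open>'v\<close>;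
  the same calculus thus differentiates forms along a path of connections, with a real
  parameter.\<close>

definition gdiff :: "('a::real_normed_vector \<Rightarrow> ('v, 'r::finite) gform) \<Rightarrow> 'a \<Rightarrow> bool" where
  "gdiff \<alpha> x \<longleftrightarrow> (\<forall>vs. (\<lambda>y. coef (\<alpha> y) vs) differentiable (at x))"

definition pd :: "'a::real_normed_vector \<Rightarrow> ('a \<Rightarrow> ('v, 'r::finite) gform) \<Rightarrow> 'a \<Rightarrow> ('v, 'r) gform" where
  "pd v \<alpha> x = Gf (\<lambda>vs. frechet_derivative (\<lambda>y. coef (\<alpha> y) vs) (at x) v)"

definition gCk :: "nat \<Rightarrow> 'a::real_normed_vector set \<Rightarrow> ('a \<Rightarrow> ('v, 'r::finite) gform) \<Rightarrow> bool" where
  "gCk k S \<alpha> \<longleftrightarrow> (\<forall>vs. Ck_on k S (\<lambda>y. coef (\<alpha> y) vs))"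

lemma coef_pd: "coef (pd v \<alpha> x) vs = frechet_derivative (\<lambda>y. coef (\<alpha> y) vs) (at x) v"
  by (simp add: pd_def)

lemma gCk_Suc_gdiff: "gCk (Suc k) S \<alpha> \<Longrightarrow> x \<in> S \<Longrightarrow> gdiff \<alpha> x"
  by (simp add: gCk_def gdiff_def)

lemma gCk_pd: "gCk (Suc k) S \<alpha> \<Longrightarrow> gCk k S (pd v \<alpha>)"
  by (simp add: gCk_def coef_pd)

lemma gCk_le: "gCk m S \<alpha> \<Longrightarrow> k \<le> m \<Longrightarrow> gCk k S \<alpha>"
  by (auto simp: gCk_def intro: Ck_on_le)

lemma gCk_add: "open S \<Longrightarrow> gCk k S \<alpha> \<Longrightarrow> gCk k S \<beta> \<Longrightarrow> gCk k S (\<lambda>x. \<alpha> x + \<beta> x)"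
  by (simp add: gCk_def coef_simps Ck_on_add)

lemma gCk_const: "gCk k S (\<lambda>x. a)"
  by (simp add: gCk_def)

lemma gCk_scaleR: "open S \<Longrightarrow> Ck_on k S f \<Longrightarrow> gCk k S \<alpha> \<Longrightarrow> gCk k S (\<lambda>x. f x *\<^sub>R \<alpha> x)"
  by (simp add: gCk_def coef_simps Ck_on_scaleR)

lemma gCk_mult: "open S \<Longrightarrow> gCk k S \<alpha> \<Longrightarrow> gCk k S \<beta> \<Longrightarrow> gCk k S (\<lambda>x. \<alpha> x * \<beta> x)"
  unfolding gCk_def coef_simps wedge_def
  by (rule allI, rule Ck_on_sum, assumption, rule Ck_on_compose_bounded_linear[OF _ bounded_linear_scaleR_right],
      assumption, rule Ck_on_bilinear[OF _ bounded_bilinear_matrix_mult], assumption) blast+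

lemma gCk_sum: "open S \<Longrightarrow> (\<And>i. i \<in> I \<Longrightarrow> gCk k S (\<alpha> i)) \<Longrightarrow> gCk k S (\<lambda>x. \<Sum>i\<in>I. \<alpha> i x)"
  by (simp add: gCk_def coef_sum Ck_on_sum)

lemma gCk_power: "open S \<Longrightarrow> gCk k S \<alpha> \<Longrightarrow> gCk k S (\<lambda>x. \<alpha> x ^ m)"
proof (induction m)
  case 0
  show ?case by (simp only: power_0 gCk_const)
next
  case (Suc m)
  then show ?case unfolding power_Suc by (intro gCk_mult)
qed

lemma pd_cong:
  assumes "open S" "x \<in> S" "\<And>y. y \<in> S \<Longrightarrow> \<alpha> y = \<beta> y"
  shows "pd v \<alpha> x = pd v \<beta> x"
proof (rule gform_eqI)
  show "coef (pd v \<alpha> x) vs = coef (pd v \<beta> x) vs" for vs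
    unfolding coef_pd
    by (rule fun_cong[OF frechet_derivative_cong_open[OF assms(1,2)]]) (simp add: assms(3))
qed

lemma pdI:
  assumes "\<And>vs. ((\<lambda>y. coef (\<alpha> y) vs) has_derivative (\<lambda>v. coef (D v) vs)) (at x)"
  shows "gdiff \<alpha> x" "pd v \<alpha> x = D v"
proof -
  show "gdiff \<alpha> x" using assms by (auto simp: gdiff_def differentiable_def)
  show "pd v \<alpha> x = D v"
    by (rule gform_eqI) (simp add: coef_pd frechet_derivative_eqI[OF assms])
qed

lemma gdiff_has_derivative:
  "gdiff \<alpha> x \<Longrightarrow> ((\<lambda>y. coef (\<alpha> y) vs) has_derivative (\<lambda>v. coef (pd v \<alpha> x) vs)) (at x)"
  unfolding coef_pd gdiff_def by (simp add: frechet_derivative_has_derivative)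

lemma pd_const: "gdiff (\<lambda>y. a) x" "pd v (\<lambda>y. a) x = 0"
  by (rule pdI[where D = "\<lambda>_. 0"], simp add: coef_simps)+

lemma pd_add:
  assumes "gdiff \<alpha> x" "gdiff \<beta> x"
  shows "gdiff (\<lambda>y. \<alpha> y + \<beta> y) x" "pd v (\<lambda>y. \<alpha> y + \<beta> y) x = pd v \<alpha> x + pd v \<beta> x"
  by (rule pdI[where D = "\<lambda>v. pd v \<alpha> x + pd v \<beta> x"], unfold coef_simps,
      intro has_derivative_add gdiff_has_derivative assms)+

lemma pd_sum:
  assumes "\<And>i. i \<in> I \<Longrightarrow> gdiff (\<alpha> i) x"
  shows "gdiff (\<lambda>y. \<Sum>i\<in>I. \<alpha> i y) x" "pd v (\<lambda>y. \<Sum>i\<in>I. \<alpha> i y) x = (\<Sum>i\<in>I. pd v (\<alpha> i) x)"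
  by (rule pdI[where D = "\<lambda>v. \<Sum>i\<in>I. pd v (\<alpha> i) x"], unfold coef_sum,
      intro has_derivative_sum gdiff_has_derivative assms, assumption)+

lemma pd_mult:
  assumes "gdiff \<alpha> x" "gdiff \<beta> x"
  shows "gdiff (\<lambda>y. \<alpha> y * \<beta> y) x" "pd v (\<lambda>y. \<alpha> y * \<beta> y) x = pd v \<alpha> x * \<beta> x + \<alpha> x * pd v \<beta> x"
proof -
  have "((\<lambda>y. coef (\<alpha> y * \<beta> y) vs) has_derivative (\<lambda>v. coef (pd v \<alpha> x * \<beta> x + \<alpha> x * pd v \<beta> x) vs)) (at x)" for vs
  proof -
    have "((\<lambda>y. \<Sum>S\<in>Pow {..<length vs}. shuffle_sign S (length vs) *\<^sub>R
          (coef (\<alpha> y) (nths vs S) ** coef (\<beta> y) (nths vs (- S)))) has_derivative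
        (\<lambda>v. \<Sum>S\<in>Pow {..<length vs}. shuffle_sign S (length vs) *\<^sub>R
          (coef (\<alpha> x) (nths vs S) ** coef (pd v \<beta> x) (nths vs (- S)) +
           coef (pd v \<alpha> x) (nths vs S) ** coef (\<beta> x) (nths vs (- S))))) (at x)"
      by (intro has_derivative_sum has_derivative_scaleR_right
          bounded_bilinear.FDERIV[OF bounded_bilinear_matrix_mult] gdiff_has_derivative assms)
    then show ?thesis
      by (simp add: coef_simps wedge_def scaleR_add_right sum.distrib add.commute)
  qed
  from pdI[OF this] show "gdiff (\<lambda>y. \<alpha> y * \<beta> y) x"
    "pd v (\<lambda>y. \<alpha> y * \<beta> y) x = pd v \<alpha> x * \<beta> x + \<alpha> x * pd v \<beta> x" by auto
qed

text \<open>Coefficients do not commute, so the differentiated factor keeps its place. The sum over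
  its position becomes the sum of transgression forms in \<open>chern_weil_local\<close>.\<close>

lemma pd_power:
  assumes "gdiff \<alpha> x"
  shows "gdiff (\<lambda>y. \<alpha> y ^ k) x"
    "pd v (\<lambda>y. \<alpha> y ^ k) x = (\<Sum>j<k. \<alpha> x ^ j * pd v \<alpha> x * \<alpha> x ^ (k - Suc j))"
proof (induction k)
  case (Suc k)
  show "gdiff (\<lambda>y. \<alpha> y ^ Suc k) x" using pd_mult(1)[OF assms Suc.IH(1)] by simp
  have "pd v (\<lambda>y. \<alpha> y ^ Suc k) x = pd v \<alpha> x * \<alpha> x ^ k + \<alpha> x * (\<Sum>j<k. \<alpha> x ^ j * pd v \<alpha> x * \<alpha> x ^ (k - Suc j))"
    using pd_mult(2)[OF assms Suc.IH(1), of v] Suc.IH(2) by simp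
  then show "pd v (\<lambda>y. \<alpha> y ^ Suc k) x = (\<Sum>j<Suc k. \<alpha> x ^ j * pd v \<alpha> x * \<alpha> x ^ (Suc k - Suc j))"
    by (simp add: sum.lessThan_Suc_shift sum_distrib_left mult.assoc del: sum.lessThan_Suc)
qed (simp_all add: pd_const)

lemma pd_gbar:
  assumes "gdiff \<alpha> x"
  shows "pd v (\<lambda>y. gbar (\<alpha> y)) x = gbar (pd v \<alpha> x)"
  by (rule pdI(2)) (simp only: coef_gbar, intro has_derivative_scaleR_right gdiff_has_derivative assms)

lemma pd_uminus:
  assumes "gdiff \<alpha> x"
  shows "pd v (\<lambda>y. - \<alpha> y) x = - pd v \<alpha> x"
  by (rule pdI(2)) (simp only: coef_simps, intro has_derivative_minus gdiff_has_derivative assms)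

lemma pd_commute:
  assumes "open S" "x \<in> S" "gCk 2 S \<alpha>"
  shows "pd v (pd w \<alpha>) x = pd w (pd v \<alpha>) x"
  using assms(3) by (intro gform_eqI) (simp add: coef_pd gCk_def frechet_derivative_commute[OF assms(1,2)])

text \<open>The exterior derivative as the sum of dx_b times the b-th partial derivative. In this
  shape its Leibniz rules follow from \<open>mult_covec\<close>.\<close>

definition gext :: "('v::euclidean_space \<Rightarrow> ('v, 'r::finite) gform) \<Rightarrow> 'v \<Rightarrow> ('v, 'r) gform" where
  "gext \<alpha> x = (\<Sum>b\<in>Basis. covec b * pd b \<alpha> x)"

lemma coef_gext:
  assumes "gdiff \<alpha> x"
  shows "coef (gext \<alpha> x) vs = (\<Sum>j<length vs. (- 1) ^ j *\<^sub>R
     frechet_derivative (\<lambda>y. coef (\<alpha> y) (take j vs @ drop (Suc j) vs)) (at x) (vs ! j))"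
proof -
  have *: "(\<Sum>b\<in>Basis. (v \<bullet> b) *\<^sub>R coef (pd b \<alpha> x) us) = frechet_derivative (\<lambda>y. coef (\<alpha> y) us) (at x) v" for v us
  proof -
    have "linear (frechet_derivative (\<lambda>y. coef (\<alpha> y) us) (at x))"
      using assms by (intro linear_frechet_derivative) (simp add: gdiff_def)
    then show ?thesis unfolding coef_pd by (rule linear_eq_sum_Basis[symmetric])
  qed
  have "coef (gext \<alpha> x) vs = (\<Sum>b\<in>Basis. \<Sum>j<length vs. ((- 1) ^ j * ((vs ! j) \<bullet> b)) *\<^sub>R
      coef (pd b \<alpha> x) (take j vs @ drop (Suc j) vs))"
    by (simp only: gext_def coef_sum coef_covec_mult)
  also have "\<dots> = (\<Sum>j<length vs. \<Sum>b\<in>Basis. ((- 1) ^ j * ((vs ! j) \<bullet> b)) *\<^sub>R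
      coef (pd b \<alpha> x) (take j vs @ drop (Suc j) vs))"
    by (rule sum.swap)
  also have "\<dots> = (\<Sum>j<length vs. (- 1) ^ j *\<^sub>R (\<Sum>b\<in>Basis. ((vs ! j) \<bullet> b) *\<^sub>R
      coef (pd b \<alpha> x) (take j vs @ drop (Suc j) vs)))"
    by (simp only: scaleR_sum_right scaleR_scaleR)
  finally show ?thesis by (simp only: *)
qed

section \<open>Chern--Weil theory in a chart\<close>

definition conn_form :: "('v::euclidean_space \<Rightarrow> 'v \<Rightarrow> complex ^ 'r ^ 'r) \<Rightarrow> 'v \<Rightarrow> ('v, 'r::finite) gform" where
  "conn_form A x = (\<Sum>b\<in>Basis. covec b * const_form (A x b))"

definition curv_form :: "('v::euclidean_space \<Rightarrow> 'v \<Rightarrow> complex ^ 'r ^ 'r) \<Rightarrow> 'v \<Rightarrow> ('v, 'r::finite) gform" where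
  "curv_form A x = gext (conn_form A) x + conn_form A x * conn_form A x"

text \<open>\<open>A x b\<close> has degree 0, so an ordinary commutator suffices here. Multiplying
  it by \<open>covec b\<close> produces the graded commutator with \<open>conn_form A\<close>, see
  \<open>cov_deriv_odd\<close> and \<open>cov_deriv_even\<close>; no degree appears in the
  definition.\<close>

definition cov_deriv :: "('v::euclidean_space \<Rightarrow> 'v \<Rightarrow> complex ^ 'r ^ 'r) \<Rightarrow>
    ('v \<Rightarrow> ('v, 'r::finite) gform) \<Rightarrow> 'v \<Rightarrow> ('v, 'r) gform" where
  "cov_deriv A \<alpha> x =
     (\<Sum>b\<in>Basis. covec b * (pd b \<alpha> x + (const_form (A x b) * \<alpha> x - \<alpha> x * const_form (A x b))))"

lemma gCk_const_form:
  assumes "Ck_on k S f" shows "gCk k S (\<lambda>x. const_form (f x))"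
  unfolding gCk_def const_form_def coef_Gf
proof
  fix vs :: "'c list"
  show "Ck_on k S (\<lambda>y. if vs = [] then f y else 0)"
    using assms by (cases "vs = []") (simp_all only: simp_thms if_True if_False Ck_on_const)
qed

lemma const_form_zero: "const_form 0 = 0"
  by (rule linear_0[OF linear_const_form])

lemma gCk_conn_form:
  assumes "open U" "\<And>b. b \<in> Basis \<Longrightarrow> Ck_on k U (\<lambda>x. A x b)"
  shows "gCk k U (conn_form A)"
  unfolding conn_form_def[abs_def]
  by (rule gCk_sum[OF assms(1)], rule gCk_mult[OF assms(1) gCk_const], rule gCk_const_form, rule assms(2))

lemma gbar_conn_form: "gbar (conn_form A x) = - conn_form A x"
  by (simp add: conn_form_def gbar_simps gbar_covec gbar_const_form sum_negf)

lemma gbar_pd_conn_form: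
  assumes "gdiff (conn_form A) x"
  shows "gbar (pd v (conn_form A) x) = - pd v (conn_form A) x"
  using pd_gbar[OF assms, of v] pd_uminus[OF assms, of v] by (simp add: gbar_conn_form)

lemma gbar_gext_conn_form:
  assumes "gdiff (conn_form A) x"
  shows "gbar (gext (conn_form A) x) = gext (conn_form A) x"
  by (simp add: gext_def gbar_simps gbar_covec gbar_pd_conn_form[OF assms])

lemma gbar_curv_form: "gdiff (conn_form A) x \<Longrightarrow> gbar (curv_form A x) = curv_form A x"
  by (simp add: curv_form_def gbar_simps gbar_gext_conn_form gbar_conn_form)

lemma gCk_gext: "open U \<Longrightarrow> gCk (Suc k) U \<alpha> \<Longrightarrow> gCk k U (gext \<alpha>)"
  unfolding gext_def[abs_def] by (rule gCk_sum, assumption, rule gCk_mult[OF _ gCk_const gCk_pd])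

lemma gCk_curv_form:
  assumes "open U" "gCk (Suc k) U (conn_form A)"
  shows "gCk k U (curv_form A)"
  unfolding curv_form_def[abs_def]
  using gCk_le[OF assms(2), of k] by (intro gCk_add gCk_mult gCk_gext assms) auto

text \<open>\<open>pd b\<close> and the commutator with \<open>A x b\<close> are both derivations.
  For even \<open>\<alpha>\<close> the covector then passes to the second factor without a sign; an
  odd one costs a sign, as in \<open>cov_deriv_mult_odd\<close>.\<close>

lemma cov_deriv_mult_even:
  assumes "gdiff \<alpha> x" "gdiff \<beta> x" "gbar (\<alpha> x) = \<alpha> x"
  shows "cov_deriv A (\<lambda>y. \<alpha> y * \<beta> y) x = cov_deriv A \<alpha> x * \<beta> x + \<alpha> x * cov_deriv A \<beta> x"
proof -
  have "covec b * (\<alpha> x * \<gamma>) = \<alpha> x * (covec b * \<gamma>)" for b \<gamma>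
    by (simp only: mult.assoc[symmetric] mult_covec_even[OF assms(3)])
  then have "\<alpha> x * cov_deriv A \<beta> x =
      (\<Sum>b\<in>Basis. covec b * (\<alpha> x * (pd b \<beta> x + (const_form (A x b) * \<beta> x - \<beta> x * const_form (A x b)))))"
    by (simp only: cov_deriv_def sum_distrib_left)
  then show ?thesis
    by (simp add: cov_deriv_def sum_distrib_right pd_mult[OF assms(1,2)] mult.assoc flip: sum.distrib distrib_left)
       (simp add: algebra_simps)
qed

lemma cov_deriv_mult_odd:
  assumes "gdiff \<alpha> x" "gdiff \<beta> x" "gbar (\<alpha> x) = - \<alpha> x"
  shows "cov_deriv A (\<lambda>y. \<alpha> y * \<beta> y) x = cov_deriv A \<alpha> x * \<beta> x - \<alpha> x * cov_deriv A \<beta> x"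
proof -
  have "- (\<alpha> x * (covec b * \<gamma>)) = covec b * (\<alpha> x * \<gamma>)" for b \<gamma>
    by (simp only: mult.assoc[symmetric] mult_covec_odd[OF assms(3)] mult_minus_left minus_minus)
  then have "- (\<alpha> x * cov_deriv A \<beta> x) =
      (\<Sum>b\<in>Basis. covec b * (\<alpha> x * (pd b \<beta> x + (const_form (A x b) * \<beta> x - \<beta> x * const_form (A x b)))))"
    by (simp only: cov_deriv_def sum_distrib_left sum_negf[symmetric])
  then show ?thesis
    unfolding diff_conv_add_uminus[of "cov_deriv A \<alpha> x * \<beta> x"]
    by (simp add: cov_deriv_def sum_distrib_right pd_mult[OF assms(1,2)] mult.assoc flip: sum.distrib distrib_left)
       (simp add: algebra_simps)
qed

lemma sum_covec_const_form: "(\<Sum>b\<in>Basis. covec b * (const_form (A x b) * \<alpha>)) = conn_form A x * \<alpha>"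
  by (simp add: conn_form_def sum_distrib_right mult.assoc)

lemma cov_deriv_odd:
  assumes "gbar (\<alpha> x) = - \<alpha> x"
  shows "cov_deriv A \<alpha> x = gext \<alpha> x + (conn_form A x * \<alpha> x + \<alpha> x * conn_form A x)"
proof -
  have "covec b * (\<alpha> x * const_form (A x b)) = - (\<alpha> x * (covec b * const_form (A x b)))" for b
    by (simp only: mult.assoc[symmetric] mult_covec_odd[OF assms] mult_minus_left minus_minus)
  then have "(\<Sum>b\<in>Basis. covec b * (\<alpha> x * const_form (A x b))) = - (\<alpha> x * conn_form A x)"
    by (simp only: conn_form_def sum_distrib_left sum_negf)
  then show ?thesis
    unfolding cov_deriv_def distrib_left right_diff_distrib sum.distrib sum_subtractf sum_covec_const_form gext_def
    by simp
qed

lemma cov_deriv_even: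
  assumes "gbar (\<alpha> x) = \<alpha> x"
  shows "cov_deriv A \<alpha> x = gext \<alpha> x + (conn_form A x * \<alpha> x - \<alpha> x * conn_form A x)"
proof -
  have "covec b * (\<alpha> x * const_form (A x b)) = \<alpha> x * (covec b * const_form (A x b))" for b
    by (simp only: mult.assoc[symmetric] mult_covec_even[OF assms])
  then have "(\<Sum>b\<in>Basis. covec b * (\<alpha> x * const_form (A x b))) = \<alpha> x * conn_form A x"
    by (simp only: conn_form_def sum_distrib_left)
  then show ?thesis
    unfolding cov_deriv_def distrib_left right_diff_distrib sum.distrib sum_subtractf sum_covec_const_form gext_def
    by simp
qed

lemma cov_deriv_scalar_form: "cov_deriv A (\<lambda>y. scalar_form (c y)) x = gext (\<lambda>y. scalar_form (c y)) x"
  by (simp add: cov_deriv_def gext_def scalar_form_const_form)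

text \<open>Second partial derivatives commute while coordinate covectors anticommute.\<close>

lemma gext_gext:
  assumes "open U" "x \<in> U" "gCk 2 U \<alpha>"
  shows "gext (gext \<alpha>) x = 0"
proof -
  have d: "gdiff (pd c \<alpha>) x" for c
    using gCk_pd[of 1 U \<alpha> c] assms(2,3) gCk_Suc_gdiff[of 0 U "pd c \<alpha>" x] by (simp add: numeral_2_eq_2)
  have "pd b (\<lambda>y. covec c * pd c \<alpha> y) x = covec c * pd b (pd c \<alpha>) x" "gdiff (\<lambda>y. covec c * pd c \<alpha> y) x" for b c
    using pd_mult(2)[OF pd_const(1)[of "covec c"] d[of c], of b] pd_mult(1)[OF pd_const(1)[of "covec c"] d[of c]]
    by (simp_all add: pd_const)
  then have "pd b (gext \<alpha>) x = (\<Sum>c\<in>Basis. covec c * pd b (pd c \<alpha>) x)" for b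
    unfolding gext_def[abs_def] by (subst pd_sum) auto
  then have "gext (gext \<alpha>) x = (\<Sum>b\<in>Basis. \<Sum>c\<in>Basis. covec b * covec c * pd b (pd c \<alpha>) x)"
    by (simp add: gext_def[of "gext \<alpha>"] sum_distrib_left mult.assoc)
  also have "\<dots> = 0"
    by (rule sum_covec_covec_symmetric) (rule pd_commute[OF assms])
  finally show ?thesis .
qed

lemma gext_add: "gdiff \<alpha> x \<Longrightarrow> gdiff \<beta> x \<Longrightarrow> gext (\<lambda>y. \<alpha> y + \<beta> y) x = gext \<alpha> x + gext \<beta> x"
  by (simp add: gext_def pd_add distrib_left sum.distrib)

text \<open>The exterior derivative is the covariant derivative of the zero connection, so the
  Leibniz rule is already available.\<close>

lemma gext_mult_odd:
  assumes "gdiff \<alpha> x" "gdiff \<beta> x" "gbar (\<alpha> x) = - \<alpha> x"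
  shows "gext (\<lambda>y. \<alpha> y * \<beta> y) x = gext \<alpha> x * \<beta> x - \<alpha> x * gext \<beta> x"
proof -
  have "cov_deriv (\<lambda>x v. 0) \<gamma> x = gext \<gamma> x" for \<gamma> :: "'a \<Rightarrow> ('a, 'b) gform"
    by (simp add: cov_deriv_def gext_def const_form_zero)
  then show ?thesis using cov_deriv_mult_odd[OF assms, of "\<lambda>x v. 0"] by simp
qed

text \<open>With F = dA + A^2 and ddA = 0 one gets dF = dA A - A dA. The commutator of A with F is
  the negative of this, because the cubic terms cancel.\<close>

lemma bianchi_identity:
  assumes "open U" "x \<in> U" "gCk 2 U (conn_form A)"
  shows "cov_deriv A (curv_form A) x = 0"
proof -
  have dA: "gdiff (conn_form A) x" using assms gCk_Suc_gdiff[of 1 U "conn_form A" x] by (simp add: numeral_2_eq_2)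
  have dE: "gdiff (gext (conn_form A)) x"
    using gCk_Suc_gdiff[OF gCk_gext[OF assms(1)], of 0 "conn_form A" x] assms by (simp add: numeral_2_eq_2)
  have "gext (curv_form A) x =
      gext (conn_form A) x * conn_form A x - conn_form A x * gext (conn_form A) x"
    unfolding curv_form_def[abs_def]
    by (subst gext_add) (simp_all add: dE pd_mult dA gext_gext[OF assms] gext_mult_odd[OF dA dA gbar_conn_form])
  then show ?thesis
    by (subst cov_deriv_even[where \<alpha> = "curv_form A" and x = x, OF gbar_curv_form[OF dA]]) (simp add: curv_form_def algebra_simps)
qed

text \<open>Each coefficient of the extra term is a matrix commutator and has trace zero. This is
  where the trace makes the forms closed.\<close>

lemma trace_cov_deriv:
  fixes \<alpha> :: "'v::euclidean_space \<Rightarrow> ('v, 'r::finite) gform"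
  shows "trace (coef (cov_deriv A \<alpha> x) vs) = trace (coef (gext \<alpha> x) vs)"
proof -
  have "trace (coef (covec b * (const_form M * \<beta> - \<beta> * const_form M)) vs) = 0" for b M and \<beta> :: "('v, 'r) gform"
    unfolding coef_covec_mult coef_simps(4) coef_const_form_mult linear_sum[OF linear_trace] linear_scale[OF linear_trace]
      linear_diff[OF linear_trace]
    by (simp add: trace_mul_sym[of M])
  then show ?thesis
    by (simp add: cov_deriv_def gext_def distrib_left sum.distrib coef_simps coef_sum linear_add[OF linear_trace]
        linear_sum[OF linear_trace])
qed

lemma cov_deriv_power:
  assumes "gdiff \<alpha> x" "gbar (\<alpha> x) = \<alpha> x" "cov_deriv A \<alpha> x = 0"
  shows "cov_deriv A (\<lambda>y. \<alpha> y ^ k) x = 0"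
proof (induction k)
  case 0
  then show ?case by (simp add: cov_deriv_def pd_const)
next
  case (Suc k)
  then show ?case
    unfolding power_Suc by (subst cov_deriv_mult_even[OF assms(1) pd_power(1)[OF assms(1)] assms(2)]) (simp add: assms)
qed

text \<open>All factors except \<open>\<alpha>\<close> are covariantly constant, so the derivative
  falls on \<open>\<alpha>\<close> alone. The sign from passing the odd \<open>\<alpha>\<close> only
  meets a term that vanishes.\<close>

lemma cov_deriv_transgression:
  assumes d: "gdiff \<sigma> x" "gdiff F x" "gdiff \<alpha> x" "gdiff \<tau> x"
    and even: "gbar (\<sigma> x) = \<sigma> x" "gbar (F x) = F x" and odd: "gbar (\<alpha> x) = - \<alpha> x"
    and 0: "cov_deriv A \<sigma> x = 0" "cov_deriv A F x = 0" "cov_deriv A \<tau> x = 0"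
  shows "cov_deriv A (\<lambda>y. \<sigma> y * F y ^ j * (\<alpha> y * (F y ^ l * \<tau> y))) x =
    \<sigma> x * F x ^ j * (cov_deriv A \<alpha> x * (F x ^ l * \<tau> x))"
proof -
  note p = pd_power(1)[OF d(2)]
  have e: "gbar (F x ^ k) = F x ^ k" for k by (simp add: gbar_power even)
  have "cov_deriv A (\<lambda>y. \<sigma> y * F y ^ j) x = 0"
    by (subst cov_deriv_mult_even[OF d(1) p even(1)]) (simp add: 0 cov_deriv_power[OF d(2) even(2) 0(2)])
  moreover have "cov_deriv A (\<lambda>y. F y ^ l * \<tau> y) x = 0"
    by (subst cov_deriv_mult_even[OF p d(4) e]) (simp add: 0 cov_deriv_power[OF d(2) even(2) 0(2)])
  ultimately show ?thesis
    by (subst cov_deriv_mult_even[OF pd_mult(1)[OF d(1) p] pd_mult(1)[OF d(3) pd_mult(1)[OF p d(4)]]])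
       (simp_all add: gbar_mult e even cov_deriv_mult_odd[OF d(3) pd_mult(1)[OF p d(4)] odd])
qed

subsection \<open>Variation of the connection along a line\<close>

lemma conn_form_line:
  "conn_form (\<lambda>x b. A x b + t *\<^sub>R a x b) x = conn_form A x + t *\<^sub>R conn_form a x"
  by (simp add: conn_form_def linear_add[OF linear_const_form] linear_scale[OF linear_const_form]
      distrib_left sum.distrib scaleR_sum_right)

lemma pd_scaleR_const:
  assumes "gdiff \<alpha> x"
  shows "gdiff (\<lambda>y. r *\<^sub>R \<alpha> y) x" "pd v (\<lambda>y. r *\<^sub>R \<alpha> y) x = r *\<^sub>R pd v \<alpha> x"
  by (rule pdI[where D = "\<lambda>v. r *\<^sub>R pd v \<alpha> x"], unfold coef_simps,
      intro has_derivative_scaleR_right gdiff_has_derivative assms)+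

lemma gext_conn_form_line:
  assumes "gdiff (conn_form A) x" "gdiff (conn_form a) x"
  shows "gext (conn_form (\<lambda>x b. A x b + t *\<^sub>R a x b)) x = gext (conn_form A) x + t *\<^sub>R gext (conn_form a) x"
  unfolding gext_def conn_form_line[abs_def]
  by (simp add: pd_add(2)[OF assms(1) pd_scaleR_const(1)[OF assms(2)]] pd_scaleR_const(2)[OF assms(2)]
      distrib_left sum.distrib scaleR_sum_right)

lemma pd_line:
  "gdiff (\<lambda>t. a + t *\<^sub>R b) (s::real)" "pd 1 (\<lambda>t. a + t *\<^sub>R b) s = b"
proof -
  have "((\<lambda>t. coef (a + t *\<^sub>R b) vs) has_derivative (\<lambda>h. coef (h *\<^sub>R b) vs)) (at s)" for vs
    unfolding coef_simps by (auto intro!: derivative_eq_intros)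
  from pdI[OF this] show "gdiff (\<lambda>t. a + t *\<^sub>R b) s" "pd 1 (\<lambda>t. a + t *\<^sub>R b) s = b" by auto
qed

text \<open>The curvature of A + ta is dA + t da + (A + ta)^2; its derivative in t is da plus the
  anticommutator of a with the current connection, which is \<open>cov_deriv\<close> of an odd
  form.\<close>

lemma pd_curv_form_line:
  assumes "gdiff (conn_form A) x" "gdiff (conn_form a) x"
  shows "gdiff (\<lambda>t. curv_form (\<lambda>x b. A x b + t *\<^sub>R a x b) x) (s::real)"
    and "pd 1 (\<lambda>t. curv_form (\<lambda>x b. A x b + t *\<^sub>R a x b) x) s =
      cov_deriv (\<lambda>x b. A x b + s *\<^sub>R a x b) (conn_form a) x"
proof -
  note l = pd_line(1)[of "conn_form A x" "conn_form a x" s] pd_line(1)[of "gext (conn_form A) x" "gext (conn_form a) x" s]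
  have eq: "(\<lambda>t. curv_form (\<lambda>x b. A x b + t *\<^sub>R a x b) x) = (\<lambda>t. (gext (conn_form A) x + t *\<^sub>R gext (conn_form a) x) +
     (conn_form A x + t *\<^sub>R conn_form a x) * (conn_form A x + t *\<^sub>R conn_form a x))"
    by (simp add: curv_form_def gext_conn_form_line[OF assms] conn_form_line fun_eq_iff)
  show "gdiff (\<lambda>t. curv_form (\<lambda>x b. A x b + t *\<^sub>R a x b) x) s"
    unfolding eq by (intro pd_add(1) pd_mult(1) l)
  show "pd 1 (\<lambda>t. curv_form (\<lambda>x b. A x b + t *\<^sub>R a x b) x) s =
      cov_deriv (\<lambda>x b. A x b + s *\<^sub>R a x b) (conn_form a) x"
    unfolding eq pd_add(2)[OF l(2) pd_mult(1)[OF l(1) l(1)]] pd_mult(2)[OF l(1) l(1)] pd_line(2)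
      cov_deriv_odd[where \<alpha> = "conn_form a" and x = x, OF gbar_conn_form] conn_form_line
    by (simp add: algebra_simps)
qed

subsection \<open>Integration of exact forms with compact support\<close>

text \<open>Passes from the Lebesgue integral over the whole space to the gauge integral over a box,
  where integrals depending on a parameter can be differentiated.\<close>

lemma lborel_integral_eq_cbox:
  fixes h :: "'a::euclidean_space \<Rightarrow> 'b::euclidean_space"
  assumes "continuous_on UNIV h" "\<And>x. x \<notin> cbox a b \<Longrightarrow> h x = 0"
  shows "integrable lborel h" "integral\<^sup>L lborel h = integral (cbox a b) h"
proof -
  have c: "continuous_on (cbox a b) h" using assms(1) continuous_on_subset by blast
  have "set_integrable lborel (cbox a b) h"
    unfolding set_integrable_def by (rule borel_integrable_compact[OF compact_cbox c])
  moreover have "indicat_real (cbox a b) x *\<^sub>R h x = h x" for x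
    using assms(2) by (cases "x \<in> cbox a b") auto
  ultimately show "integrable lborel h" "integral\<^sup>L lborel h = integral (cbox a b) h"
    using set_borel_integral_eq_integral(2)[of "cbox a b" h]
    by (simp_all add: set_integrable_def set_lebesgue_integral_def)
qed

text \<open>Translation invariance: the integral of \<open>f (x + s v)\<close> does not depend on s,
  and differentiating at s = 0 under the integral sign gives the claim for any direction at
  once.\<close>

lemma integral_frechet_derivative_eq_0:
  fixes f :: "'a::euclidean_space \<Rightarrow> 'b::euclidean_space"
  assumes f: "\<And>x. f differentiable (at x)" and c: "continuous_on UNIV (\<lambda>x. frechet_derivative f (at x) v)"
    and K: "compact K" "\<And>x. x \<notin> K \<Longrightarrow> f x = 0"
  shows "integrable lborel (\<lambda>x. frechet_derivative f (at x) v)"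
    "integral\<^sup>L lborel (\<lambda>x. frechet_derivative f (at x) v) = 0"
proof -
  have contf: "continuous_on UNIV f"
    using f by (simp add: differentiable_imp_continuous_on differentiable_on_def differentiable_at_withinI)
  \<comment> \<open>The box has to contain the support of every translate with s between -1 and 1,
    so that one fixed domain of integration serves for all s.\<close>
  have "compact ((\<lambda>(x, s). x - s *\<^sub>R v) ` (K \<times> {-1..1::real}))"
    using K(1) by (intro compact_continuous_image) (auto simp: case_prod_unfold intro!: continuous_intros compact_Times)
  then obtain a b where ab: "(\<lambda>(x, s). x - s *\<^sub>R v) ` (K \<times> {-1..1::real}) \<subseteq> cbox a b"
    by (meson bounded_subset_cbox_symmetric compact_imp_bounded)
  have supp: "f (x + s *\<^sub>R v) = 0" if "x \<notin> cbox a b" "s \<in> {-1..1}" for x s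
  proof (rule K(2))
    show "x + s *\<^sub>R v \<notin> K"
    proof
      assume "x + s *\<^sub>R v \<in> K"
      then have "(\<lambda>(x, s). x - s *\<^sub>R v) (x + s *\<^sub>R v, s) \<in> cbox a b" using ab that by blast
      then show False using that by simp
    qed
  qed
  have zero: "frechet_derivative f (at x) v = 0" if "x \<notin> cbox a b" for x
  proof -
    have "x \<notin> K"
    proof
      assume "x \<in> K"
      then have "(\<lambda>(x, s). x - s *\<^sub>R v) (x, 0) \<in> (\<lambda>(x, s). x - s *\<^sub>R v) ` (K \<times> {-1..1::real})"
        by (intro imageI) simp
      with ab have "(\<lambda>(x, s). x - s *\<^sub>R v) (x, 0 :: real) \<in> cbox a b" by (rule subsetD)
      then show False using that by simp
    qed
    then have "frechet_derivative f (at x) = frechet_derivative (\<lambda>x. 0) (at x)"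
      by (intro frechet_derivative_cong_open[of "- K"]) (use K in \<open>auto simp: compact_imp_closed open_Compl\<close>)
    then show ?thesis by simp
  qed
  have eq: "integral (cbox a b) (\<lambda>x. f (x + s *\<^sub>R v)) = integral\<^sup>L lborel f" if "s \<in> {-1..1}" for s
  proof -
    have "integral (cbox a b) (\<lambda>x. f (x + s *\<^sub>R v)) = integral\<^sup>L lborel (\<lambda>x. f (s *\<^sub>R v + x))"
      using lborel_integral_eq_cbox(2)[of "\<lambda>x. f (x + s *\<^sub>R v)" a b] supp[OF _ that]
      by (simp add: add.commute continuous_on_compose2[OF contf] continuous_intros)
    also have "\<dots> = integral\<^sup>L (distr lborel borel ((+) (s *\<^sub>R v))) f"
      by (rule integral_distr[symmetric]) (use contf in \<open>auto intro: borel_measurable_continuous_onI\<close>)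
    finally show ?thesis by (simp add: lborel_distr_plus)
  qed
  have "((\<lambda>s. integral (cbox a b) (\<lambda>x. f (x + s *\<^sub>R v))) has_vector_derivative
      integral (cbox a b) (\<lambda>x. frechet_derivative f (at (x + 0 *\<^sub>R v)) v)) (at 0 within {-1..1})"
  proof (rule leibniz_rule_vector_derivative)
    show "((\<lambda>s. f (x + s *\<^sub>R v)) has_vector_derivative frechet_derivative f (at (x + s *\<^sub>R v)) v) (at s within {-1..1})" for s x
      by (rule has_vector_derivative_line[OF f])
    show "(\<lambda>x. f (x + s *\<^sub>R v)) integrable_on cbox a b" for s
      by (intro integrable_continuous continuous_on_compose2[OF contf] continuous_intros) auto
    show "continuous_on ({-1..1} \<times> cbox a b) (\<lambda>(s, x). frechet_derivative f (at (x + s *\<^sub>R v)) v)"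
      unfolding case_prod_unfold by (intro continuous_on_compose2[OF c] continuous_intros) auto
  qed auto
  then have 1: "((\<lambda>s. integral\<^sup>L lborel f) has_vector_derivative
      integral (cbox a b) (\<lambda>x. frechet_derivative f (at x) v)) (at 0 within {-1..1})"
    by (rule has_vector_derivative_transform[rotated 2, THEN has_vector_derivative_eq_rhs]) (simp_all add: eq)
  have "at (0::real) within {-1..1} \<noteq> bot" by (simp add: trivial_limit_within)
  from vector_derivative_unique_within[OF this 1 has_vector_derivative_const]
  have "integral (cbox a b) (\<lambda>x. frechet_derivative f (at x) v) = 0" .
  with lborel_integral_eq_cbox[OF c zero]
  show "integrable lborel (\<lambda>x. frechet_derivative f (at x) v)"
    "integral\<^sup>L lborel (\<lambda>x. frechet_derivative f (at x) v) = 0" by auto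
qed

lemma continuous_on_extend_zero:
  fixes f :: "'a::topological_space \<Rightarrow> 'b::real_normed_vector"
  assumes "open U" "closed K" "continuous_on U f" "\<And>x. x \<in> U - K \<Longrightarrow> f x = 0" "K \<subseteq> U"
  shows "continuous_on UNIV (\<lambda>x. if x \<in> U then f x else 0)"
proof -
  have "continuous_on (U \<union> - K) (\<lambda>x. if x \<in> U then f x else 0)"
  proof (rule continuous_on_open_Un)
    show "continuous_on U (\<lambda>x. if x \<in> U then f x else 0)"
      using assms(3) by (rule continuous_on_eq) simp
    show "continuous_on (- K) (\<lambda>x. if x \<in> U then f x else 0)"
      by (rule continuous_on_eq[OF continuous_on_const[of _ 0]]) (use assms in auto)
  qed (use assms in auto)
  moreover have "U \<union> - K = UNIV" using assms by auto
  ultimately show ?thesis by simp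
qed

text \<open>A function in a chart means something only on \<open>U\<close>. Its extension by zero is
  differentiable everywhere, because the open sets \<open>U\<close> and \<open>- K\<close> cover the
  space.\<close>

lemma integral_exact_compact_support:
  fixes f :: "'a::euclidean_space \<Rightarrow> 'b::euclidean_space"
  assumes "open U" "compact K" "K \<subseteq> U" "Ck_on 1 U f" "\<And>x. x \<in> U - K \<Longrightarrow> f x = 0"
  shows "integrable lborel (\<lambda>x. if x \<in> U then frechet_derivative f (at x) v else 0)"
    "integral\<^sup>L lborel (\<lambda>x. if x \<in> U then frechet_derivative f (at x) v else 0) = 0"
proof -
  define F where "F = (\<lambda>x. if x \<in> U then f x else 0)"
  have K: "closed K" "open (- K)" using assms(2) by (auto simp: compact_imp_closed open_Compl)
  have eq: "frechet_derivative F (at x) v = (if x \<in> U then frechet_derivative f (at x) v else 0)"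
    and diff: "F differentiable (at x)" for x
  proof -
    consider "x \<in> U" | "x \<notin> U" "x \<in> - K" using assms(3) by auto
    then have "frechet_derivative F (at x) v = (if x \<in> U then frechet_derivative f (at x) v else 0) \<and> F differentiable (at x)"
    proof cases
      case 1
      then have "frechet_derivative F (at x) = frechet_derivative f (at x)" "F differentiable (at x) \<longleftrightarrow> f differentiable (at x)"
        using frechet_derivative_cong_open[OF assms(1), of x F f] differentiable_cong_open[OF assms(1), of x F f]
        by (auto simp: F_def)
      then show ?thesis using 1 assms(4) by simp
    next
      case 2
      have "F y = 0" if "y \<in> - K" for y using assms(5) that by (auto simp: F_def)
      then have "frechet_derivative F (at x) = frechet_derivative (\<lambda>x. 0) (at x)"
        "F differentiable (at x) \<longleftrightarrow> (\<lambda>x. 0 :: 'b) differentiable (at x)"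
        using frechet_derivative_cong_open[OF K(2), of x F "\<lambda>x. 0"] differentiable_cong_open[OF K(2), of x F "\<lambda>x. 0"] 2
        by auto
      then show ?thesis using 2 by simp
    qed
    then show "frechet_derivative F (at x) v = (if x \<in> U then frechet_derivative f (at x) v else 0)"
      "F differentiable (at x)" by auto
  qed
  have "frechet_derivative f (at x) v = 0" if "x \<in> U - K" for x
  proof -
    have "frechet_derivative f (at x) = frechet_derivative (\<lambda>x. 0) (at x)"
      by (rule frechet_derivative_cong_open[of "U - K"]) (use assms K that in auto)
    then show ?thesis by simp
  qed
  then have "continuous_on UNIV (\<lambda>x. if x \<in> U then frechet_derivative f (at x) v else 0)"
    using assms(4) by (intro continuous_on_extend_zero[OF assms(1) K(1) _ _ assms(3)]) auto
  then have c: "continuous_on UNIV (\<lambda>x. frechet_derivative F (at x) v)" by (simp add: eq)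
  have "F x = 0" if "x \<notin> K" for x using assms(5) that by (auto simp: F_def)
  from integral_frechet_derivative_eq_0[OF diff c assms(2) this]
  show "integrable lborel (\<lambda>x. if x \<in> U then frechet_derivative f (at x) v else 0)"
    "integral\<^sup>L lborel (\<lambda>x. if x \<in> U then frechet_derivative f (at x) v else 0) = 0"
    by (simp_all add: eq)
qed

lemma gCk_cong:
  assumes "open S" "\<And>x. x \<in> S \<Longrightarrow> \<alpha> x = \<beta> x" "gCk k S \<alpha>"
  shows "gCk k S \<beta>"
proof -
  have "Ck_on k S (\<lambda>y. coef (\<beta> y) vs)" for vs
    by (rule Ck_on_cong[OF assms(1), of "\<lambda>y. coef (\<alpha> y) vs"]) (use assms in \<open>auto simp: gCk_def\<close>)
  then show ?thesis by (simp add: gCk_def)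
qed

lemma bounded_linear_trace: "bounded_linear (trace :: complex ^ 'r ^ 'r \<Rightarrow> complex)"
  using linear_trace linear_conv_bounded_linear by blast

lemma Ck_on_trace_coef: "open S \<Longrightarrow> gCk k S \<alpha> \<Longrightarrow> Ck_on k S (\<lambda>x. trace (coef (\<alpha> x) vs))"
  by (rule Ck_on_compose_bounded_linear[OF _ bounded_linear_trace]) (auto simp: gCk_def)

lemma frechet_derivative_trace_coef:
  assumes "gdiff \<alpha> x"
  shows "frechet_derivative (\<lambda>y. trace (coef (\<alpha> y) vs)) (at x) v = trace (frechet_derivative (\<lambda>y. coef (\<alpha> y) vs) (at x) v)"
    "(\<lambda>y. trace (coef (\<alpha> y) vs)) differentiable (at x)"
proof -
  have "((\<lambda>y. trace (coef (\<alpha> y) vs)) has_derivative (\<lambda>v. trace (frechet_derivative (\<lambda>y. coef (\<alpha> y) vs) (at x) v))) (at x)"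
    using assms by (intro bounded_linear.has_derivative[OF bounded_linear_trace] frechet_derivative_has_derivative)
      (simp add: gdiff_def)
  then show "frechet_derivative (\<lambda>y. trace (coef (\<alpha> y) vs)) (at x) v = trace (frechet_derivative (\<lambda>y. coef (\<alpha> y) vs) (at x) v)"
    "(\<lambda>y. trace (coef (\<alpha> y) vs)) differentiable (at x)"
    by (auto simp: frechet_derivative_eqI differentiable_def)
qed

text \<open>On a fixed list of vectors the exterior derivative is a signed sum of derivatives in
  constant directions, each of a compactly supported function. This stands in for Stokes'
  theorem.\<close>

lemma integral_trace_gext:
  fixes \<eta> :: "'v::euclidean_space \<Rightarrow> ('v, 'r::finite) gform"
  assumes "open U" "compact K" "K \<subseteq> U" "gCk 1 U \<eta>" "\<And>x. x \<in> U - K \<Longrightarrow> \<eta> x = 0"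
  shows "integrable lborel (\<lambda>x. if x \<in> U then trace (coef (gext \<eta> x) vs) else 0)"
    "integral\<^sup>L lborel (\<lambda>x. if x \<in> U then trace (coef (gext \<eta> x) vs) else 0) = 0"
proof -
  define f where "f = (\<lambda>j y. trace (coef (\<eta> y) (take j vs @ drop (Suc j) vs)))"
  let ?g = "\<lambda>j x. if x \<in> U then frechet_derivative (f j) (at x) (vs ! j) else 0"
  have "integrable lborel (?g j)" "integral\<^sup>L lborel (?g j) = 0" for j
    using integral_exact_compact_support[OF assms(1-3), of "f j"] Ck_on_trace_coef[OF assms(1,4)] assms(5)
    by (simp_all add: f_def coef_simps linear_0[OF linear_trace] del: Ck_on.simps One_nat_def)
  moreover have "(\<lambda>x. if x \<in> U then trace (coef (gext \<eta> x) vs) else 0) =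
      (\<lambda>x. \<Sum>j<length vs. (- 1) ^ j *\<^sub>R ?g j x)"
  proof
    fix x
    show "(if x \<in> U then trace (coef (gext \<eta> x) vs) else 0) = (\<Sum>j<length vs. (- 1) ^ j *\<^sub>R ?g j x)"
    proof (cases "x \<in> U")
      case True
      then have d: "gdiff \<eta> x" using assms(4) gCk_Suc_gdiff[of 0] by simp
      show ?thesis
        using True by (simp add: coef_gext[OF d] f_def frechet_derivative_trace_coef(1)[OF d]
            linear_sum[OF linear_trace] linear_scale[OF linear_trace])
    qed simp
  qed
  ultimately show "integrable lborel (\<lambda>x. if x \<in> U then trace (coef (gext \<eta> x) vs) else 0)"
    "integral\<^sup>L lborel (\<lambda>x. if x \<in> U then trace (coef (gext \<eta> x) vs) else 0) = 0"
    by (simp_all add: integral_sum)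
qed

lemma differentiable_real_has_vector_derivative:
  fixes f :: "real \<Rightarrow> 'a::real_normed_vector"
  assumes "f differentiable (at t)"
  shows "(f has_vector_derivative frechet_derivative f (at t) 1) (at t within T)"
  using has_vector_derivative_line[of f 0 t 1 T] assms by simp

lemma gCk_0_compose:
  "continuous_on S f \<Longrightarrow> f ` S \<subseteq> T \<Longrightarrow> gCk 0 T \<alpha> \<Longrightarrow> gCk 0 S (\<lambda>x. \<alpha> (f x))"
  by (auto simp: gCk_def intro: continuous_on_compose2)

text \<open>The local form of the Chern--Weil theorem: a compactly supported change of the connection
  changes \<open>tr (\<sigma> F\<^sup>k \<tau>)\<close> by an exact form with compact support.\<close>

lemma chern_weil_local:
  fixes A a :: "'v::euclidean_space \<Rightarrow> 'v \<Rightarrow> complex ^ 'r ^ 'r::finite" and k :: nat and vs :: "'v list"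
  assumes U: "open U" and K: "compact K" "K \<subseteq> U"
    and A: "\<And>b. b \<in> Basis \<Longrightarrow> Ck_on 2 U (\<lambda>x. A x b)"
    and a: "\<And>b. b \<in> Basis \<Longrightarrow> Ck_on 2 U (\<lambda>x. a x b)"
    and a0: "\<And>x b. x \<in> U - K \<Longrightarrow> a x b = 0"
    and \<sigma>: "gCk 1 U (\<lambda>x. scalar_form (c x) :: ('v, 'r) gform)" "\<And>x. x \<in> U \<Longrightarrow> gext (\<lambda>x. scalar_form (c x)) x = (0 :: ('v, 'r) gform)"
      "\<And>x. x \<in> U \<Longrightarrow> gbar (scalar_form (c x)) = (scalar_form (c x) :: ('v, 'r) gform)"
    and \<tau>: "gCk 1 U (\<lambda>x. scalar_form (e x) :: ('v, 'r) gform)" "\<And>x. x \<in> U \<Longrightarrow> gext (\<lambda>x. scalar_form (e x)) x = (0 :: ('v, 'r) gform)"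
  defines "q \<equiv> \<lambda>A x. trace (coef (scalar_form (c x) * curv_form A x ^ k * scalar_form (e x) :: ('v, 'r) gform) vs)"
  shows "continuous_on UNIV (\<lambda>x. if x \<in> U then q (\<lambda>x b. A x b + a x b) x - q A x else 0)"
    "integral\<^sup>L lborel (\<lambda>x. if x \<in> U then q (\<lambda>x b. A x b + a x b) x - q A x else 0) = 0"
proof -
  define B where "B = (\<lambda>t x b. A x b + t *\<^sub>R a x b)"
  define F where "F = (\<lambda>t. curv_form (B t))"
  define S where "S = (\<lambda>x. scalar_form (c x) :: ('v, 'r) gform)"
  define Y where "Y = (\<lambda>x. scalar_form (e x) :: ('v, 'r) gform)"
  define D where "D = (\<lambda>t. cov_deriv (B t) (conn_form a))"
  define Tr where "Tr = (\<lambda>g :: ('v, 'r) gform. trace (coef g vs))"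
  \<comment> \<open>The derivative of the integrand in \<open>t\<close>, according to
    \<open>pd_power\<close>: one curvature factor gives way to \<open>D t x\<close>, the derivative
    of the curvature.\<close>
  define q' where "q' = (\<lambda>t x. \<Sum>j<k. Tr (S x * F t x ^ j * (D t x * (F t x ^ (k - Suc j) * Y x))))"
  have "Ck_on 2 U (\<lambda>x. B t x b)" if "b \<in> Basis" for t b
    unfolding B_def
    by (rule Ck_on_add[OF U A[OF that] Ck_on_compose_bounded_linear[OF U bounded_linear_scaleR_right a[OF that]]])
  then have CB: "gCk 2 U (conn_form (B t))" for t by (rule gCk_conn_form[OF U])
  have CA: "gCk 2 U (conn_form A)" and Ca: "gCk 2 U (conn_form a)"
    using A a by (auto intro!: gCk_conn_form[OF U])
  have d: "gdiff (conn_form (B t)) x" "gdiff (conn_form A) x" "gdiff (conn_form a) x" if "x \<in> U" for t x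
    using gCk_Suc_gdiff[of 1 U _ x] that CB CA Ca by (auto simp: numeral_2_eq_2)
  have CF: "gCk 1 U (F t)" for t
    unfolding F_def by (rule gCk_curv_form[OF U]) (use CB in \<open>simp add: numeral_2_eq_2\<close>)
  have dF: "gdiff (F t) x" and dS: "gdiff S x" and dY: "gdiff Y x" if "x \<in> U" for t x
    using gCk_Suc_gdiff[of 0 U _ x] that CF \<sigma>(1) \<tau>(1) by (auto simp: S_def Y_def)
  have conn0: "conn_form a x = 0" if "x \<in> U - K" for x
    by (simp add: conn_form_def a0[OF that] const_form_zero)
  have openK: "open (U - K)" using U K(1) by (simp add: compact_imp_closed open_Diff)

  have qF: "q (B t) x = Tr (S x * F t x ^ k * Y x)" for t x
    by (simp add: q_def Tr_def S_def Y_def F_def)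
  have deriv: "((\<lambda>t. q (B t) x) has_vector_derivative q' t x) (at t within T)" if x: "x \<in> U" for t x T
  proof -
    have F': "gdiff (\<lambda>t. F t x) t" "pd 1 (\<lambda>t. F t x) t = D t x"
      unfolding F_def D_def B_def using pd_curv_form_line[OF d(2,3)[OF x], of t] by auto
    note p = pd_mult(1)[OF pd_const(1)[of "S x"] pd_power(1)[OF F'(1), of k]]
    note p2 = pd_mult(1)[OF p pd_const(1)[of "Y x"]]
    have "pd 1 (\<lambda>t. S x * F t x ^ k * Y x) t = S x * (\<Sum>j<k. F t x ^ j * D t x * F t x ^ (k - Suc j)) * Y x"
      by (simp add: pd_mult(2)[OF p pd_const(1)] pd_mult(2)[OF pd_const(1) pd_power(1)[OF F'(1)]] pd_const
          pd_power(2)[OF F'(1)] F'(2))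
    then have "Tr (pd 1 (\<lambda>t. S x * F t x ^ k * Y x) t) = q' t x"
      by (simp add: q'_def Tr_def sum_distrib_left sum_distrib_right coef_sum linear_sum[OF linear_trace] mult.assoc)
    then show ?thesis
      using differentiable_real_has_vector_derivative[OF frechet_derivative_trace_coef(2)[OF p2, of vs], of T]
        frechet_derivative_trace_coef(1)[OF p2, of vs 1]
      by (simp add: qF Tr_def coef_pd)
  qed
  \<comment> \<open>The transgression form: the differentiated curvature factor is replaced by
    \<open>conn_form a\<close>, whose support in \<open>K\<close> it inherits.\<close>
  define \<eta> where "\<eta> = (\<lambda>t j y. S y * F t y ^ j * (conn_form a y * (F t y ^ (k - Suc j) * Y y)))"
  have exact: "q' t x = (\<Sum>j<k. Tr (gext (\<eta> t j) x))" if x: "x \<in> U" for t x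
  proof -
    have "cov_deriv (B t) (\<eta> t j) x = S x * F t x ^ j * (D t x * (F t x ^ (k - Suc j) * Y x))" for j
      unfolding \<eta>_def D_def
    proof (rule cov_deriv_transgression)
      show "cov_deriv (B t) S x = 0" "cov_deriv (B t) Y x = 0"
        using \<sigma>(2)[OF x] \<tau>(2)[OF x] by (simp_all add: S_def Y_def cov_deriv_scalar_form)
      show "cov_deriv (B t) (F t) x = 0"
        unfolding F_def by (rule bianchi_identity[OF U x CB])
      show "gbar (S x) = S x" using \<sigma>(3)[OF x] by (simp add: S_def)
      show "gbar (F t x) = F t x" unfolding F_def by (rule gbar_curv_form[OF d(1)[OF x]])
    qed (use x dF dS dY d gbar_conn_form in auto)
    then show ?thesis
      unfolding q'_def Tr_def by (intro sum.cong refl) (metis trace_cov_deriv)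
  qed
  have int0: "integral\<^sup>L lborel (\<lambda>x. if x \<in> U then q' t x else 0) = 0" for t
  proof -
    have C: "gCk 1 U (\<eta> t j)" for j
      unfolding \<eta>_def using CF \<sigma>(1) \<tau>(1) gCk_le[OF Ca, of 1]
      by (intro gCk_mult gCk_power U) (auto simp: S_def Y_def)
    have "\<eta> t j x = 0" if "x \<in> U - K" for j x by (simp add: \<eta>_def conn0[OF that])
    then have "integrable lborel (\<lambda>x. if x \<in> U then Tr (gext (\<eta> t j) x) else 0)"
      "integral\<^sup>L lborel (\<lambda>x. if x \<in> U then Tr (gext (\<eta> t j) x) else 0) = 0" for j
      unfolding Tr_def by (rule integral_trace_gext[OF U K C]; blast)+
    moreover have "(\<lambda>x. if x \<in> U then q' t x else 0) = (\<lambda>x. \<Sum>j<k. if x \<in> U then Tr (gext (\<eta> t j) x) else 0)"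
      by (auto simp: exact)
    ultimately show ?thesis by (simp add: integral_sum)
  qed

  \<comment> \<open>Differentiating under the integral needs continuity jointly in \<open>t\<close>
    and \<open>x\<close>. It holds because the curvature and its derivative are polynomials in
    \<open>t\<close> with coefficients continuous on \<open>U\<close>.\<close>
  have UU: "open (UNIV \<times> U)" "closed (UNIV \<times> K)" "UNIV \<times> K \<subseteq> (UNIV :: real set) \<times> U"
    using U K by (auto intro: open_Times closed_Times compact_imp_closed)
  have lift: "gCk 0 ((UNIV::real set) \<times> U) (\<lambda>p. \<alpha> (snd p))" if "gCk m U \<alpha>" for \<alpha> :: "'v \<Rightarrow> ('v, 'r) gform" and m
    by (rule gCk_0_compose[OF continuous_on_snd[OF continuous_on_id] _ gCk_le[OF that]]) auto
  have cont_fst: "Ck_on 0 ((UNIV::real set) \<times> U) fst" by (simp add: continuous_on_fst[OF continuous_on_id])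
  have gE: "gCk 1 U (gext (conn_form A))" "gCk 1 U (gext (conn_form a))"
    using CA Ca by (auto intro!: gCk_gext[OF U] simp: numeral_2_eq_2)
  have CB2: "gCk 0 (UNIV \<times> U) (\<lambda>p. conn_form A (snd p) + fst p *\<^sub>R conn_form a (snd p))"
    by (intro gCk_add gCk_scaleR UU cont_fst lift[OF CA] lift[OF Ca])
  have F_eq: "F t x = (gext (conn_form A) x + t *\<^sub>R gext (conn_form a) x) +
      (conn_form A x + t *\<^sub>R conn_form a x) * (conn_form A x + t *\<^sub>R conn_form a x)" if "x \<in> U" for t x
    unfolding F_def B_def curv_form_def using gext_conn_form_line[OF d(2,3)[OF that]] by (simp add: conn_form_line)
  have CF2: "gCk 0 (UNIV \<times> U) (\<lambda>p. F (fst p) (snd p))"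
    by (rule gCk_cong[OF UU(1), of "\<lambda>p. (gext (conn_form A) (snd p) + fst p *\<^sub>R gext (conn_form a) (snd p)) +
      (conn_form A (snd p) + fst p *\<^sub>R conn_form a (snd p)) * (conn_form A (snd p) + fst p *\<^sub>R conn_form a (snd p))"])
     (use F_eq in \<open>auto intro!: gCk_add[OF UU(1)] gCk_mult[OF UU(1)] gCk_scaleR[OF UU(1)] cont_fst lift[OF gE(1)] lift[OF gE(2)] lift[OF CA] lift[OF Ca]\<close>)
  have D_eq: "D t x = gext (conn_form a) x + ((conn_form A x + t *\<^sub>R conn_form a x) * conn_form a x +
      conn_form a x * (conn_form A x + t *\<^sub>R conn_form a x))" for t x
    unfolding D_def cov_deriv_odd[where \<alpha> = "conn_form a" and x = x, OF gbar_conn_form] by (simp add: B_def conn_form_line)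
  have CD2: "gCk 0 (UNIV \<times> U) (\<lambda>p. D (fst p) (snd p))"
    unfolding D_eq
    by (intro gCk_add[OF UU(1)] gCk_mult[OF UU(1)] CB2 lift[OF gE(2)] lift[OF Ca])
  have contTr: "continuous_on (UNIV \<times> U) (\<lambda>p. Tr (\<alpha> p))" if "gCk 0 ((UNIV::real set) \<times> U) \<alpha>" for \<alpha>
    using Ck_on_trace_coef[OF UU(1) that] by (simp add: Tr_def)
  have SY: "gCk 0 ((UNIV::real set) \<times> U) (\<lambda>p. S (snd p))" "gCk 0 ((UNIV::real set) \<times> U) (\<lambda>p. Y (snd p))"
    using lift \<sigma>(1) \<tau>(1) by (auto simp: S_def Y_def)
  have cq': "continuous_on (UNIV \<times> U) (\<lambda>p. q' (fst p) (snd p))"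
    unfolding q'_def by (intro continuous_on_sum contTr gCk_mult[OF UU(1)] gCk_power[OF UU(1)] CF2 CD2 SY)
  have cq: "continuous_on (UNIV \<times> U) (\<lambda>p. q (B (fst p)) (snd p))"
    unfolding qF by (intro contTr gCk_mult[OF UU(1)] gCk_power[OF UU(1)] CF2 SY)
  have D0: "D t x = 0" if "x \<in> U - K" for t x
  proof -
    have "pd b (conn_form a) x = 0" for b
      using pd_cong[OF openK that, of "conn_form a" "\<lambda>x. 0" b] conn0 by (simp add: pd_const)
    then show ?thesis by (simp add: D_eq gext_def conn0[OF that])
  qed
  have q'0: "q' t x = 0" if "x \<in> U - K" for t x
    by (simp add: q'_def D0[OF that] Tr_def coef_simps(1) linear_0[OF linear_trace])
  have F0: "F t x = F 0 x" if "x \<in> U - K" for t x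
  proof -
    have "pd b (conn_form a) x = 0" for b
      using pd_cong[OF openK that, of "conn_form a" "\<lambda>x. 0" b] conn0 by (simp add: pd_const)
    then show ?thesis using that by (simp add: F_eq gext_def conn0[OF that])
  qed
  \<comment> \<open>\<open>q (B t)\<close> alone need not vanish outside \<open>K\<close>;
    subtracting its value at t = 0 gives an integrand of compact support.\<close>
  define w where "w = (\<lambda>t x. if x \<in> U then q (B t) x - q (B 0) x else 0)"
  have B01: "B 0 = A" "B 1 = (\<lambda>x b. A x b + a x b)" by (simp_all add: B_def)
  have cw: "continuous_on UNIV (w t)" for t
  proof -
    have "continuous_on U (\<lambda>x. (\<lambda>p. q (B (fst p)) (snd p)) (s, x))" for s
      by (rule continuous_on_compose2[OF cq continuous_on_Pair[OF continuous_on_const continuous_on_id]]) auto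
    then have c: "continuous_on U (\<lambda>x. q (B s) x)" for s by simp
    show ?thesis
      unfolding w_def
      by (rule continuous_on_extend_zero[OF U compact_imp_closed[OF K(1)] continuous_on_diff[OF c c] _ K(2)])
         (simp add: qF F0[of _ t])
  qed
  show "continuous_on UNIV (\<lambda>x. if x \<in> U then q (\<lambda>x b. A x b + a x b) x - q A x else 0)"
    using cw[of 1] unfolding w_def B01 .
  obtain l u where lu: "K \<subseteq> cbox l u"
    using K(1) by (meson bounded_subset_cbox_symmetric compact_imp_bounded)
  have w0: "w t x = 0" if "x \<notin> cbox l u" for t x
  proof (cases "x \<in> U")
    case True
    then have "F t x = F 0 x" using that lu by (intro F0) auto
    then show ?thesis by (simp add: w_def qF)
  qed (simp add: w_def)
  have cq'2: "continuous_on UNIV (\<lambda>p. if p \<in> UNIV \<times> U then q' (fst p) (snd p) else 0)"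
    by (rule continuous_on_extend_zero[OF UU(1,2) cq' _ UU(3)]) (auto intro: q'0)
  have I0: "integral (cbox l u) (\<lambda>x. if x \<in> U then q' t x else 0) = 0" for t
  proof -
    have "continuous_on UNIV (\<lambda>x. (\<lambda>p. if p \<in> UNIV \<times> U then q' (fst p) (snd p) else 0) (t, x))"
      by (rule continuous_on_compose2[OF cq'2 continuous_on_Pair[OF continuous_on_const continuous_on_id]]) auto
    then have c: "continuous_on UNIV (\<lambda>x. if x \<in> U then q' t x else 0)" by (simp cong: if_cong)
    have z: "(if x \<in> U then q' t x else 0) = 0" if "x \<notin> cbox l u" for x
      using that lu q'0[of x t] by auto
    show ?thesis using lborel_integral_eq_cbox(2)[OF c z] int0[of t] by (rule trans[OF sym])
  qed
  \<comment> \<open>The derivative of this integral is the integral of \<open>q'\<close>, which is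
    0. Hence the integral keeps its value at t = 0, where \<open>w\<close> is zero.\<close>
  have "((\<lambda>t. integral (cbox l u) (w t)) has_vector_derivative
      integral (cbox l u) (\<lambda>x. if x \<in> U then q' t x else 0)) (at t within {0..1})" if "t \<in> {0..1}" for t
  proof (rule leibniz_rule_vector_derivative)
    show "((\<lambda>t. w t x) has_vector_derivative (if x \<in> U then q' t x else 0)) (at t within {0..1})" for t x
    proof (cases "x \<in> U")
      case True
      have "((\<lambda>t. q (B t) x - q (B 0) x) has_vector_derivative q' t x - 0) (at t within {0..1})"
        by (intro has_vector_derivative_diff deriv[OF True] has_vector_derivative_const)
      then show ?thesis using True by (simp add: w_def)
    qed (simp add: w_def has_vector_derivative_const)
    show "w t integrable_on cbox l u" for t
      using cw continuous_on_subset by (blast intro: integrable_continuous)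
    show "continuous_on ({0..1} \<times> cbox l u) (\<lambda>(t, x). if x \<in> U then q' t x else 0)"
      by (rule continuous_on_subset[OF cq'2[unfolded mem_Times_iff], simplified case_prod_unfold[symmetric], THEN continuous_on_eq])
         auto
  qed (use that in auto)
  then have "((\<lambda>t. integral (cbox l u) (w t)) has_vector_derivative 0) (at t within {0..1})" if "t \<in> {0..1}" for t
    using that by (simp only: I0)
  then obtain C where "\<And>t. t \<in> {0..1} \<Longrightarrow> integral (cbox l u) (w t) = C"
    using has_vector_derivative_zero_constant[of "{0..1::real}" "\<lambda>t. integral (cbox l u) (w t)"] by auto
  then have "integral (cbox l u) (w 1) = integral (cbox l u) (w 0)" by simp
  moreover have "w 0 = (\<lambda>x. 0)" by (auto simp: w_def)
  ultimately have "integral (cbox l u) (w 1) = 0" by simp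
  then have "integral\<^sup>L lborel (w 1) = 0"
    using lborel_integral_eq_cbox(2)[OF cw[of 1] w0] by simp
  then show "integral\<^sup>L lborel (\<lambda>x. if x \<in> U then q (\<lambda>x b. A x b + a x b) x - q A x else 0) = 0"
    unfolding w_def B01 .
qed

section \<open>Forms of top degree\<close>

lemma alternating_form_move_front:
  assumes "alternating_form f"
  shows "f (us @ v # ws) = (- 1) ^ length us *\<^sub>R f (v # us @ ws)"
  using assms
proof (induction us arbitrary: f)
  case (Cons u us)
  have "f (u # us @ v # ws) = (- 1) ^ length us *\<^sub>R f (u # v # us @ ws)"
    using Cons.IH[OF contract_alternating[OF Cons.prems, of u]] unfolding contract_def .
  moreover have "f (u # v # us @ ws) = - f (v # u # us @ ws)"
    using alternating_form_swap[OF Cons.prems, of "[]"] unfolding append_Nil .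
  ultimately show ?case by (simp only: append_Cons list.size power_add power_one_right) simp
qed simp

text \<open>The sign is left undetermined: the purpose is to carry vanishing from one ordering of a
  basis to another.\<close>

lemma alternating_form_permute:
  assumes "alternating_form f" "mset xs = mset ys"
  shows "f xs = f ys \<or> f xs = - f ys"
  using assms
proof (induction xs arbitrary: ys f)
  case (Cons x xs)
  then have "x \<in> set ys" by (metis list.set_intros(1) set_mset_mset)
  then obtain us ws where ys: "ys = us @ x # ws" by (meson split_list)
  with Cons.prems(2) have "mset xs = mset (us @ ws)" by simp
  from Cons.IH[OF contract_alternating[OF Cons.prems(1)] this, of x]
  have "f (x # xs) = f (x # us @ ws) \<or> f (x # xs) = - f (x # us @ ws)" by (simp add: contract_def)
  moreover have "f ys = f (x # us @ ws) \<or> f ys = - f (x # us @ ws)"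
    using alternating_form_move_front[OF Cons.prems(1), of us x ws] unfolding ys
    by (cases "even (length us)") simp_all
  ultimately show ?case by auto
qed simp

lemma alternating_form_eq_zero:
  fixes f :: "'v::euclidean_space list \<Rightarrow> 'a::real_vector"
  assumes f: "alternating_form f" and bs: "distinct bs" "set bs = Basis" and 0: "f bs = 0" and len: "length vs = DIM('v)"
  shows "f vs = 0"
proof -
  \<comment> \<open>The vectors are expanded into \<open>Basis\<close> one after the other, and
    \<open>us\<close> holds those already replaced. At the end either a basis vector repeats or
    \<open>us\<close> is a reordering of \<open>bs\<close>.\<close>
  have "f (us @ ws) = 0" if "set us \<subseteq> Basis" "length (us @ ws) = DIM('v)" for us ws
    using that
  proof (induction ws arbitrary: us)
    case Nil
    show ?case
    proof (cases "distinct us")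
      case True
      then have "set us = Basis"
        using Nil by (intro card_subset_eq) (auto simp: distinct_card)
      then have "mset us = mset bs" using bs True set_eq_iff_mset_eq_distinct by blast
      then show ?thesis using alternating_form_permute[OF f, of us bs] 0 by simp
    next
      case False
      then obtain as b cs ds where "us = as @ [b] @ cs @ [b] @ ds" using not_distinct_decomp by blast
      then show ?thesis using alternating_formD(2)[OF f] by simp
    qed
  next
    case (Cons w ws)
    have "f (us @ w # ws) = (\<Sum>b\<in>Basis. (w \<bullet> b) *\<^sub>R f (us @ b # ws))"
      by (rule linear_eq_sum_Basis[OF alternating_formD(1)[OF f]])
    also have "\<dots> = 0"
      using Cons.IH[of "us @ [b]" for b] Cons.prems by (intro sum.neutral) simp
    finally show ?case .
  qed
  from this[of "[]" vs] show ?thesis using len by simp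
qed

text \<open>A fixed enumeration translates between list positions and the index type that
  \<open>det\<close> requires.\<close>

definition bidx :: "'m::finite \<Rightarrow> nat" where
  "bidx = (SOME f. bij_betw f UNIV {..<CARD('m)})"

lemma bidx: "bij_betw (bidx :: 'm::finite \<Rightarrow> nat) UNIV {..<CARD('m)}"
proof -
  have "\<exists>f. bij_betw f (UNIV :: 'm set) {..<CARD('m)}"
    using ex_bij_betw_finite_nat[of "UNIV :: 'm set"] by (simp add: lessThan_atLeast0)
  then show ?thesis unfolding bidx_def by (rule someI_ex)
qed

lemma bidx_less: "bidx (k :: 'm::finite) < CARD('m)"
  using bidx[where 'm = 'm] by (auto simp: bij_betw_def)

lemma bidx_eq_iff: "bidx i = bidx (j :: 'm::finite) \<longleftrightarrow> i = j"
  using bidx[where 'm = 'm] by (auto simp: bij_betw_def inj_on_def)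

lemma bidx_surj: "p < CARD('m) \<Longrightarrow> \<exists>k :: 'm::finite. bidx k = p"
  using bidx[where 'm = 'm] unfolding bij_betw_def by (metis imageE lessThan_iff)

text \<open>The type \<open>'m\<close> indexes the rows; its cardinality is the real dimension.\<close>

definition frame_matrix :: "'v::euclidean_space list \<Rightarrow> 'v list \<Rightarrow> real ^ 'm ^ ('m::finite)" where
  "frame_matrix bs vs = (\<chi> i j. (vs ! bidx i) \<bullet> (bs ! bidx j))"

lemma alternating_form_det:
  "alternating_form (\<lambda>vs. if length vs = CARD('m) then det (frame_matrix bs vs :: real ^ 'm ^ ('m::finite)) else 0)"
proof -
  have lin: "linear (\<lambda>v. det (frame_matrix bs (us @ v # ws) :: real ^ 'm ^ 'm))"
    if "length (us @ undefined # ws) = CARD('m)" for us ws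
  proof -
    from that have "length us < CARD('m)" by simp
    then obtain k :: 'm where k: "bidx k = length us" using bidx_surj by blast
    \<comment> \<open>Only row \<open>k\<close> contains the variable vector. The placeholder 0
      writes the other rows as independent of it, the form in which row linearity of
      \<open>det\<close> applies.\<close>
    have *: "frame_matrix bs (us @ v # ws) = (\<chi> i. if i = k then (\<chi> j. v \<bullet> (bs ! bidx j))
        else (\<chi> j. ((us @ 0 # ws) ! bidx i) \<bullet> (bs ! bidx j)) :: real ^ 'm ^ 'm)" for v
    proof -
      have "(us @ v # ws) ! bidx i = (us @ 0 # ws) ! bidx i" if "i \<noteq> k" for i :: 'm
        using that k bidx_eq_iff[of i k] by (auto simp: nth_append nth_Cons')
      then show ?thesis by (auto simp: frame_matrix_def vec_eq_iff k[symmetric]) (simp add: k)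
    qed
    have "(\<chi> j. (v + w) \<bullet> (bs ! bidx j)) = (\<chi> j. v \<bullet> (bs ! bidx j)) + (\<chi> j. w \<bullet> (bs ! bidx j) :: real ^ 'm)"
      "(\<chi> j. (r *\<^sub>R v) \<bullet> (bs ! bidx j)) = r *s (\<chi> j. v \<bullet> (bs ! bidx j) :: real ^ 'm)" for v w r
      by (simp_all add: vec_eq_iff inner_add_left)
    then show ?thesis
      unfolding * by (intro linearI) (simp_all only: det_row_add det_row_mul real_scaleR_def)
  qed
  have "det (frame_matrix bs (us @ v # ws @ v # ys) :: real ^ 'm ^ 'm) = 0"
    if "length (us @ v # ws @ v # ys) = CARD('m)" for us ws ys v
  proof -
    from that have "length us < CARD('m)" "length us + Suc (length ws) < CARD('m)" by simp_all
    then obtain k l :: 'm where k: "bidx k = length us" and l: "bidx l = length us + Suc (length ws)"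
      using bidx_surj by metis
    then have "k \<noteq> l" by auto
    then show ?thesis
      by (rule det_identical_rows) (simp add: row_def frame_matrix_def k l nth_append)
  qed
  moreover have "linear (\<lambda>v. if length (us @ v # ws) = CARD('m)
      then det (frame_matrix bs (us @ v # ws) :: real ^ 'm ^ 'm) else 0)" for us ws
    using lin[of us ws] by (cases "length (us @ undefined # ws) = CARD('m)") (simp_all add: linear_zero)
  ultimately show ?thesis by (simp only: alternating_form_def) simp
qed

text \<open>The difference of the two sides is alternating and vanishes on \<open>bs\<close>,
  because the frame matrix of \<open>bs\<close> against itself is the identity; then
  \<open>alternating_form_eq_zero\<close> applies.\<close>

lemma alternating_form_top_degree:
  fixes f :: "'v::euclidean_space list \<Rightarrow> 'a::real_vector"
  assumes f: "alternating_form f" and bs: "distinct bs" "set bs = Basis"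
    and card: "CARD('m::finite) = DIM('v)" and len: "length vs = DIM('v)"
  shows "f vs = det (frame_matrix bs vs :: real ^ 'm ^ 'm) *\<^sub>R f bs"
proof -
  let ?d = "\<lambda>vs. if length vs = CARD('m) then det (frame_matrix bs vs :: real ^ 'm ^ 'm) else 0"
  have lbs: "length bs = DIM('v)" using bs distinct_card[of bs] by simp
  have less: "bidx i < length bs" for i :: 'm using bidx_less[of i] by (simp add: lbs card)
  then have "bs ! bidx i \<in> Basis" for i :: 'm using nth_mem bs(2) by blast
  then have "(bs ! bidx i) \<bullet> (bs ! bidx j) = (if i = j then 1 else 0)" for i j :: 'm
    by (simp add: inner_Basis nth_eq_iff_index_eq[OF bs(1) less less] bidx_eq_iff)
  then have "frame_matrix bs bs = (mat 1 :: real ^ 'm ^ 'm)"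
    by (simp add: frame_matrix_def mat_def)
  then have "?d bs = 1" by (simp add: lbs card)
  have l: "linear (\<lambda>r :: real. - r *\<^sub>R f bs)"
    by (intro linearI) (simp_all add: scaleR_diff_left)
  have "alternating_form (\<lambda>vs. f vs + - ?d vs *\<^sub>R f bs)"
    by (rule alternating_form_add[OF f alternating_form_compose_linear[OF l alternating_form_det]])
  then have "f vs + - ?d vs *\<^sub>R f bs = 0"
    by (rule alternating_form_eq_zero[OF _ bs _ len]) (simp only: \<open>?d bs = 1\<close> scaleR_minus_left scaleR_one add.right_inverse)
  then show ?thesis by (simp add: len card)
qed

lemma complex_frame_enum:
  obtains ks where "distinct ks" "set ks = (UNIV :: 'n::finite set)"
    "complex_frame = concat (map (\<lambda>k. [axis k 1, axis k \<i>]) ks)"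
proof
  let ?ks = "SOME ks. distinct ks \<and> set ks = (UNIV :: 'n set)"
  have "\<exists>ks. distinct ks \<and> set ks = (UNIV :: 'n set)"
    using finite_distinct_list[of "UNIV :: 'n set"] by auto
  from someI_ex[OF this] show "distinct ?ks" "set ?ks = UNIV" by auto
  show "complex_frame = concat (map (\<lambda>k. [axis k 1, axis k \<i>]) ?ks)" by (rule complex_frame_def)
qed

lemma set_complex_frame: "set complex_frame = (Basis :: (complex ^ 'n) set)"
proof -
  obtain ks where ks: "set ks = (UNIV :: 'n set)"
    "complex_frame = concat (map (\<lambda>k. [axis k 1, axis k \<i>]) ks)" using complex_frame_enum by blast
  have B: "u \<in> Basis \<longleftrightarrow> u = 1 \<or> u = \<i>" for u by (simp add: Basis_complex_def)
  show ?thesis unfolding ks(2) by (auto simp: Basis_vec_def ks(1) B)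
qed

lemma length_complex_frame: "length (complex_frame :: (complex ^ 'n::finite) list) = 2 * CARD('n)"
proof -
  obtain ks where ks: "distinct ks" "set ks = (UNIV :: 'n set)"
    "complex_frame = concat (map (\<lambda>k. [axis k 1, axis k \<i>]) ks)" using complex_frame_enum by blast
  have "length ks = CARD('n)" using ks(1,2) distinct_card[of ks] by simp
  moreover have "length (concat (map (\<lambda>k. [axis k 1, axis k \<i>]) ks)) = 2 * length ks" by (induction ks) auto
  ultimately show ?thesis by (simp add: ks(3))
qed

lemma distinct_complex_frame: "distinct (complex_frame :: (complex ^ 'n::finite) list)"
  by (rule card_distinct) (simp add: set_complex_frame length_complex_frame)

text \<open>\<open>'n bit0\<close> serves as an index type of cardinality twice that of
  \<open>'n\<close>, the real dimension.\<close>

lemma complex_frame_top_degree: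
  fixes f :: "(complex ^ 'n::finite) list \<Rightarrow> 'a::real_vector"
  assumes "alternating_form f" "length vs = 2 * CARD('n)"
  shows "f vs = det (frame_matrix complex_frame vs :: real ^ 'n bit0 ^ 'n bit0) *\<^sub>R f complex_frame"
  by (rule alternating_form_top_degree[OF assms(1) distinct_complex_frame set_complex_frame]) (simp_all add: assms(2))

section \<open>Positivity of the Kaehler volume form\<close>

text \<open>The conditions on a Kaehler form at one point, detached from the manifold so that they
  can be followed along a segment of linear forms.\<close>

definition kaehler_pointwise :: "((complex ^ 'n::finite) list \<Rightarrow> real) \<Rightarrow> bool" where
  "kaehler_pointwise \<Omega> \<longleftrightarrow> alternating_form \<Omega> \<and>
     (\<forall>vs. length vs \<noteq> 2 \<longrightarrow> \<Omega> vs = 0) \<and>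
     (\<forall>v w. \<Omega> [\<i> *s v, \<i> *s w] = \<Omega> [v, w]) \<and>
     (\<forall>v. v \<noteq> 0 \<longrightarrow> \<Omega> [v, \<i> *s v] > 0)"

lemma wedge_cong:
  assumes "\<And>S. f (nths vs S) = f' (nths vs S)" "\<And>S. g (nths vs S) = g' (nths vs S)"
  shows "wedge mul f g vs = wedge mul f' g' vs"
  by (simp add: wedge_def assms)

lemma bilinear_times: "bilinear ((*) :: 'a::real_algebra \<Rightarrow> 'a \<Rightarrow> 'a)"
  by (auto simp: bilinear_def intro!: linearI simp: algebra_simps)

lemma wedge_const_left:
  fixes f :: "'v list \<Rightarrow> 'a::real_vector"
  assumes "bilinear m"
  shows "wedge m (\<lambda>vs. if vs = [] then c else 0) f vs = m c (f vs)"
proof (induction vs arbitrary: f)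
  case (Cons v vs)
  have "contract v (\<lambda>vs. if vs = [] then c else 0) = (\<lambda>_. 0)"
    "grade_inv (\<lambda>vs :: 'v list. if vs = [] then c else 0) = (\<lambda>vs. if vs = [] then c else 0)"
    by (auto simp: contract_def grade_inv_def)
  then show ?case by (simp add: wedge_Cons[OF assms] assms Cons.IH) (simp add: contract_def)
qed simp

text \<open>Contract with \<open>u\<close> and \<open>w\<close> in turn. A factor contracted by only
  one of them is a one-form that vanishes on \<open>rest\<close>, so both must hit the same factor,
  and each of the \<open>k\<close> factors contributes equally.\<close>

lemma wedge_power_orthogonal_pair:
  fixes \<Omega> :: "'v list \<Rightarrow> real"
  assumes deg: "\<And>vs. length vs \<noteq> 2 \<Longrightarrow> \<Omega> vs = 0"
    and orth: "\<And>x. x \<in> set rest \<Longrightarrow> \<Omega> [u, x] = 0 \<and> \<Omega> [w, x] = 0"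
  shows "wedge_power (*) 1 \<Omega> k (u # w # rest) = real k * \<Omega> [u, w] * wedge_power (*) 1 \<Omega> (k - 1) rest"
  using orth
proof (induction k arbitrary: rest)
  case (Suc k)
  let ?W = "wedge_power (*) 1 \<Omega>"
  note m = bilinear_times[where 'a = real]
  have zero: "wedge (*) (grade_inv (contract y \<Omega>)) g rest = 0" if "y \<in> {u, w}" for y g
  proof -
    have "grade_inv (contract y \<Omega>) (nths rest S) = 0" for S
    proof (cases "length (nths rest S) = 1")
      case True
      then obtain x where x: "nths rest S = [x]" by (metis length_0_conv length_Suc_conv One_nat_def)
      then have "x \<in> set rest" using set_nths_subset[of rest S] by auto
      then show ?thesis using Suc.prems that x by (auto simp: grade_inv_def contract_def)
    qed (simp add: grade_inv_def contract_def deg)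
    then show ?thesis using wedge_cong[of "grade_inv (contract y \<Omega>)" rest "\<lambda>_. 0" g g "(*)"] m by simp
  qed
  have "contract w (contract u \<Omega>) = (\<lambda>vs. if vs = [] then \<Omega> [u, w] else 0)"
    by (auto simp: contract_def deg)
  then have "?W (Suc k) (u # w # rest) = \<Omega> [u, w] * ?W k rest + wedge (*) \<Omega> (contract w (contract u (?W k))) rest"
    by (simp add: wedge_Cons[OF m] wedge_const_left[OF m] zero contract_grade_inv wedge_minus_left[OF m])
  also have "wedge (*) \<Omega> (contract w (contract u (?W k))) rest =
      wedge (*) \<Omega> (\<lambda>vs. (real k * \<Omega> [u, w]) *\<^sub>R ?W (k - 1) vs) rest"
  proof (rule wedge_cong)
    show "contract w (contract u (?W k)) (nths rest S) = (real k * \<Omega> [u, w]) *\<^sub>R ?W (k - 1) (nths rest S)" for S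
      using Suc.IH[of "nths rest S"] Suc.prems set_nths_subset[of rest S] by (auto simp: contract_def)
  qed simp
  also have "\<dots> = real k * \<Omega> [u, w] * wedge (*) \<Omega> (?W (k - 1)) rest"
    by (subst wedge_scale_right[OF m]) simp
  \<comment> \<open>For k = 0 the prefactor vanishes, so the truncated \<open>k - 1\<close> does no
    harm.\<close>
  also have "\<dots> = real k * \<Omega> [u, w] * ?W k rest" by (cases k) simp_all
  finally show ?case by (simp add: algebra_simps)
qed simp

text \<open>The real frame u, i u, ... in the order used by \<open>complex_frame\<close>.\<close>

definition complex_pairs :: "(complex ^ 'n) list \<Rightarrow> (complex ^ 'n) list" where
  "complex_pairs us = concat (map (\<lambda>u. [u, \<i> *s u]) us)"

text \<open>Peeling off one pair at a time multiplies by the current length and by the positive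
  value on that pair, so the total is m! times the product of these values.\<close>

lemma wedge_power_orthogonal_pairs:
  fixes \<Omega> :: "(complex ^ 'n) list \<Rightarrow> real"
  assumes "\<And>vs. length vs \<noteq> 2 \<Longrightarrow> \<Omega> vs = 0" and pos: "\<And>u. u \<in> set us \<Longrightarrow> \<Omega> [u, \<i> *s u] > 0"
    and "sorted_wrt (\<lambda>u v. \<Omega> [u, v] = 0 \<and> \<Omega> [u, \<i> *s v] = 0 \<and> \<Omega> [\<i> *s u, v] = 0 \<and> \<Omega> [\<i> *s u, \<i> *s v] = 0) us"
  shows "wedge_power (*) 1 \<Omega> (length us) (complex_pairs us) > 0"
  using assms(2,3)
proof (induction us)
  case (Cons u us)
  then have "wedge_power (*) 1 \<Omega> (length (u # us)) (u # (\<i> *s u) # complex_pairs us) =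
      real (length (u # us)) * \<Omega> [u, \<i> *s u] * wedge_power (*) 1 \<Omega> (length us) (complex_pairs us)"
    by (subst wedge_power_orthogonal_pair[OF assms(1)]) (auto simp: complex_pairs_def)
  moreover have "\<dots> > 0" using Cons by (intro mult_pos_pos) auto
  ultimately show ?case by (simp add: complex_pairs_def)
qed (simp add: complex_pairs_def)

lemma ii_smult_ii: "\<i> *s (\<i> *s v) = - v" for v :: "complex ^ 'n"
  by (simp add: vec_eq_iff)

text \<open>A dimension count: orthogonality to \<open>m\<close> earlier vectors and their multiples
  by i imposes at most 2m real linear conditions in dimension 2n. The conditions on i v follow from
  invariance under i.\<close>

lemma kaehler_pointwise_orthogonal_vectors:
  fixes \<Omega> :: "(complex ^ 'n::finite) list \<Rightarrow> real"
  assumes \<Omega>: "kaehler_pointwise \<Omega>" and "m \<le> CARD('n)"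
  shows "\<exists>us. length us = m \<and> 0 \<notin> set us \<and>
    sorted_wrt (\<lambda>u v. \<Omega> [u, v] = 0 \<and> \<Omega> [u, \<i> *s v] = 0 \<and> \<Omega> [\<i> *s u, v] = 0 \<and> \<Omega> [\<i> *s u, \<i> *s v] = 0) us"
  using assms(2)
proof (induction m)
  case (Suc m)
  then obtain us where us: "length us = m" "0 \<notin> set us"
    "sorted_wrt (\<lambda>u v. \<Omega> [u, v] = 0 \<and> \<Omega> [u, \<i> *s v] = 0 \<and> \<Omega> [\<i> *s u, v] = 0 \<and> \<Omega> [\<i> *s u, \<i> *s v] = 0) us"
    by auto
  have lin: "linear (\<lambda>v. \<Omega> [v, x])" for x
    using \<Omega> alternating_formD(1)[of \<Omega> "[]" "[x]"] by (simp add: kaehler_pointwise_def)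
  have lin2: "linear (\<lambda>v. \<Omega> [x, v])" for x
    using \<Omega> alternating_formD(1)[of \<Omega> "[x]" "[]"] by (simp add: kaehler_pointwise_def)
  have J: "\<Omega> [\<i> *s v, \<i> *s w] = \<Omega> [v, w]" for v w using \<Omega> by (simp add: kaehler_pointwise_def)
  \<comment> \<open>\<open>r x\<close> represents the functional v -> \<open>\<Omega> [v, x]\<close>
    through the inner product, so the conditions become ordinary orthogonality.\<close>
  define r where "r = (\<lambda>x. \<Sum>b\<in>Basis. \<Omega> [b, x] *\<^sub>R b)"
  have r: "v \<bullet> r x = \<Omega> [v, x]" for v x
    using linear_eq_sum_Basis[OF lin, of v x] by (simp add: r_def inner_sum_right mult.commute)
  have "dim (r ` set (complex_pairs us)) \<le> card (set (complex_pairs us))"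
    by (rule order_trans[OF dim_le_card' card_image_le]) auto
  also have "\<dots> \<le> length (complex_pairs us)" by (rule card_length)
  also have "\<dots> = 2 * m" unfolding us(1)[symmetric] complex_pairs_def by (induction us) auto
  also have "\<dots> < DIM(complex ^ 'n)" using Suc.prems by simp
  finally obtain v where v: "v \<noteq> 0" "\<And>y. y \<in> span (r ` set (complex_pairs us)) \<Longrightarrow> orthogonal v y"
    by (rule orthogonal_to_subspace_exists) blast
  then have vx: "\<Omega> [v, x] = 0" if "x \<in> set (complex_pairs us)" for x
    using that r[of v x] span_base[of "r x" "r ` set (complex_pairs us)"] by (simp add: orthogonal_def)
  have "\<Omega> [v, u] = 0 \<and> \<Omega> [v, \<i> *s u] = 0 \<and> \<Omega> [\<i> *s v, u] = 0 \<and> \<Omega> [\<i> *s v, \<i> *s u] = 0" if "u \<in> set us" for u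
  proof -
    have "\<Omega> [v, u] = 0" "\<Omega> [v, \<i> *s u] = 0" using vx that by (auto simp: complex_pairs_def)
    moreover have "\<Omega> [\<i> *s v, \<i> *s (\<i> *s u)] = - \<Omega> [\<i> *s v, u]"
      unfolding ii_smult_ii by (rule linear_neg[OF lin2])
    ultimately show ?thesis by (simp only: J) simp
  qed
  then show ?case using us v(1) by (intro exI[of _ "v # us"]) auto
qed simp

text \<open>An orthogonal list of complex pairs gives a nonzero value, and a top-degree form that is
  nonzero somewhere is nonzero on every basis. The sign relative to \<open>complex_frame\<close>
  stays open, which the deformation to \<open>std_form\<close> settles.\<close>

lemma kaehler_pointwise_top_nonzero:
  fixes \<Omega> :: "(complex ^ 'n::finite) list \<Rightarrow> real"
  assumes \<Omega>: "kaehler_pointwise \<Omega>"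
  shows "wedge_power (*) 1 \<Omega> CARD('n) complex_frame \<noteq> 0"
proof
  assume 0: "wedge_power (*) 1 \<Omega> CARD('n) complex_frame = 0"
  obtain us where us: "length us = CARD('n)" "0 \<notin> set us"
    "sorted_wrt (\<lambda>u v. \<Omega> [u, v] = 0 \<and> \<Omega> [u, \<i> *s v] = 0 \<and> \<Omega> [\<i> *s u, v] = 0 \<and> \<Omega> [\<i> *s u, \<i> *s v] = 0) us"
    using kaehler_pointwise_orthogonal_vectors[OF \<Omega> order_refl] by blast
  have "wedge_power (*) 1 \<Omega> (length us) (complex_pairs us) > 0"
  proof (rule wedge_power_orthogonal_pairs[OF _ _ us(3)])
    show "\<Omega> vs = 0" if "length vs \<noteq> 2" for vs using \<Omega> that by (simp add: kaehler_pointwise_def)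
    show "\<Omega> [u, \<i> *s u] > 0" if "u \<in> set us" for u
    proof -
      have "u \<noteq> 0" using us(2) that by auto
      then show ?thesis using \<Omega> by (simp add: kaehler_pointwise_def)
    qed
  qed
  moreover have "length (complex_pairs us) = 2 * CARD('n)"
    unfolding us(1)[symmetric] complex_pairs_def by (induction us) auto
  moreover have "alternating_form (wedge_power (*) 1 \<Omega> CARD('n))"
    using \<Omega> by (intro wedge_power_alternating bilinear_times) (simp add: kaehler_pointwise_def)
  ultimately show False
    using alternating_form_eq_zero[where f = "wedge_power (*) 1 \<Omega> CARD('n)" and vs = "complex_pairs us",
        OF _ distinct_complex_frame set_complex_frame 0] us(1) by simp
qed

text \<open>The flat Kaehler form, with the sign for which its value on v, i v is the squared length
  of v.\<close>

definition std_form :: "(complex ^ 'n::finite) list \<Rightarrow> real" where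
  "std_form vs = (case vs of [v, w] \<Rightarrow> (\<i> *s v) \<bullet> w | _ \<Rightarrow> 0)"

lemma inner_ii: "(\<i> *s v) \<bullet> (\<i> *s w) = v \<bullet> w" "(\<i> *s v) \<bullet> v = 0" "v \<bullet> (\<i> *s w) = - ((\<i> *s v) \<bullet> w)" for v w :: "complex ^ 'n"
  by (simp_all add: inner_vec_def inner_complex_def sum.neutral add.commute mult.commute flip: sum_negf)

lemma linear_ii: "linear (\<lambda>v. \<i> *s v :: complex ^ 'n)"
  by (auto intro!: linearI simp: vec_eq_iff algebra_simps)

lemma kaehler_pointwise_std_form: "kaehler_pointwise (std_form :: (complex ^ 'n::finite) list \<Rightarrow> real)"
  unfolding kaehler_pointwise_def
proof (intro conjI allI impI)
  show "alternating_form (std_form :: (complex ^ 'n) list \<Rightarrow> real)"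
  proof (rule alternating_formI)
    fix us ws :: "(complex ^ 'n) list" and v
    have l1: "linear (\<lambda>v. (\<i> *s v) \<bullet> w)" for w :: "complex ^ 'n"
      by (rule linear_compose[OF linear_ii bounded_linear.linear[OF bounded_linear_inner_left], unfolded o_def])
    have l2: "linear (\<lambda>v. w \<bullet> v)" for w :: "complex ^ 'n"
      using bounded_linear.linear[OF bounded_linear_inner_right] by blast
    consider "us = []" "\<exists>w. ws = [w]" | "\<exists>u. us = [u]" "ws = []" | "length us + length ws \<noteq> 1"
      by (cases us; cases ws) (auto simp: length_Suc_conv)
    then show "linear (\<lambda>v. std_form (us @ v # ws))"
    proof cases
      case 3
      then have "std_form (us @ v # ws) = 0" for v
        by (auto simp: std_form_def Cons_eq_append_conv append_eq_Cons_conv split: list.splits)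
      then show ?thesis by (simp add: linear_zero)
    qed (auto simp: std_form_def l1 l2)
    show "std_form (us @ v # v # ws) = 0"
      by (auto simp: std_form_def inner_ii append_eq_Cons_conv split: list.splits)
  qed
qed (auto simp: std_form_def inner_ii ii_smult_ii vector_smult_lneg split: list.splits)

lemma std_form_top_positive: "wedge_power (*) 1 std_form CARD('n) (complex_frame :: (complex ^ 'n::finite) list) > 0"
proof -
  obtain ks where ks: "distinct ks" "set ks = (UNIV :: 'n set)"
    "complex_frame = concat (map (\<lambda>k. [axis k 1, axis k \<i>]) ks)" using complex_frame_enum by blast
  have ii: "\<i> *s axis k c = axis k (\<i> * c)" for k :: 'n and c
    by (auto simp: axis_def vec_eq_iff)
  let ?us = "map (\<lambda>k. axis k (1::complex)) ks"
  have cp: "complex_frame = complex_pairs ?us"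
    unfolding ks(3) complex_pairs_def by (simp add: o_def ii)
  have "sorted_wrt (\<lambda>k l. k \<noteq> l) ks" using ks(1) by (induction ks) auto
  then have "sorted_wrt (\<lambda>u v. std_form [u, v] = 0 \<and> std_form [u, \<i> *s v] = 0 \<and>
      std_form [\<i> *s u, v] = 0 \<and> std_form [\<i> *s u, \<i> *s v] = 0) ?us"
    unfolding sorted_wrt_map by (rule sorted_wrt_mono_rel[rotated]) (auto simp: std_form_def ii inner_axis_axis)
  then have "wedge_power (*) 1 std_form (length ?us) (complex_pairs ?us) > 0"
    by (intro wedge_power_orthogonal_pairs) (auto simp: std_form_def ii inner_axis_axis split: list.splits)
  moreover have "length ?us = CARD('n)" using ks(1,2) distinct_card[of ks] by simp
  ultimately show ?thesis by (simp add: cp)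
qed

text \<open>Along the segment from the standard form to \<open>\<Omega>\<close> the top power never vanishes on the frame.\<close>

lemma kaehler_pointwise_top_positive:
  fixes \<Omega> :: "(complex ^ 'n::finite) list \<Rightarrow> real"
  assumes \<Omega>: "kaehler_pointwise \<Omega>"
  shows "wedge_power (*) 1 \<Omega> CARD('n) complex_frame > 0"
proof (rule ccontr)
  define \<Omega>s where "\<Omega>s = (\<lambda>s vs. (1 - s) * std_form vs + s * \<Omega> vs)"
  have K: "kaehler_pointwise (\<Omega>s s)" if "0 \<le> s" "s \<le> 1" for s
    unfolding kaehler_pointwise_def
  proof (intro conjI allI impI)
    note k = kaehler_pointwise_std_form[where 'n = 'n, unfolded kaehler_pointwise_def] \<Omega>[unfolded kaehler_pointwise_def]
    show "alternating_form (\<Omega>s s)"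
      unfolding \<Omega>s_def using k
      by (intro alternating_form_add alternating_form_compose_linear[of "\<lambda>r. c * r" for c]) (auto intro!: linearI simp: algebra_simps)
    show "\<Omega>s s [v, \<i> *s v] > 0" if v: "v \<noteq> 0" for v
    \<comment> \<open>For s > 0 strict positivity comes from the term with \<open>\<Omega>\<close>;
      at s = 0 it comes from \<open>std_form\<close>.\<close>
    proof (cases "s = 0")
      case False
      then show ?thesis
        unfolding \<Omega>s_def using k v \<open>0 \<le> s\<close> \<open>s \<le> 1\<close>
        by (intro add_nonneg_pos mult_nonneg_nonneg mult_pos_pos) (auto simp: less_imp_le)
    qed (use k v in \<open>simp add: \<Omega>s_def\<close>)
  qed (use kaehler_pointwise_std_form[where 'n = 'n] \<Omega> in \<open>auto simp: \<Omega>s_def kaehler_pointwise_def\<close>)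
  have cont: "continuous_on UNIV (\<lambda>s. wedge_power (*) 1 (\<Omega>s s) k vs)" for k vs
  proof (induction k arbitrary: vs)
    case (Suc k)
    then show ?case unfolding wedge_power.simps wedge_def \<Omega>s_def by (intro continuous_intros)
  qed (simp add: continuous_on_const)
  assume "\<not> wedge_power (*) 1 \<Omega> CARD('n) complex_frame > 0"
  moreover have "\<Omega>s 1 = \<Omega>" "\<Omega>s 0 = std_form" by (auto simp: \<Omega>s_def)
  ultimately have "\<exists>s\<ge>0. s \<le> 1 \<and> wedge_power (*) 1 (\<Omega>s s) CARD('n) complex_frame = 0"
    using std_form_top_positive[where 'n = 'n] continuous_on_subset[OF cont]
    by (intro IVT2') (auto simp: not_less)
  then show False using kaehler_pointwise_top_nonzero[OF K] by blast
qed

section \<open>Adjoints with respect to a Hermitian metric\<close>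

definition pos_hermitian :: "complex ^ 'r ^ 'r \<Rightarrow> bool" where
  "pos_hermitian H \<longleftrightarrow> conj_transpose H = (H :: complex ^ 'r ^ 'r::finite) \<and>
     (\<forall>v. v \<noteq> 0 \<longrightarrow> 0 < Re (\<Sum>a\<in>UNIV. cnj (v $ a) * (H *v v) $ a))"

lemma conj_transpose_nth: "conj_transpose M $ i $ j = cnj (M $ j $ i)"
  by (simp add: conj_transpose_def map_matrix_def transpose_def)

lemma conj_transpose_mult: "conj_transpose (A ** B) = conj_transpose B ** conj_transpose A"
  by (simp add: vec_eq_iff conj_transpose_nth matrix_matrix_mult_def mult.commute)

lemma conj_transpose_conj_transpose [simp]: "conj_transpose (conj_transpose A) = A"
  by (simp add: vec_eq_iff conj_transpose_nth)

lemma conj_transpose_mat: "conj_transpose (mat c) = mat (cnj c)"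
  by (simp add: vec_eq_iff conj_transpose_nth mat_def)

lemma linear_conj_transpose: "linear conj_transpose"
  by (auto intro!: linearI simp: vec_eq_iff conj_transpose_nth)

lemma trace_conj_transpose: "trace (conj_transpose A) = cnj (trace A)"
  by (simp add: trace_def conj_transpose_nth)

lemma matrix_inv_left_right:
  assumes "invertible (A :: 'a::field ^ 'n ^ 'n)"
  shows "A ** matrix_inv A = mat 1" "matrix_inv A ** A = mat 1"
  using assms unfolding invertible_def matrix_inv_def by (metis (mono_tags, lifting) someI_ex)+

lemma matrix_inv_unique:
  assumes "A ** B = mat 1" shows "matrix_inv A = (B :: 'a::field ^ 'n ^ 'n)"
proof -
  have "invertible A" using assms invertible_right_inverse by blast
  then have "matrix_inv A ** A = mat 1" by (rule matrix_inv_left_right)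
  then show ?thesis by (metis assms matrix_mul_assoc matrix_mul_lid matrix_mul_rid)
qed

lemma pos_hermitian_invertible:
  assumes "pos_hermitian H" shows "invertible H"
  unfolding invertible_left_inverse matrix_left_invertible_ker
proof (intro allI impI)
  fix v assume 0: "H *v v = 0"
  have "Re (\<Sum>a\<in>UNIV. cnj (v $ a) * (H *v v) $ a) = 0" unfolding 0 by simp
  then show "v = 0" using assms unfolding pos_hermitian_def by fastforce
qed

lemma quadratic_form_eq:
  "(conj_transpose Q ** H ** Q) $ a $ a = (\<Sum>c\<in>UNIV. cnj (column a Q $ c) * (H *v column a Q) $ c)"
  unfolding matrix_mul_assoc[symmetric]
  by (simp add: matrix_matrix_mult_def[of "conj_transpose Q"] conj_transpose_nth column_def
      matrix_matrix_mult_def[of H] matrix_vector_mult_def)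

lemma pos_hermitian_quadratic_real:
  assumes "pos_hermitian H"
  shows "(conj_transpose Q ** H ** Q) $ a $ a = of_real (Re ((conj_transpose Q ** H ** Q) $ a $ a))"
proof -
  have "conj_transpose (conj_transpose Q ** H ** Q) = conj_transpose Q ** H ** Q"
    using assms by (simp add: conj_transpose_mult pos_hermitian_def matrix_mul_assoc)
  then have "cnj ((conj_transpose Q ** H ** Q) $ a $ a) = (conj_transpose Q ** H ** Q) $ a $ a"
    by (metis conj_transpose_nth)
  then show ?thesis by (metis Reals_cnj_iff of_real_Re)
qed

text \<open>Gram--Schmidt: the columns of \<open>P\<close> with index in \<open>I\<close> are made orthonormal one after another, the
  others being zero; while \<open>I\<close> is not everything, \<open>P\<^sup>* H\<close> has a zero row, hence a kernel.\<close>

lemma pos_hermitian_orthonormal_basis: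
  assumes H: "pos_hermitian (H :: complex ^ 'r ^ 'r::finite)"
  obtains P where "conj_transpose P ** H ** P = mat 1"
proof -
  have "\<exists>P. \<forall>a b. (conj_transpose P ** H ** P) $ a $ b = (if a = b \<and> a \<in> I then 1 else 0)" if "finite I" for I
    using that
  proof (induction I)
    case empty
    have "(conj_transpose 0 ** H ** 0) = (0 :: complex ^ 'r ^ 'r)"
      by (simp add: matrix_matrix_mult_def vec_eq_iff)
    then show ?case by (intro exI[of _ 0]) simp
  next
    case (insert i I)
    then obtain P where P: "\<And>a b. (conj_transpose P ** H ** P) $ a $ b = (if a = b \<and> a \<in> I then 1 else 0)" by auto
    have Pi: "column i P = 0"
    proof (rule ccontr)
      assume "column i P \<noteq> 0"
      then have "Re ((conj_transpose P ** H ** P) $ i $ i) > 0"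
        using H unfolding quadratic_form_eq pos_hermitian_def by blast
      then show False using P[of i i] insert.hyps by simp
    qed
    then have "row i (conj_transpose P ** H) = 0"
      by (simp add: row_def column_def vec_eq_iff matrix_matrix_mult_def conj_transpose_nth)
    then have "det (conj_transpose P ** H) = 0" by (rule det_zero_row)
    then have "\<not> invertible (conj_transpose P ** H)" by (simp add: invertible_det_nz)
    then obtain v where v: "v \<noteq> 0" "(conj_transpose P ** H) *v v = 0"
      unfolding invertible_left_inverse matrix_left_invertible_ker by auto
    define q where "q = Re (\<Sum>a\<in>UNIV. cnj (v $ a) * (H *v v) $ a)"
    have q: "q > 0" using H v(1) by (simp add: q_def pos_hermitian_def)
    define w where "w = of_real (1 / sqrt q) *s v"
    define Q where "Q = (\<chi> a b. if b = i then w $ a else P $ a $ b)"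
    have colQ: "column b Q = (if b = i then w else column b P)" for b
      by (simp add: Q_def column_def vec_eq_iff)
    have ent: "(conj_transpose R ** H ** S) $ a $ b = (\<Sum>c\<in>UNIV. cnj (column a R $ c) * (H *v column b S) $ c)" for R S a b
      unfolding matrix_mul_assoc[symmetric]
      by (simp add: matrix_matrix_mult_def[of "conj_transpose R"] conj_transpose_nth column_def
          matrix_matrix_mult_def[of H] matrix_vector_mult_def)
    have Pv: "(\<Sum>c\<in>UNIV. cnj (column a P $ c) * (H *v w) $ c) = 0" for a
    proof -
      have "(\<Sum>c\<in>UNIV. cnj (column a P $ c) * (H *v v) $ c) = ((conj_transpose P ** H) *v v) $ a"
        unfolding matrix_vector_mul_assoc[symmetric]
        by (simp add: matrix_vector_mult_def[of "conj_transpose P"] conj_transpose_nth column_def)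
      then have "(\<Sum>c\<in>UNIV. cnj (column a P $ c) * (H *v v) $ c) = 0" by (simp add: v)
      moreover have "(\<Sum>c\<in>UNIV. cnj (column a P $ c) * (H *v w) $ c) =
          of_real (1 / sqrt q) * (\<Sum>c\<in>UNIV. cnj (column a P $ c) * (H *v v) $ c)"
        by (simp add: w_def vec.scale sum_distrib_left mult_ac)
      ultimately show ?thesis by simp
    qed
    have wP: "(\<Sum>c\<in>UNIV. cnj (w $ c) * (H *v column a P) $ c) = 0" for a
    proof -
      have Hs: "cnj (H $ c $ d) = H $ d $ c" for c d
        using H by (metis conj_transpose_nth pos_hermitian_def)
      have "(\<Sum>c\<in>UNIV. cnj (w $ c) * (H *v column a P) $ c) = cnj (\<Sum>c\<in>UNIV. cnj (column a P $ c) * (H *v w) $ c)"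
        unfolding matrix_vector_mult_def
        by (simp add: sum_distrib_left Hs, subst sum.swap) (simp add: mult_ac)
      then show ?thesis by (simp add: Pv)
    qed
    have ww: "(\<Sum>c\<in>UNIV. cnj (w $ c) * (H *v w) $ c) = 1"
    proof -
      \<comment> \<open>A matrix with all columns equal to \<open>v\<close> puts the number v* H v
        on its diagonal, so that its reality can be read off from
        \<open>pos_hermitian_quadratic_real\<close>.\<close>
      define V where "V = (\<chi> a b :: 'r. v $ a)"
      have "column i V = v" by (simp add: V_def column_def vec_eq_iff)
      then have "(\<Sum>c\<in>UNIV. cnj (v $ c) * (H *v v) $ c) = of_real q"
        using pos_hermitian_quadratic_real[OF H, of V i] unfolding quadratic_form_eq by (simp add: q_def)
      moreover have "(\<Sum>c\<in>UNIV. cnj (w $ c) * (H *v w) $ c) =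
          of_real (1 / sqrt q) * of_real (1 / sqrt q) * (\<Sum>c\<in>UNIV. cnj (v $ c) * (H *v v) $ c)"
        by (simp add: w_def vec.scale sum_distrib_left mult_ac)
      moreover have "1 / sqrt q * (1 / sqrt q) * q = 1" using q by (simp add: field_simps)
      ultimately show ?thesis by (metis of_real_1 of_real_mult)
    qed
    have "(conj_transpose Q ** H ** Q) $ a $ b = (if a = b \<and> a \<in> insert i I then 1 else 0)" for a b
      using P[of a b] wP Pv ww unfolding ent colQ by auto
    then show ?case by blast
  qed
  from this[of UNIV] obtain P where "\<forall>a b. (conj_transpose P ** H ** P) $ a $ b = (if a = b then 1 else 0)" by auto
  then have "conj_transpose P ** H ** P = mat 1" by (simp add: vec_eq_iff mat_def)
  then show ?thesis by (rule that)
qed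

text \<open>An orthonormal basis \<open>P\<close> gives H^-1 = P P*. Cyclicity of the trace then
  writes the number as the sum of the squared \<open>H\<close>-lengths of the columns of
  \<open>T ** P\<close>.\<close>

lemma trace_adj_wrt:
  assumes H: "pos_hermitian H"
  shows "trace (T ** adj_wrt H T) = of_real (Re (trace (T ** adj_wrt H T)))"
    "Re (trace (T ** adj_wrt H T)) \<ge> 0" "Re (trace (T ** adj_wrt H T)) = 0 \<longleftrightarrow> T = 0"
proof -
  obtain P where P: "conj_transpose P ** H ** P = mat 1" using pos_hermitian_orthonormal_basis[OF H] .
  then have P1: "P ** (conj_transpose P ** H) = mat 1" by (simp add: matrix_left_right_inverse)
  then have "(P ** conj_transpose P) ** H = mat 1" by (simp add: matrix_mul_assoc)
  then have "H ** (P ** conj_transpose P) = mat 1" using matrix_left_right_inverse by blast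
  then have inv: "matrix_inv H = P ** conj_transpose P" by (rule matrix_inv_unique)
  have "trace (T ** adj_wrt H T) = trace ((T ** P) ** (conj_transpose (T ** P) ** H))"
    by (simp add: adj_wrt_def inv conj_transpose_mult matrix_mul_assoc)
  also have "\<dots> = trace (conj_transpose (T ** P) ** H ** (T ** P))"
    by (rule trace_mul_sym)
  finally have tr: "trace (T ** adj_wrt H T) = (\<Sum>a\<in>UNIV. (conj_transpose (T ** P) ** H ** (T ** P)) $ a $ a)"
    by (simp add: trace_def)
  let ?q = "\<lambda>a. Re ((conj_transpose (T ** P) ** H ** (T ** P)) $ a $ a)"
  have q: "?q a \<ge> 0" "?q a = 0 \<longleftrightarrow> column a (T ** P) = 0" for a
  proof -
    have "?q a > 0" if "column a (T ** P) \<noteq> 0"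
      using H that unfolding quadratic_form_eq pos_hermitian_def by blast
    moreover have "?q a = 0" if "column a (T ** P) = 0"
      unfolding quadratic_form_eq that by simp
    ultimately have "?q a \<ge> 0 \<and> (?q a = 0 \<longleftrightarrow> column a (T ** P) = 0)" by force
    then show "?q a \<ge> 0" "?q a = 0 \<longleftrightarrow> column a (T ** P) = 0" by auto
  qed
  show "trace (T ** adj_wrt H T) = of_real (Re (trace (T ** adj_wrt H T)))"
    unfolding tr Re_sum of_real_sum by (intro sum.cong refl pos_hermitian_quadratic_real[OF H])
  show "Re (trace (T ** adj_wrt H T)) \<ge> 0"
    unfolding tr Re_sum by (intro sum_nonneg q)
  have "Re (trace (T ** adj_wrt H T)) = 0 \<longleftrightarrow> (\<forall>a. column a (T ** P) = 0)"
    unfolding tr Re_sum by (subst sum_nonneg_eq_0_iff) (auto simp: q)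
  also have "\<dots> \<longleftrightarrow> T ** P = 0" by (auto simp: column_def vec_eq_iff)
  also have "\<dots> \<longleftrightarrow> T = 0"
  proof
    assume "T ** P = 0"
    then have "T ** (P ** (conj_transpose P ** H)) = 0"
      by (simp add: matrix_mul_assoc)
    then show "T = 0" by (simp add: P1)
  qed (simp add: matrix_matrix_mult_def vec_eq_iff)
  finally show "Re (trace (T ** adj_wrt H T)) = 0 \<longleftrightarrow> T = 0" .
qed

section \<open>Change of variables\<close>

text \<open>The formula is applied to each coordinate \<open>f x \<bullet> a\<close>, packed as a
  vector in \<open>real ^ 1\<close>, and the coordinates are reassembled.\<close>

lemma change_of_variables_cart:
  fixes f :: "real ^ 'm::{finite,wellorder} \<Rightarrow> 'b::euclidean_space" and g :: "real ^ 'm::_ \<Rightarrow> real ^ 'm::_"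
  assumes S: "S \<in> sets lebesgue" and der: "\<And>x. x \<in> S \<Longrightarrow> (g has_derivative g' x) (at x within S)"
    and inj: "inj_on g S"
  shows "f absolutely_integrable_on (g ` S) \<longleftrightarrow> (\<lambda>x. \<bar>det (matrix (g' x))\<bar> *\<^sub>R f (g x)) absolutely_integrable_on S"
    "f absolutely_integrable_on (g ` S) \<Longrightarrow>
      integral S (\<lambda>x. \<bar>det (matrix (g' x))\<bar> *\<^sub>R f (g x)) = integral (g ` S) f"
proof -
  let ?J = "\<lambda>x. \<bar>det (matrix (g' x))\<bar>"
  have vec1: "F absolutely_integrable_on T \<longleftrightarrow> (\<lambda>x. F x $ 1) absolutely_integrable_on T"
    for F :: "real ^ 'm::_ \<Rightarrow> real ^ 1" and T
    by (subst absolutely_integrable_componentwise_iff) (simp add: Basis_vec_def inner_axis UNIV_1)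
  have comp: "((\<lambda>x. f x \<bullet> a) absolutely_integrable_on (g ` S) \<longleftrightarrow> (\<lambda>x. ?J x * (f (g x) \<bullet> a)) absolutely_integrable_on S) \<and>
     ((\<lambda>x. f x \<bullet> a) absolutely_integrable_on (g ` S) \<longrightarrow>
       integral S (\<lambda>x. ?J x * (f (g x) \<bullet> a)) = integral (g ` S) (\<lambda>x. f x \<bullet> a))" for a
  proof -
    define F :: "real ^ 'm::_ \<Rightarrow> real ^ 1" where "F = (\<lambda>x. \<chi> i. f x \<bullet> a)"
    have F1: "(\<lambda>x. F x $ 1) = (\<lambda>x. f x \<bullet> a)" "(\<lambda>x. (?J x *\<^sub>R F (g x)) $ 1) = (\<lambda>x. ?J x * (f (g x) \<bullet> a))"
      by (simp_all add: F_def)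
    note cv = has_absolute_integral_change_of_variables[OF S der inj, of F]
    have 1: "F absolutely_integrable_on (g ` S) \<longleftrightarrow> (\<lambda>x. ?J x *\<^sub>R F (g x)) absolutely_integrable_on S"
      using cv by blast
    have 2: "integral S (\<lambda>x. ?J x *\<^sub>R F (g x)) = integral (g ` S) F" if "F absolutely_integrable_on (g ` S)"
      using cv that by blast
    have "integral S (\<lambda>x. (?J x *\<^sub>R F (g x)) $ 1) = integral (g ` S) (\<lambda>x. F x $ 1)" if "F absolutely_integrable_on (g ` S)"
      using 1 2 that by (simp only: integral_component_eq_cart[OF set_lebesgue_integral_eq_integral(1)])
    with 1 show ?thesis unfolding vec1 F1 by blast
  qed
  show iff: "f absolutely_integrable_on (g ` S) \<longleftrightarrow> (\<lambda>x. ?J x *\<^sub>R f (g x)) absolutely_integrable_on S"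
    by (subst (1 2) absolutely_integrable_componentwise_iff) (simp add: comp)
  assume f: "f absolutely_integrable_on (g ` S)"
  have fa: "(\<lambda>x. f x \<bullet> a) absolutely_integrable_on (g ` S)" if "a \<in> Basis" for a
    using f that absolutely_integrable_componentwise_iff by blast
  show "integral S (\<lambda>x. ?J x *\<^sub>R f (g x)) = integral (g ` S) f"
  proof (rule euclidean_eqI)
    fix a :: 'b assume a: "a \<in> Basis"
    have "integral S (\<lambda>x. ?J x *\<^sub>R f (g x)) \<bullet> a = integral S (\<lambda>x. (?J x *\<^sub>R f (g x)) \<bullet> a)"
      using iff f by (simp only: integral_component_eq[OF set_lebesgue_integral_eq_integral(1)])
    also have "\<dots> = integral (g ` S) (\<lambda>x. f x \<bullet> a)"
      using comp[of a] fa[OF a] by simp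
    also have "\<dots> = integral (g ` S) f \<bullet> a"
      using f by (simp only: integral_component_eq[OF set_lebesgue_integral_eq_integral(1)])
    finally show "integral S (\<lambda>x. ?J x *\<^sub>R f (g x)) \<bullet> a = integral (g ` S) f \<bullet> a" .
  qed
qed

section \<open>Real coordinates on complex n-space\<close>

definition from_real :: "real ^ (('n::finite) bit0) \<Rightarrow> complex ^ ('n::finite)" where
  "from_real y = (\<Sum>k\<in>UNIV. (y $ k) *\<^sub>R (complex_frame ! bidx k))"

definition to_real :: "complex ^ ('n::finite) \<Rightarrow> real ^ (('n::finite) bit0)" where
  "to_real z = (\<chi> k. z \<bullet> (complex_frame ! bidx k))"

lemma bij_betw_frame: "bij_betw (\<lambda>k :: ('n::finite) bit0. complex_frame ! bidx k) UNIV (Basis :: (complex ^ 'n::finite) set)"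
proof -
  have "bij_betw ((!) (complex_frame :: (complex ^ 'n) list)) {..<length (complex_frame :: (complex ^ 'n) list)} (set complex_frame)"
    by (rule bij_betw_nth[OF distinct_complex_frame]) auto
  then have "bij_betw ((!) (complex_frame :: (complex ^ 'n) list)) {..<CARD('n bit0)} Basis"
    by (simp add: set_complex_frame length_complex_frame)
  from bij_betw_trans[OF bidx this] show ?thesis by (simp add: o_def)
qed

lemma inner_frame: "(complex_frame ! bidx k) \<bullet> (complex_frame ! bidx l :: complex ^ 'n::finite) = (if k = l then 1 else 0)"
  for k l :: "('n::finite) bit0"
proof -
  have "complex_frame ! bidx k \<in> (Basis :: (complex ^ 'n) set)" for k :: "'n bit0"
    using bij_betw_frame[where 'n = 'n] by (auto simp: bij_betw_def)
  moreover have "complex_frame ! bidx k = (complex_frame ! bidx l :: complex ^ 'n) \<longleftrightarrow> k = l"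
    using bij_betw_frame[where 'n = 'n] by (auto simp: bij_betw_def inj_on_def)
  ultimately show ?thesis by (simp add: inner_Basis)
qed

lemma from_real_inner: "from_real y \<bullet> (complex_frame ! bidx k) = y $ k"
  by (simp add: from_real_def inner_sum_left inner_frame if_distrib sum.delta' cong: if_cong)

lemma to_real_from_real [simp]: "to_real (from_real y) = y"
  by (simp add: to_real_def from_real_inner vec_eq_iff)

lemma from_real_to_real [simp]: "from_real (to_real z) = (z :: complex ^ 'n::finite)"
proof -
  have "from_real (to_real z) = (\<Sum>b\<in>Basis. (z \<bullet> b) *\<^sub>R b)"
    unfolding from_real_def to_real_def
    using sum.reindex_bij_betw[OF bij_betw_frame[where 'n = 'n], of "\<lambda>b. (z \<bullet> b) *\<^sub>R b"]
    by (simp only: vec_lambda_beta)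
  then show ?thesis by (simp only: euclidean_representation)
qed

lemma linear_from_real: "linear from_real"
  by (auto intro!: linearI simp: from_real_def scaleR_left_distrib sum.distrib scaleR_sum_right)

lemma linear_to_real: "linear to_real"
  by (auto intro!: linearI simp: to_real_def vec_eq_iff inner_add_left)

lemma bounded_linear_from_real: "bounded_linear from_real" and bounded_linear_to_real: "bounded_linear to_real"
  using linear_from_real linear_to_real linear_conv_bounded_linear by blast+

lemma from_real_axis: "from_real (axis k 1) = complex_frame ! bidx k"
  by (simp add: from_real_def axis_def if_distrib[of "\<lambda>r. r *\<^sub>R _"] sum.delta cong: if_cong)

lemma measurable_from_real: "from_real \<in> borel_measurable borel"
  by (rule borel_measurable_continuous_onI[OF linear_continuous_on[OF bounded_linear_from_real]])

text \<open>\<open>complex_frame\<close> enumerates \<open>Basis\<close>, so boxes correspond to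
  boxes with the same product of side lengths, and these values determine
  \<open>lborel\<close>.\<close>

lemma lborel_from_real: "distr lborel borel from_real = (lborel :: (complex ^ 'n::finite) measure)"
proof (rule lborel_eqI[symmetric])
  fix l u :: "complex ^ 'n" assume lu: "\<And>b. b \<in> Basis \<Longrightarrow> l \<bullet> b \<le> u \<bullet> b"
  have B: "(Basis :: (complex ^ 'n) set) = range (\<lambda>k :: 'n bit0. complex_frame ! bidx k)"
    using bij_betw_frame[where 'n = 'n] by (simp add: bij_betw_def)
  have "from_real -` box l u = box (to_real l) (to_real u)"
  proof (rule set_eqI)
    fix y :: "real ^ 'n bit0"
    have "y \<in> from_real -` box l u \<longleftrightarrow> (\<forall>k. l \<bullet> (complex_frame ! bidx k) < y $ k \<and> y $ k < u \<bullet> (complex_frame ! bidx k))"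
      unfolding vimage_eq box_def B by (simp add: from_real_inner)
    then show "y \<in> from_real -` box l u \<longleftrightarrow> y \<in> box (to_real l) (to_real u)"
      by (simp add: mem_box_cart to_real_def)
  qed
  then have "emeasure (distr lborel borel from_real) (box l u) = emeasure lborel (box (to_real l) (to_real u))"
    using measurable_from_real by (subst emeasure_distr) auto
  also have "\<dots> = (\<Prod>b\<in>Basis. (to_real u - to_real l) \<bullet> b)"
  proof (rule emeasure_lborel_box)
    fix b :: "real ^ 'n bit0" assume "b \<in> Basis"
    then obtain k where "b = axis k 1" by (auto simp: Basis_vec_def)
    moreover have "complex_frame ! bidx k \<in> (Basis :: (complex ^ 'n) set)"
      using bij_betw_frame[where 'n = 'n] by (auto simp: bij_betw_def)
    ultimately show "to_real l \<bullet> b \<le> to_real u \<bullet> b" using lu by (simp add: to_real_def inner_axis)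
  qed
  also have "(\<Prod>b\<in>Basis. (to_real u - to_real l) \<bullet> b) = (\<Prod>k\<in>(UNIV :: 'n bit0 set). (u - l) \<bullet> (complex_frame ! bidx k))"
  proof -
    have "bij_betw (\<lambda>k. axis k 1) UNIV (Basis :: (real ^ 'n bit0) set)"
      by (auto simp: bij_betw_def inj_on_def Basis_vec_def axis_eq_axis)
    from prod.reindex_bij_betw[OF this, of "\<lambda>b. (to_real u - to_real l) \<bullet> b", symmetric]
    show ?thesis by (simp add: to_real_def inner_axis inner_diff_left)
  qed
  also have "\<dots> = (\<Prod>b\<in>Basis. (u - l) \<bullet> b)"
    by (rule prod.reindex_bij_betw[OF bij_betw_frame[where 'n = 'n]])
  finally show "emeasure (distr lborel borel from_real) (box l u) = ennreal (\<Prod>b\<in>Basis. (u - l) \<bullet> b)" .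
qed simp

lemma set_integral_from_real:
  fixes f :: "complex ^ 'n::finite \<Rightarrow> 'b::{banach, second_countable_topology}"
  assumes "set_borel_measurable borel S f"
  shows "set_integrable lborel S f \<longleftrightarrow> set_integrable lborel (to_real ` S) (\<lambda>y. f (from_real y))"
    "(LINT z:S|lborel. f z) = (LINT y:to_real ` S|lborel. f (from_real y))"
proof -
  have ind: "indicat_real (to_real ` S) y = indicat_real S (from_real y)" for y
    by (auto simp: indicator_def) (metis from_real_to_real image_iff to_real_from_real)+
  have m: "(\<lambda>z. indicat_real S z *\<^sub>R f z) \<in> borel_measurable borel"
    using assms by (simp add: set_borel_measurable_def)
  have fr: "from_real \<in> measurable lborel (borel :: (complex ^ 'n) measure)"
    using measurable_from_real by simp
  show "set_integrable lborel S f \<longleftrightarrow> set_integrable lborel (to_real ` S) (\<lambda>y. f (from_real y))"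
    unfolding set_integrable_def ind
    by (subst lborel_from_real[symmetric], rule integrable_distr_eq[OF fr m])
  show "(LINT z:S|lborel. f z) = (LINT y:to_real ` S|lborel. f (from_real y))"
    unfolding set_lebesgue_integral_def ind
    by (subst lborel_from_real[symmetric], rule integral_distr[OF fr m])
qed

text \<open>Forms are integrated against \<open>lborel\<close>, while the change of variables is
  stated for \<open>lebesgue\<close>; for Borel integrands the completion makes no
  difference.\<close>

lemma set_integrable_lebesgue_lborel:
  fixes f :: "'a::euclidean_space \<Rightarrow> 'b::euclidean_space"
  assumes "set_borel_measurable borel S f"
  shows "f absolutely_integrable_on S \<longleftrightarrow> set_integrable lborel S f"
    "set_integrable lborel S f \<Longrightarrow> (LINT z:S|lborel. f z) = integral S f"
proof -
  have m: "(\<lambda>z. indicat_real S z *\<^sub>R f z) \<in> borel_measurable lborel"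
    using assms by (simp add: set_borel_measurable_def)
  show 1: "f absolutely_integrable_on S \<longleftrightarrow> set_integrable lborel S f"
    unfolding set_integrable_def by (rule integrable_completion[OF m])
  have "(LINT z:S|lborel. f z) = (LINT z:S|lebesgue. f z)"
    unfolding set_lebesgue_integral_def by (rule integral_completion[OF m, symmetric])
  then show "(LINT z:S|lborel. f z) = integral S f" if "set_integrable lborel S f"
    using that 1 set_lebesgue_integral_eq_integral(2) by metis
qed

lemma change_of_variables_complex:
  fixes \<phi> :: "complex ^ 'n::finite \<Rightarrow> complex ^ 'n" and f :: "complex ^ 'n \<Rightarrow> 'b::euclidean_space"
  defines "J \<equiv> \<lambda>L. \<bar>det (frame_matrix complex_frame (map L complex_frame) :: real ^ 'n bit0 ^ 'n bit0)\<bar>"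
  assumes S: "S \<in> sets borel" and der: "\<And>x. x \<in> S \<Longrightarrow> (\<phi> has_derivative \<phi>' x) (at x)"
    and inj: "inj_on \<phi> S"
    and m1: "set_borel_measurable borel (\<phi> ` S) f"
    and m2: "set_borel_measurable borel S (\<lambda>x. J (\<phi>' x) *\<^sub>R f (\<phi> x))"
  shows "set_integrable lborel S (\<lambda>x. J (\<phi>' x) *\<^sub>R f (\<phi> x)) \<longleftrightarrow> set_integrable lborel (\<phi> ` S) f"
    "set_integrable lborel (\<phi> ` S) f \<Longrightarrow>
      (LINT x:S|lborel. J (\<phi>' x) *\<^sub>R f (\<phi> x)) = (LINT y:\<phi> ` S|lborel. f y)"
proof -
  define g where "g = (\<lambda>y. to_real (\<phi> (from_real y)))"
  define g' where "g' = (\<lambda>y v. to_real (\<phi>' (from_real y) (from_real v)))"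
  define T where "T = (to_real ` S :: (real ^ 'n bit0) set)"
  have T: "T = from_real -` S"
    by (auto simp: T_def) (metis from_real_to_real image_iff to_real_from_real)
  then have T_borel: "T \<in> sets borel"
    using measurable_sets[OF measurable_from_real S] by simp
  then have T_leb: "T \<in> sets lebesgue" by simp
  have dg: "(g has_derivative g' y) (at y within T)" if "y \<in> T" for y
  proof -
    have "from_real y \<in> S" using that by (simp add: T)
    then have "((\<phi> \<circ> from_real) has_derivative (\<phi>' (from_real y) \<circ> from_real)) (at y)"
      by (intro diff_chain_at bounded_linear_imp_has_derivative[OF bounded_linear_from_real] der)
    from bounded_linear.has_derivative[OF bounded_linear_to_real this]
    have "((\<lambda>y. to_real (\<phi> (from_real y))) has_derivative (\<lambda>v. to_real (\<phi>' (from_real y) (from_real v)))) (at y)"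
      by (simp add: o_def)
    then show ?thesis unfolding g_def g'_def by (rule has_derivative_at_withinI)
  qed
  have inj_g: "inj_on g T"
  proof (rule inj_onI)
    fix x y assume "x \<in> T" "y \<in> T" "g x = g y"
    then have "\<phi> (from_real x) = \<phi> (from_real y)" by (metis from_real_to_real g_def)
    then have "from_real x = from_real y" using inj \<open>x \<in> T\<close> \<open>y \<in> T\<close> by (auto simp: T inj_on_def)
    then show "x = y" by (metis to_real_from_real)
  qed
  have gT: "g ` T = to_real ` (\<phi> ` S)"
    by (simp add: T_def image_image g_def)
  have J: "\<bar>det (matrix (g' y))\<bar> = J (\<phi>' (from_real y))" for y
  proof -
    \<comment> \<open>\<open>frame_matrix\<close> stores the images of the frame as rows,
      \<open>matrix\<close> as columns; the determinant does not see the difference.\<close>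
    have "matrix (g' y) = transpose (frame_matrix complex_frame (map (\<phi>' (from_real y)) complex_frame))"
      by (simp add: matrix_def g'_def to_real_def transpose_def frame_matrix_def vec_eq_iff from_real_axis
          length_complex_frame bidx_less[of "_ :: 'n bit0", simplified])
    then show ?thesis by (simp add: J_def)
  qed
  have meas: "set_borel_measurable borel (to_real ` A) (\<lambda>y. h (from_real y))"
    if "set_borel_measurable borel A h" for A and h :: "complex ^ 'n \<Rightarrow> 'b"
  proof -
    have ind: "indicat_real (to_real ` A) y = indicat_real A (from_real y)" for y
      by (auto simp: indicator_def) (metis from_real_to_real image_iff to_real_from_real)+
    show ?thesis
      using measurable_compose[OF measurable_from_real that[unfolded set_borel_measurable_def]]
      by (simp add: set_borel_measurable_def ind)
  qed
  note i1 = set_integral_from_real[OF m1] and i2 = set_integral_from_real[OF m2]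
  note l1 = set_integrable_lebesgue_lborel[OF meas[OF m1]] and l2 = set_integrable_lebesgue_lborel[OF meas[OF m2]]
  note cv = change_of_variables_cart[OF T_leb dg inj_g, of "\<lambda>y. f (from_real y)", unfolded gT J]
  have eq: "\<phi> (from_real y) = from_real (g y)" for y by (simp add: g_def)
  show iff: "set_integrable lborel S (\<lambda>x. J (\<phi>' x) *\<^sub>R f (\<phi> x)) \<longleftrightarrow> set_integrable lborel (\<phi> ` S) f"
    using i1(1) i2(1) l1(1) l2(1) cv(1) by (simp add: T_def[symmetric] eq)
  show "(LINT x:S|lborel. J (\<phi>' x) *\<^sub>R f (\<phi> x)) = (LINT y:\<phi> ` S|lborel. f y)" if "set_integrable lborel (\<phi> ` S) f"
  proof -
    have a: "set_integrable lborel (to_real ` \<phi> ` S) (\<lambda>y. f (from_real y))" using that i1(1) by simp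
    have b: "set_integrable lborel (to_real ` S) (\<lambda>y. J (\<phi>' (from_real y)) *\<^sub>R f (\<phi> (from_real y)))"
      using that iff i2(1) by simp
    show ?thesis
      unfolding i1(2) i2(2) l1(2)[OF a] l2(2)[OF b]
      using cv(2) a l1(1) by (simp add: T_def[symmetric] eq)
  qed
qed

section \<open>Integration on a compact complex manifold\<close>

definition jac_det :: "('x, 'n::finite) atlas \<Rightarrow> nat \<Rightarrow> nat \<Rightarrow> 'x \<Rightarrow> real" where
  "jac_det X i j x =
     det (frame_matrix complex_frame (map (chart_deriv X i (coord X j) x) complex_frame) :: real ^ 'n bit0 ^ 'n bit0)"

text \<open>\<open>F i x\<close> stands for the value of a top-degree form on
  \<open>complex_frame\<close> in chart \<open>i\<close>. The absolute Jacobian separates the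
  measure theory from orientation, which \<open>jac_det_pos\<close> supplies afterwards.\<close>

definition chart_density :: "('x::topological_space, 'n::finite) atlas \<Rightarrow> (nat \<Rightarrow> 'x \<Rightarrow> 'b::euclidean_space) \<Rightarrow> bool" where
  "chart_density X F \<longleftrightarrow> (\<forall>i<charts X. continuous_on (dom X i) (F i)) \<and>
     (\<forall>i<charts X. \<forall>j<charts X. \<forall>x\<in>dom X i \<inter> dom X j. F i x = \<bar>jac_det X i j x\<bar> *\<^sub>R F j x)"

definition chart_integral :: "('x, 'n::finite) atlas \<Rightarrow> (nat \<Rightarrow> 'x \<Rightarrow> 'b::euclidean_space) \<Rightarrow> nat \<Rightarrow> 'x set \<Rightarrow> 'b" where
  "chart_integral X F i E = (LINT z:coord X i ` E|lborel. F i (param X i z))"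

definition density_integral :: "('x, 'n::finite) atlas \<Rightarrow> (nat \<Rightarrow> 'x \<Rightarrow> 'b::euclidean_space) \<Rightarrow> 'b" where
  "density_integral X F = (\<Sum>i<charts X. chart_integral X F i (disjointed (dom X) i))"

lemma form_integral_eq_density_integral:
  "form_integral X \<alpha> = density_integral X (\<lambda>i x. \<alpha> i x complex_frame)"
  by (simp add: form_integral_def density_integral_def chart_integral_def)

lemma set_borel_measurable_continuous:
  fixes f :: "'a::topological_space \<Rightarrow> 'b::real_normed_vector"
  shows "S \<in> sets borel \<Longrightarrow> continuous_on S f \<Longrightarrow> set_borel_measurable borel S f"
  unfolding set_borel_measurable_def by (rule borel_measurable_continuous_on_indicator)

locale cx_manifold =
  fixes X :: "('x::t2_space, 'n::finite) atlas"
  assumes manifold: "compact_complex_manifold X"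
begin

lemma chart_homeomorphism:
  assumes "i < charts X"
  shows "homeomorphism (dom X i) (coord X i ` dom X i) (coord X i) (param X i)"
  using manifold assms by (simp add: compact_complex_manifold_def)

lemma open_chart: "i < charts X \<Longrightarrow> open (dom X i)" "i < charts X \<Longrightarrow> open (coord X i ` dom X i)"
  using manifold by (auto simp: compact_complex_manifold_def)

lemma continuous_chart:
  "i < charts X \<Longrightarrow> continuous_on (dom X i) (coord X i)"
  "i < charts X \<Longrightarrow> continuous_on (coord X i ` dom X i) (param X i)"
  using chart_homeomorphism by (auto simp: homeomorphism_def)

lemma param_coord: "i < charts X \<Longrightarrow> x \<in> dom X i \<Longrightarrow> param X i (coord X i x) = x"
  using chart_homeomorphism by (auto simp: homeomorphism_def)

lemma coord_param: "i < charts X \<Longrightarrow> z \<in> coord X i ` dom X i \<Longrightarrow> coord X i (param X i z) = z"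
  by (auto simp: param_coord)

lemma param_image: "i < charts X \<Longrightarrow> S \<subseteq> dom X i \<Longrightarrow> z \<in> coord X i ` S \<Longrightarrow> param X i z \<in> S"
  using param_coord by auto

lemma coord_image_eq:
  "i < charts X \<Longrightarrow> S \<subseteq> dom X i \<Longrightarrow> coord X i ` S = param X i -` S \<inter> coord X i ` dom X i"
  using param_coord by (auto simp: image_iff)

lemma inj_on_coord: "i < charts X \<Longrightarrow> inj_on (coord X i) (dom X i)"
  by (metis inj_on_inverseI param_coord)

lemma charts_cover: obtains i where "i < charts X" "x \<in> dom X i"
proof -
  have "x \<in> (\<Union>i<charts X. dom X i)" using manifold by (simp add: compact_complex_manifold_def)
  then show ?thesis using that by auto
qed

lemma open_coord_image:
  assumes "i < charts X" "open W" "W \<subseteq> dom X i" shows "open (coord X i ` W)"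
  unfolding coord_image_eq[OF assms(1,3)]
  using continuous_open_preimage[OF continuous_chart(2)[OF assms(1)] open_chart(2)[OF assms(1)] assms(2)]
  by (simp add: Int_commute)

lemma open_overlap: "i < charts X \<Longrightarrow> j < charts X \<Longrightarrow> open (coord X i ` (dom X i \<inter> dom X j))"
  by (rule open_coord_image) (auto intro: open_chart)

lemma open_param_image:
  assumes "i < charts X" "open B" "B \<subseteq> coord X i ` dom X i" shows "open (param X i ` B)"
proof -
  have "param X i ` B = coord X i -` B \<inter> dom X i"
    using assms param_coord[OF assms(1)] by (auto simp: image_iff subset_iff) (metis)+
  then show ?thesis
    using continuous_open_preimage[OF continuous_chart(1)[OF assms(1)] open_chart(1)[OF assms(1)] assms(2)]
    by (simp add: Int_commute)
qed

lemma coord_param_image: "i < charts X \<Longrightarrow> B \<subseteq> coord X i ` dom X i \<Longrightarrow> coord X i ` param X i ` B = B"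
  using coord_param by (force simp: image_image subset_iff)

lemma borel_coord_image:
  assumes "i < charts X" "E \<in> sets borel" "E \<subseteq> dom X i" shows "coord X i ` E \<in> sets borel"
proof -
  let ?R = "restrict_space borel (coord X i ` dom X i)"
  have "param X i -` E \<inter> space ?R \<in> sets ?R"
    by (rule measurable_sets[OF borel_measurable_continuous_on_restrict[OF continuous_chart(2)[OF assms(1)]] assms(2)])
  then show ?thesis
    unfolding coord_image_eq[OF assms(1,3)]
    using open_chart(2)[OF assms(1)] by (simp add: sets_restrict_space_iff space_restrict_space)
qed

lemma Ck_on_transition:
  assumes "i < charts X" "j < charts X"
  shows "Ck_on k (coord X i ` (dom X i \<inter> dom X j)) (\<lambda>z. coord X j (param X i z))"
proof (rule Ck_on_vec_lambda[OF open_overlap[OF assms]])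
  fix a
  have "chart_holomorphic X i (dom X i \<inter> dom X j) (\<lambda>x. coord X j x $ a)"
    using manifold assms by (simp add: compact_complex_manifold_def)
  then show "Ck_on k (coord X i ` (dom X i \<inter> dom X j)) (\<lambda>x. coord X j (param X i x) $ a)"
    using smooth_on_Ck by (fastforce simp: chart_holomorphic_def chart_smooth_def o_def)
qed

lemma has_derivative_transition:
  assumes "i < charts X" "j < charts X" "x \<in> dom X i \<inter> dom X j"
  shows "((\<lambda>z. coord X j (param X i z)) has_derivative chart_deriv X i (coord X j) x) (at (coord X i x))"
proof -
  have "(\<lambda>z. coord X j (param X i z)) differentiable (at (coord X i x))"
    using Ck_on_transition[OF assms(1,2), of 1] assms(3) by simp
  from frechet_derivative_has_derivative[OF this] show ?thesis
    by (simp add: chart_deriv_def[abs_def] o_def)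
qed

lemma chart_deriv_chain:
  fixes f :: "'x \<Rightarrow> 'b::real_normed_vector"
  assumes "i < charts X" "j < charts X" "x \<in> dom X i \<inter> dom X j"
    and f: "(f \<circ> param X j) differentiable (at (coord X j x))"
  shows "chart_deriv X i f x v = chart_deriv X j f x (chart_deriv X i (coord X j) x v)"
    "(f \<circ> param X i) differentiable (at (coord X i x))"
proof -
  have x: "param X i (coord X i x) = x" using assms param_coord by auto
  let ?U = "coord X i ` (dom X i \<inter> dom X j)"
  have eq: "f (param X i z) = (f \<circ> param X j) (coord X j (param X i z))" if "z \<in> ?U" for z
    using that assms(1,2) by (auto simp: param_coord)
  note d = has_derivative_transition[OF assms(1-3)]
  have d1: "(\<lambda>z. coord X j (param X i z)) differentiable (at (coord X i x))"
    using d by (auto simp: differentiable_def)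
  have d2: "(f \<circ> param X j) differentiable (at (coord X j (param X i (coord X i x))))" using f by (simp add: x)
  have U: "open ?U" "coord X i x \<in> ?U" using open_overlap assms by auto
  show "chart_deriv X i f x v = chart_deriv X j f x (chart_deriv X i (coord X j) x v)"
    using frechet_derivative_cong_open[OF U, of "f \<circ> param X i" "\<lambda>z. (f \<circ> param X j) (coord X j (param X i z))"] eq
      frechet_derivative_compose(1)[OF d1 d2, of v]
    by (simp add: chart_deriv_def x o_def)
  show "(f \<circ> param X i) differentiable (at (coord X i x))"
    using differentiable_cong_open[OF U, of "f \<circ> param X i" "\<lambda>z. (f \<circ> param X j) (coord X j (param X i z))"] eq
      frechet_derivative_compose(2)[OF d1 d2] by (simp add: o_def)
qed

lemma continuous_on_chart_function:
  "i < charts X \<Longrightarrow> continuous_on (dom X i) f \<Longrightarrow> continuous_on (coord X i ` dom X i) (\<lambda>z. f (param X i z))"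
  by (rule continuous_on_compose2[OF _ continuous_chart(2)]) (auto simp: param_coord)

lemma measurable_chart_function:
  fixes f :: "'x \<Rightarrow> 'b::real_normed_vector"
  assumes "i < charts X" "continuous_on (dom X i) f" "E \<in> sets borel" "E \<subseteq> dom X i"
  shows "set_borel_measurable borel (coord X i ` E) (\<lambda>z. f (param X i z))"
  by (rule set_borel_measurable_continuous[OF borel_coord_image[OF assms(1,3,4)]])
     (rule continuous_on_subset[OF continuous_on_chart_function[OF assms(1,2)]], use assms in auto)

lemma density_continuous: "chart_density X F \<Longrightarrow> i < charts X \<Longrightarrow> continuous_on (dom X i) (F i)"
  unfolding chart_density_def by blast

lemma density_transform:
  "chart_density X F \<Longrightarrow> i < charts X \<Longrightarrow> j < charts X \<Longrightarrow> x \<in> dom X i \<Longrightarrow> x \<in> dom X j \<Longrightarrow>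
    F i x = \<bar>jac_det X i j x\<bar> *\<^sub>R F j x"
  unfolding chart_density_def by blast

lemma densityI:
  assumes "\<And>i. i < charts X \<Longrightarrow> continuous_on (dom X i) (F i)"
    "\<And>i j x. i < charts X \<Longrightarrow> j < charts X \<Longrightarrow> x \<in> dom X i \<Longrightarrow> x \<in> dom X j \<Longrightarrow>
      F i x = \<bar>jac_det X i j x\<bar> *\<^sub>R F j x"
  shows "chart_density X F"
  using assms unfolding chart_density_def by blast

lemma chart_change_of_variables:
  assumes F: "chart_density X F" and ij: "i < charts X" "j < charts X"
    and E: "E \<in> sets borel" "E \<subseteq> dom X i \<inter> dom X j"
  shows "set_integrable lborel (coord X i ` E) (\<lambda>z. F i (param X i z)) \<longleftrightarrow>
      set_integrable lborel (coord X j ` E) (\<lambda>z. F j (param X j z))"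
    "set_integrable lborel (coord X j ` E) (\<lambda>z. F j (param X j z)) \<Longrightarrow>
      chart_integral X F i E = chart_integral X F j E"
proof -
  let ?S = "coord X i ` E" and ?\<phi> = "\<lambda>z. coord X j (param X i z)" and ?f = "\<lambda>z. F j (param X j z)"
  let ?\<phi>' = "\<lambda>z. chart_deriv X i (coord X j) (param X i z)"
  let ?J = "\<lambda>L. \<bar>det (frame_matrix complex_frame (map L complex_frame) :: real ^ 'n bit0 ^ 'n bit0)\<bar>"
  have S: "?S \<in> sets borel" using borel_coord_image[OF ij(1) E(1)] E(2) by simp
  have img: "?\<phi> ` ?S = coord X j ` E"
    unfolding image_image using E(2) by (intro image_cong refl) (auto simp: param_coord[OF ij(1)])
  have eq: "F i (param X i z) = ?J (?\<phi>' z) *\<^sub>R ?f (?\<phi> z)" if "z \<in> ?S" for z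
  proof -
    from that obtain x where x: "z = coord X i x" "x \<in> dom X i \<inter> dom X j" using E(2) by blast
    then have px: "param X i z = x" "param X j (coord X j x) = x" using param_coord ij by auto
    have "F i x = \<bar>jac_det X i j x\<bar> *\<^sub>R F j x" using F x(2) ij unfolding chart_density_def by blast
    then show ?thesis unfolding jac_det_def by (simp only: px)
  qed
  have der: "(?\<phi> has_derivative ?\<phi>' z) (at z)" if "z \<in> ?S" for z
  proof -
    from that obtain x where x: "z = coord X i x" "x \<in> dom X i \<inter> dom X j" using E(2) by blast
    then have px: "param X i z = x" using param_coord ij by auto
    show ?thesis using has_derivative_transition[OF ij x(2)] unfolding px x(1)[symmetric] .
  qed
  have inj: "inj_on ?\<phi> ?S"
  proof (rule inj_onI)
    fix z w assume "z \<in> ?S" "w \<in> ?S" and eq: "coord X j (param X i z) = coord X j (param X i w)"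
    then obtain x y where x: "z = coord X i x" "x \<in> dom X i" "x \<in> dom X j"
      and y: "w = coord X i y" "y \<in> dom X i" "y \<in> dom X j" using E(2) by blast
    then have "coord X j x = coord X j y" using eq param_coord ij by simp
    then have "x = y" using inj_on_coord[OF ij(2)] x y by (simp add: inj_on_def)
    then show "z = w" using x y by simp
  qed
  have m1: "set_borel_measurable borel (?\<phi> ` ?S) ?f"
    unfolding img by (rule measurable_chart_function[OF ij(2) density_continuous[OF F ij(2)] E(1)]) (use E(2) in blast)
  have mi: "set_borel_measurable borel ?S (\<lambda>z. F i (param X i z))"
    by (rule measurable_chart_function[OF ij(1) density_continuous[OF F ij(1)] E(1)]) (use E(2) in blast)
  \<comment> \<open>The integrands agree only on \<open>?S\<close>; multiplied by the indicator they
    agree as functions, which is what the definitions of the set integrals contain.\<close>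
  have "(\<lambda>z. indicat_real ?S z *\<^sub>R F i (param X i z)) = (\<lambda>z. indicat_real ?S z *\<^sub>R (?J (?\<phi>' z) *\<^sub>R ?f (?\<phi> z)))"
  proof
    fix z
    show "indicat_real ?S z *\<^sub>R F i (param X i z) = indicat_real ?S z *\<^sub>R (?J (?\<phi>' z) *\<^sub>R ?f (?\<phi> z))"
      by (cases "z \<in> ?S") (simp only: eq, simp only: indicator_simps scaleR_zero_left not_False_eq_True)
  qed
  then have cong: "set_borel_measurable borel ?S (\<lambda>z. ?J (?\<phi>' z) *\<^sub>R ?f (?\<phi> z))"
    "set_integrable lborel ?S (\<lambda>z. F i (param X i z)) \<longleftrightarrow> set_integrable lborel ?S (\<lambda>z. ?J (?\<phi>' z) *\<^sub>R ?f (?\<phi> z))"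
    "(LINT z:?S|lborel. F i (param X i z)) = (LINT z:?S|lborel. ?J (?\<phi>' z) *\<^sub>R ?f (?\<phi> z))"
    using mi by (simp_all only: set_borel_measurable_def set_integrable_def set_lebesgue_integral_def)
  note cv = change_of_variables_complex[OF S der inj m1 cong(1), unfolded img]
  show "set_integrable lborel (coord X i ` E) (\<lambda>z. F i (param X i z)) \<longleftrightarrow>
      set_integrable lborel (coord X j ` E) (\<lambda>z. F j (param X j z))"
    using cong(2) cv(1) by blast
  show "chart_integral X F i E = chart_integral X F j E"
    if "set_integrable lborel (coord X j ` E) (\<lambda>z. F j (param X j z))"
    unfolding chart_integral_def cong(3) by (rule cv(2)[OF _ that])
qed

text \<open>The doubled radius leaves room for a cut-off that is 1 on the ball and still supported
  inside the chart. The balls also provide compact pieces on which densities are bounded.\<close>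

lemma finite_ball_cover:
  obtains P where "finite P" "\<And>m z r. (m, z, r) \<in> P \<Longrightarrow> m < charts X \<and> r > 0 \<and> cball z (2 * r) \<subseteq> coord X m ` dom X m"
    "\<And>x. \<exists>(m, z, r)\<in>P. x \<in> param X m ` ball z r"
proof -
  let ?Q = "{(m, z, r). m < charts X \<and> r > 0 \<and> cball z (2 * r) \<subseteq> coord X m ` dom X m}"
  let ?V = "\<lambda>(m, z, r). param X m ` ball z r"
  have compact: "compact (UNIV :: 'x set)" using manifold by (simp add: compact_complex_manifold_def)
  have op: "open (?V p)" if "p \<in> ?Q" for p
  proof -
    obtain m z r where p: "p = (m, z, r)" by (cases p)
    have "ball z r \<subseteq> cball z (2 * r)" using that p by (auto simp: subset_iff)
    then show ?thesis using that open_param_image[of m "ball z r"] by (auto simp: p)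
  qed
  have cov: "UNIV \<subseteq> (\<Union>p\<in>?Q. ?V p)"
  proof
    fix x :: 'x
    obtain m where m: "m < charts X" "x \<in> dom X m" by (rule charts_cover)
    then obtain e where e: "e > 0" "cball (coord X m x) e \<subseteq> coord X m ` dom X m"
      using open_chart(2) open_contains_cball by (metis imageI)
    have "(m, coord X m x, e / 2) \<in> ?Q" using m e by simp
    moreover have "x \<in> ?V (m, coord X m x, e / 2)"
      using e param_coord[OF m] by (auto simp: image_iff intro!: bexI[of _ "coord X m x"])
    ultimately show "x \<in> (\<Union>p\<in>?Q. ?V p)" by blast
  qed
  from compactE_image[OF compact op cov] obtain P where P: "P \<subseteq> ?Q" "finite P" "UNIV \<subseteq> (\<Union>p\<in>P. ?V p)" by blast
  show ?thesis
  proof (rule that[OF P(2)])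
    show "m < charts X \<and> r > 0 \<and> cball z (2 * r) \<subseteq> coord X m ` dom X m" if "(m, z, r) \<in> P" for m z r
      using that P(1) by auto
    show "\<exists>(m, z, r)\<in>P. x \<in> param X m ` ball z r" for x using P(3) by fastforce
  qed
qed

lemma compact_param_image:
  assumes "i < charts X" "compact K" "K \<subseteq> coord X i ` dom X i" shows "compact (param X i ` K)" "closed (param X i ` K)"
proof -
  show "compact (param X i ` K)"
    by (rule compact_continuous_image[OF continuous_on_subset[OF continuous_chart(2)[OF assms(1)] assms(3)] assms(2)])
  then show "closed (param X i ` K)" by (rule compact_imp_closed)
qed

text \<open>In its own chart \<open>F i\<close> may be unbounded near the edge of the coordinate
  image. Finitely many pieces of \<open>E\<close> lie in compact coordinate balls of other charts,
  where the integrand is bounded, and integrability is carried back by the change of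
  variables.\<close>

lemma density_integrable:
  assumes F: "chart_density X F" and i: "i < charts X" and E: "E \<in> sets borel" "E \<subseteq> dom X i"
  shows "set_integrable lborel (coord X i ` E) (\<lambda>z. F i (param X i z))"
proof -
  obtain P where P: "finite P" "\<And>m z r. (m, z, r) \<in> P \<Longrightarrow> m < charts X \<and> r > 0 \<and> cball z (2 * r) \<subseteq> coord X m ` dom X m"
    "\<And>x. \<exists>(m, z, r)\<in>P. x \<in> param X m ` ball z r" by (rule finite_ball_cover) blast
  define C where "C = (\<lambda>(m, z, r). E \<inter> param X m ` cball z r)"
  have C: "C p \<in> sets borel \<and> coord X i ` C p \<in> sets lborel \<and>
      set_integrable lborel (coord X i ` C p) (\<lambda>z. F i (param X i z))" if "p \<in> P" for p
  proof -
    obtain m z r where p: "p = (m, z, r)" by (cases p)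
    have m: "m < charts X" "r > 0" "cball z (2 * r) \<subseteq> coord X m ` dom X m" using P(2) that p by auto
    then have sub: "cball z r \<subseteq> coord X m ` dom X m" by (auto simp: subset_iff)
    have Cb: "C p \<in> sets borel"
      using compact_param_image(2)[OF m(1) compact_cball sub] E by (auto simp: C_def p)
    have Cm: "C p \<subseteq> dom X m" using sub param_image[OF m(1) order_refl] by (auto simp: C_def p)
    have "set_integrable lborel (cball z r) (\<lambda>z. F m (param X m z))"
      unfolding set_integrable_def
    proof (rule borel_integrable_compact[OF compact_cball])
      have "continuous_on (dom X m) (F m)" by (rule density_continuous[OF F m(1)])
      then show "continuous_on (cball z r) (\<lambda>z. F m (param X m z))"
        using continuous_on_chart_function[OF m(1)] sub continuous_on_subset by blast
    qed
    moreover have "coord X m ` C p \<subseteq> coord X m ` param X m ` cball z r"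
      unfolding C_def p by (intro image_mono) simp
    then have "coord X m ` C p \<subseteq> cball z r" unfolding coord_param_image[OF m(1) sub] .
    moreover have "coord X m ` C p \<in> sets lborel" using borel_coord_image[OF m(1) Cb Cm] by simp
    ultimately have "set_integrable lborel (coord X m ` C p) (\<lambda>z. F m (param X m z))"
      by (intro set_integrable_subset[of lborel "cball z r" _ "coord X m ` C p"])
    moreover have Ci: "C p \<subseteq> dom X i" using E by (auto simp: C_def p)
    ultimately have "set_integrable lborel (coord X i ` C p) (\<lambda>z. F i (param X i z))"
      using chart_change_of_variables(1)[OF F i m(1) Cb] Cm by blast
    then show ?thesis
      using borel_coord_image[OF i Cb Ci] Cb by simp
  qed
  have "E = (\<Union>p\<in>P. C p)"
  proof
    show "E \<subseteq> (\<Union>p\<in>P. C p)"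
    proof
      fix x assume "x \<in> E"
      obtain m z r where "(m, z, r) \<in> P" "x \<in> param X m ` ball z r" using P(3)[of x] by auto
      then show "x \<in> (\<Union>p\<in>P. C p)"
        using \<open>x \<in> E\<close> by (intro UN_I[of "(m, z, r)"]) (auto simp: C_def)
    qed
  qed (auto simp: C_def)
  then have "coord X i ` E = (\<Union>p\<in>P. coord X i ` C p)" by blast
  moreover have "set_integrable lborel (\<Union>p\<in>P. coord X i ` C p) (\<lambda>z. F i (param X i z))"
    by (rule set_integrable_UN[OF P(1)]) (use C in blast)+
  ultimately show ?thesis by simp
qed

lemma borel_disjointed:
  assumes "i < charts X"
  shows "disjointed (dom X) i \<in> sets borel" "disjointed (dom X) i \<subseteq> dom X i"
proof -
  have "dom X k \<in> sets borel" if "k \<le> i" for k using open_chart(1)[of k] that assms by auto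
  then have "dom X i - (\<Union>k\<in>{0..<i}. dom X k) \<in> sets borel"
    by (intro sets.Diff sets.finite_UN) auto
  then show "disjointed (dom X) i \<in> sets borel" by (simp add: disjointed_def)
qed (auto simp: disjointed_def)

lemma UN_disjointed_charts: "(\<Union>i<charts X. disjointed (dom X) i) = UNIV"
proof -
  have "(\<Union>i<charts X. disjointed (dom X) i) = (\<Union>i<charts X. dom X i)"
    using finite_UN_disjointed_eq[of "dom X" "charts X"] by (simp add: lessThan_atLeast0)
  then show ?thesis using manifold by (simp add: compact_complex_manifold_def)
qed

text \<open>All pieces are carried into the fixed chart \<open>m\<close>, where they are disjoint
  with union \<open>E\<close>. This frees the integral from the order of the charts that enters
  \<open>disjointed\<close>.\<close>

lemma density_integral_eq_sum_in_chart:
  assumes F: "chart_density X F" and m: "m < charts X" and E: "E \<in> sets borel" "E \<subseteq> dom X m"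
  shows "chart_integral X F m E = (\<Sum>i<charts X. chart_integral X F i (disjointed (dom X) i \<inter> E))"
proof -
  have D: "disjointed (dom X) i \<inter> E \<in> sets borel" "disjointed (dom X) i \<inter> E \<subseteq> dom X i \<inter> dom X m" if "i < charts X" for i
    using borel_disjointed[OF that] E by auto
  have "chart_integral X F i (disjointed (dom X) i \<inter> E) = chart_integral X F m (disjointed (dom X) i \<inter> E)" if "i < charts X" for i
    using D[OF that] by (intro chart_change_of_variables(2)[OF F that m] density_integrable[OF F m]) auto
  then have "(\<Sum>i<charts X. chart_integral X F i (disjointed (dom X) i \<inter> E)) =
      (\<Sum>i<charts X. integral\<^sup>L lborel (\<lambda>z. indicat_real (coord X m ` (disjointed (dom X) i \<inter> E)) z *\<^sub>R F m (param X m z)))"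
    by (simp add: chart_integral_def set_lebesgue_integral_def)
  also have "\<dots> = integral\<^sup>L lborel (\<lambda>z. \<Sum>i<charts X. indicat_real (coord X m ` (disjointed (dom X) i \<inter> E)) z *\<^sub>R F m (param X m z))"
  proof (rule Bochner_Integration.integral_sum[symmetric])
    fix i assume "i \<in> {..<charts X}"
    then have "i < charts X" by simp
    note Di = D[OF this]
    from Di(2) have "disjointed (dom X) i \<inter> E \<subseteq> dom X m" by blast
    from density_integrable[OF F m Di(1) this]
    show "integrable lborel (\<lambda>z. indicat_real (coord X m ` (disjointed (dom X) i \<inter> E)) z *\<^sub>R F m (param X m z))"
      by (simp only: set_integrable_def)
  qed
  also have "\<dots> = integral\<^sup>L lborel (\<lambda>z. indicat_real (coord X m ` E) z *\<^sub>R F m (param X m z))"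
  proof (intro Bochner_Integration.integral_cong refl)
    fix z
    have "indicat_real (\<Union>i<charts X. coord X m ` (disjointed (dom X) i \<inter> E)) z =
        (\<Sum>i<charts X. indicat_real (coord X m ` (disjointed (dom X) i \<inter> E)) z)"
    proof (rule indicator_UN_disjoint[OF finite_lessThan])
      have "disjoint_family_on (disjointed (dom X)) {..<charts X}"
        using disjoint_family_disjointed by (rule disjoint_family_on_mono[rotated]) auto
      then show "disjoint_family_on (\<lambda>i. coord X m ` (disjointed (dom X) i \<inter> E)) {..<charts X}"
        unfolding disjoint_family_on_def
      proof (intro ballI impI)
        fix i j assume ij: "i \<in> {..<charts X}" "j \<in> {..<charts X}" "i \<noteq> j"
          and "\<forall>i\<in>{..<charts X}. \<forall>j\<in>{..<charts X}. i \<noteq> j \<longrightarrow> disjointed (dom X) i \<inter> disjointed (dom X) j = {}"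
        then have "(disjointed (dom X) i \<inter> E) \<inter> (disjointed (dom X) j \<inter> E) = {}" by blast
        moreover have "coord X m ` ((disjointed (dom X) i \<inter> E) \<inter> (disjointed (dom X) j \<inter> E)) =
            coord X m ` (disjointed (dom X) i \<inter> E) \<inter> coord X m ` (disjointed (dom X) j \<inter> E)"
          by (rule inj_on_image_Int[OF inj_on_coord[OF m]]) (use E(2) in blast)+
        ultimately show "coord X m ` (disjointed (dom X) i \<inter> E) \<inter> coord X m ` (disjointed (dom X) j \<inter> E) = {}"
          by (simp only: image_empty)
      qed
    qed
    moreover have "(\<Union>i<charts X. coord X m ` (disjointed (dom X) i \<inter> E)) = coord X m ` E"
      using UN_disjointed_charts by blast
    ultimately show "(\<Sum>i<charts X. indicat_real (coord X m ` (disjointed (dom X) i \<inter> E)) z *\<^sub>R F m (param X m z)) =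
        indicat_real (coord X m ` E) z *\<^sub>R F m (param X m z)"
      by (simp only: scaleR_sum_left)
  qed
  finally show ?thesis by (simp add: chart_integral_def set_lebesgue_integral_def)
qed

text \<open>The density vanishes off \<open>dom X m\<close>, so every piece may be intersected with
  that domain and all of them reassembled in chart \<open>m\<close>.\<close>

lemma density_integral_supported:
  assumes F: "chart_density X F" and m: "m < charts X"
    and 0: "\<And>i x. i < charts X \<Longrightarrow> x \<in> dom X i \<Longrightarrow> x \<notin> dom X m \<Longrightarrow> F i x = 0"
  shows "density_integral X F = chart_integral X F m (dom X m)"
proof -
  have "chart_integral X F i (disjointed (dom X) i) = chart_integral X F i (disjointed (dom X) i \<inter> dom X m)"
    if i: "i < charts X" for i
    unfolding chart_integral_def set_lebesgue_integral_def
  proof (intro Bochner_Integration.integral_cong refl)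
    fix z
    note D = borel_disjointed(2)[OF i]
    consider "z \<in> coord X i ` (disjointed (dom X) i \<inter> dom X m)"
      | "z \<notin> coord X i ` disjointed (dom X) i" | x where "z = coord X i x" "x \<in> disjointed (dom X) i" "x \<notin> dom X m"
      by blast
    then show "indicat_real (coord X i ` disjointed (dom X) i) z *\<^sub>R F i (param X i z) =
        indicat_real (coord X i ` (disjointed (dom X) i \<inter> dom X m)) z *\<^sub>R F i (param X i z)"
    proof cases
      case 3
      then have "F i (param X i z) = 0" using D 0[OF i, of x] param_coord[OF i, of x] by auto
      then show ?thesis by simp
    next
      case 1
      then have "z \<in> coord X i ` disjointed (dom X) i" by blast
      with 1 show ?thesis by simp
    next
      case 2
      then have "z \<notin> coord X i ` (disjointed (dom X) i \<inter> dom X m)" by blast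
      with 2 show ?thesis by simp
    qed
  qed
  then have "density_integral X F = (\<Sum>i<charts X. chart_integral X F i (disjointed (dom X) i \<inter> dom X m))"
    by (simp add: density_integral_def)
  also have "\<dots> = chart_integral X F m (dom X m)"
    by (rule density_integral_eq_sum_in_chart[OF F m, symmetric]) (use open_chart(1)[OF m] in auto)
  finally show ?thesis .
qed

section \<open>Linearity and positivity of the integral over the manifold\<close>

lemma density_add:
  assumes "chart_density X F" "chart_density X G" shows "chart_density X (\<lambda>i x. F i x + G i x)"
proof (rule densityI)
  show "continuous_on (dom X i) (\<lambda>x. F i x + G i x)" if "i < charts X" for i
    by (intro continuous_on_add density_continuous assms that)
  show "F i x + G i x = \<bar>jac_det X i j x\<bar> *\<^sub>R (F j x + G j x)"
    if "i < charts X" "j < charts X" "x \<in> dom X i" "x \<in> dom X j" for i j x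
    unfolding scaleR_add_right using density_transform[OF assms(1) that] density_transform[OF assms(2) that] by (simp only:)
qed

lemma density_linear:
  assumes "bounded_linear L" "chart_density X F" shows "chart_density X (\<lambda>i x. L (F i x))"
proof (rule densityI)
  show "continuous_on (dom X i) (\<lambda>x. L (F i x))" if "i < charts X" for i
    by (rule bounded_linear.continuous_on[OF assms(1) density_continuous[OF assms(2) that]])
  show "L (F i x) = \<bar>jac_det X i j x\<bar> *\<^sub>R L (F j x)"
    if "i < charts X" "j < charts X" "x \<in> dom X i" "x \<in> dom X j" for i j x
    unfolding density_transform[OF assms(2) that] by (rule linear_scale[OF bounded_linear.linear[OF assms(1)]])
qed

lemma density_integral_add:
  assumes "chart_density X F" "chart_density X G"
  shows "density_integral X (\<lambda>i x. F i x + G i x) = density_integral X F + density_integral X G"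
  unfolding density_integral_def chart_integral_def sum.distrib[symmetric]
proof (intro sum.cong refl set_integral_add)
  fix i assume "i \<in> {..<charts X}"
  then have i: "i < charts X" by simp
  show "set_integrable lborel (coord X i ` disjointed (dom X) i) (\<lambda>z. F i (param X i z))"
    "set_integrable lborel (coord X i ` disjointed (dom X) i) (\<lambda>z. G i (param X i z))"
    by (rule density_integrable[OF assms(1) i borel_disjointed[OF i]] density_integrable[OF assms(2) i borel_disjointed[OF i]])+
qed

lemma density_integral_linear:
  assumes L: "bounded_linear L" and F: "chart_density X F"
  shows "density_integral X (\<lambda>i x. L (F i x)) = L (density_integral X F)"
proof -
  have "chart_integral X (\<lambda>i x. L (F i x)) i (disjointed (dom X) i) = L (chart_integral X F i (disjointed (dom X) i))"
    if "i < charts X" for i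
  proof -
    have "integrable lborel (\<lambda>z. indicat_real (coord X i ` disjointed (dom X) i) z *\<^sub>R F i (param X i z))"
      using density_integrable[OF F that borel_disjointed[OF that]] by (simp add: set_integrable_def)
    from integral_bounded_linear[OF L this] show ?thesis
      by (simp add: chart_integral_def set_lebesgue_integral_def linear_scale[OF bounded_linear.linear[OF L]])
  qed
  then show ?thesis
    by (simp add: density_integral_def linear_sum[OF bounded_linear.linear[OF L]])
qed

lemma chart_integral_nonneg:
  fixes F :: "nat \<Rightarrow> 'x \<Rightarrow> real"
  assumes "i < charts X" "E \<subseteq> dom X i" "\<And>x. x \<in> dom X i \<Longrightarrow> F i x \<ge> 0"
  shows "chart_integral X F i E \<ge> 0"
  unfolding chart_integral_def set_lebesgue_integral_def
  by (rule Bochner_Integration.integral_nonneg)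
    (use assms param_image[OF assms(1,2)] in \<open>auto simp: indicator_def zero_le_mult_iff subset_iff\<close>)

lemma chart_integral_mono_set:
  fixes F :: "nat \<Rightarrow> 'x \<Rightarrow> real"
  assumes F: "chart_density X F" and i: "i < charts X" and E: "D \<in> sets borel" "E \<in> sets borel" "D \<subseteq> E" "E \<subseteq> dom X i"
    and pos: "\<And>x. x \<in> dom X i \<Longrightarrow> F i x \<ge> 0"
  shows "chart_integral X F i D \<le> chart_integral X F i E"
  unfolding chart_integral_def set_lebesgue_integral_def
proof (rule integral_mono)
  show "integrable lborel (\<lambda>z. indicat_real (coord X i ` D) z *\<^sub>R F i (param X i z))"
    "integrable lborel (\<lambda>z. indicat_real (coord X i ` E) z *\<^sub>R F i (param X i z))"
    using density_integrable[OF F i] E by (auto simp: set_integrable_def)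
  fix z
  show "indicat_real (coord X i ` D) z *\<^sub>R F i (param X i z) \<le> indicat_real (coord X i ` E) z *\<^sub>R F i (param X i z)"
    using E pos param_image[OF i E(4)] by (auto simp: indicator_def subset_iff)
qed

lemma density_integral_nonneg:
  fixes F :: "nat \<Rightarrow> 'x \<Rightarrow> real"
  assumes "\<And>i x. i < charts X \<Longrightarrow> x \<in> dom X i \<Longrightarrow> F i x \<ge> 0"
  shows "density_integral X F \<ge> 0"
  unfolding density_integral_def
  by (intro sum_nonneg chart_integral_nonneg) (use assms borel_disjointed in auto)

text \<open>A positive value would persist on a small coordinate ball. The ball may be cut by
  several of the disjoint pieces, so its integral is first rewritten as a sum over them; each
  summand is then at most zero, although the ball has positive measure.\<close>

lemma density_integral_eq_0:
  fixes F :: "nat \<Rightarrow> 'x \<Rightarrow> real"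
  assumes F: "chart_density X F" and pos: "\<And>i x. i < charts X \<Longrightarrow> x \<in> dom X i \<Longrightarrow> F i x \<ge> 0"
    and 0: "density_integral X F = 0" and m: "m < charts X" "x \<in> dom X m"
  shows "F m x = 0"
proof (rule ccontr)
  assume "F m x \<noteq> 0"
  let ?f = "\<lambda>z. F m (param X m z)" and ?U = "coord X m ` dom X m"
  have cont: "continuous_on ?U ?f"
    by (rule continuous_on_chart_function[OF m(1) density_continuous[OF F m(1)]])
  have "open (?U \<inter> ?f -` {0<..})"
    using continuous_open_preimage[OF cont open_chart(2)[OF m(1)] open_greaterThan] .
  moreover have "coord X m x \<in> ?U \<inter> ?f -` {0<..}"
    using m pos[OF m] \<open>F m x \<noteq> 0\<close> by (simp add: param_coord)
  ultimately obtain r where r: "r > 0" "ball (coord X m x) r \<subseteq> ?U \<inter> ?f -` {0<..}"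
    by (meson openE)
  let ?B = "ball (coord X m x) r"
  define W where "W = param X m ` ?B"
  have BU: "?B \<subseteq> ?U" using r by auto
  have W: "W \<in> sets borel" "W \<subseteq> dom X m" "coord X m ` W = ?B"
    using open_param_image[OF m(1) open_ball BU] param_image[OF m(1) order_refl] BU coord_param_image[OF m(1) BU]
    by (auto simp: W_def)
  have "chart_integral X F i (disjointed (dom X) i) = 0" if "i < charts X" for i
  proof -
    have nn: "chart_integral X F k (disjointed (dom X) k) \<ge> 0" if "k \<in> {..<charts X}" for k
      by (rule chart_integral_nonneg) (use that pos borel_disjointed in auto)
    have "(\<Sum>k<charts X. chart_integral X F k (disjointed (dom X) k)) = 0"
      using 0 by (simp add: density_integral_def)
    then show ?thesis using that nn by (subst (asm) sum_nonneg_eq_0_iff) auto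
  qed
  then have "chart_integral X F i (disjointed (dom X) i \<inter> W) \<le> 0" if "i < charts X" for i
    using chart_integral_mono_set[OF F that, of "disjointed (dom X) i \<inter> W" "disjointed (dom X) i"]
      borel_disjointed[OF that] W pos that by auto
  then have "chart_integral X F m W \<le> 0"
    unfolding density_integral_eq_sum_in_chart[OF F m(1) W(1,2)] by (intro sum_nonpos) auto
  moreover have "chart_integral X F m W \<ge> 0"
    by (rule chart_integral_nonneg) (use W m pos in auto)
  ultimately have I0: "(LINT z|lborel. indicat_real ?B z *\<^sub>R ?f z) = 0"
    by (simp add: chart_integral_def set_lebesgue_integral_def W(3))
  have "integrable lborel (\<lambda>z. indicat_real ?B z *\<^sub>R ?f z)"
    using density_integrable[OF F m(1) W(1,2)] by (simp add: set_integrable_def W(3))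
  moreover have "indicat_real ?B z *\<^sub>R ?f z \<ge> 0" for z using r by (auto simp: indicator_def)
  ultimately have "AE z in lborel. indicat_real ?B z *\<^sub>R ?f z = 0"
    using I0 integral_nonneg_eq_0_iff_AE[of lborel "\<lambda>z. indicat_real ?B z *\<^sub>R ?f z"] by simp
  then have "AE z in lborel. z \<notin> ?B"
    by eventually_elim (use r in \<open>auto simp: indicator_def split: if_splits\<close>)
  then have "emeasure lborel ?B = 0"
    by (subst (asm) AE_iff_measurable[where N = ?B]) auto
  moreover have "emeasure lborel ?B \<noteq> 0"
    using r(1) open_not_negligible[of ?B] negligible_iff_emeasure0[of ?B] by auto
  ultimately show False by simp
qed

end

section \<open>Cut-off functions\<close>

lemma Ck_on_Un:
  assumes "open S" "open T" "Ck_on k S f" "Ck_on k T f"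
  shows "Ck_on k (S \<union> T) f"
  using assms(3,4)
proof (induction k arbitrary: f)
  case 0
  then show ?case using continuous_on_open_Un[OF assms(1,2)] by simp
next
  case (Suc k)
  then show ?case by (simp add: ball_Un)
qed

lemma has_derivative_max_power:
  "((\<lambda>s::real. max 0 s ^ Suc (Suc n)) has_real_derivative (real (n + 2) * max 0 s ^ Suc n)) (at s)"
proof -
  consider "s > 0" | "s < 0" | "s = 0" by linarith
  then show ?thesis
  proof cases
    case 1
    have "((\<lambda>s::real. s ^ Suc (Suc n)) has_real_derivative (real (n + 2) * s ^ Suc n)) (at s)"
      using DERIV_pow[of "Suc (Suc n)" s] by simp
    then have "((\<lambda>s::real. max 0 s ^ Suc (Suc n)) has_real_derivative (real (n + 2) * s ^ Suc n)) (at s)"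
      by (rule has_field_derivative_transform_within_open[of _ _ _ "{0<..}"]) (use 1 in auto)
    then show ?thesis using 1 by simp
  next
    case 2
    have "((\<lambda>s::real. 0 :: real) has_real_derivative 0) (at s)" by simp
    then have "((\<lambda>s::real. max 0 s ^ Suc (Suc n)) has_real_derivative 0) (at s)"
      by (rule has_field_derivative_transform_within_open[of _ _ _ "{..<0}"]) (use 2 in auto)
    then show ?thesis using 2 by simp
  next
    case 3
    have "((\<lambda>h::real. max 0 h ^ Suc n) \<longlongrightarrow> max 0 0 ^ Suc n) (at 0)"
      by (intro tendsto_intros)
    then have "((\<lambda>h::real. max 0 h ^ Suc n) \<longlongrightarrow> 0) (at 0)" by simp
    then have "((\<lambda>h::real. max 0 h ^ Suc (Suc n) / h) \<longlongrightarrow> 0) (at 0)"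
      by (rule Lim_transform_eventually) (auto simp: eventually_at_filter max_def intro!: always_eventually)
    then show ?thesis using 3 by (simp add: DERIV_def)
  qed
qed

text \<open>The elementary substitute for exp(-1/s): vanishing to order k + 1 at 0 glues the two
  halves to a map of class Ck.\<close>

lemma Ck_on_max_power: "Ck_on k UNIV (\<lambda>s::real. max 0 s ^ Suc k)"
proof (induction k)
  case 0
  show ?case by (auto intro!: continuous_intros)
next
  case (Suc k)
  have D: "((\<lambda>s::real. max 0 s ^ Suc (Suc k)) has_derivative (\<lambda>v. (real (k + 2) * max 0 s ^ Suc k) * v)) (at s)" for s
    using has_derivative_max_power[of k s] unfolding has_field_derivative_def .
  have "Ck_on k UNIV (\<lambda>s. (real (k + 2) * max 0 s ^ Suc k) * v)" for v
    using Suc by (intro Ck_on_mult Ck_on_const open_UNIV)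
  then have "Ck_on k UNIV (\<lambda>s. frechet_derivative (\<lambda>s::real. max 0 s ^ Suc (Suc k)) (at s) v)" for v
    unfolding frechet_derivative_eqI[OF D] .
  then show ?case using D unfolding Ck_on.simps(2) differentiable_def by blast
qed

lemma bump_function_exists:
  fixes z :: "'a::euclidean_space"
  assumes "r > 0"
  obtains \<theta> :: "'a \<Rightarrow> real" where "Ck_on 2 UNIV \<theta>" "\<And>y. y \<in> ball z r \<Longrightarrow> \<theta> y = 1" "\<And>y. y \<notin> cball z (2 * r) \<Longrightarrow> \<theta> y = 0"
proof
  define w where "w = (\<lambda>s::real. max 0 s ^ 3)"
  \<comment> \<open>On the inner ball \<open>4 * r\<^sup>2\<close> minus the squared distance is at
    least \<open>3 * r\<^sup>2\<close>, so \<open>c\<close> lifts the inner \<open>w\<close> to at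
    least 1 and the outer \<open>w\<close> vanishes. Beyond radius 2r the inner \<open>w\<close>
    vanishes and the outer one is \<open>w 1 = 1\<close>.\<close>
  define c where "c = 1 / (3 * r\<^sup>2) ^ 3"
  let ?\<theta> = "\<lambda>y. 1 - w (1 - c * w (4 * r\<^sup>2 - (y - z) \<bullet> (y - z)))"
  have w: "Ck_on 2 UNIV w" using Ck_on_max_power[of 2] by (simp add: w_def numeral_3_eq_3 numeral_2_eq_2)
  have "Ck_on 2 UNIV (\<lambda>y::'a. (y - z) \<bullet> (y - z))"
    by (rule Ck_on_bilinear[OF open_UNIV bounded_bilinear_inner]) (rule Ck_on_diff[OF open_UNIV Ck_on_id Ck_on_const])+
  then have "Ck_on 2 UNIV (\<lambda>y. 4 * r\<^sup>2 - (y - z) \<bullet> (y - z))"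
    by (rule Ck_on_diff[OF open_UNIV Ck_on_const])
  then have "Ck_on 2 UNIV (\<lambda>y. w (4 * r\<^sup>2 - (y - z) \<bullet> (y - z)))"
    by (rule Ck_on_compose[OF open_UNIV _ w]) simp
  then have "Ck_on 2 UNIV (\<lambda>y. 1 - c * w (4 * r\<^sup>2 - (y - z) \<bullet> (y - z)))"
    by (intro Ck_on_diff Ck_on_mult Ck_on_const open_UNIV)
  then have "Ck_on 2 UNIV (\<lambda>y. w (1 - c * w (4 * r\<^sup>2 - (y - z) \<bullet> (y - z))))"
    by (rule Ck_on_compose[OF open_UNIV _ w]) simp
  then show "Ck_on 2 UNIV ?\<theta>" by (rule Ck_on_diff[OF open_UNIV Ck_on_const])
  show "?\<theta> y = 1" if "y \<in> ball z r" for y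
  proof -
    have "norm (y - z) < r" using that by (simp add: dist_norm norm_minus_commute)
    then have "(y - z) \<bullet> (y - z) \<le> r\<^sup>2"
      using power_mono[of "norm (y - z)" r 2] by (simp add: power2_norm_eq_inner)
    then have "3 * r\<^sup>2 \<le> 4 * r\<^sup>2 - (y - z) \<bullet> (y - z)" by simp
    then have "(3 * r\<^sup>2) ^ 3 \<le> w (4 * r\<^sup>2 - (y - z) \<bullet> (y - z))"
      unfolding w_def by (intro power_mono) auto
    then have "1 \<le> c * w (4 * r\<^sup>2 - (y - z) \<bullet> (y - z))"
      using assms by (simp add: c_def field_simps)
    then show ?thesis by (simp add: w_def)
  qed
  show "?\<theta> y = 0" if "y \<notin> cball z (2 * r)" for y
  proof -
    have "norm (y - z) > 2 * r" using that by (simp add: dist_norm norm_minus_commute)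
    then have "(y - z) \<bullet> (y - z) \<ge> (2 * r)\<^sup>2"
      using power_mono[of "2 * r" "norm (y - z)" 2] assms by (simp add: power2_norm_eq_inner)
    then show ?thesis by (simp add: w_def power2_eq_square)
  qed
qed

section \<open>Curvature and changes of frame\<close>

definition curv :: "('v::euclidean_space \<Rightarrow> 'v \<Rightarrow> complex ^ 'r ^ 'r) \<Rightarrow> 'v \<Rightarrow> 'v \<Rightarrow> 'v \<Rightarrow> complex ^ 'r ^ ('r::finite)" where
  "curv A z v w = frechet_derivative (\<lambda>z. A z w) (at z) v - frechet_derivative (\<lambda>z. A z v) (at z) w
     + (A z v ** A z w - A z w ** A z v)"

lemmas matrix_bilinear =
  bilinear_ladd[OF bilinear_matrix_mult] bilinear_radd[OF bilinear_matrix_mult]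
  bilinear_lsub[OF bilinear_matrix_mult] bilinear_rsub[OF bilinear_matrix_mult]

lemma frechet_derivative_linear_param:
  fixes C :: "'a::real_normed_vector \<Rightarrow> 'b::euclidean_space \<Rightarrow> 'c::real_normed_vector"
  assumes "open V" "y \<in> V" "\<And>y. y \<in> V \<Longrightarrow> linear (C y)"
    and d: "\<And>b. b \<in> Basis \<Longrightarrow> (\<lambda>y. C y b) differentiable (at y)"
  shows "frechet_derivative (\<lambda>y. C y u) (at y) w = (\<Sum>b\<in>Basis. (u \<bullet> b) *\<^sub>R frechet_derivative (\<lambda>y. C y b) (at y) w)"
    "(\<lambda>y. C y u) differentiable (at y)"
proof -
  have "((\<lambda>y. \<Sum>b\<in>Basis. (u \<bullet> b) *\<^sub>R C y b) has_derivative
      (\<lambda>w. \<Sum>b\<in>Basis. (u \<bullet> b) *\<^sub>R frechet_derivative (\<lambda>y. C y b) (at y) w)) (at y)"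
    by (intro has_derivative_sum has_derivative_scaleR_right frechet_derivative_has_derivative d)
  then have "((\<lambda>y. C y u) has_derivative (\<lambda>w. \<Sum>b\<in>Basis. (u \<bullet> b) *\<^sub>R frechet_derivative (\<lambda>y. C y b) (at y) w)) (at y)"
    by (rule has_derivative_transform_within_open[OF _ assms(1,2)]) (rule linear_eq_sum_Basis[OF assms(3), symmetric])
  then show "frechet_derivative (\<lambda>y. C y u) (at y) w = (\<Sum>b\<in>Basis. (u \<bullet> b) *\<^sub>R frechet_derivative (\<lambda>y. C y b) (at y) w)"
    "(\<lambda>y. C y u) differentiable (at y)"
    by (auto simp: frechet_derivative_eqI differentiable_def)
qed

text \<open>Differentiate the transformation law in a second direction and antisymmetrise. The
  second derivatives of \<open>G\<close> and \<open>\<phi>\<close> are symmetric and drop out; the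
  remaining first derivatives of \<open>G\<close> are eliminated by the law itself.\<close>

lemma curvature_gauge_transform:
  fixes A C :: "'v::euclidean_space \<Rightarrow> 'v \<Rightarrow> complex ^ 'r ^ 'r::finite" and G :: "'v \<Rightarrow> complex ^ 'r ^ 'r" and \<phi> :: "'v \<Rightarrow> 'v"
  assumes U: "open U" and V: "open V" "\<phi> ` U \<subseteq> V" and \<phi>: "Ck_on 2 U \<phi>" and G: "Ck_on 2 U G"
    and A: "\<And>v. Ck_on 1 U (\<lambda>z. A z v)" and C: "\<And>v. Ck_on 1 V (\<lambda>y. C y v)" "\<And>y. y \<in> V \<Longrightarrow> linear (C y)"
    and law: "\<And>z v. z \<in> U \<Longrightarrow> G z ** C (\<phi> z) (frechet_derivative \<phi> (at z) v) = A z v ** G z + frechet_derivative G (at z) v"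
    and z: "z \<in> U"
  shows "G z ** curv C (\<phi> z) (frechet_derivative \<phi> (at z) v) (frechet_derivative \<phi> (at z) w) = curv A z v w ** G z"
proof -
  let ?d = "\<lambda>f v z. frechet_derivative f (at z) v"
  have d\<phi>: "\<phi> differentiable (at z)" "(\<lambda>z. ?d \<phi> v z) differentiable (at z)" for v
    using \<phi> z by (auto simp: numeral_2_eq_2)
  have dG: "G differentiable (at z)" "(\<lambda>z. ?d G v z) differentiable (at z)" for v
    using G z by (auto simp: numeral_2_eq_2)
  have dA: "(\<lambda>z. A z v) differentiable (at z)" for v using A[of v] z by simp
  have \<phi>z: "\<phi> z \<in> V" using V(2) z by auto
  have dC: "(\<lambda>y. C y v) differentiable (at (\<phi> z))" for v using C(1)[of v] \<phi>z by simp
  have dC\<phi>: "(\<lambda>z. C (\<phi> z) b) differentiable (at z)" for b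
    by (rule frechet_derivative_compose(2)[OF d\<phi>(1) dC])
  define c where "c = (\<lambda>v z. C (\<phi> z) (?d \<phi> v z))"
  \<comment> \<open>The derivative of \<open>c v\<close> in direction \<open>w\<close>; both the
    point and the vector argument of \<open>C\<close> move with \<open>z\<close>.\<close>
  define D where "D = (\<lambda>v w. C (\<phi> z) (?d (\<lambda>z. ?d \<phi> v z) w z) + ?d (\<lambda>y. C y (?d \<phi> v z)) (?d \<phi> w z) (\<phi> z))"
  have dc: "(c v has_derivative (\<lambda>w. D v w)) (at z)" for v
  proof -
    have "((\<lambda>z. \<Sum>b\<in>Basis. (?d \<phi> v z \<bullet> b) *\<^sub>R C (\<phi> z) b) has_derivative
        (\<lambda>w. \<Sum>b\<in>Basis. (?d \<phi> v z \<bullet> b) *\<^sub>R ?d (\<lambda>z. C (\<phi> z) b) w z + (?d (\<lambda>z. ?d \<phi> v z) w z \<bullet> b) *\<^sub>R C (\<phi> z) b)) (at z)"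
      by (intro has_derivative_sum has_derivative_scaleR has_derivative_inner_left
          frechet_derivative_has_derivative d\<phi> dC\<phi>)
    moreover have "(\<Sum>b\<in>Basis. (?d \<phi> v z \<bullet> b) *\<^sub>R ?d (\<lambda>z. C (\<phi> z) b) w z + (?d (\<lambda>z. ?d \<phi> v z) w z \<bullet> b) *\<^sub>R C (\<phi> z) b) = D v w" for w
    proof -
      have "?d (\<lambda>y. C y (?d \<phi> v z)) (?d \<phi> w z) (\<phi> z) =
          (\<Sum>b\<in>Basis. (?d \<phi> v z \<bullet> b) *\<^sub>R ?d (\<lambda>z. C (\<phi> z) b) w z)"
        unfolding frechet_derivative_compose(1)[OF d\<phi>(1) dC]
        by (rule frechet_derivative_linear_param(1)[OF V(1) \<phi>z C(2) dC])
      moreover have "C (\<phi> z) (?d (\<lambda>z. ?d \<phi> v z) w z) = (\<Sum>b\<in>Basis. (?d (\<lambda>z. ?d \<phi> v z) w z \<bullet> b) *\<^sub>R C (\<phi> z) b)"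
        by (rule linear_eq_sum_Basis[OF C(2)[OF \<phi>z]])
      ultimately show ?thesis unfolding D_def sum.distrib by (simp only: add.commute)
    qed
    ultimately have "((\<lambda>z. \<Sum>b\<in>Basis. (?d \<phi> v z \<bullet> b) *\<^sub>R C (\<phi> z) b) has_derivative (\<lambda>w. D v w)) (at z)"
      by (simp only:)
    then show ?thesis
    proof (rule has_derivative_transform_within_open[OF _ U z])
      show "(\<Sum>b\<in>Basis. (?d \<phi> v z \<bullet> b) *\<^sub>R C (\<phi> z) b) = c v z" if "z \<in> U" for z
        unfolding c_def by (rule linear_eq_sum_Basis[symmetric]) (use C(2) V(2) that in auto)
    qed
  qed
  have eq: "?d G w z ** c v z + G z ** D v w =
      ?d (\<lambda>z. A z v) w z ** G z + A z v ** ?d G w z + ?d (\<lambda>z. ?d G v z) w z" for v w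
  proof -
    note bm = bounded_bilinear_matrix_mult
    have 1: "((\<lambda>z. G z ** c v z) has_derivative (\<lambda>w. G z ** D v w + ?d G w z ** c v z)) (at z)"
      by (intro bounded_bilinear.FDERIV[OF bm] frechet_derivative_has_derivative dG dc)
    have 2: "((\<lambda>z. A z v ** G z + ?d G v z) has_derivative
        (\<lambda>w. (A z v ** ?d G w z + ?d (\<lambda>z. A z v) w z ** G z) + ?d (\<lambda>z. ?d G v z) w z)) (at z)"
      by (intro has_derivative_add bounded_bilinear.FDERIV[OF bm] frechet_derivative_has_derivative dG dA)
    have "((\<lambda>z. G z ** c v z) has_derivative
        (\<lambda>w. (A z v ** ?d G w z + ?d (\<lambda>z. A z v) w z ** G z) + ?d (\<lambda>z. ?d G v z) w z)) (at z)"
      by (rule has_derivative_transform_within_open[OF 2 U z]) (simp add: c_def law)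
    from has_derivative_unique[OF 1 this, THEN fun_cong, of w] show ?thesis by (simp add: add_ac)
  qed
  have sym: "?d (\<lambda>z. ?d G v z) w z = ?d (\<lambda>z. ?d G w z) v z" "?d (\<lambda>z. ?d \<phi> v z) w z = ?d (\<lambda>z. ?d \<phi> w z) v z" for v w
    by (rule frechet_derivative_commute[OF U z G], rule frechet_derivative_commute[OF U z \<phi>])
  have lawz: "?d G v z = G z ** c v z - A z v ** G z" for v
    using law[OF z, of v] by (simp add: c_def)
  have cC: "curv C (\<phi> z) (?d \<phi> v z) (?d \<phi> w z) = D w v - D v w + (c v z ** c w z - c w z ** c v z)"
    by (simp add: curv_def D_def c_def sym(2)[of v w])
  have e1: "G z ** D w v = ?d (\<lambda>z. A z w) v z ** G z + A z w ** ?d G v z + ?d (\<lambda>z. ?d G w z) v z - ?d G v z ** c w z"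
    using eq[of v w] by (simp add: algebra_simps)
  have e2: "G z ** D v w = ?d (\<lambda>z. A z v) w z ** G z + A z v ** ?d G w z + ?d (\<lambda>z. ?d G w z) v z - ?d G w z ** c v z"
    using eq[of w v] sym(1)[of v w] by (simp add: algebra_simps)
  show ?thesis
    unfolding cC matrix_bilinear e1 e2
    by (simp add: curv_def lawz matrix_bilinear matrix_mul_assoc)
qed

subsection \<open>Connections of class C2\<close>

text \<open>Interpolating between smooth connections with cut-off functions that are only twice
  differentiable leaves the smooth connections.\<close>

definition C2_connection ::
    "('x, 'n::finite) atlas \<Rightarrow> (nat \<Rightarrow> nat \<Rightarrow> 'x \<Rightarrow> complex ^ 'r ^ 'r::finite) \<Rightarrow> ('x, 'n, 'r) conn \<Rightarrow> bool" where
  "C2_connection X g A \<longleftrightarrow>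
     (\<forall>i<charts X.
        (\<forall>x\<in>dom X i. linear (A i x)) \<and>
        (\<forall>v. Ck_on 2 (coord X i ` dom X i) (\<lambda>z. A i (param X i z) v)) \<and>
        (\<forall>j<charts X. \<forall>x\<in>dom X i \<inter> dom X j. \<forall>v.
           g i j x ** A j x (chart_deriv X i (coord X j) x v) = A i x v ** g i j x + chart_deriv X i (g i j) x v))"

lemma connection_C2: "connection X g A \<Longrightarrow> C2_connection X g A"
  unfolding connection_def C2_connection_def chart_smooth_def o_def by (blast intro: smooth_on_Ck)

definition local_conn :: "('x, 'n::finite) atlas \<Rightarrow> ('x, 'n, 'r::finite) conn \<Rightarrow> nat \<Rightarrow> complex ^ 'n \<Rightarrow> complex ^ 'n \<Rightarrow> complex ^ 'r ^ 'r" where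
  "local_conn X A i z v = A i (param X i z) v"

lemma coef_conn_form:
  assumes "linear (A z)"
  shows "coef (conn_form A z) vs = (case vs of [v] \<Rightarrow> A z v | _ \<Rightarrow> 0)"
proof -
  have "coef (conn_form A z) vs = (\<Sum>b\<in>Basis. coef (covec b) vs ** A z b)"
    by (simp only: conn_form_def coef_sum coef_const_form_mult)
  also have "\<dots> = (case vs of [v] \<Rightarrow> (\<Sum>b\<in>Basis. (v \<bullet> b) *\<^sub>R A z b) | _ \<Rightarrow> 0)"
    by (simp add: covec_def scalar_form_def mat_of_real_mult linear_0[OF linear_mat] bilinear_lzero[OF bilinear_matrix_mult]
        split: list.splits)
  also have "\<dots> = (case vs of [v] \<Rightarrow> A z v | _ \<Rightarrow> 0)"
    using linear_eq_sum_Basis[OF assms, symmetric] by (simp only:)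
  finally show ?thesis .
qed

text \<open>With \<open>L\<close> the differential of a coordinate change this is the pullback at a
  point. It respects products, so transformation laws need to be checked on factors only.\<close>

definition gpull :: "('v \<Rightarrow> 'w) \<Rightarrow> ('w, 'r::finite) gform \<Rightarrow> ('v, 'r) gform" where
  "gpull L a = Gf (\<lambda>vs. coef a (map L vs))"

lemma gpull_mult: "gpull L (a * b) = gpull L a * gpull L b"
  by (rule gform_eqI) (simp add: gpull_def coef_simps wedge_map)

lemma gpull_power: "gpull L (a ^ k) = gpull L a ^ k"
proof (induction k)
  case 0
  show ?case by (rule gform_eqI) (simp add: gpull_def coef_simps)
next
  case (Suc k)
  then show ?case by (simp only: power_Suc gpull_mult)
qed

text \<open>Alternation as a predicate closed under the algebra operations; it permits comparing
  top-degree values on different frames.\<close>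

definition galt :: "('v::real_vector, 'r::finite) gform \<Rightarrow> bool" where
  "galt a \<longleftrightarrow> alternating_form (coef a)"

lemma galt_mult: "galt a \<Longrightarrow> galt b \<Longrightarrow> galt (a * b)"
  by (simp add: galt_def coef_simps wedge_alternating[OF bilinear_matrix_mult])

lemma galt_add: "galt a \<Longrightarrow> galt b \<Longrightarrow> galt (a + b)"
  unfolding galt_def using alternating_form_add[of "coef a" "coef b"] by (simp add: coef_simps[abs_def])

lemma galt_sum: "(\<And>i. i \<in> I \<Longrightarrow> galt (f i)) \<Longrightarrow> galt (\<Sum>i\<in>I. f i)"
  unfolding galt_def using alternating_form_sum[of I "\<lambda>i. coef (f i)"] by (simp add: coef_sum[abs_def])

lemma galt_const_form: "galt (const_form M)"
  by (simp add: galt_def const_form_def alternating_form_unit)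

lemma galt_power: "galt a \<Longrightarrow> galt (a ^ k)"
  unfolding galt_def coef_power by (rule wedge_power_alternating[OF bilinear_matrix_mult])

lemma galt_scaleR: "galt a \<Longrightarrow> galt (r *\<^sub>R a)"
  unfolding galt_def coef_simps[abs_def]
  by (rule alternating_form_compose_linear[of "\<lambda>M. r *\<^sub>R M"]) (auto intro!: linearI simp: algebra_simps)

lemma galt_scalar_form: "alternating_form c \<Longrightarrow> galt (scalar_form c)"
  unfolding galt_def scalar_form_def coef_Gf by (rule alternating_form_compose_linear[OF linear_mat])

lemma galt_covec: "galt (covec b)"
  unfolding covec_def
proof (rule galt_scalar_form, rule alternating_formI)
  fix us ws :: "'a list" and v
  let ?f = "\<lambda>vs. case vs of [v] \<Rightarrow> complex_of_real (v \<bullet> b) | _ \<Rightarrow> 0"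
  show "linear (\<lambda>v. ?f (us @ v # ws))"
  proof (cases "us = [] \<and> ws = []")
    case True
    then show ?thesis by (auto intro!: linearI simp: inner_add_left scaleR_conv_of_real)
  next
    case False
    then have "?f (us @ v # ws) = 0" for v by (cases us; cases ws; auto split: list.splits)
    then show ?thesis by (simp add: linear_zero)
  qed
  show "?f (us @ v # v # ws) = 0" by (cases us) (auto split: list.splits)
qed

lemma galt_conn_form: "galt (conn_form A z)"
  unfolding conn_form_def by (intro galt_sum galt_mult galt_covec galt_const_form)

lemma pd_const_form:
  fixes f :: "'a::real_normed_vector \<Rightarrow> complex ^ 'r ^ 'r::finite"
  assumes "f differentiable (at x)"
  shows "gdiff (\<lambda>y. const_form (f y) :: ('v, 'r) gform) x"
    "pd v (\<lambda>y. const_form (f y)) x = (const_form (frechet_derivative f (at x) v) :: ('v, 'r) gform)"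
proof -
  have "((\<lambda>y. coef (const_form (f y)) vs) has_derivative (\<lambda>v. coef (const_form (frechet_derivative f (at x) v)) vs)) (at x)" for vs :: "'v list"
    using frechet_derivative_has_derivative[OF assms] by (cases "vs = []") (simp_all add: const_form_def)
  from pdI[OF this] show "gdiff (\<lambda>y. const_form (f y) :: ('v, 'r) gform) x"
    "pd v (\<lambda>y. const_form (f y)) x = (const_form (frechet_derivative f (at x) v) :: ('v, 'r) gform)" by auto
qed

lemma galt_curv_form:
  assumes "\<And>b. b \<in> Basis \<Longrightarrow> (\<lambda>z. A z b) differentiable (at z)"
  shows "galt (curv_form A z)"
proof -
  have d: "gdiff (\<lambda>y. covec c * const_form (A y c)) z" "pd b (\<lambda>y. covec c * const_form (A y c)) z =
      covec c * const_form (frechet_derivative (\<lambda>y. A y c) (at z) b)" if "c \<in> Basis" for b c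
    using pd_mult(1)[OF pd_const(1) pd_const_form(1)[OF assms[OF that]], of "covec c"]
      pd_mult(2)[OF pd_const(1) pd_const_form(1)[OF assms[OF that]], of b "covec c"]
    by (simp_all add: pd_const pd_const_form(2)[OF assms[OF that]])
  have "galt (pd b (conn_form A) z)" for b
  proof -
    have "pd b (conn_form A) z = (\<Sum>c\<in>Basis. covec c * const_form (frechet_derivative (\<lambda>y. A y c) (at z) b))"
      unfolding conn_form_def[abs_def] by (simp add: pd_sum(2)[OF d(1)] d(2))
    then show ?thesis by (simp add: galt_sum galt_mult galt_covec galt_const_form)
  qed
  then show ?thesis
    unfolding curv_form_def gext_def by (intro galt_add galt_sum galt_mult galt_covec galt_conn_form)
qed

lemma cov_deriv_zero_connection: "cov_deriv (\<lambda>x v. 0) \<gamma> x = gext \<gamma> x"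
  by (simp add: cov_deriv_def gext_def const_form_zero)

lemma gext_sum:
  assumes "\<And>i. i \<in> I \<Longrightarrow> gdiff (\<alpha> i) x"
  shows "gext (\<lambda>y. \<Sum>i\<in>I. \<alpha> i y) x = (\<Sum>i\<in>I. gext (\<alpha> i) x)"
proof -
  have "pd b (\<lambda>y. \<Sum>i\<in>I. \<alpha> i y) x = (\<Sum>i\<in>I. pd b (\<alpha> i) x)" for b
    by (rule pd_sum(2)[OF assms])
  then show ?thesis
    unfolding gext_def by (simp only: sum_distrib_left) (rule sum.swap)
qed

section \<open>The forms of the central charge in the algebra of matrix-valued forms\<close>

definition stab_gform :: "(nat \<Rightarrow> complex) \<Rightarrow> ('x, 'n, real) form \<Rightarrow> nat \<Rightarrow> 'x \<Rightarrow> (complex ^ 'n::finite, 'r::finite) gform" where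
  "stab_gform \<rho> \<omega> i x = scalar_form (stability_form \<rho> \<omega> i x)"

definition real_gform :: "('x, 'n, real) form \<Rightarrow> nat \<Rightarrow> 'x \<Rightarrow> (complex ^ 'n::finite, 'r::finite) gform" where
  "real_gform \<alpha> i x = scalar_form (\<lambda>vs. of_real (\<alpha> i x vs))"

definition curv_gform :: "('x, 'n::finite) atlas \<Rightarrow> ('x, 'n, 'r) conn \<Rightarrow> nat \<Rightarrow> 'x \<Rightarrow> (complex ^ 'n, 'r::finite) gform" where
  "curv_gform X A i x = Gf (curvature X A i x)"

definition exp_gform :: "('x, 'n::finite) atlas \<Rightarrow> ('x, 'n, 'r) conn \<Rightarrow> nat \<Rightarrow> 'x \<Rightarrow> (complex ^ 'n, 'r::finite) gform" where
  "exp_gform X A i x = Gf (exp_curvature X A i x)"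

lemma exp_gform_eq:
  fixes A :: "('x, 'n::finite, 'r::finite) conn"
  shows "exp_gform X A i x =
     (\<Sum>k\<le>CARD('n). (1 / fact k) *\<^sub>R (const_form (mat (\<i> / (2 * of_real pi))) * curv_gform X A i x) ^ k)"
proof (rule gform_eqI)
  fix vs
  have "coef (const_form (mat (\<i> / (2 * of_real pi))) * curv_gform X A i x) =
      (\<lambda>us. mat (\<i> / (2 * of_real pi)) ** curvature X A i x us)"
    by (rule ext) (simp only: coef_const_form_mult curv_gform_def coef_Gf)
  then show "coef (exp_gform X A i x) vs =
      coef (\<Sum>k\<le>CARD('n). (1 / fact k) *\<^sub>R (const_form (mat (\<i> / (2 * of_real pi))) * curv_gform X A i x) ^ k) vs"
    by (simp only: exp_gform_def coef_Gf exp_curvature_def coef_sum coef_simps(6) coef_power)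
qed

text \<open>The mixed products in \<open>Z_form\<close>, scalar times matrix and matrix times real,
  become ring products once scalars are embedded by \<open>scalar_form\<close>.\<close>

lemma Z_form_eq:
  fixes A :: "('x, 'n::finite, 'r::finite) conn"
  shows "Z_form X \<rho> \<omega> \<upsilon> A i x vs =
    (if length vs = 2 * CARD('n) then coef (stab_gform \<rho> \<omega> i x * exp_gform X A i x * real_gform \<upsilon> i x) vs else 0)"
proof -
  have 1: "wedge (\<lambda>c M. mat c ** M) (stability_form \<rho> \<omega> i x) (exp_curvature X A i x) =
      coef (stab_gform \<rho> \<omega> i x * exp_gform X A i x)"
    by (rule ext) (simp add: coef_simps stab_gform_def scalar_form_def exp_gform_def wedge_def)
  have "wedge (\<lambda>M t. t *\<^sub>R M) (coef a) (\<upsilon> i x) vs = coef (a * real_gform \<upsilon> i x) vs" for a :: "(complex ^ 'n, 'r) gform"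
    by (simp add: coef_simps real_gform_def scalar_form_def wedge_def mat_mult_commute[symmetric] mat_of_real_mult)
  then show ?thesis unfolding Z_form_def degree_part_def 1 by simp
qed

lemma const_form_mat_commute: "const_form (mat c) * a = a * const_form (mat c)"
  by (rule gform_eqI) (simp add: coef_const_form_mult mat_mult_commute)

lemma const_form_mat_mult_power: "(const_form (mat c) * a) ^ k = const_form (mat (c ^ k)) * a ^ k"
proof (induction k)
  case 0
  have "const_form (mat 1) * 1 = (1 :: ('a, 'b) gform)"
    by (rule gform_eqI) (simp add: const_form_def coef_simps)
  then show ?case by simp
next
  case (Suc k)
  have m: "const_form (mat c) * const_form (mat (c ^ k)) = (const_form (mat (c * c ^ k)) :: ('a, 'b) gform)"
  proof (rule gform_eqI)
    have "coef (const_form M) vs = (if vs = [] then M else 0)" for M :: "complex ^ 'b ^ 'b" and vs :: "'a list"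
      by (simp add: const_form_def)
    then show "coef (const_form (mat c) * const_form (mat (c ^ k))) vs = coef (const_form (mat (c * c ^ k)) :: ('a, 'b) gform) vs" for vs
      by (simp add: coef_const_form_mult mat_mult_mat bilinear_rzero[OF bilinear_matrix_mult])
  qed
  have "(const_form (mat c) * a) ^ Suc k = const_form (mat c) * (a * const_form (mat (c ^ k))) * a ^ k"
    by (simp only: power_Suc Suc mult.assoc)
  also have "\<dots> = (const_form (mat c) * const_form (mat (c ^ k))) * (a * a ^ k)"
    by (simp only: const_form_mat_commute[of "c ^ k" a, symmetric] mult.assoc)
  finally show ?case by (simp only: m power_Suc)
qed

text \<open>The k-th term of tr Z(A) on the frame without its constant (i / 2 pi)^k / k!, so that
  the local theorem can be applied to a plain power of the curvature.\<close>

definition chern_term :: "('x, 'n::finite) atlas \<Rightarrow> (nat \<Rightarrow> complex) \<Rightarrow> ('x, 'n, real) form \<Rightarrow> ('x, 'n, real) form \<Rightarrow>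
    nat \<Rightarrow> ('x, 'n, 'r::finite) conn \<Rightarrow> nat \<Rightarrow> 'x \<Rightarrow> complex" where
  "chern_term X \<rho> \<omega> \<upsilon> k A i x =
     trace (coef (stab_gform \<rho> \<omega> i x * curv_gform X A i x ^ k * real_gform \<upsilon> i x) complex_frame)"

lemma trace_Z_form:
  fixes A :: "('x, 'n::finite, 'r::finite) conn"
  shows "trace (Z_form X \<rho> \<omega> \<upsilon> A i x complex_frame) =
    (\<Sum>k\<le>CARD('n). ((\<i> / (2 * of_real pi)) ^ k / fact k) * chern_term X \<rho> \<omega> \<upsilon> k A i x)"
proof -
  let ?c = "\<i> / (2 * of_real pi)"
  let ?S = "stab_gform \<rho> \<omega> i x :: (complex ^ 'n, 'r) gform" and ?F = "curv_gform X A i x" and ?Y = "real_gform \<upsilon> i x :: (complex ^ 'n, 'r) gform"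
  have "?S * exp_gform X A i x * ?Y = (\<Sum>k\<le>CARD('n). (1 / fact k) *\<^sub>R (?S * (const_form (mat (?c ^ k)) * ?F ^ k) * ?Y))"
    by (simp add: exp_gform_eq const_form_mat_mult_power sum_distrib_left sum_distrib_right)
  also have "\<dots> = (\<Sum>k\<le>CARD('n). (1 / fact k) *\<^sub>R (const_form (mat (?c ^ k)) * (?S * ?F ^ k * ?Y)))"
    by (intro sum.cong refl arg_cong[where f = "\<lambda>a. _ *\<^sub>R a"])
       (simp only: mult.assoc[symmetric] const_form_mat_commute[of _ ?S])
  finally have "trace (Z_form X \<rho> \<omega> \<upsilon> A i x complex_frame) =
      trace (coef (\<Sum>k\<le>CARD('n). (1 / fact k) *\<^sub>R (const_form (mat (?c ^ k)) * (?S * ?F ^ k * ?Y))) complex_frame)"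
    by (simp add: Z_form_eq length_complex_frame)
  also have "\<dots> = (\<Sum>k\<le>CARD('n). (1 / fact k) *\<^sub>R (?c ^ k * chern_term X \<rho> \<omega> \<upsilon> k A i x))"
    by (simp only: coef_sum coef_simps(6) coef_const_form_mult linear_sum[OF linear_trace] linear_scale[OF linear_trace]
        trace_mat_mult chern_term_def)
  finally show ?thesis by (simp add: scaleR_conv_of_real)
qed

text \<open>The trace is linear over scalar forms, so it may be taken before or after multiplying by
  the two of them. For the Chern connection the left side is the integrand of Z(E).\<close>

lemma central_charge_integrand:
  fixes A :: "('x, 'n::finite, 'r::finite) conn"
  shows "wedge (\<lambda>c t. c * of_real t)
      (wedge (*) (stability_form \<rho> \<omega> i x) (\<lambda>vs. trace (exp_curvature X A i x vs))) (\<upsilon> i x) complex_frame =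
    trace (Z_form X \<rho> \<omega> \<upsilon> A i x complex_frame)"
proof -
  have "trace (coef (stab_gform \<rho> \<omega> i x * exp_gform X A i x) us) =
      wedge (*) (stability_form \<rho> \<omega> i x) (\<lambda>vs. trace (exp_curvature X A i x vs)) us" for us
    unfolding coef_simps
    by (subst wedge_hom[OF linear_trace, of "(**)" "\<lambda>M N. trace (M ** N)" id id])
       (simp_all add: wedge_def stab_gform_def scalar_form_def exp_gform_def trace_mat_mult)
  moreover have "trace (coef (a * real_gform \<upsilon> i x) vs) =
      wedge (\<lambda>c t. c * of_real t) (\<lambda>us. trace (coef a us)) (\<upsilon> i x) vs" for a :: "(complex ^ 'n, 'r) gform" and vs
    unfolding coef_simps
    by (subst wedge_hom[OF linear_trace, of "(**)" "\<lambda>M N. trace (M ** N)" id id])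
       (simp_all add: wedge_def real_gform_def scalar_form_def mat_mult_commute[symmetric] trace_mat_mult mult.commute)
  ultimately show ?thesis by (simp add: Z_form_eq length_complex_frame)
qed

text \<open>As a polynomial in the Kaehler form, the stability form inherits parity, closedness,
  smoothness and alternation from it.\<close>

lemma stab_gform_eq:
  "(stab_gform \<rho> \<omega> i x :: (complex ^ 'n::finite, 'r::finite) gform) =
     (\<Sum>d\<le>CARD('n). const_form (mat (\<rho> d)) * real_gform \<omega> i x ^ d)"
proof (rule gform_eqI)
  fix vs
  have 1: "linear (\<lambda>r. mat (complex_of_real r) :: complex ^ 'r ^ 'r)"
    using linear_compose[OF bounded_linear.linear[OF bounded_linear_of_real] linear_mat] by (simp add: o_def)
  have "coef (real_gform \<omega> i x ^ d :: (complex ^ 'n, 'r) gform) vs = mat (of_real (form_power \<omega> d i x vs))" for d vs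
    unfolding coef_power form_power_def
  proof (induction d arbitrary: vs)
    case 0
    then show ?case by (simp add: linear_0[OF linear_mat])
  next
    case (Suc d)
    have "mat (of_real (wedge_power (*) 1 (\<omega> i x) (Suc d) vs)) =
        wedge (**) (\<lambda>us. mat (of_real (\<omega> i x us))) (\<lambda>us. mat (of_real (wedge_power (*) 1 (\<omega> i x) d us)) :: complex ^ 'r ^ 'r) vs"
      unfolding wedge_power.simps by (rule wedge_hom[OF 1]) (simp add: mat_mult_mat)
    moreover have "wedge_power (**) (mat 1) (coef (real_gform \<omega> i x :: (complex ^ 'n, 'r) gform)) d =
        (\<lambda>us. mat (of_real (wedge_power (*) 1 (\<omega> i x) d us)))"
      by (rule ext) (rule Suc)
    ultimately show ?case by (simp only: wedge_power.simps real_gform_def scalar_form_def coef_Gf)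
  qed
  then show "coef (stab_gform \<rho> \<omega> i x :: (complex ^ 'n, 'r) gform) vs =
      coef (\<Sum>d\<le>CARD('n). const_form (mat (\<rho> d)) * real_gform \<omega> i x ^ d) vs"
    by (simp add: stab_gform_def scalar_form_def stability_form_def coef_sum coef_const_form_mult linear_sum[OF linear_mat] mat_mult_mat)
qed

section \<open>Invariance of the integrals of the Chern--Weil forms\<close>

lemma power_intertwine:
  fixes a b G :: "'a::monoid_mult"
  assumes "a * G = G * b" shows "a ^ k * G = G * b ^ k"
proof (induction k)
  case (Suc k)
  have "a ^ Suc k * G = a * (a ^ k * G)" by (simp add: mult.assoc)
  also have "\<dots> = (a * G) * b ^ k" by (simp add: Suc mult.assoc)
  also have "\<dots> = G * b ^ Suc k" by (simp add: assms mult.assoc)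
  finally show ?case .
qed simp

lemma frechet_derivative_vec_nth:
  assumes "f differentiable (at z)"
  shows "frechet_derivative (\<lambda>z. f z $ a) (at z) v = frechet_derivative f (at z) v $ a"
  by (rule frechet_derivative_eqI[OF bounded_linear.has_derivative[OF bounded_linear_vec_nth frechet_derivative_has_derivative[OF assms]], THEN fun_cong])

lemma continuous_on_matrix_mult:
  fixes M N :: "'a::topological_space \<Rightarrow> complex ^ 'r ^ 'r::finite"
  shows "continuous_on S M \<Longrightarrow> continuous_on S N \<Longrightarrow> continuous_on S (\<lambda>x. M x ** N x)"
  by (rule bounded_bilinear.continuous_on[OF bounded_bilinear_matrix_mult])

context cx_manifold
begin

lemma smooth_formD:
  assumes "smooth_form X \<alpha>"
  shows "i < charts X \<Longrightarrow> x \<in> dom X i \<Longrightarrow> alternating_form (\<alpha> i x)"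
    "i < charts X \<Longrightarrow> Ck_on k (coord X i ` dom X i) (\<lambda>z. \<alpha> i (param X i z) vs)"
    "i < charts X \<Longrightarrow> j < charts X \<Longrightarrow> x \<in> dom X i \<Longrightarrow> x \<in> dom X j \<Longrightarrow>
      \<alpha> i x vs = \<alpha> j x (map (chart_deriv X i (coord X j) x) vs)"
  using assms unfolding smooth_form_def chart_smooth_def o_def by (blast intro: smooth_on_Ck)+

lemma closed_form_smooth: "closed_form X \<alpha> \<Longrightarrow> smooth_form X \<alpha>"
  by (simp add: closed_form_def)

lemma chart_deriv_cong:
  assumes "i < charts X" "open W" "W \<subseteq> dom X i" "x \<in> W" "\<And>y. y \<in> W \<Longrightarrow> f y = f' y"
  shows "chart_deriv X i f x = chart_deriv X i f' x"
proof -
  have "frechet_derivative (f \<circ> param X i) (at (coord X i x)) = frechet_derivative (f' \<circ> param X i) (at (coord X i x))"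
    by (rule frechet_derivative_cong_open[OF open_coord_image[OF assms(1-3)]])
      (use assms param_image[OF assms(1,3)] in auto)
  then show ?thesis by (simp add: chart_deriv_def[abs_def])
qed

lemma alternating_chart_change:
  fixes f :: "(complex ^ 'n) list \<Rightarrow> 'b::real_vector"
  assumes "alternating_form f"
  shows "f (map (chart_deriv X i (coord X j) x) complex_frame) = jac_det X i j x *\<^sub>R f complex_frame"
  unfolding jac_det_def
  by (rule complex_frame_top_degree[OF assms]) (simp add: length_complex_frame)

lemma curvature_cong:
  assumes "i < charts X" "open W" "W \<subseteq> dom X i" "x \<in> W" "\<And>y. y \<in> W \<Longrightarrow> A i y = B i y"
  shows "curvature X A i x = curvature X B i x"
proof
  fix vs
  have "chart_deriv X i (\<lambda>y. one_form A i y us) x = chart_deriv X i (\<lambda>y. one_form B i y us) x" for us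
    by (rule chart_deriv_cong[OF assms(1-4)]) (simp add: one_form_def assms(5) split: list.split)
  moreover have "one_form A i x = one_form B i x"
    by (rule ext) (simp add: one_form_def assms(4,5) split: list.split)
  ultimately show "curvature X A i x vs = curvature X B i x vs"
    by (simp add: curvature_def ext_deriv_def)
qed

text \<open>In another chart \<open>i\<close> the function is smooth on the overlap with
  \<open>dom X m\<close> and identically 0 off the transported ball. That ball is compact, hence
  closed in a Hausdorff space, so these two open sets cover \<open>dom X i\<close>.\<close>

lemma chart_bump:
  assumes m: "m < charts X" and r: "r > 0" and sub: "cball z0 (2 * r) \<subseteq> coord X m ` dom X m"
  obtains \<psi> :: "'x \<Rightarrow> real" where "\<And>i. i < charts X \<Longrightarrow> Ck_on 2 (coord X i ` dom X i) (\<lambda>z. \<psi> (param X i z))"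
    "\<And>x. x \<in> param X m ` ball z0 r \<Longrightarrow> \<psi> x = 1" "\<And>x. x \<notin> param X m ` cball z0 (2 * r) \<Longrightarrow> \<psi> x = 0"
proof -
  obtain \<theta> :: "complex ^ 'n \<Rightarrow> real" where \<theta>: "Ck_on 2 UNIV \<theta>" "\<And>y. y \<in> ball z0 r \<Longrightarrow> \<theta> y = 1" "\<And>y. y \<notin> cball z0 (2 * r) \<Longrightarrow> \<theta> y = 0"
    by (rule bump_function_exists[OF r, of z0], rule that)
  define \<psi> where "\<psi> = (\<lambda>x. if x \<in> dom X m then \<theta> (coord X m x) else 0)"
  let ?K = "param X m ` cball z0 (2 * r)"
  have closed: "closed ?K" by (rule compact_param_image(2)[OF m compact_cball sub])
  have zero: "\<psi> x = 0" if "x \<notin> ?K" for x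
  proof (cases "x \<in> dom X m")
    case True
    have "coord X m x \<notin> cball z0 (2 * r)"
    proof
      assume "coord X m x \<in> cball z0 (2 * r)"
      then have "param X m (coord X m x) \<in> ?K" by (rule imageI)
      then show False using that param_coord[OF m True] by simp
    qed
    then show ?thesis by (simp add: \<psi>_def \<theta>(3))
  qed (simp add: \<psi>_def)
  have one: "\<psi> x = 1" if x: "x \<in> param X m ` ball z0 r" for x
  proof -
    obtain y where y: "y \<in> ball z0 r" "x = param X m y" using x by blast
    then have "y \<in> cball z0 (2 * r)" using r by auto
    then have yU: "y \<in> coord X m ` dom X m" using sub by blast
    have "x \<in> dom X m" unfolding y(2) by (rule param_image[OF m order_refl yU])
    then show ?thesis using \<theta>(2)[OF y(1)] coord_param[OF m yU] y(2) by (simp add: \<psi>_def)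
  qed
  have smooth: "Ck_on 2 (coord X i ` dom X i) (\<lambda>z. \<psi> (param X i z))" if i: "i < charts X" for i
  proof -
    let ?S = "coord X i ` (dom X i \<inter> dom X m)" and ?T = "coord X i ` (dom X i - ?K)"
    have S: "open ?S" by (rule open_overlap[OF i m])
    have T: "open ?T" by (rule open_coord_image[OF i]) (use open_chart(1)[OF i] closed in auto)
    have "Ck_on 2 ?S (\<lambda>z. \<theta> (coord X m (param X i z)))"
      by (rule Ck_on_compose[OF S Ck_on_transition[OF i m] \<theta>(1)]) simp
    then have 1: "Ck_on 2 ?S (\<lambda>z. \<psi> (param X i z))"
      by (rule Ck_on_cong[OF S, rotated]) (use param_image[OF i, of "dom X i \<inter> dom X m"] in \<open>simp add: \<psi>_def\<close>)
    have 2: "Ck_on 2 ?T (\<lambda>z. \<psi> (param X i z))"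
      by (rule Ck_on_cong[OF T _ Ck_on_const[of _ _ 0]]) (use param_image[OF i, of "dom X i - ?K"] zero in simp)
    have "?K \<subseteq> dom X m" using sub param_image[OF m order_refl] by blast
    then have "coord X i ` dom X i = ?S \<union> ?T" by blast
    then show ?thesis using Ck_on_Un[OF S T 1 2] by simp
  qed
  show ?thesis by (rule that[OF smooth one zero])
qed

lemma continuous_on_chartI:
  assumes "i < charts X" "continuous_on (coord X i ` dom X i) (\<lambda>z. f (param X i z))"
  shows "continuous_on (dom X i) f"
proof -
  have "continuous_on (dom X i) (\<lambda>x. f (param X i (coord X i x)))"
    by (rule continuous_on_compose2[OF assms(2) continuous_chart(1)[OF assms(1)]]) simp
  then show ?thesis by (rule continuous_on_eq) (simp add: param_coord[OF assms(1)])
qed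

lemma density_sum:
  assumes "finite I" "\<And>k. k \<in> I \<Longrightarrow> chart_density X (F k)"
  shows "chart_density X (\<lambda>i x. \<Sum>k\<in>I. F k i x) \<and>
    density_integral X (\<lambda>i x. \<Sum>k\<in>I. F k i x) = (\<Sum>k\<in>I. density_integral X (F k))"
  using assms
proof (induction I rule: finite_induct)
  case empty
  have "chart_density X (\<lambda>i x. 0 :: 'b)" by (rule densityI) simp_all
  then show ?case by (simp add: density_integral_def chart_integral_def)
next
  case (insert k I)
  then have "chart_density X (F k)" "chart_density X (\<lambda>i x. \<Sum>k\<in>I. F k i x)"
    "density_integral X (\<lambda>i x. \<Sum>k\<in>I. F k i x) = (\<Sum>k\<in>I. density_integral X (F k))" by auto
  then show ?case
    unfolding sum.insert[OF insert.hyps] by (simp add: density_add density_integral_add)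
qed

lemma density_integral_cong:
  assumes "\<And>i x. i < charts X \<Longrightarrow> x \<in> dom X i \<Longrightarrow> F i x = G i x"
  shows "density_integral X F = density_integral X G"
  unfolding density_integral_def chart_integral_def
proof (intro sum.cong refl set_lebesgue_integral_cong)
  fix i assume "i \<in> {..<charts X}"
  then have i: "i < charts X" by simp
  show "coord X i ` disjointed (dom X) i \<in> sets lborel" using borel_coord_image[OF i borel_disjointed[OF i]] by simp
  show "\<forall>z. z \<in> coord X i ` disjointed (dom X) i \<longrightarrow> F i (param X i z) = G i (param X i z)"
    using assms[OF i] param_image[OF i borel_disjointed(2)[OF i]] borel_disjointed(2)[OF i] by blast
qed

end

locale kaehler_bundle = cx_manifold X
  for X :: "('x::t2_space, 'n::finite) atlas" +
  fixes g :: "nat \<Rightarrow> nat \<Rightarrow> 'x \<Rightarrow> complex ^ 'r ^ 'r::finite"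
    and h :: "nat \<Rightarrow> 'x \<Rightarrow> complex ^ 'r ^ 'r"
    and \<rho> :: "nat \<Rightarrow> complex"
    and \<omega> \<upsilon> :: "('x, 'n, real) form"
  assumes kaehler: "kaehler_form X \<omega>" and hol_bundle: "holomorphic_bundle X g"
    and metric: "hermitian_metric X g h" and unipotent: "unipotent_form X \<upsilon>"
begin

lemma closed_forms: "closed_form X \<omega>" "closed_form X \<upsilon>"
  using kaehler unipotent by (simp_all add: kaehler_form_def unipotent_form_def)

subsection \<open>The transition functions\<close>

lemma transition_invertible:
  assumes "i < charts X" "j < charts X" "x \<in> dom X i" "x \<in> dom X j"
  shows "g i j x ** g j i x = mat 1" "g j i x ** g i j x = mat 1" "invertible (g i j x)"
proof -
  have "g a b x ** g b a x = mat 1" if "a < charts X" "b < charts X" "x \<in> dom X a" "x \<in> dom X b" for a b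
  proof -
    have "g a b x ** g b a x = g a a x" "g a a x = mat 1"
      using hol_bundle that unfolding holomorphic_bundle_def by blast+
    then show ?thesis by simp
  qed
  then show 1: "g i j x ** g j i x = mat 1" "g j i x ** g i j x = mat 1" using assms by blast+
  then show "invertible (g i j x)" unfolding invertible_def by blast
qed

lemma Ck_on_transition_function:
  assumes "i < charts X" "j < charts X"
  shows "Ck_on k (coord X i ` (dom X i \<inter> dom X j)) (\<lambda>z. g i j (param X i z))"
proof (rule Ck_on_vec_lambda[OF open_overlap[OF assms]], rule Ck_on_vec_lambda[OF open_overlap[OF assms]])
  fix a b
  have "chart_holomorphic X i (dom X i \<inter> dom X j) (\<lambda>x. g i j x $ a $ b)"
    using hol_bundle assms unfolding holomorphic_bundle_def by blast
  then show "Ck_on k (coord X i ` (dom X i \<inter> dom X j)) (\<lambda>z. g i j (param X i z) $ a $ b)"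
    unfolding chart_holomorphic_def chart_smooth_def o_def by (blast intro: smooth_on_Ck)
qed

lemma conjugate_trace:
  assumes "i < charts X" "j < charts X" "x \<in> dom X i" "x \<in> dom X j"
    and "M ** g i j x = g i j x ** N"
  shows "trace M = trace N"
proof -
  note inv = transition_invertible[OF assms(1-4)]
  have "M = M ** (g i j x ** g j i x)" by (simp add: inv)
  also have "\<dots> = g i j x ** (N ** g j i x)" by (simp add: matrix_mul_assoc assms(5))
  finally have "trace M = trace ((N ** g j i x) ** g i j x)" by (metis trace_mul_sym)
  also have "\<dots> = trace N" by (simp add: matrix_mul_assoc[symmetric] inv)
  finally show ?thesis .
qed

subsection \<open>Curvature\<close>

lemma C2_connectionD:
  assumes "C2_connection X g A" "i < charts X"
  shows "x \<in> dom X i \<Longrightarrow> linear (A i x)"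
    "Ck_on 2 (coord X i ` dom X i) (\<lambda>z. local_conn X A i z v)"
    "z \<in> coord X i ` dom X i \<Longrightarrow> linear (local_conn X A i z)"
    "j < charts X \<Longrightarrow> x \<in> dom X i \<Longrightarrow> x \<in> dom X j \<Longrightarrow>
      g i j x ** A j x (chart_deriv X i (coord X j) x v) = A i x v ** g i j x + chart_deriv X i (g i j) x v"
proof -
  show lin: "x \<in> dom X i \<Longrightarrow> linear (A i x)" for x
    using assms unfolding C2_connection_def by blast
  show "Ck_on 2 (coord X i ` dom X i) (\<lambda>z. local_conn X A i z v)"
    using assms unfolding C2_connection_def local_conn_def by blast
  show "z \<in> coord X i ` dom X i \<Longrightarrow> linear (local_conn X A i z)"
    unfolding local_conn_def using lin[OF param_image[OF assms(2) order_refl]] by simp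
  show "j < charts X \<Longrightarrow> x \<in> dom X i \<Longrightarrow> x \<in> dom X j \<Longrightarrow>
      g i j x ** A j x (chart_deriv X i (coord X j) x v) = A i x v ** g i j x + chart_deriv X i (g i j) x v"
    using assms unfolding C2_connection_def by blast
qed

lemma gCk_local_conn:
  assumes "C2_connection X g A" "i < charts X"
  shows "gCk 2 (coord X i ` dom X i) (conn_form (local_conn X A i))"
  by (rule gCk_conn_form[OF open_chart(2)[OF assms(2)]]) (rule C2_connectionD(2)[OF assms])

lemma one_form_eq:
  assumes "C2_connection X g A" "i < charts X" "z \<in> coord X i ` dom X i"
  shows "one_form A i (param X i z) = coef (conn_form (local_conn X A i) z)"
  by (rule ext) (simp add: coef_conn_form[where A = "local_conn X A i" and z = z, OF C2_connectionD(3)[OF assms]]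
      one_form_def local_conn_def split: list.split)

text \<open>Carries the curvature on the manifold into the chart, where the Bianchi identity and the
  local Chern--Weil theorem are available.\<close>

lemma curvature_eq:
  assumes A: "C2_connection X g A" and i: "i < charts X" and x: "x \<in> dom X i"
  shows "curv_gform X A i x = curv_form (local_conn X A i) (coord X i x)"
proof (rule gform_eqI)
  fix vs
  let ?z = "coord X i x" and ?U = "coord X i ` dom X i"
  have z: "?z \<in> ?U" using x by simp
  have d: "gdiff (conn_form (local_conn X A i)) ?z"
    using gCk_Suc_gdiff[of 1 ?U _ ?z] gCk_local_conn[OF A i] z by (simp add: numeral_2_eq_2)
  have "frechet_derivative ((\<lambda>y. one_form A i y us) \<circ> param X i) (at ?z) =
      frechet_derivative (\<lambda>z. coef (conn_form (local_conn X A i) z) us) (at ?z)" for us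
    by (rule frechet_derivative_cong_open[OF open_chart(2)[OF i] z]) (simp add: one_form_eq[OF A i])
  then have "ext_deriv X (one_form A) i x vs = coef (gext (conn_form (local_conn X A i)) ?z) vs"
    by (simp add: coef_gext[OF d] ext_deriv_def chart_deriv_def)
  moreover have "one_form A i x = coef (conn_form (local_conn X A i) ?z)"
    using one_form_eq[OF A i z] param_coord[OF i x] by simp
  ultimately show "coef (curv_gform X A i x) vs = coef (curv_form (local_conn X A i) ?z) vs"
    by (simp add: curv_gform_def curvature_def curv_form_def coef_simps)
qed

lemma curvature_pair:
  assumes i: "i < charts X" and x: "x \<in> dom X i"
  shows "curvature X A i x [v, w] = curv (local_conn X A i) (coord X i x) v w"
    "length vs \<noteq> 2 \<Longrightarrow> curvature X A i x vs = 0"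
proof -
  have w: "wedge (**) (one_form A i x) (one_form A i x) [v, w] = A i x v ** A i x w - A i x w ** A i x v"
    by (simp add: wedge_Cons[OF bilinear_matrix_mult] contract_def grade_inv_def one_form_def
        bilinear_lneg[OF bilinear_matrix_mult] bilinear_rzero[OF bilinear_matrix_mult] bilinear_lzero[OF bilinear_matrix_mult])
  have "ext_deriv X (one_form A) i x [v, w] =
      chart_deriv X i (\<lambda>y. A i y w) x v - chart_deriv X i (\<lambda>y. A i y v) x w"
    by (simp add: ext_deriv_def one_form_def numeral_2_eq_2)
  then show "curvature X A i x [v, w] = curv (local_conn X A i) (coord X i x) v w"
    by (simp add: curvature_def w curv_def local_conn_def chart_deriv_def o_def param_coord[OF i x])
  assume len: "length vs \<noteq> 2"
  have one: "one_form A i y us = 0" if "length us \<noteq> 1" for y us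
    using that by (auto simp: one_form_def split: list.split)
  have "one_form A i y (take j vs @ drop (Suc j) vs) = 0" if "j < length vs" for j y
    by (rule one) (use len that in simp)
  then have "(\<lambda>y. one_form A i y (take j vs @ drop (Suc j) vs)) = (\<lambda>y. 0)" if "j < length vs" for j using that by auto
  then have 1: "ext_deriv X (one_form A) i x vs = 0"
    by (simp add: ext_deriv_def chart_deriv_def o_def frechet_derivative_const)
  have "one_form A i x (nths vs S) ** one_form A i x (nths vs (- S)) = 0" for S
  proof -
    have "length (nths vs S) \<noteq> 1 \<or> length (nths vs (- S)) \<noteq> 1" using length_nths_complement[of vs S] len by auto
    then show ?thesis
      using one[of "nths vs S" x] one[of "nths vs (- S)" x]
      by (auto simp: bilinear_lzero[OF bilinear_matrix_mult] bilinear_rzero[OF bilinear_matrix_mult])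
  qed
  then have "wedge (**) (one_form A i x) (one_form A i x) vs = 0" by (simp add: wedge_def)
  with 1 show "curvature X A i x vs = 0" by (simp add: curvature_def)
qed

lemma curvature_transform:
  assumes A: "C2_connection X g A" and ij: "i < charts X" "j < charts X" and x: "x \<in> dom X i" "x \<in> dom X j"
  shows "curvature X A i x vs ** g i j x = g i j x ** curvature X A j x (map (chart_deriv X i (coord X j) x) vs)"
proof (cases "length vs = 2")
  case False
  have "curvature X A i x vs = 0" by (rule curvature_pair(2)[OF ij(1) x(1) False])
  moreover have "curvature X A j x (map (chart_deriv X i (coord X j) x) vs) = 0"
    by (rule curvature_pair(2)[OF ij(2) x(2)]) (simp add: False)
  ultimately show ?thesis
    by (simp add: bilinear_lzero[OF bilinear_matrix_mult] bilinear_rzero[OF bilinear_matrix_mult])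
next
  case True
  then obtain v w where vs: "vs = [v, w]" by (metis length_0_conv length_Suc_conv numeral_2_eq_2)
  let ?U = "coord X i ` (dom X i \<inter> dom X j)" and ?V = "coord X j ` dom X j"
  let ?\<phi> = "\<lambda>z. coord X j (param X i z)" and ?G = "\<lambda>z. g i j (param X i z)"
  have px: "param X i (coord X i x) = x" by (rule param_coord[OF ij(1) x(1)])
  have pU: "param X i z \<in> dom X i \<inter> dom X j" if "z \<in> ?U" for z
    using param_image[OF ij(1) _ that] by blast
  have d\<phi>: "frechet_derivative ?\<phi> (at z) v = chart_deriv X i (coord X j) (param X i z) v" if "z \<in> ?U" for z v
    using coord_param[OF ij(1)] that by (auto simp: chart_deriv_def o_def)
  have dG: "frechet_derivative ?G (at z) v = chart_deriv X i (g i j) (param X i z) v" if "z \<in> ?U" for z v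
    using coord_param[OF ij(1)] that by (auto simp: chart_deriv_def o_def)
  have "?G (coord X i x) ** curv (local_conn X A j) (?\<phi> (coord X i x))
        (frechet_derivative ?\<phi> (at (coord X i x)) v) (frechet_derivative ?\<phi> (at (coord X i x)) w) =
      curv (local_conn X A i) (coord X i x) v w ** ?G (coord X i x)"
  proof (rule curvature_gauge_transform[OF open_overlap[OF ij] open_chart(2)[OF ij(2)] _
        Ck_on_transition[OF ij] Ck_on_transition_function[OF ij]])
    show "?\<phi> ` ?U \<subseteq> ?V" using pU by blast
    show "Ck_on 1 ?U (\<lambda>z. local_conn X A i z v)" for v
      by (rule Ck_on_subset[OF Ck_on_le[OF C2_connectionD(2)[OF A ij(1)]]]) auto
    show "Ck_on 1 ?V (\<lambda>z. local_conn X A j z v)" for v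
      by (rule Ck_on_le[OF C2_connectionD(2)[OF A ij(2)]]) simp
    show "linear (local_conn X A j y)" if "y \<in> ?V" for y
      by (rule C2_connectionD(3)[OF A ij(2) that])
    show "?G z ** local_conn X A j (?\<phi> z) (frechet_derivative ?\<phi> (at z) v) =
        local_conn X A i z v ** ?G z + frechet_derivative ?G (at z) v" if z: "z \<in> ?U" for z v
      unfolding d\<phi>[OF z] dG[OF z] local_conn_def
      using C2_connectionD(4)[OF A ij(1) ij(2), of "param X i z" v] pU[OF z] param_coord[OF ij(2), of "param X i z"] by simp
    show "coord X i x \<in> ?U" using x by blast
  qed
  moreover have "coord X i x \<in> ?U" using x by blast
  ultimately show ?thesis
    unfolding vs by (simp add: px d\<phi> curvature_pair(1)[OF ij(1) x(1)] curvature_pair(1)[OF ij(2) x(2)])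
qed

subsection \<open>Transformation and regularity of the Chern--Weil forms\<close>

lemma curv_gform_transform:
  assumes "C2_connection X g A" "i < charts X" "j < charts X" "x \<in> dom X i" "x \<in> dom X j"
  shows "curv_gform X A i x * const_form (g i j x) =
    const_form (g i j x) * gpull (chart_deriv X i (coord X j) x) (curv_gform X A j x)"
  by (rule gform_eqI) (simp add: coef_const_form_mult curv_gform_def gpull_def curvature_transform[OF assms])

lemma real_gform_transform:
  assumes "smooth_form X \<alpha>" "i < charts X" "j < charts X" "x \<in> dom X i" "x \<in> dom X j"
  shows "real_gform \<alpha> i x = gpull (chart_deriv X i (coord X j) x) (real_gform \<alpha> j x)"
  unfolding real_gform_def scalar_form_def gpull_def coef_Gf by (simp only: smooth_formD(3)[OF assms])

lemma stab_gform_transform: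
  assumes "i < charts X" "j < charts X" "x \<in> dom X i" "x \<in> dom X j"
  shows "(stab_gform \<rho> \<omega> i x :: (complex ^ 'n, 'r) gform) = gpull (chart_deriv X i (coord X j) x) (stab_gform \<rho> \<omega> j x)"
proof (rule gform_eqI)
  fix vs
  have "form_power \<omega> d i x vs = form_power \<omega> d j x (map (chart_deriv X i (coord X j) x) vs)" for d
    unfolding form_power_def wedge_power_map
    by (simp only: smooth_formD(3)[OF closed_form_smooth[OF closed_forms(1)] assms, symmetric])
  then show "coef (stab_gform \<rho> \<omega> i x :: (complex ^ 'n, 'r) gform) vs = coef (gpull (chart_deriv X i (coord X j) x) (stab_gform \<rho> \<omega> j x)) vs"
    by (simp add: stab_gform_def scalar_form_def gpull_def stability_form_def)
qed

text \<open>The two outer factors are scalar, so the constant matrix \<open>g i j x\<close> passes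
  through them and only the middle factor is conjugated. That factor is kept general to serve for
  powers of the curvature and for its exponential.\<close>

lemma stab_product_transform:
  assumes "i < charts X" "j < charts X" "x \<in> dom X i" "x \<in> dom X j"
    and E: "E i * const_form (g i j x) = const_form (g i j x) * gpull (chart_deriv X i (coord X j) x) (E j)"
  shows "coef (stab_gform \<rho> \<omega> i x * E i * real_gform \<upsilon> i x) vs ** g i j x =
    g i j x ** coef (stab_gform \<rho> \<omega> j x * E j * real_gform \<upsilon> j x) (map (chart_deriv X i (coord X j) x) vs)"
proof -
  let ?P = "gpull (chart_deriv X i (coord X j) x) :: (complex ^ 'n, 'r) gform \<Rightarrow> _" and ?G = "const_form (g i j x) :: (complex ^ 'n, 'r) gform"
  note S = stab_gform_transform[OF assms(1-4)] and Y = real_gform_transform[OF closed_form_smooth[OF closed_forms(2)] assms(1-4)]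
  have YG: "real_gform \<upsilon> i x * ?G = ?G * real_gform \<upsilon> i x"
    unfolding real_gform_def by (rule scalar_form_const_form[symmetric])
  have SG: "stab_gform \<rho> \<omega> i x * ?G = ?G * stab_gform \<rho> \<omega> i x"
    unfolding stab_gform_def by (rule scalar_form_const_form[symmetric])
  have "stab_gform \<rho> \<omega> i x * E i * real_gform \<upsilon> i x * ?G = stab_gform \<rho> \<omega> i x * (E i * ?G) * real_gform \<upsilon> i x"
    by (simp only: mult.assoc YG)
  also have "\<dots> = stab_gform \<rho> \<omega> i x * ?G * ?P (E j) * real_gform \<upsilon> i x"
    by (simp only: E mult.assoc)
  also have "\<dots> = ?G * (stab_gform \<rho> \<omega> i x * ?P (E j) * real_gform \<upsilon> i x)"
    by (simp only: SG mult.assoc)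
  also have "\<dots> = ?G * ?P (stab_gform \<rho> \<omega> j x * E j * real_gform \<upsilon> j x)"
    by (simp only: gpull_mult S Y)
  finally have "coef (stab_gform \<rho> \<omega> i x * E i * real_gform \<upsilon> i x * ?G) vs = coef (?G * ?P (stab_gform \<rho> \<omega> j x * E j * real_gform \<upsilon> j x)) vs"
    by simp
  then show ?thesis by (simp only: coef_const_form_mult) (simp add: gpull_def)
qed

lemma galt_curv_gform:
  assumes "C2_connection X g A" "i < charts X" "x \<in> dom X i" shows "galt (curv_gform X A i x)"
  unfolding curvature_eq[OF assms]
proof (rule galt_curv_form)
  show "(\<lambda>z. local_conn X A i z b) differentiable at (coord X i x)" for b
    using C2_connectionD(2)[OF assms(1,2), of b] assms(3) by (simp add: numeral_2_eq_2)
qed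

lemma galt_real_gform: "smooth_form X \<alpha> \<Longrightarrow> i < charts X \<Longrightarrow> x \<in> dom X i \<Longrightarrow> galt (real_gform \<alpha> i x)"
  unfolding real_gform_def
  by (rule galt_scalar_form)
     (rule alternating_form_compose_linear[OF bounded_linear.linear[OF bounded_linear_of_real] smooth_formD(1)])

lemma galt_stab_gform: "i < charts X \<Longrightarrow> x \<in> dom X i \<Longrightarrow> galt (stab_gform \<rho> \<omega> i x :: (complex ^ 'n, 'r) gform)"
  unfolding stab_gform_eq
  by (intro galt_sum galt_mult galt_const_form galt_power galt_real_gform closed_form_smooth closed_forms)

lemma galt_exp_gform:
  "C2_connection X g A \<Longrightarrow> i < charts X \<Longrightarrow> x \<in> dom X i \<Longrightarrow> galt (exp_gform X A i x)"
  unfolding exp_gform_eq by (intro galt_sum galt_scaleR galt_power galt_mult galt_const_form galt_curv_gform)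

lemma exp_gform_transform:
  assumes "C2_connection X g A" "i < charts X" "j < charts X" "x \<in> dom X i" "x \<in> dom X j"
  shows "exp_gform X A i x * const_form (g i j x) =
    const_form (g i j x) * gpull (chart_deriv X i (coord X j) x) (exp_gform X A j x)"
proof -
  let ?P = "gpull (chart_deriv X i (coord X j) x) :: (complex ^ 'n, 'r) gform \<Rightarrow> _" and ?G = "const_form (g i j x) :: (complex ^ 'n, 'r) gform"
  let ?c = "const_form (mat (\<i> / (2 * of_real pi))) :: (complex ^ 'n, 'r) gform"
  have c: "?P ?c = ?c" by (rule gform_eqI) (simp add: gpull_def const_form_def)
  have "?c * curv_gform X A i x * ?G = ?G * ?P (?c * curv_gform X A j x)"
  proof -
    have "?c * curv_gform X A i x * ?G = ?c * ?G * ?P (curv_gform X A j x)"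
      by (simp only: mult.assoc curv_gform_transform[OF assms])
    also have "\<dots> = ?G * (?c * ?P (curv_gform X A j x))"
      by (simp only: const_form_mat_commute[of _ ?G] mult.assoc)
    finally show ?thesis by (simp only: gpull_mult c)
  qed
  from power_intertwine[OF this]
  have "(?c * curv_gform X A i x) ^ k * ?G = ?G * ?P ((?c * curv_gform X A j x) ^ k)" for k
    by (simp only: gpull_power)
  moreover have "?P (\<Sum>k\<le>CARD('n). (1 / fact k) *\<^sub>R f k) = (\<Sum>k\<le>CARD('n). (1 / fact k) *\<^sub>R ?P (f k))" for f
    by (rule gform_eqI) (simp add: gpull_def coef_sum coef_simps)
  ultimately show ?thesis
    unfolding exp_gform_eq by (simp add: sum_distrib_left sum_distrib_right)
qed

section \<open>Positivity of the Jacobians, regularity and closedness of the forms\<close>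

lemma kaehler_pointwise: "i < charts X \<Longrightarrow> x \<in> dom X i \<Longrightarrow> kaehler_pointwise (\<omega> i x)"
  unfolding kaehler_pointwise_def
  using kaehler smooth_formD(1)[OF closed_form_smooth[OF closed_forms(1)]] unfolding kaehler_form_def by blast

lemma volume_positive: "i < charts X \<Longrightarrow> x \<in> dom X i \<Longrightarrow> volume_form \<omega> i x complex_frame > 0"
  using kaehler_pointwise_top_positive[OF kaehler_pointwise] by (simp add: volume_form_def form_power_def)

lemma alternating_form_power: "i < charts X \<Longrightarrow> x \<in> dom X i \<Longrightarrow> alternating_form (form_power \<omega> d i x)"
  unfolding form_power_def
  by (rule wedge_power_alternating[OF bilinear_times smooth_formD(1)[OF closed_form_smooth[OF closed_forms(1)]]])

lemma form_power_transform:
  assumes "i < charts X" "j < charts X" "x \<in> dom X i" "x \<in> dom X j"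
  shows "form_power \<omega> d i x complex_frame = jac_det X i j x * form_power \<omega> d j x complex_frame"
proof -
  have "form_power \<omega> d i x complex_frame = form_power \<omega> d j x (map (chart_deriv X i (coord X j) x) complex_frame)"
    unfolding form_power_def wedge_power_map
    by (simp only: smooth_formD(3)[OF closed_form_smooth[OF closed_forms(1)] assms, symmetric])
  then show ?thesis using alternating_chart_change[OF alternating_form_power[OF assms(2,4), of d], of i j x] by simp
qed

text \<open>The volume form is positive on \<open>complex_frame\<close> in both charts, and the
  Jacobian is the quotient of the two values.\<close>

lemma jac_det_pos:
  assumes "i < charts X" "j < charts X" "x \<in> dom X i" "x \<in> dom X j"
  shows "jac_det X i j x > 0"
proof -
  have "volume_form \<omega> i x complex_frame = jac_det X i j x * volume_form \<omega> j x complex_frame"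
    using form_power_transform[OF assms] by (simp add: volume_form_def)
  then show ?thesis
    using volume_positive[OF assms(1,3)] volume_positive[OF assms(2,4)] by (metis zero_less_mult_pos2)
qed

lemma gCk_real_gform:
  assumes "smooth_form X \<alpha>" "i < charts X"
  shows "gCk k (coord X i ` dom X i) (\<lambda>z. real_gform \<alpha> i (param X i z) :: (complex ^ 'n, 'r) gform)"
  unfolding gCk_def real_gform_def scalar_form_def coef_Gf
proof
  fix vs
  have "bounded_linear (\<lambda>r. mat (complex_of_real r) :: complex ^ 'r ^ 'r)"
    using linear_compose[OF bounded_linear.linear[OF bounded_linear_of_real] linear_mat] linear_conv_bounded_linear
    by (auto simp: o_def)
  from Ck_on_compose_bounded_linear[OF open_chart(2)[OF assms(2)] this smooth_formD(2)[OF assms]]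
  show "Ck_on k (coord X i ` dom X i) (\<lambda>z. mat (complex_of_real (\<alpha> i (param X i z) vs)) :: complex ^ 'r ^ 'r)" .
qed

lemma gCk_stab_gform:
  assumes "i < charts X"
  shows "gCk k (coord X i ` dom X i) (\<lambda>z. stab_gform \<rho> \<omega> i (param X i z) :: (complex ^ 'n, 'r) gform)"
  unfolding stab_gform_eq
  by (intro gCk_sum gCk_mult gCk_const gCk_power gCk_real_gform closed_form_smooth closed_forms assms open_chart(2))

lemma gext_real_gform:
  assumes "closed_form X \<alpha>" "i < charts X" "z \<in> coord X i ` dom X i"
  shows "gext (\<lambda>z. real_gform \<alpha> i (param X i z)) z = (0 :: (complex ^ 'n, 'r) gform)"
proof (rule gform_eqI)
  fix vs
  let ?f = "\<lambda>us z. \<alpha> i (param X i z) us"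
  have d: "gdiff (\<lambda>z. real_gform \<alpha> i (param X i z) :: (complex ^ 'n, 'r) gform) z"
    by (rule gCk_Suc_gdiff[OF gCk_real_gform[OF closed_form_smooth[OF assms(1)] assms(2)] assms(3)])
  have lin: "linear (\<lambda>r. mat (complex_of_real r) :: complex ^ 'r ^ 'r)"
    using linear_compose[OF bounded_linear.linear[OF bounded_linear_of_real] linear_mat] by (simp add: o_def)
  then have bl: "bounded_linear (\<lambda>r. mat (complex_of_real r) :: complex ^ 'r ^ 'r)"
    by (simp add: linear_conv_bounded_linear)
  have "frechet_derivative (\<lambda>y. mat (complex_of_real (?f us y)) :: complex ^ 'r ^ 'r) (at z) v =
      mat (complex_of_real (frechet_derivative (?f us) (at z) v))" for us v
  proof -
    have "?f us differentiable (at z)"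
      by (rule Ck_on_Suc_differentiable[OF smooth_formD(2)[OF closed_form_smooth[OF assms(1)] assms(2)] assms(3)])
    from bounded_linear.has_derivative[OF bl frechet_derivative_has_derivative[OF this]]
    show ?thesis by (rule frechet_derivative_eqI[THEN fun_cong])
  qed
  then have "coef (gext (\<lambda>z. real_gform \<alpha> i (param X i z) :: (complex ^ 'n, 'r) gform) z) vs =
      (\<Sum>j<length vs. (- 1) ^ j *\<^sub>R mat (complex_of_real (frechet_derivative (?f (take j vs @ drop (Suc j) vs)) (at z) (vs ! j))))"
    by (simp only: coef_gext[OF d]) (simp only: real_gform_def scalar_form_def coef_Gf)
  also have "\<dots> = mat (complex_of_real (ext_deriv X \<alpha> i (param X i z) vs))"
    unfolding ext_deriv_def chart_deriv_def o_def linear_sum[OF lin] linear_scale[OF lin]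
    by (simp only: coord_param[OF assms(2,3)])
  also have "ext_deriv X \<alpha> i (param X i z) vs = 0"
    using assms(1,2) param_image[OF assms(2) order_refl assms(3)] unfolding closed_form_def by blast
  finally show "coef (gext (\<lambda>z. real_gform \<alpha> i (param X i z) :: (complex ^ 'n, 'r) gform) z) vs = coef 0 vs"
    by (simp add: coef_simps linear_0[OF linear_mat])
qed

lemma gbar_kaehler: "i < charts X \<Longrightarrow> x \<in> dom X i \<Longrightarrow> gbar (real_gform \<omega> i x) = (real_gform \<omega> i x :: (complex ^ 'n, 'r) gform)"
proof (rule gform_eqI)
  fix vs
  assume "i < charts X" "x \<in> dom X i"
  then have "\<omega> i x vs = 0" if "length vs \<noteq> 2" using kaehler that unfolding kaehler_form_def by blast
  then show "coef (gbar (real_gform \<omega> i x)) vs = coef (real_gform \<omega> i x :: (complex ^ 'n, 'r) gform) vs"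
    by (cases "length vs = 2") (simp_all add: coef_gbar real_gform_def scalar_form_def linear_0[OF linear_mat])
qed

lemma gbar_stab_gform: "i < charts X \<Longrightarrow> x \<in> dom X i \<Longrightarrow> gbar (stab_gform \<rho> \<omega> i x) = (stab_gform \<rho> \<omega> i x :: (complex ^ 'n, 'r) gform)"
  by (simp add: stab_gform_eq gbar_simps gbar_const_form gbar_kaehler)

text \<open>Powers of the closed even form omega are closed by \<open>cov_deriv_power\<close> for
  the zero connection, and constant coefficients do no harm.\<close>

lemma gext_stab_gform:
  assumes "i < charts X" "z \<in> coord X i ` dom X i"
  shows "gext (\<lambda>z. stab_gform \<rho> \<omega> i (param X i z)) z = (0 :: (complex ^ 'n, 'r) gform)"
proof -
  let ?W = "\<lambda>z. real_gform \<omega> i (param X i z) :: (complex ^ 'n, 'r) gform"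
  have x: "param X i z \<in> dom X i" by (rule param_image[OF assms(1) order_refl assms(2)])
  have d: "gdiff ?W z"
    by (rule gCk_Suc_gdiff[OF gCk_real_gform[OF closed_form_smooth[OF closed_forms(1)] assms(1)] assms(2)])
  have "cov_deriv (\<lambda>x v. 0) (\<lambda>z. ?W z ^ k) z = 0" for k
    by (rule cov_deriv_power[where \<alpha> = ?W, OF d gbar_kaehler[OF assms(1) x]])
       (simp add: cov_deriv_zero_connection gext_real_gform[OF closed_forms(1) assms])
  then have p: "gext (\<lambda>z. ?W z ^ k) z = 0" for k by (simp add: cov_deriv_zero_connection)
  have "gext (\<lambda>z. const_form M * ?W z ^ k) z = 0" for M k
    using cov_deriv_mult_even[OF pd_const(1)[of "const_form M" z] pd_power(1)[OF d, of k] gbar_const_form, of "\<lambda>x v. 0"]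
    unfolding cov_deriv_zero_connection by (simp add: p) (simp add: gext_def pd_const)
  then show ?thesis
    unfolding stab_gform_eq
    by (subst gext_sum) (auto intro: pd_mult(1)[OF pd_const(1) pd_power(1)[OF d]])
qed

lemma chern_term_density:
  assumes A: "C2_connection X g A"
  shows "chart_density X (chern_term X \<rho> \<omega> \<upsilon> k A)"
proof (rule densityI)
  fix i assume i: "i < charts X"
  let ?U = "coord X i ` dom X i"
  have "gCk 1 ?U (\<lambda>z. curv_form (local_conn X A i) z)"
    by (rule gCk_curv_form[OF open_chart(2)[OF i]]) (use gCk_local_conn[OF A i] in \<open>simp add: numeral_2_eq_2\<close>)
  then have "gCk 0 ?U (\<lambda>z. curv_form (local_conn X A i) z)" by (rule gCk_le) simp
  then have "gCk 0 ?U (\<lambda>z. stab_gform \<rho> \<omega> i (param X i z) * curv_form (local_conn X A i) z ^ k * real_gform \<upsilon> i (param X i z))"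
    by (intro gCk_mult gCk_power open_chart(2) i gCk_stab_gform gCk_real_gform closed_form_smooth closed_forms)
  from Ck_on_trace_coef[OF open_chart(2)[OF i] this, of complex_frame]
  have "continuous_on ?U (\<lambda>z. trace (coef (stab_gform \<rho> \<omega> i (param X i z) * curv_form (local_conn X A i) z ^ k * real_gform \<upsilon> i (param X i z)) complex_frame))"
    by simp
  then have "continuous_on (dom X i) (\<lambda>x. trace (coef (stab_gform \<rho> \<omega> i (param X i (coord X i x)) *
      curv_form (local_conn X A i) (coord X i x) ^ k * real_gform \<upsilon> i (param X i (coord X i x))) complex_frame))"
    by (rule continuous_on_compose2[OF _ continuous_chart(1)[OF i]]) simp
  then show "continuous_on (dom X i) (chern_term X \<rho> \<omega> \<upsilon> k A i)"
    by (rule continuous_on_eq) (simp add: chern_term_def curvature_eq[OF A i] param_coord[OF i])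
next
  fix i j x assume *: "i < charts X" "j < charts X" "x \<in> dom X i" "x \<in> dom X j"
  let ?a = "\<lambda>i. stab_gform \<rho> \<omega> i x * curv_gform X A i x ^ k * real_gform \<upsilon> i x"
  have E: "curv_gform X A i x ^ k * const_form (g i j x) =
      const_form (g i j x) * gpull (chart_deriv X i (coord X j) x) (curv_gform X A j x ^ k)"
    unfolding gpull_power by (rule power_intertwine[OF curv_gform_transform[OF A *]])
  have "trace (coef (?a i) complex_frame) = trace (coef (?a j) (map (chart_deriv X i (coord X j) x) complex_frame))"
    by (rule conjugate_trace[OF * stab_product_transform[OF *, of "\<lambda>i. curv_gform X A i x ^ k", OF E]])
  also have "\<dots> = jac_det X i j x *\<^sub>R trace (coef (?a j) complex_frame)"
  proof (rule alternating_chart_change, rule alternating_form_compose_linear[OF linear_trace])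
    have "galt (?a j)"
      by (intro galt_mult galt_power galt_stab_gform galt_curv_gform galt_real_gform closed_form_smooth closed_forms A *)
    then show "alternating_form (coef (?a j))" by (simp add: galt_def)
  qed
  finally show "chern_term X \<rho> \<omega> \<upsilon> k A i x = \<bar>jac_det X i j x\<bar> *\<^sub>R chern_term X \<rho> \<omega> \<upsilon> k A j x"
    using jac_det_pos[OF *] by (simp add: chern_term_def)
qed

end

context kaehler_bundle
begin

subsection \<open>Deformation of connections\<close>

lemma chern_term_integral_step:
  assumes A: "C2_connection X g A" and B: "C2_connection X g B"
    and m: "m < charts X" and K: "compact K" "K \<subseteq> coord X m ` dom X m"
    and agree: "\<And>i x. i < charts X \<Longrightarrow> x \<in> dom X i \<Longrightarrow> x \<notin> param X m ` K \<Longrightarrow> A i x = B i x"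
  shows "density_integral X (chern_term X \<rho> \<omega> \<upsilon> k A) = density_integral X (chern_term X \<rho> \<omega> \<upsilon> k B)"
proof -
  let ?T = "chern_term X \<rho> \<omega> \<upsilon> k" and ?U = "coord X m ` dom X m"
  define D where "D = (\<lambda>i x. ?T B i x + - ?T A i x)"
  note dA = chern_term_density[OF A, of k] and dB = chern_term_density[OF B, of k]
  note bl = bounded_linear_minus[OF bounded_linear_ident, where 'b = complex]
  have dD: "chart_density X D" unfolding D_def by (rule density_add[OF dB density_linear[OF bl dA]])
  have ID: "density_integral X D = density_integral X (?T B) - density_integral X (?T A)"
    unfolding D_def by (simp only: density_integral_add[OF dB density_linear[OF bl dA]] density_integral_linear[OF bl dA]) simp
  have closed: "closed (param X m ` K)" by (rule compact_param_image(2)[OF m K])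
  have KU: "param X m ` K \<subseteq> dom X m" using K(2) param_image[OF m order_refl] by blast
  have D0: "D i x = 0" if "i < charts X" "x \<in> dom X i" "x \<notin> param X m ` K" for i x
  proof -
    \<comment> \<open>Curvature involves a derivative, so agreement of the connections is needed on
      a neighbourhood; the complement of the closed image of \<open>K\<close> is one.\<close>
    have "curvature X A i x = curvature X B i x"
      by (rule curvature_cong[OF that(1), of "dom X i - param X m ` K"])
         (use that agree open_chart(1)[OF that(1)] closed in auto)
    then show ?thesis by (simp add: D_def chern_term_def curv_gform_def)
  qed
  have "density_integral X D = chart_integral X D m (dom X m)"
    by (rule density_integral_supported[OF dD m]) (use D0 KU in blast)
  also have "\<dots> = integral\<^sup>L lborel (\<lambda>z. if z \<in> ?U then D m (param X m z) else 0)"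
    unfolding chart_integral_def set_lebesgue_integral_def
    by (intro Bochner_Integration.integral_cong refl) simp
  also have "\<dots> = 0"
  proof -
    define a where "a = (\<lambda>z b. local_conn X B m z b - local_conn X A m z b)"
    let ?q = "\<lambda>C z. trace (coef (scalar_form (stability_form \<rho> \<omega> m (param X m z)) * curv_form C z ^ k *
        scalar_form (\<lambda>vs. of_real (\<upsilon> m (param X m z) vs)) :: (complex ^ 'n, 'r) gform) complex_frame)"
    have Ba: "(\<lambda>z b. local_conn X A m z b + a z b) = local_conn X B m" by (simp add: a_def fun_eq_iff)
    have x: "param X m z \<in> dom X m" if "z \<in> ?U" for z by (rule param_image[OF m order_refl that])
    have "integral\<^sup>L lborel (\<lambda>z. if z \<in> ?U then ?q (\<lambda>z b. local_conn X A m z b + a z b) z - ?q (local_conn X A m) z else 0) = 0"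
    proof (rule chern_weil_local(2)[OF open_chart(2)[OF m] K])
      show "Ck_on 2 ?U (\<lambda>z. local_conn X A m z b)" for b by (rule C2_connectionD(2)[OF A m])
      show "Ck_on 2 ?U (\<lambda>z. a z b)" for b
        unfolding a_def by (rule Ck_on_diff[OF open_chart(2)[OF m] C2_connectionD(2)[OF B m] C2_connectionD(2)[OF A m]])
      show "a z b = 0" if z: "z \<in> ?U - K" for z b
      proof -
        have "param X m z \<notin> param X m ` K"
        proof
          assume "param X m z \<in> param X m ` K"
          then obtain w where "w \<in> K" "param X m z = param X m w" by blast
          then have "z = w" using coord_param[OF m, of z] coord_param[OF m, of w] z K(2) by auto
          then show False using z \<open>w \<in> K\<close> by blast
        qed
        from agree[OF m x this] z show ?thesis by (simp add: a_def local_conn_def)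
      qed
      show "gCk 1 ?U (\<lambda>z. scalar_form (stability_form \<rho> \<omega> m (param X m z)) :: (complex ^ 'n, 'r) gform)"
        using gCk_stab_gform[OF m] unfolding stab_gform_def .
      show "gext (\<lambda>z. scalar_form (stability_form \<rho> \<omega> m (param X m z))) z = (0 :: (complex ^ 'n, 'r) gform)" if "z \<in> ?U" for z
        using gext_stab_gform[OF m that] unfolding stab_gform_def .
      show "gbar (scalar_form (stability_form \<rho> \<omega> m (param X m z))) =
          (scalar_form (stability_form \<rho> \<omega> m (param X m z)) :: (complex ^ 'n, 'r) gform)" if "z \<in> ?U" for z
        using gbar_stab_gform[OF m x[OF that]] unfolding stab_gform_def .
      show "gCk 1 ?U (\<lambda>z. scalar_form (\<lambda>vs. of_real (\<upsilon> m (param X m z) vs)) :: (complex ^ 'n, 'r) gform)"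
        using gCk_real_gform[OF closed_form_smooth[OF closed_forms(2)] m] unfolding real_gform_def .
      show "gext (\<lambda>z. scalar_form (\<lambda>vs. of_real (\<upsilon> m (param X m z) vs))) z = (0 :: (complex ^ 'n, 'r) gform)" if "z \<in> ?U" for z
        using gext_real_gform[OF closed_forms(2) m that] unfolding real_gform_def .
    qed
    moreover have "D m (param X m z) = ?q (\<lambda>z b. local_conn X A m z b + a z b) z - ?q (local_conn X A m) z" if "z \<in> ?U" for z
      unfolding Ba D_def chern_term_def stab_gform_def real_gform_def curvature_eq[OF A m x[OF that]] curvature_eq[OF B m x[OF that]]
        coord_param[OF m that] by simp
    then have eq: "(\<lambda>z. if z \<in> ?U then D m (param X m z) else 0) =
        (\<lambda>z. if z \<in> ?U then ?q (\<lambda>z b. local_conn X A m z b + a z b) z - ?q (local_conn X A m) z else 0)"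
      by (simp only: fun_eq_iff split: if_split) blast
    ultimately show ?thesis unfolding eq by blast
  qed
  finally show ?thesis using ID by simp
qed

text \<open>The inhomogeneous terms cancel in the difference of two connections, which can therefore
  be scaled by a function.\<close>

lemma C2_connection_interpolate:
  assumes A: "C2_connection X g A" and B: "C2_connection X g B"
    and \<psi>: "\<And>i. i < charts X \<Longrightarrow> Ck_on 2 (coord X i ` dom X i) (\<lambda>z. \<psi> (param X i z))"
  shows "C2_connection X g (\<lambda>i x v. A i x v + \<psi> x *\<^sub>R (B i x v - A i x v))"
  unfolding C2_connection_def
proof (intro allI impI conjI ballI)
  fix i assume i: "i < charts X"
  show "linear (\<lambda>v. A i x v + \<psi> x *\<^sub>R (B i x v - A i x v))" if "x \<in> dom X i" for x
    by (intro linear_compose_add linear_compose_scale_right linear_compose_sub C2_connectionD(1)[OF A i that] C2_connectionD(1)[OF B i that])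
  show "Ck_on 2 (coord X i ` dom X i) (\<lambda>z. A i (param X i z) v + \<psi> (param X i z) *\<^sub>R (B i (param X i z) v - A i (param X i z) v))" for v
    using C2_connectionD(2)[OF A i, of v] C2_connectionD(2)[OF B i, of v] unfolding local_conn_def
    by (intro Ck_on_add Ck_on_scaleR Ck_on_diff open_chart(2) i \<psi>)
  fix j x v assume j: "j < charts X" and x: "x \<in> dom X i \<inter> dom X j"
  let ?L = "chart_deriv X i (coord X j) x"
  have a: "g i j x ** A j x (?L v) = A i x v ** g i j x + chart_deriv X i (g i j) x v"
    and b: "g i j x ** B j x (?L v) = B i x v ** g i j x + chart_deriv X i (g i j) x v"
    using C2_connectionD(4)[OF A i j, of x v] C2_connectionD(4)[OF B i j, of x v] x by auto
  show "g i j x ** (A j x (?L v) + \<psi> x *\<^sub>R (B j x (?L v) - A j x (?L v))) =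
      (A i x v + \<psi> x *\<^sub>R (B i x v - A i x v)) ** g i j x + chart_deriv X i (g i j) x v"
    by (simp add: matrix_bilinear bilinear_lmul[OF bilinear_matrix_mult] bilinear_rmul[OF bilinear_matrix_mult] a b)
qed

lemma chern_term_integral_invariant:
  assumes A: "C2_connection X g A" and B: "C2_connection X g B"
  shows "density_integral X (chern_term X \<rho> \<omega> \<upsilon> k A) = density_integral X (chern_term X \<rho> \<omega> \<upsilon> k B)"
proof -
  let ?I = "\<lambda>C. density_integral X (chern_term X \<rho> \<omega> \<upsilon> k C)"
  obtain P where P: "finite P" "\<And>m z r. (m, z, r) \<in> P \<Longrightarrow> m < charts X \<and> r > 0 \<and> cball z (2 * r) \<subseteq> coord X m ` dom X m"
    "\<And>x. \<exists>(m, z, r)\<in>P. x \<in> param X m ` ball z r" by (rule finite_ball_cover, rule that)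
  \<comment> \<open>Induction over the balls already treated: there \<open>C\<close> agrees with
    \<open>B\<close>, and since every step interpolates towards \<open>B\<close>, agreement once
    reached is kept.\<close>
  have "\<exists>C. C2_connection X g C \<and> ?I C = ?I A \<and>
      (\<forall>i<charts X. \<forall>x\<in>dom X i. (\<exists>(m, z, r)\<in>Q. x \<in> param X m ` ball z r) \<longrightarrow> C i x = B i x)" if "Q \<subseteq> P" for Q
    using finite_subset[OF that P(1)] that
  proof (induction Q)
    case empty
    then show ?case using A by auto
  next
    case (insert p Q)
    then obtain C where C: "C2_connection X g C" "?I C = ?I A"
      "\<And>i x. i < charts X \<Longrightarrow> x \<in> dom X i \<Longrightarrow> \<exists>(m, z, r)\<in>Q. x \<in> param X m ` ball z r \<Longrightarrow> C i x = B i x"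
      by auto
    obtain m z r where p: "p = (m, z, r)" by (cases p)
    have m: "m < charts X" "r > 0" "cball z (2 * r) \<subseteq> coord X m ` dom X m" using P(2) insert.prems p by blast+
    obtain \<psi> :: "'x \<Rightarrow> real" where \<psi>: "\<And>i. i < charts X \<Longrightarrow> Ck_on 2 (coord X i ` dom X i) (\<lambda>z. \<psi> (param X i z))"
      "\<And>x. x \<in> param X m ` ball z r \<Longrightarrow> \<psi> x = 1" "\<And>x. x \<notin> param X m ` cball z (2 * r) \<Longrightarrow> \<psi> x = 0"
      by (rule chart_bump[OF m], rule that)
    define C' where "C' = (\<lambda>i x v. C i x v + \<psi> x *\<^sub>R (B i x v - C i x v))"
    have C': "C2_connection X g C'" unfolding C'_def by (rule C2_connection_interpolate[OF C(1) B \<psi>(1)])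
    have "?I C = ?I C'"
      by (rule chern_term_integral_step[OF C(1) C' m(1) compact_cball m(3)]) (simp add: C'_def \<psi>(3))
    moreover have "C' i x = B i x" if "i < charts X" "x \<in> dom X i" "\<exists>(m, z, r)\<in>insert p Q. x \<in> param X m ` ball z r" for i x
    proof (cases "x \<in> param X m ` ball z r")
      case True
      then show ?thesis by (simp add: C'_def \<psi>(2))
    next
      case False
      then have "C i x = B i x" using that p by (intro C(3)) auto
      then show ?thesis by (simp add: C'_def)
    qed
    ultimately show ?case using C' C(2) by (intro exI[of _ C'] conjI allI impI ballI) simp_all
  qed
  from this[OF order_refl] obtain C where C: "C2_connection X g C" "?I C = ?I A"
    "\<And>i x. i < charts X \<Longrightarrow> x \<in> dom X i \<Longrightarrow> C i x = B i x" using P(3) by metis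
  obtain m where m: "m < charts X" using charts_cover[of undefined] by blast
  \<comment> \<open>\<open>C\<close> and \<open>B\<close> agree on all chart domains but may differ
    as functions outside them; a step with empty support exchanges one for the other.\<close>
  have "?I C = ?I B" by (rule chern_term_integral_step[OF C(1) B m compact_empty]) (use C(3) in auto)
  then show ?thesis using C(2) by simp
qed

end

subsection \<open>The Chern connection\<close>

lemma Ck_on_det:
  fixes M :: "'a::real_normed_vector \<Rightarrow> complex ^ 'r ^ 'r::finite"
  assumes "open S" "\<And>i j. Ck_on k S (\<lambda>x. M x $ i $ j)"
  shows "Ck_on k S (\<lambda>x. det (M x))"
  unfolding det_def by (intro Ck_on_sum Ck_on_mult Ck_on_const Ck_on_prod assms)

text \<open>Solving for a column of the inverse exhibits its entries as quotients of determinants,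
  whose regularity follows from that of the entries of \<open>M\<close>.\<close>

lemma matrix_inv_cramer:
  fixes M :: "complex ^ 'r ^ 'r::finite"
  assumes "invertible M"
  shows "matrix_inv M $ a $ b = det (\<chi> i j. if j = a then (if i = b then 1 else 0) else M $ i $ j) * inverse (det M)"
proof -
  have d: "det M \<noteq> 0" using assms by (simp add: invertible_det_nz)
  have "M *v column b (matrix_inv M) = column b (M ** matrix_inv M)"
    by (simp add: matrix_vector_mult_def column_def matrix_matrix_mult_def vec_eq_iff)
  also have "\<dots> = (\<chi> i. if i = b then 1 else 0)"
    by (simp add: matrix_inv_left_right[OF assms] column_def mat_def)
  finally have "column b (matrix_inv M) =
      (\<chi> k. det (\<chi> i j. if j = k then (\<chi> i. if i = b then 1 else 0) $ i else M $ i $ j) / det M)"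
    unfolding cramer[OF d] .
  then have "column b (matrix_inv M) $ a = det (\<chi> i j. if j = a then (if i = b then 1 else 0) else M $ i $ j) / det M"
    by (simp cong: if_cong)
  then show ?thesis by (simp add: column_def divide_inverse)
qed

lemma Ck_on_matrix_inv:
  fixes M :: "'a::real_normed_vector \<Rightarrow> complex ^ 'r ^ 'r::finite"
  assumes S: "open S" and M: "Ck_on k S M" and inv: "\<And>x. x \<in> S \<Longrightarrow> invertible (M x)"
  shows "Ck_on k S (\<lambda>x. matrix_inv (M x))"
proof (rule Ck_on_vec_lambda[OF S], rule Ck_on_vec_lambda[OF S])
  fix a b
  have ent: "Ck_on k S (\<lambda>x. M x $ i $ j)" for i j
    by (rule Ck_on_vec_nth[OF S Ck_on_vec_nth[OF S M]])
  have "Ck_on k S (\<lambda>x. (\<chi> i j. if j = a then (if i = b then 1 else 0) else M x $ i $ j) $ i $ j)" for i j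
    using ent by (cases "j = a") simp_all
  then have "Ck_on k S (\<lambda>x. det (\<chi> i j. if j = a then (if i = b then 1 else 0) else M x $ i $ j))"
    by (rule Ck_on_det[OF S])
  moreover have "Ck_on k S (\<lambda>x. inverse (det (M x)))"
    by (rule Ck_on_inverse[OF S Ck_on_det[OF S ent]]) (use inv in \<open>simp add: invertible_det_nz\<close>)
  ultimately have "Ck_on k S (\<lambda>x. det (\<chi> i j. if j = a then (if i = b then 1 else 0) else M x $ i $ j) * inverse (det (M x)))"
    by (rule Ck_on_mult[OF S])
  then show "Ck_on k S (\<lambda>x. matrix_inv (M x) $ a $ b)"
    by (rule Ck_on_cong[OF S, rotated]) (simp add: matrix_inv_cramer[OF inv])
qed

lemma mult_mat_mult: "N ** (mat c ** M) = mat c ** (N ** M)" for M N :: "complex ^ 'r ^ 'r::finite"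
  using mat_mult_commute[of c N] by (simp add: matrix_mul_assoc)

lemma mat_mult_mat_mult: "mat c ** (mat d ** M) = mat (c * d) ** M" for M :: "complex ^ 'r ^ 'r::finite"
  by (simp only: matrix_mul_assoc mat_mult_mat)

lemma conj_transpose_mat_mult: "conj_transpose (mat c ** M) = mat (cnj c) ** conj_transpose M"
  by (simp only: conj_transpose_mult conj_transpose_mat mat_mult_commute)

text \<open>Here \<open>a\<close> and \<open>b\<close> are the derivatives of the metric along v and
  i v, and \<open>d\<close> that of the holomorphic transition function. Terms with the conjugate of
  \<open>d\<close> cancel because -i times the conjugate of i is -1; terms with \<open>d\<close>
  double because -i times i is 1.\<close>

lemma chern_connection_transform_matrix:
  fixes G H a b d :: "complex ^ 'r ^ 'r::finite"
  shows "(conj_transpose d ** H ** G + conj_transpose G ** a ** G + conj_transpose G ** H ** d) -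
      mat \<i> ** (conj_transpose (mat \<i> ** d) ** H ** G + conj_transpose G ** b ** G + conj_transpose G ** H ** (mat \<i> ** d)) =
    conj_transpose G ** ((a - mat \<i> ** b) ** G + (H ** d + H ** d))"
proof -
  \<comment> \<open>Left multiplication by \<open>mat c\<close> under its own name, so that it can
    be moved through products like a scalar.\<close>
  define s :: "complex \<Rightarrow> complex ^ 'r ^ 'r \<Rightarrow> complex ^ 'r ^ 'r" where "s = (\<lambda>c M. mat c ** M)"
  have fold: "mat c ** M = s c M" for c M by (simp add: s_def)
  have s: "N ** s c M = s c (N ** M)" "s c N ** M = s c (N ** M)" "s c (s e M) = s (c * e) M"
    "s c (M + N) = s c M + s c N" "s c (M - N) = s c M - s c N"
    "conj_transpose (s c M) = s (cnj c) (conj_transpose M)" "s (- 1) M = - M" "s 1 M = M" for c e N M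
    using mult_mat_mult[of N c M] mat_mult_mat_mult[of c e M] conj_transpose_mat_mult[of c M]
    by (simp_all add: s_def matrix_mul_assoc matrix_bilinear vec_eq_iff mat_mult_nth)
  have two: "N ** (2 * M) = 2 * (N ** M)" for N M :: "complex ^ 'r ^ 'r"
    by (simp only: mult_2 matrix_bilinear)
  show ?thesis unfolding fold by (simp add: matrix_bilinear s matrix_mul_assoc two)
qed

context kaehler_bundle
begin

lemma metricD:
  assumes "i < charts X"
  shows "Ck_on k (coord X i ` dom X i) (\<lambda>z. h i (param X i z))"
    "x \<in> dom X i \<Longrightarrow> pos_hermitian (h i x)"
    "j < charts X \<Longrightarrow> x \<in> dom X i \<Longrightarrow> x \<in> dom X j \<Longrightarrow> h j x = conj_transpose (g i j x) ** h i x ** g i j x"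
proof -
  show "Ck_on k (coord X i ` dom X i) (\<lambda>z. h i (param X i z))"
    using metric assms unfolding hermitian_metric_def chart_smooth_def o_def by (blast intro: smooth_on_Ck)
  show "x \<in> dom X i \<Longrightarrow> pos_hermitian (h i x)"
    using metric assms unfolding hermitian_metric_def pos_hermitian_def by blast
  show "j < charts X \<Longrightarrow> x \<in> dom X i \<Longrightarrow> x \<in> dom X j \<Longrightarrow> h j x = conj_transpose (g i j x) ** h i x ** g i j x"
    using metric assms unfolding hermitian_metric_def by blast
qed

lemma Ck_on_metric_inv:
  assumes "i < charts X"
  shows "Ck_on k (coord X i ` dom X i) (\<lambda>z. matrix_inv (h i (param X i z)))"
  by (rule Ck_on_matrix_inv[OF open_chart(2)[OF assms] metricD(1)[OF assms]])
     (use pos_hermitian_invertible metricD(2)[OF assms] param_image[OF assms order_refl] in blast)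

lemma transition_complex_linear:
  assumes ij: "i < charts X" "j < charts X" and x: "x \<in> dom X i" "x \<in> dom X j"
  shows "chart_deriv X i (coord X j) x (\<i> *s v) = \<i> *s chart_deriv X i (coord X j) x v"
proof -
  have d: "(\<lambda>z. coord X j (param X i z)) differentiable (at (coord X i x))"
    using has_derivative_transition[OF ij, of x] x unfolding differentiable_def by blast
  have "chart_deriv X i (\<lambda>x. coord X j x $ a) x w = chart_deriv X i (coord X j) x w $ a" for a w
    using frechet_derivative_vec_nth[OF d, of a w] by (simp add: chart_deriv_def o_def)
  moreover have "chart_deriv X i (\<lambda>x. coord X j x $ a) x (\<i> *s v) = \<i> * chart_deriv X i (\<lambda>x. coord X j x $ a) x v" for a
    using manifold ij x unfolding compact_complex_manifold_def chart_holomorphic_def by blast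
  ultimately show ?thesis by (simp add: vec_eq_iff)
qed

lemma transition_function_complex_linear:
  assumes ij: "i < charts X" "j < charts X" and x: "x \<in> dom X i" "x \<in> dom X j"
  shows "chart_deriv X i (g i j) x (\<i> *s v) = mat \<i> ** chart_deriv X i (g i j) x v"
proof -
  have d: "(\<lambda>z. g i j (param X i z)) differentiable (at (coord X i x))"
    using Ck_on_Suc_differentiable[OF Ck_on_transition_function[OF ij]] x by blast
  have d': "(\<lambda>z. g i j (param X i z) $ a) differentiable (at (coord X i x))" for a
    using bounded_linear.has_derivative[OF bounded_linear_vec_nth frechet_derivative_has_derivative[OF d]]
    unfolding differentiable_def by blast
  have "chart_deriv X i (\<lambda>x. g i j x $ a $ b) x w = chart_deriv X i (g i j) x w $ a $ b" for a b w
    using frechet_derivative_vec_nth[OF d'[of a], of b w] frechet_derivative_vec_nth[OF d, of a w]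
    by (simp add: chart_deriv_def o_def)
  moreover have "chart_deriv X i (\<lambda>x. g i j x $ a $ b) x (\<i> *s v) = \<i> * chart_deriv X i (\<lambda>x. g i j x $ a $ b) x v" for a b
    using hol_bundle ij x unfolding holomorphic_bundle_def chart_holomorphic_def by blast
  ultimately show ?thesis by (simp add: vec_eq_iff mat_mult_nth)
qed

lemma metric_derivative_transform:
  assumes ij: "i < charts X" "j < charts X" and x: "x \<in> dom X i" "x \<in> dom X j"
  shows "chart_deriv X j (h j) x (chart_deriv X i (coord X j) x v) =
    conj_transpose (chart_deriv X i (g i j) x v) ** h i x ** g i j x +
    conj_transpose (g i j x) ** chart_deriv X i (h i) x v ** g i j x +
    conj_transpose (g i j x) ** h i x ** chart_deriv X i (g i j) x v"
proof -
  let ?z = "coord X i x" and ?U = "coord X i ` (dom X i \<inter> dom X j)"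
  let ?G = "\<lambda>z. g i j (param X i z)" and ?H = "\<lambda>z. h i (param X i z)"
  have z: "?z \<in> ?U" using x by blast
  have px: "param X i ?z = x" by (rule param_coord[OF ij(1) x(1)])
  have xx: "x \<in> dom X i \<inter> dom X j" using x by blast
  have hj: "(h j \<circ> param X j) differentiable (at (coord X j x))"
    using Ck_on_Suc_differentiable[OF metricD(1)[OF ij(2)]] x unfolding o_def by blast
  have dG: "?G differentiable (at ?z)" by (rule Ck_on_Suc_differentiable[OF Ck_on_transition_function[OF ij] z])
  have dH: "?H differentiable (at ?z)" using Ck_on_Suc_differentiable[OF metricD(1)[OF ij(1)]] x by blast
  let ?dG = "frechet_derivative ?G (at ?z)" and ?dH = "frechet_derivative ?H (at ?z)"
  note bm = bounded_bilinear_matrix_mult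
  have bc: "bounded_linear (conj_transpose :: complex ^ 'r ^ 'r \<Rightarrow> _)"
    using linear_conj_transpose linear_conv_bounded_linear by blast
  have "((\<lambda>z. conj_transpose (?G z) ** ?H z ** ?G z) has_derivative
      (\<lambda>v. (conj_transpose (?G ?z) ** ?H ?z) ** ?dG v +
        (conj_transpose (?G ?z) ** ?dH v + conj_transpose (?dG v) ** ?H ?z) ** ?G ?z)) (at ?z)"
    by (intro bounded_bilinear.FDERIV[OF bm] bounded_linear.has_derivative[OF bc] frechet_derivative_has_derivative dG dH)
  then have "((h j \<circ> param X i) has_derivative
      (\<lambda>v. (conj_transpose (?G ?z) ** ?H ?z) ** ?dG v +
        (conj_transpose (?G ?z) ** ?dH v + conj_transpose (?dG v) ** ?H ?z) ** ?G ?z)) (at ?z)"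
  proof (rule has_derivative_transform_within_open[OF _ open_overlap[OF ij] z])
    show "conj_transpose (?G z) ** ?H z ** ?G z = (h j \<circ> param X i) z" if "z \<in> ?U" for z
    proof -
      have "param X i z \<in> dom X i \<inter> dom X j" by (rule param_image[OF ij(1) _ that]) blast
      then show ?thesis using metricD(3)[OF ij(1) ij(2)] by simp
    qed
  qed
  from frechet_derivative_eqI[OF this, THEN fun_cong, of v]
  have "chart_deriv X i (h j) x v = (conj_transpose (g i j x) ** h i x) ** chart_deriv X i (g i j) x v +
        (conj_transpose (g i j x) ** chart_deriv X i (h i) x v + conj_transpose (chart_deriv X i (g i j) x v) ** h i x) ** g i j x"
    by (simp add: chart_deriv_def px o_def)
  then show ?thesis
    unfolding chart_deriv_chain(1)[OF ij xx hj, symmetric] by (simp add: matrix_bilinear matrix_mul_assoc add_ac)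
qed

lemma metric_inv_transform:
  assumes ij: "i < charts X" "j < charts X" and x: "x \<in> dom X i" "x \<in> dom X j"
  shows "g i j x ** matrix_inv (h j x) ** conj_transpose (g i j x) = matrix_inv (h i x)"
proof -
  note inv = transition_invertible[OF ij x]
  have h: "invertible (h i x)" "invertible (h j x)" using pos_hermitian_invertible metricD(2) ij x by blast+
  have "h i x ** (g i j x ** matrix_inv (h j x) ** conj_transpose (g i j x)) =
      (conj_transpose (g j i x) ** conj_transpose (g i j x)) ** h i x ** (g i j x ** matrix_inv (h j x) ** conj_transpose (g i j x))"
    by (simp add: conj_transpose_mult[symmetric] inv conj_transpose_mat)
  also have "\<dots> = conj_transpose (g j i x) ** ((conj_transpose (g i j x) ** h i x ** g i j x) ** matrix_inv (h j x)) ** conj_transpose (g i j x)"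
    by (simp add: matrix_mul_assoc)
  also have "\<dots> = mat 1"
    unfolding metricD(3)[OF ij(1) ij(2) x, symmetric] matrix_inv_left_right[OF h(2)]
    by (simp add: conj_transpose_mult[symmetric] inv conj_transpose_mat)
  finally show ?thesis by (rule matrix_inv_unique[symmetric])
qed

text \<open>This is the reference connection that defines Z(E). Its inhomogeneous term comes from
  the doubled term of \<open>chern_connection_transform_matrix\<close>: the factor 1/2 and the
  inverse metric reduce it to the derivative of \<open>g i j\<close>.\<close>

lemma chern_connection_C2: "C2_connection X g (chern_connection X h)"
  unfolding C2_connection_def
proof (intro allI impI conjI ballI)
  fix i assume i: "i < charts X"
  let ?U = "coord X i ` dom X i"
  have dh: "(h i \<circ> param X i) differentiable (at (coord X i x))" if "x \<in> dom X i" for x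
    using Ck_on_Suc_differentiable[OF metricD(1)[OF i]] that unfolding o_def by blast
  show "linear (chern_connection X h i x)" if x: "x \<in> dom X i" for x
  proof -
    have l: "linear (chart_deriv X i (h i) x)"
      unfolding chart_deriv_def[abs_def] by (rule linear_frechet_derivative[OF dh[OF x]])
    have l2: "linear (\<lambda>v. chart_deriv X i (h i) x (\<i> *s v))"
      using linear_compose[OF linear_ii l] by (simp add: o_def)
    have ml: "linear ((**) M :: complex ^ 'r ^ 'r \<Rightarrow> _)" for M :: "complex ^ 'r ^ 'r"
      by (rule bilinear_matrix_mult[unfolded bilinear_def, THEN conjunct1, THEN spec])
    have "linear (\<lambda>v. chart_deriv X i (h i) x v - mat \<i> ** chart_deriv X i (h i) x (\<i> *s v))"
      using linear_compose[OF l2 ml] by (intro linear_compose_sub l) (simp add: o_def)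
    from linear_compose[OF this ml, of "matrix_inv (h i x) ** mat (1 / 2)"]
    show ?thesis unfolding chern_connection_def[abs_def] by (simp add: o_def)
  qed
  show "Ck_on 2 ?U (\<lambda>z. chern_connection X h i (param X i z) v)" for v
  proof -
    have fd: "Ck_on 2 ?U (\<lambda>z. frechet_derivative (\<lambda>z. h i (param X i z)) (at z) w)" for w
      by (rule Ck_on_frechet_derivative[OF metricD(1)[OF i]])
    have "Ck_on 2 ?U (\<lambda>z. matrix_inv (h i (param X i z)) ** mat (1 / 2) **
        (frechet_derivative (\<lambda>z. h i (param X i z)) (at z) v - mat \<i> ** frechet_derivative (\<lambda>z. h i (param X i z)) (at z) (\<i> *s v)))"
      by (rule Ck_on_bilinear[OF open_chart(2)[OF i] bounded_bilinear_matrix_mult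
            Ck_on_bilinear[OF open_chart(2)[OF i] bounded_bilinear_matrix_mult Ck_on_metric_inv[OF i] Ck_on_const]
            Ck_on_diff[OF open_chart(2)[OF i] fd
              Ck_on_bilinear[OF open_chart(2)[OF i] bounded_bilinear_matrix_mult Ck_on_const fd]]])
    then show ?thesis
      by (rule Ck_on_cong[OF open_chart(2)[OF i], rotated]) (simp only: chern_connection_def chart_deriv_def o_def coord_param[OF i])
  qed
  fix j x v assume j: "j < charts X" and "x \<in> dom X i \<inter> dom X j"
  then have x: "x \<in> dom X i" "x \<in> dom X j" by auto
  let ?L = "chart_deriv X i (coord X j) x" and ?G = "g i j x" and ?H = "h i x"
  let ?d = "chart_deriv X i (g i j) x v" and ?a = "chart_deriv X i (h i) x v" and ?b = "chart_deriv X i (h i) x (\<i> *s v)"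
  have iL: "\<i> *s ?L v = ?L (\<i> *s v)" by (rule transition_complex_linear[OF i j x, symmetric])
  have half: "mat (1 / 2) ** (M + M) = (M :: complex ^ 'r ^ 'r)" for M
    by (simp add: vec_eq_iff mat_mult_nth)
  have D: "chart_deriv X j (h j) x (?L v) - mat \<i> ** chart_deriv X j (h j) x (\<i> *s ?L v) =
      conj_transpose ?G ** ((?a - mat \<i> ** ?b) ** ?G + (?H ** ?d + ?H ** ?d))"
    unfolding iL metric_derivative_transform[OF i j x] transition_function_complex_linear[OF i j x]
    by (rule chern_connection_transform_matrix)
  have hi: "invertible (h i x)" by (rule pos_hermitian_invertible[OF metricD(2)[OF i x(1)]])
  have "?G ** chern_connection X h j x (?L v) =
      (?G ** matrix_inv (h j x) ** conj_transpose ?G) ** (mat (1 / 2) ** ((?a - mat \<i> ** ?b) ** ?G + (?H ** ?d + ?H ** ?d)))"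
    unfolding chern_connection_def matrix_mul_assoc[symmetric] D mult_mat_mult[of "conj_transpose ?G"] ..
  also have "\<dots> = matrix_inv (h i x) ** (mat (1 / 2) ** ((?a - mat \<i> ** ?b) ** ?G) + ?H ** ?d)"
    unfolding metric_inv_transform[OF i j x] bilinear_radd[OF bilinear_matrix_mult, of "mat (1 / 2)" "(?a - mat \<i> ** ?b) ** ?G"] half ..
  also have "\<dots> = chern_connection X h i x v ** ?G + (matrix_inv (h i x) ** ?H) ** ?d"
    unfolding chern_connection_def by (simp add: matrix_bilinear matrix_mul_assoc)
  finally show "?G ** chern_connection X h j x (?L v) = chern_connection X h i x v ** ?G + ?d"
    by (simp add: matrix_inv_left_right[OF hi])
qed

end

section \<open>The lower bound of the Z-Yang--Mills functional\<close>

lemma wedge_power_degree: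
  fixes \<Omega> :: "'v list \<Rightarrow> real"
  assumes "\<And>vs. length vs \<noteq> 2 \<Longrightarrow> \<Omega> vs = 0" "length vs \<noteq> 2 * k"
  shows "wedge_power (*) 1 \<Omega> k vs = 0"
  using assms(2)
proof (induction k arbitrary: vs)
  case (Suc k)
  have "\<Omega> (nths vs S) * wedge_power (*) 1 \<Omega> k (nths vs (- S)) = 0" for S
    using length_nths_complement[of vs S] Suc.prems assms(1)[of "nths vs S"] Suc.IH[of "nths vs (- S)"]
    by (cases "length (nths vs S) = 2") auto
  then show ?case unfolding wedge_power.simps wedge_def by (simp only:) simp
qed auto

lemma continuous_on_wedge_power:
  fixes f :: "'a::topological_space \<Rightarrow> 'v list \<Rightarrow> real"
  assumes "\<And>vs. continuous_on S (\<lambda>x. f x vs)"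
  shows "continuous_on S (\<lambda>x. wedge_power (*) 1 (f x) k vs)"
proof (induction k arbitrary: vs)
  case (Suc k)
  show ?case unfolding wedge_power.simps wedge_def by (intro continuous_intros assms Suc)
qed simp

lemma mat_scaleR_one: "mat (complex_of_real c) = c *\<^sub>R (mat 1 :: complex ^ 'r ^ 'r::finite)"
  using mat_of_real_mult[of c "mat 1"] by simp

lemma trace_mat: "trace (mat c :: complex ^ 'r ^ 'r::finite) = of_nat CARD('r) * c"
  by (simp add: trace_def mat_def)

lemma Re_wrt_Im_wrt: "T = Re_wrt H T + mat \<i> ** Im_wrt H T"
  by (simp add: Re_wrt_def Im_wrt_def vec_eq_iff mat_mult_nth field_simps)

context
  fixes H :: "complex ^ 'r ^ 'r::finite"
  assumes H: "invertible H"
begin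

lemma adj_wrt_mat: "adj_wrt H (mat c) = mat (cnj c)"
proof -
  have "adj_wrt H (mat c) = mat (cnj c) ** (matrix_inv H ** H)"
    by (simp only: adj_wrt_def conj_transpose_mat mat_mult_commute[of "cnj c" "matrix_inv H", symmetric] matrix_mul_assoc)
  then show ?thesis by (simp add: matrix_inv_left_right[OF H])
qed

lemma adj_wrt_diff: "adj_wrt H (S - T) = adj_wrt H S - adj_wrt H T"
  by (simp add: adj_wrt_def linear_diff[OF linear_conj_transpose] matrix_bilinear)

lemma adj_wrt_mat_mult: "adj_wrt H (mat c ** T) = mat (cnj c) ** adj_wrt H T"
  by (simp add: adj_wrt_def conj_transpose_mat_mult mult_mat_mult matrix_mul_assoc[symmetric])

lemma trace_adj_wrt_cnj: "trace (adj_wrt H T) = cnj (trace T)"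
proof -
  have "trace (adj_wrt H T) = trace (H ** (matrix_inv H ** conj_transpose T))"
    unfolding adj_wrt_def by (rule trace_mul_sym)
  then show ?thesis by (simp add: matrix_mul_assoc matrix_inv_left_right[OF H] trace_conj_transpose)
qed

lemma Re_trace_Re_wrt: "Re (trace (Re_wrt H T)) = Re (trace T)"
  by (simp add: Re_wrt_def trace_mat_mult linear_add[OF linear_trace] trace_adj_wrt_cnj)

lemma Re_wrt_scalar: "Re_wrt H (c *\<^sub>R mat 1) = c *\<^sub>R mat 1" "Im_wrt H (c *\<^sub>R mat 1) = 0"
proof -
  have "adj_wrt H (c *\<^sub>R mat 1) = c *\<^sub>R mat 1"
    unfolding mat_scaleR_one[symmetric] adj_wrt_mat by simp
  then show "Re_wrt H (c *\<^sub>R mat 1) = c *\<^sub>R mat 1" "Im_wrt H (c *\<^sub>R mat 1) = 0"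
    by (simp_all add: Re_wrt_def Im_wrt_def vec_eq_iff mat_mult_nth)
qed

text \<open>Multiplication by \<open>e\<close> of modulus 1 preserves the norm of \<open>T\<close>,
  and the two cross terms are complex conjugate to each other, which leaves twice a real
  part.\<close>

lemma norm_deviation:
  fixes T :: "complex ^ 'r ^ 'r" and c :: real
  assumes "cmod e = 1"
  defines "D \<equiv> mat e ** T - mat (of_real c)"
  shows "Re (trace (D ** adj_wrt H D)) =
    Re (trace (T ** adj_wrt H T)) - 2 * c * Re (e * trace T) + c\<^sup>2 * CARD('r)"
proof -
  have e: "e * cnj e = 1" using assms(1) by (simp add: complex_norm_square[symmetric])
  have 1: "(mat e ** T) ** (mat (cnj e) ** S) = T ** S" for S :: "complex ^ 'r ^ 'r"
  proof -
    have "(mat e ** T) ** (mat (cnj e) ** S) = mat (e * cnj e) ** (T ** S)"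
      by (simp only: mult_mat_mult[of T] mat_mult_mat_mult matrix_mul_assoc[symmetric])
    then show ?thesis by (simp only: e matrix_mul_lid)
  qed
  have "D ** adj_wrt H D = T ** adj_wrt H T - mat (of_real c) ** (mat e ** T) -
      (mat (of_real c) ** (mat (cnj e) ** adj_wrt H T) - mat (of_real c * of_real c))"
    unfolding D_def adj_wrt_diff adj_wrt_mat_mult adj_wrt_mat
    by (simp add: matrix_bilinear 1 mat_mult_mat mat_mult_commute[of _ "mat e ** T"])
  then have "trace (D ** adj_wrt H D) = trace (T ** adj_wrt H T) - of_real c * (e * trace T) -
      (of_real c * (cnj e * cnj (trace T)) - of_nat CARD('r) * (of_real c * of_real c))"
    by (simp only: linear_diff[OF linear_trace] trace_mat_mult trace_adj_wrt_cnj trace_mat)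
  from arg_cong[OF this, of Re] show ?thesis by (simp add: power2_eq_square algebra_simps)
qed

end

lemma form_power_top: "form_power \<omega> CARD('n) i x vs = fact CARD('n) * volume_form (\<omega> :: ('x, 'n::finite, real) form) i x vs"
  by (simp add: volume_form_def)

context kaehler_bundle
begin

text \<open>Z(E) is defined by the Chern connection; invariance of each \<open>chern_term\<close>
  transfers the value to an arbitrary connection.\<close>

lemma trace_Z_form_density:
  assumes B: "C2_connection X g B"
  shows "chart_density X (\<lambda>i x. trace (Z_form X \<rho> \<omega> \<upsilon> B i x complex_frame))" (is ?density)
    "density_integral X (\<lambda>i x. trace (Z_form X \<rho> \<omega> \<upsilon> B i x complex_frame)) = central_charge X h \<rho> \<omega> \<upsilon>" (is ?integral)
proof -
  let ?a = "\<lambda>k. (\<i> / (2 * of_real pi)) ^ k / fact k :: complex"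
  have 1: "chart_density X (\<lambda>i x. \<Sum>k\<le>CARD('n). ?a k * chern_term X \<rho> \<omega> \<upsilon> k C i x) \<and>
      density_integral X (\<lambda>i x. \<Sum>k\<le>CARD('n). ?a k * chern_term X \<rho> \<omega> \<upsilon> k C i x) =
      (\<Sum>k\<le>CARD('n). ?a k * density_integral X (chern_term X \<rho> \<omega> \<upsilon> k C))" if C: "C2_connection X g C" for C
    unfolding density_integral_linear[OF bounded_linear_mult_right chern_term_density[OF C], symmetric]
    by (rule density_sum[OF finite_atMost density_linear[OF bounded_linear_mult_right chern_term_density[OF C]]])
  show ?density using 1[OF B] unfolding trace_Z_form by blast
  have "central_charge X h \<rho> \<omega> \<upsilon> = density_integral X (\<lambda>i x. trace (Z_form X \<rho> \<omega> \<upsilon> (chern_connection X h) i x complex_frame))"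
    unfolding central_charge_def form_integral_eq_density_integral central_charge_integrand ..
  also have "\<dots> = (\<Sum>k\<le>CARD('n). ?a k * density_integral X (chern_term X \<rho> \<omega> \<upsilon> k (chern_connection X h)))"
    unfolding trace_Z_form using 1[OF chern_connection_C2] by blast
  also have "\<dots> = (\<Sum>k\<le>CARD('n). ?a k * density_integral X (chern_term X \<rho> \<omega> \<upsilon> k B))"
    by (simp only: chern_term_integral_invariant[OF chern_connection_C2 B])
  finally show ?integral unfolding trace_Z_form using 1[OF B] by simp
qed

lemma form_power_continuous: "i < charts X \<Longrightarrow> continuous_on (dom X i) (\<lambda>x. form_power \<omega> d i x vs)"
  unfolding form_power_def
  by (rule continuous_on_wedge_power, rule continuous_on_chartI)
     (use smooth_formD(2)[OF closed_form_smooth[OF closed_forms(1)], of _ 0] in simp_all)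

lemma volume_transform:
  assumes "i < charts X" "j < charts X" "x \<in> dom X i" "x \<in> dom X j"
  shows "volume_form \<omega> i x complex_frame = jac_det X i j x * volume_form \<omega> j x complex_frame"
  using form_power_transform[OF assms] by (simp add: volume_form_def)

lemma volume_continuous: "i < charts X \<Longrightarrow> continuous_on (dom X i) (\<lambda>x. volume_form \<omega> i x complex_frame)"
  unfolding volume_form_def by (intro continuous_intros form_power_continuous) simp_all

lemma volume_density: "chart_density X (\<lambda>i x. volume_form \<omega> i x complex_frame)"
proof (rule densityI[OF volume_continuous])
  fix i j x assume "i < charts X" "j < charts X" "x \<in> dom X i" "x \<in> dom X j"
  from volume_transform[OF this] jac_det_pos[OF this]
  show "volume_form \<omega> i x complex_frame = \<bar>jac_det X i j x\<bar> *\<^sub>R volume_form \<omega> j x complex_frame" by simp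
qed

abbreviation "total_volume \<equiv> form_integral X (volume_form \<omega>)"

lemma volume_integral_pos: "total_volume > 0"
proof -
  obtain m x where m: "m < charts X" "x \<in> dom X m" using charts_cover[of undefined] by blast
  have "total_volume \<ge> 0"
    unfolding form_integral_eq_density_integral by (rule density_integral_nonneg) (use volume_positive less_imp_le in blast)
  moreover have "total_volume \<noteq> 0"
  proof
    assume "total_volume = 0"
    then have "volume_form \<omega> m x complex_frame = 0"
      unfolding form_integral_eq_density_integral
      by (intro density_integral_eq_0[OF volume_density _ _ m]) (use volume_positive less_imp_le in blast)+
    then show False using volume_positive[OF m] by simp
  qed
  ultimately show ?thesis by simp
qed

subsection \<open>Endomorphism fields\<close>

text \<open>Continuous sections of End E in local frames; continuity is what
  \<open>chart_density\<close> asks for.\<close>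

definition endo_field :: "(nat \<Rightarrow> 'x \<Rightarrow> complex ^ 'r ^ 'r) \<Rightarrow> bool" where
  "endo_field T \<longleftrightarrow> (\<forall>i<charts X. continuous_on (dom X i) (T i) \<and>
     (\<forall>j<charts X. \<forall>x\<in>dom X i \<inter> dom X j. T i x ** g i j x = g i j x ** T j x))"

lemma endo_fieldD:
  assumes "endo_field T" "i < charts X"
  shows "continuous_on (dom X i) (T i)"
    "j < charts X \<Longrightarrow> x \<in> dom X i \<Longrightarrow> x \<in> dom X j \<Longrightarrow> T i x ** g i j x = g i j x ** T j x"
  using assms unfolding endo_field_def by blast+

text \<open>A change of frame conjugates both an endomorphism and its adjoint by
  \<open>g i j\<close>, so the trace of their product is independent of the chart; the volume form
  contributes the Jacobian.\<close>

lemma norm_density: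
  assumes T: "endo_field T"
  shows "chart_density X (\<lambda>i x. Re (trace (T i x ** adj_wrt (h i x) (T i x))) * volume_form \<omega> i x complex_frame)"
proof (rule densityI)
  fix i assume i: "i < charts X"
  have h: "continuous_on (dom X i) (h i)" "continuous_on (dom X i) (\<lambda>x. matrix_inv (h i x))"
    using metricD(1)[OF i, of 0] Ck_on_metric_inv[OF i, of 0] by (auto intro: continuous_on_chartI[OF i])
  have c: "continuous_on (dom X i) (\<lambda>x. conj_transpose (T i x))"
    by (rule bounded_linear.continuous_on[OF _ endo_fieldD(1)[OF T i]]) (use linear_conj_transpose linear_conv_bounded_linear in blast)
  have tr: "bounded_linear (trace :: complex ^ 'r ^ 'r \<Rightarrow> complex)"
    using linear_trace linear_conv_bounded_linear by blast
  show "continuous_on (dom X i) (\<lambda>x. Re (trace (T i x ** adj_wrt (h i x) (T i x))) * volume_form \<omega> i x complex_frame)"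
    unfolding adj_wrt_def
    by (rule continuous_on_mult[OF continuous_on_Re[OF bounded_linear.continuous_on[OF tr
            continuous_on_matrix_mult[OF endo_fieldD(1)[OF T i]
              continuous_on_matrix_mult[OF continuous_on_matrix_mult[OF h(2) c] h(1)]]]] volume_continuous[OF i]])
next
  fix i j x assume *: "i < charts X" "j < charts X" "x \<in> dom X i" "x \<in> dom X j"
  let ?g = "g i j x" and ?N = "\<lambda>i. T i x ** adj_wrt (h i x) (T i x)"
  note Tg = endo_fieldD(2)[OF T *]
  have "adj_wrt (h i x) (T i x) ** ?g = (?g ** matrix_inv (h j x) ** conj_transpose ?g) ** conj_transpose (T i x) ** h i x ** ?g"
    unfolding adj_wrt_def metric_inv_transform[OF *] ..
  also have "\<dots> = ?g ** matrix_inv (h j x) ** conj_transpose (T i x ** ?g) ** h i x ** ?g"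
    by (simp add: conj_transpose_mult matrix_mul_assoc)
  also have "\<dots> = ?g ** adj_wrt (h j x) (T j x)"
    unfolding Tg adj_wrt_def metricD(3)[OF *] by (simp add: conj_transpose_mult matrix_mul_assoc)
  finally have adj: "adj_wrt (h i x) (T i x) ** ?g = ?g ** adj_wrt (h j x) (T j x)" .
  have "?N i ** ?g = T i x ** ?g ** adj_wrt (h j x) (T j x)"
    by (simp add: matrix_mul_assoc[symmetric] adj)
  also have "\<dots> = ?g ** ?N j"
    unfolding Tg by (simp add: matrix_mul_assoc)
  finally have "trace (?N i) = trace (?N j)" by (rule conjugate_trace[OF *])
  then show "Re (trace (?N i)) * volume_form \<omega> i x complex_frame =
      \<bar>jac_det X i j x\<bar> *\<^sub>R (Re (trace (?N j)) * volume_form \<omega> j x complex_frame)"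
    using volume_transform[OF *] jac_det_pos[OF *] by simp
qed

lemma norm_volume_nonneg:
  assumes "i < charts X" "x \<in> dom X i"
  shows "Re (trace (T ** adj_wrt (h i x) T)) * volume_form \<omega> i x complex_frame \<ge> 0"
  using trace_adj_wrt(2)[OF metricD(2)[OF assms], of T] volume_positive[OF assms] by simp

lemma norm_integral_eq_0:
  assumes T: "endo_field T"
  shows "density_integral X (\<lambda>i x. Re (trace (T i x ** adj_wrt (h i x) (T i x))) * volume_form \<omega> i x complex_frame) = 0
    \<longleftrightarrow> (\<forall>i<charts X. \<forall>x\<in>dom X i. T i x = 0)" (is "density_integral X ?F = 0 \<longleftrightarrow> ?Z")
proof
  assume 0: "density_integral X ?F = 0"
  show ?Z
  proof (intro allI impI ballI)
    fix i x assume i: "i < charts X" "x \<in> dom X i"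
    have "?F i x = 0" by (rule density_integral_eq_0[OF norm_density[OF T] norm_volume_nonneg 0 i])
    then show "T i x = 0" using volume_positive[OF i] trace_adj_wrt(3)[OF metricD(2)[OF i]] by simp
  qed
next
  assume Z: ?Z
  then have "density_integral X ?F \<ge> 0" "density_integral X (\<lambda>i x. - ?F i x) \<ge> 0"
    by (intro density_integral_nonneg; simp add: linear_0[OF linear_trace] bilinear_lzero[OF bilinear_matrix_mult])+
  then show "density_integral X ?F = 0"
    using density_integral_linear[OF bounded_linear_minus[OF bounded_linear_ident] norm_density[OF T]] by simp
qed

lemma continuous_on_Z_form:
  assumes A: "C2_connection X g A" and i: "i < charts X"
  shows "continuous_on (dom X i) (\<lambda>x. Z_form X \<rho> \<omega> \<upsilon> A i x vs)"
proof (cases "length vs = 2 * CARD('n)")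
  case True
  let ?U = "coord X i ` dom X i"
  have "gCk 1 ?U (\<lambda>z. curv_form (local_conn X A i) z)"
    by (rule gCk_curv_form[OF open_chart(2)[OF i]]) (use gCk_local_conn[OF A i] in \<open>simp add: numeral_2_eq_2\<close>)
  then have F: "gCk 0 ?U (\<lambda>z. curv_form (local_conn X A i) z)" by (rule gCk_le) simp
  let ?E = "\<lambda>z. \<Sum>k\<le>CARD('n). (1 / fact k) *\<^sub>R (const_form (mat (\<i> / (2 * of_real pi))) * curv_form (local_conn X A i) z) ^ k :: (complex ^ 'n, 'r) gform"
  have "gCk 0 ?U (\<lambda>z. stab_gform \<rho> \<omega> i (param X i z) * ?E z * real_gform \<upsilon> i (param X i z))"
    by (intro gCk_mult gCk_sum gCk_scaleR Ck_on_const gCk_power gCk_const F open_chart(2) i gCk_stab_gform gCk_real_gform closed_form_smooth closed_forms)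
  then have "continuous_on ?U (\<lambda>z. coef (stab_gform \<rho> \<omega> i (param X i z) * ?E z * real_gform \<upsilon> i (param X i z)) vs)"
    unfolding gCk_def by simp
  then have "continuous_on ?U (\<lambda>z. Z_form X \<rho> \<omega> \<upsilon> A i (param X i z) vs)"
  proof (rule continuous_on_eq)
    fix z assume z: "z \<in> ?U"
    have "exp_gform X A i (param X i z) = ?E z"
      unfolding exp_gform_eq curvature_eq[OF A i param_image[OF i order_refl z]] coord_param[OF i z] ..
    then show "coef (stab_gform \<rho> \<omega> i (param X i z) * ?E z * real_gform \<upsilon> i (param X i z)) vs = Z_form X \<rho> \<omega> \<upsilon> A i (param X i z) vs"
      by (simp add: Z_form_eq True)
  qed
  then show ?thesis by (rule continuous_on_chartI[OF i])
qed (simp add: Z_form_eq)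

lemma alternating_Z_form:
  assumes "C2_connection X g A" "i < charts X" "x \<in> dom X i"
  shows "alternating_form (Z_form X \<rho> \<omega> \<upsilon> A i x)"
proof -
  have "galt (stab_gform \<rho> \<omega> i x * exp_gform X A i x * real_gform \<upsilon> i x)"
    by (intro galt_mult galt_stab_gform galt_exp_gform galt_real_gform closed_form_smooth closed_forms assms)
  from alternating_degree_part[OF this[unfolded galt_def], of "2 * CARD('n)"]
  show ?thesis by (simp add: degree_part_def[abs_def] Z_form_eq[abs_def])
qed

lemma Z_form_transform:
  assumes A: "C2_connection X g A" and *: "i < charts X" "j < charts X" "x \<in> dom X i" "x \<in> dom X j"
  shows "Z_form X \<rho> \<omega> \<upsilon> A i x complex_frame ** g i j x =
    jac_det X i j x *\<^sub>R (g i j x ** Z_form X \<rho> \<omega> \<upsilon> A j x complex_frame)"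
proof -
  have "Z_form X \<rho> \<omega> \<upsilon> A i x complex_frame ** g i j x =
      g i j x ** Z_form X \<rho> \<omega> \<upsilon> A j x (map (chart_deriv X i (coord X j) x) complex_frame)"
    using stab_product_transform[OF *, of "\<lambda>i. exp_gform X A i x", OF exp_gform_transform[OF A *], of complex_frame]
    by (simp add: Z_form_eq length_complex_frame)
  then show ?thesis
    unfolding alternating_chart_change[OF alternating_Z_form[OF A *(2,4)]]
    by (simp add: bilinear_rmul[OF bilinear_matrix_mult])
qed

abbreviation "\<zeta> \<equiv> zeta X \<rho> \<omega> \<upsilon>"

lemma Z_form_frame:
  assumes "i < charts X" "x \<in> dom X i"
  shows "Z_form X \<rho> \<omega> \<upsilon> A i x complex_frame = volume_form \<omega> i x complex_frame *\<^sub>R \<zeta> A i x"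
  using volume_positive[OF assms] by (simp add: zeta_def)

text \<open>The Jacobians of numerator and denominator cancel in \<open>zeta\<close>, and scalar
  matrices commute with the transition functions.\<close>

lemma endo_field_zeta:
  assumes A: "C2_connection X g A"
  shows "endo_field (\<lambda>i x. mat e ** \<zeta> A i x - mat c)"
  unfolding endo_field_def
proof (intro allI impI conjI ballI)
  fix i assume i: "i < charts X"
  have "continuous_on (dom X i) (\<zeta> A i)"
    unfolding zeta_def[abs_def]
    by (intro continuous_intros volume_continuous[OF i] continuous_on_Z_form[OF A i])
       (use volume_positive[OF i] in force)
  then show "continuous_on (dom X i) (\<lambda>x. mat e ** \<zeta> A i x - mat c)"
    by (intro continuous_on_diff continuous_on_matrix_mult continuous_on_const)
  fix j x assume "j < charts X" "x \<in> dom X i \<inter> dom X j"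
  then have *: "i < charts X" "j < charts X" "x \<in> dom X i" "x \<in> dom X j" using i by auto
  have "\<zeta> A i x ** g i j x = g i j x ** \<zeta> A j x"
    using Z_form_transform[OF A *] volume_transform[OF *] jac_det_pos[OF *]
    by (simp add: zeta_def bilinear_lmul[OF bilinear_matrix_mult] bilinear_rmul[OF bilinear_matrix_mult])
  then have "(mat e ** \<zeta> A i x) ** g i j x = g i j x ** (mat e ** \<zeta> A j x)"
    unfolding mult_mat_mult[of "g i j x"] matrix_mul_assoc[symmetric] by simp
  then show "(mat e ** \<zeta> A i x - mat c) ** g i j x = g i j x ** (mat e ** \<zeta> A j x - mat c)"
    by (simp only: matrix_bilinear mat_mult_commute[of c "g i j x"])
qed

subsection \<open>Completing the square\<close>

abbreviation "Z\<^sub>E \<equiv> central_charge X h \<rho> \<omega> \<upsilon>"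

definition phase :: complex where "phase = exp (- \<i> * of_real (Arg Z\<^sub>E))"
text \<open>The value of c that maximises 2 c |Z(E)| - c^2 rk Vol; the maximum is
  \<open>ZYM_bound\<close>.\<close>

definition slope :: real where "slope = cmod Z\<^sub>E / (real CARD('r) * total_volume)"

abbreviation "deviation A i x \<equiv> mat phase ** \<zeta> A i x - mat (complex_of_real slope)"

lemma phase: "cmod phase = 1" "phase * Z\<^sub>E = of_real (cmod Z\<^sub>E)"
proof -
  show "cmod phase = 1" by (simp add: phase_def)
  have "Z\<^sub>E = of_real (cmod Z\<^sub>E) * exp (\<i> * of_real (Arg Z\<^sub>E))"
    using Arg_eq[of Z\<^sub>E] by (cases "Z\<^sub>E = 0") auto
  then have "phase * Z\<^sub>E = of_real (cmod Z\<^sub>E) * (exp (\<i> * of_real (Arg Z\<^sub>E)) * phase)"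
    by (metis mult.assoc mult.commute)
  also have "exp (\<i> * of_real (Arg Z\<^sub>E)) * phase = 1"
    by (simp add: phase_def exp_minus_inverse)
  finally show "phase * Z\<^sub>E = of_real (cmod Z\<^sub>E)" by simp
qed

lemma phase_density:
  assumes B: "C2_connection X g B"
  shows "chart_density X (\<lambda>i x. Re (phase * trace (Z_form X \<rho> \<omega> \<upsilon> B i x complex_frame)))"
    "density_integral X (\<lambda>i x. Re (phase * trace (Z_form X \<rho> \<omega> \<upsilon> B i x complex_frame))) = cmod Z\<^sub>E"
proof -
  note bl = bounded_linear_compose[OF bounded_linear_Re bounded_linear_mult_right]
  show "chart_density X (\<lambda>i x. Re (phase * trace (Z_form X \<rho> \<omega> \<upsilon> B i x complex_frame)))"
    by (rule density_linear[OF bl trace_Z_form_density(1)[OF B]])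
  have "density_integral X (\<lambda>i x. Re (phase * trace (Z_form X \<rho> \<omega> \<upsilon> B i x complex_frame))) = Re (phase * Z\<^sub>E)"
    unfolding trace_Z_form_density(2)[OF B, symmetric] by (rule density_integral_linear[OF bl trace_Z_form_density(1)[OF B]])
  then show "density_integral X (\<lambda>i x. Re (phase * trace (Z_form X \<rho> \<omega> \<upsilon> B i x complex_frame))) = cmod Z\<^sub>E"
    by (simp only: phase Re_complex_of_real)
qed

lemma ZYM_eq_bound_plus:
  assumes B: "C2_connection X g B"
  shows "ZYM X h \<rho> \<omega> \<upsilon> B = ZYM_bound X h \<rho> \<omega> \<upsilon> + density_integral X (\<lambda>i x.
    Re (trace (deviation B i x ** adj_wrt (h i x) (deviation B i x))) * volume_form \<omega> i x complex_frame)"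
proof -
  let ?c = slope and ?v = "\<lambda>i x. volume_form \<omega> i x complex_frame"
  let ?D = "\<lambda>i x. Re (trace (deviation B i x ** adj_wrt (h i x) (deviation B i x))) * ?v i x"
  let ?P = "\<lambda>i x. Re (phase * trace (Z_form X \<rho> \<omega> \<upsilon> B i x complex_frame))"
  \<comment> \<open>The cross term and the constant term of the square, brought to the other side;
    the integral is 2 c |Z(E)| - c^2 rk Vol.\<close>
  let ?G = "\<lambda>i x. 2 * ?c * ?P i x + - (?c\<^sup>2 * CARD('r)) * ?v i x"
  have D: "chart_density X ?D" by (rule norm_density[OF endo_field_zeta[OF B]])
  note P = phase_density[OF B] and V = volume_density
  have P2: "chart_density X (\<lambda>i x. 2 * ?c * ?P i x)" "density_integral X (\<lambda>i x. 2 * ?c * ?P i x) = 2 * ?c * cmod Z\<^sub>E"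
    unfolding P(2)[symmetric]
    by (rule density_linear[OF bounded_linear_mult_right P(1)] density_integral_linear[OF bounded_linear_mult_right P(1)])+
  have V2: "chart_density X (\<lambda>i x. - (?c\<^sup>2 * CARD('r)) * ?v i x)" "density_integral X (\<lambda>i x. - (?c\<^sup>2 * CARD('r)) * ?v i x) = - (?c\<^sup>2 * CARD('r)) * total_volume"
    unfolding form_integral_eq_density_integral[of _ "volume_form \<omega>"]
    by (rule density_linear[OF bounded_linear_mult_right V] density_integral_linear[OF bounded_linear_mult_right V])+
  have G: "chart_density X ?G" "density_integral X ?G = 2 * ?c * cmod Z\<^sub>E + - (?c\<^sup>2 * CARD('r)) * total_volume"
    unfolding P2(2)[symmetric] V2(2)[symmetric]
    by (rule density_add[OF P2(1) V2(1)] density_integral_add[OF P2(1) V2(1)])+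
  define N where "N = (\<lambda>i x. Re (trace (\<zeta> B i x ** adj_wrt (h i x) (\<zeta> B i x))) * ?v i x)"
  have "endo_field (\<zeta> B)" using endo_field_zeta[OF B, of 1 0] by (simp add: linear_0[OF linear_mat])
  from norm_density[OF this] have N: "chart_density X N" unfolding N_def .
  have eq: "N i x = ?D i x + ?G i x" if i: "i < charts X" "x \<in> dom X i" for i x
  proof -
    have inv: "invertible (h i x)" by (rule pos_hermitian_invertible[OF metricD(2)[OF i]])
    have "?P i x = ?v i x * Re (phase * trace (\<zeta> B i x))"
      unfolding Z_form_frame[OF i] by (simp add: linear_scale[OF linear_trace] algebra_simps)
    \<comment> \<open>The completed square in real numbers: \<open>a\<close> is the squared norm of
      zeta, \<open>p\<close> the rotated real trace, \<open>s\<close> the slope and \<open>m\<close>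
      its square times the rank.\<close>
    moreover have "a * v = (a - 2 * s * p + m) * v + (2 * s * (v * p) + - m * v)" for a v s p m :: real
      by (simp add: algebra_simps)
    ultimately show ?thesis unfolding norm_deviation[OF inv phase(1)] N_def by (simp only:)
  qed
  have "ZYM X h \<rho> \<omega> \<upsilon> B = density_integral X N"
    unfolding ZYM_def form_integral_eq_density_integral N_def ..
  also have "\<dots> = density_integral X (\<lambda>i x. ?D i x + ?G i x)"
    by (rule density_integral_cong[OF eq])
  also have "\<dots> = density_integral X ?D + (2 * ?c * cmod Z\<^sub>E + - (?c\<^sup>2 * CARD('r)) * total_volume)"
    unfolding density_integral_add[OF D G(1)] G(2) ..
  also have "2 * ?c * cmod Z\<^sub>E + - (?c\<^sup>2 * CARD('r)) * total_volume = ZYM_bound X h \<rho> \<omega> \<upsilon>"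
    using volume_integral_pos by (simp add: ZYM_bound_def slope_def power2_eq_square field_simps)
  finally show ?thesis by simp
qed

section \<open>The lower bound and the case of equality\<close>

lemma ZYM_ge_bound:
  assumes "C2_connection X g B" shows "ZYM X h \<rho> \<omega> \<upsilon> B \<ge> ZYM_bound X h \<rho> \<omega> \<upsilon>"
  unfolding ZYM_eq_bound_plus[OF assms] using density_integral_nonneg[OF norm_volume_nonneg] by simp

lemma ZYM_eq_bound_iff:
  assumes B: "C2_connection X g B"
  shows "ZYM X h \<rho> \<omega> \<upsilon> B = ZYM_bound X h \<rho> \<omega> \<upsilon> \<longleftrightarrow>
    (\<forall>i<charts X. \<forall>x\<in>dom X i. mat phase ** \<zeta> B i x = slope *\<^sub>R mat 1)"
  unfolding ZYM_eq_bound_plus[OF B] mat_scaleR_one[symmetric]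
  using norm_integral_eq_0[OF endo_field_zeta[OF B], of phase "of_real slope"] by simp

text \<open>The lower bound holds for every competitor, so attaining it already makes a connection
  an absolute minimum.\<close>

lemma ZYM_minimum_iff:
  assumes A: "A \<in> integrable_unitary_connections X g h"
  shows "ZYM_minimum X g h \<rho> \<omega> \<upsilon> A \<longleftrightarrow> ZYM X h \<rho> \<omega> \<upsilon> A = ZYM_bound X h \<rho> \<omega> \<upsilon>"
proof -
  have "ZYM X h \<rho> \<omega> \<upsilon> B \<ge> ZYM_bound X h \<rho> \<omega> \<upsilon>" if "B \<in> integrable_unitary_connections X g h" for B
    by (rule ZYM_ge_bound[OF connection_C2]) (use that in \<open>simp add: integrable_unitary_connections_def\<close>)
  then show ?thesis using A unfolding ZYM_minimum_def is_arg_min_def by (auto simp: not_less)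
qed

text \<open>The two equations make the rotated Z(A) equal to m times the volume form times the
  identity, with m = lam n!. Integrating the trace gives m rk Vol = |Z(E)|, so m is the
  slope.\<close>

lemma critical_constant_imp_zeta:
  assumes A: "C2_connection X g A" and crit: "Z_critical X h \<rho> \<omega> \<upsilon> A"
    and const: "has_constant_real_part X h \<rho> \<omega> \<upsilon> A lam" and i: "i < charts X" "x \<in> dom X i"
  shows "mat phase ** \<zeta> A i x = slope *\<^sub>R mat 1"
proof -
  let ?m = "lam * fact CARD('n)" and ?v = "\<lambda>i x. volume_form \<omega> i x complex_frame"
  have rot: "mat phase ** Z_form X \<rho> \<omega> \<upsilon> A i x complex_frame = (?m * ?v i x) *\<^sub>R mat 1"
    if i: "i < charts X" "x \<in> dom X i" for i x
  proof -
    let ?R = "rotated_Z_form X h \<rho> \<omega> \<upsilon> A i x complex_frame"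
    have "Re_wrt (h i x) ?R = (?m * ?v i x) *\<^sub>R mat 1"
      using const i unfolding has_constant_real_part_def by (simp add: volume_form_def)
    moreover have "Im_wrt (h i x) ?R = 0" using crit i unfolding Z_critical_def by blast
    ultimately have "?R = (?m * ?v i x) *\<^sub>R mat 1"
      using Re_wrt_Im_wrt[of ?R "h i x"] by (simp add: bilinear_rzero[OF bilinear_matrix_mult])
    then show ?thesis by (simp add: rotated_Z_form_def phase_def)
  qed
  have "cmod Z\<^sub>E = density_integral X (\<lambda>i x. Re (phase * trace (Z_form X \<rho> \<omega> \<upsilon> A i x complex_frame)))"
    by (rule phase_density(2)[OF A, symmetric])
  also have "\<dots> = density_integral X (\<lambda>i x. (?m * CARD('r)) * ?v i x)"
  proof (rule density_integral_cong)
    fix i x assume "i < charts X" "x \<in> dom X i"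
    from arg_cong[OF rot[OF this], of trace]
    show "Re (phase * trace (Z_form X \<rho> \<omega> \<upsilon> A i x complex_frame)) = (?m * CARD('r)) * ?v i x"
      unfolding trace_mat_mult by (simp add: linear_scale[OF linear_trace] trace_mat)
  qed
  also have "\<dots> = (?m * CARD('r)) * total_volume"
    unfolding form_integral_eq_density_integral[of _ "volume_form \<omega>"]
    by (rule density_integral_linear[OF bounded_linear_mult_right volume_density])
  finally have m: "?m = slope" using volume_integral_pos by (simp add: slope_def field_simps)
  have "mat phase ** \<zeta> A i x = (1 / ?v i x) *\<^sub>R (mat phase ** Z_form X \<rho> \<omega> \<upsilon> A i x complex_frame)"
    by (simp add: zeta_def bilinear_rmul[OF bilinear_matrix_mult])
  also have "\<dots> = slope *\<^sub>R mat 1"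
    unfolding rot[OF i] m using volume_positive[OF i] by simp
  finally show ?thesis .
qed

text \<open>The factorial appears because omega^n is n! times the volume form. Equality on
  \<open>complex_frame\<close> extends to all lists: in degree 2n both sides are determined by their
  value there, and in other degrees both vanish.\<close>

lemma zeta_imp_critical_constant:
  assumes A: "C2_connection X g A"
    and \<zeta>: "\<And>i x. i < charts X \<Longrightarrow> x \<in> dom X i \<Longrightarrow> mat phase ** \<zeta> A i x = slope *\<^sub>R mat 1"
  shows "Z_critical X h \<rho> \<omega> \<upsilon> A" "has_constant_real_part X h \<rho> \<omega> \<upsilon> A (slope / fact CARD('n))"
proof -
  have R: "rotated_Z_form X h \<rho> \<omega> \<upsilon> A i x vs = (slope / fact CARD('n) * form_power \<omega> CARD('n) i x vs) *\<^sub>R mat 1"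
    if i: "i < charts X" "x \<in> dom X i" for i x vs
  proof (cases "length vs = 2 * CARD('n)")
    case True
    let ?d = "det (frame_matrix complex_frame vs :: real ^ 'n bit0 ^ 'n bit0)" and ?v = "volume_form \<omega> i x complex_frame"
    have "Z_form X \<rho> \<omega> \<upsilon> A i x vs = (?d * ?v) *\<^sub>R \<zeta> A i x"
      unfolding complex_frame_top_degree[OF alternating_Z_form[OF A i] True] Z_form_frame[OF i] by simp
    then have "rotated_Z_form X h \<rho> \<omega> \<upsilon> A i x vs = (?d * ?v) *\<^sub>R (slope *\<^sub>R mat 1)"
      unfolding rotated_Z_form_def phase_def[symmetric] by (simp only: bilinear_rmul[OF bilinear_matrix_mult] \<zeta>[OF i])
    moreover have "form_power \<omega> CARD('n) i x vs = ?d * (fact CARD('n) * ?v)"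
      using complex_frame_top_degree[OF alternating_form_power[OF i] True] form_power_top[of \<omega> i x complex_frame] by simp
    ultimately show ?thesis by simp
  next
    case False
    have "\<omega> i x us = 0" if "length us \<noteq> 2" for us
      using kaehler i that unfolding kaehler_form_def by blast
    then have "form_power \<omega> CARD('n) i x vs = 0"
      unfolding form_power_def by (rule wedge_power_degree[OF _ False])
    moreover have "Z_form X \<rho> \<omega> \<upsilon> A i x vs = 0" using False by (simp add: Z_form_eq)
    ultimately show ?thesis by (simp add: rotated_Z_form_def bilinear_rzero[OF bilinear_matrix_mult])
  qed
  have inv: "invertible (h i x)" if "i < charts X" "x \<in> dom X i" for i x
    by (rule pos_hermitian_invertible[OF metricD(2)[OF that]])
  show "Z_critical X h \<rho> \<omega> \<upsilon> A" unfolding Z_critical_def by (simp add: R Re_wrt_scalar[OF inv])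
  show "has_constant_real_part X h \<rho> \<omega> \<upsilon> A (slope / fact CARD('n))"
    unfolding has_constant_real_part_def by (simp add: R Re_wrt_scalar[OF inv])
qed

text \<open>One point suffices: there the trace of the real part is lam times the rank times the
  positive value of omega^n on the frame.\<close>

lemma calibrated_imp_pos:
  assumes cal: "Z_almost_calibrated X h \<rho> \<omega> \<upsilon> A" and const: "has_constant_real_part X h \<rho> \<omega> \<upsilon> A lam"
  shows "lam > 0"
proof -
  obtain i x where i: "i < charts X" "x \<in> dom X i" using charts_cover[of undefined] by blast
  let ?R = "rotated_Z_form X h \<rho> \<omega> \<upsilon> A i x complex_frame"
  have "0 < Re (trace ?R)" using cal i unfolding Z_almost_calibrated_def by blast
  also have "\<dots> = Re (trace (Re_wrt (h i x) ?R))"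
    by (rule Re_trace_Re_wrt[OF pos_hermitian_invertible[OF metricD(2)[OF i]], symmetric])
  also have "Re_wrt (h i x) ?R = (lam * form_power \<omega> CARD('n) i x complex_frame) *\<^sub>R mat 1"
    using const i unfolding has_constant_real_part_def by blast
  finally have "0 < lam * (fact CARD('n) * volume_form \<omega> i x complex_frame * CARD('r))"
    unfolding form_power_top by (simp add: linear_scale[OF linear_trace] trace_mat mult.assoc)
  moreover have "0 < fact CARD('n) * volume_form \<omega> i x complex_frame * CARD('r)"
    using volume_positive[OF i] by simp
  ultimately show ?thesis by (rule zero_less_mult_pos2)
qed

end

theorem theorem4p5p11:
  fixes X :: "('x::t2_space, 'n::finite) atlas"
    and g :: "nat \<Rightarrow> nat \<Rightarrow> 'x \<Rightarrow> complex ^ 'r ^ 'r::finite"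
    and h :: "nat \<Rightarrow> 'x \<Rightarrow> complex ^ 'r ^ 'r"
    and \<rho> :: "nat \<Rightarrow> complex"
    and \<omega> \<upsilon> :: "('x, 'n, real) form"
    and A :: "('x, 'n, 'r) conn"
  assumes "compact_complex_manifold X"
    and "kaehler_form X \<omega>"
    and "holomorphic_bundle X g"
    and "hermitian_metric X g h"
    and "stability_vector CARD('n) \<rho>"
    and "unipotent_form X \<upsilon>"
    and "central_charge X h \<rho> \<omega> \<upsilon> \<noteq> 0"
    and "A \<in> integrable_unitary_connections X g h"
  shows "(ZYM_minimum X g h \<rho> \<omega> \<upsilon> A \<longleftrightarrow>
           Z_critical X h \<rho> \<omega> \<upsilon> A \<and> (\<exists>lam. has_constant_real_part X h \<rho> \<omega> \<upsilon> A lam)) \<and>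
         (\<forall>lam. Z_almost_calibrated X h \<rho> \<omega> \<upsilon> A \<longrightarrow>
           has_constant_real_part X h \<rho> \<omega> \<upsilon> A lam \<longrightarrow> lam > 0)"
proof -
  interpret kaehler_bundle X g h \<rho> \<omega> \<upsilon>
    using assms by unfold_locales
  have A: "C2_connection X g A"
    by (rule connection_C2) (use assms(8) in \<open>simp add: integrable_unitary_connections_def\<close>)
  show ?thesis
    unfolding ZYM_minimum_iff[OF assms(8)] ZYM_eq_bound_iff[OF A]
    using critical_constant_imp_zeta[OF A] zeta_imp_critical_constant[OF A] calibrated_imp_pos by blast
qed

end
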